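(* Let $G$ be a locally compact Hausdorff second countable groupoid with a left Haar system. If $\phi=(\xi,\eta)\in B(G)$ is a coefficient of a $G$-Hilbert bundle $(\{\mathfrak H_u\},L)$, with $\xi,\eta$ bounded continuous sections, then the multiplication map $T_\phi$ is completely bounded on $C^*(G)$, and $$\|T_\phi\|_{cb}\le\|\xi\|\,\|\eta\|.$$
   Context: $G$ has unit space $G^0$ and range and source maps $r,s$. A $G$-Hilbert bundle is a continuous field of Hilbert spaces $\mathfrak H=\{\mathfrak H_u\}_{u\in G^0}$ (in the sense of Dixmier) together with linear surjective isometries $L_x:\mathfrak H_{s(x)}\to\mathfrak H_{r(x)}$ ($x\in G$), multiplicative on composable pairs (a groupoid homomorphism), such that for all bounded continuous sections $\xi,\eta$ the function $(\xi,\eta):x\mapsto (L_x\xi(s(x)),\eta(r(x)))$ is continuous on $G$; this function is called a coefficient of the bundle. $\|\xi\|=\sup_u\|\xi(u)\|$. Inner products are conjugate linear in the first variable. $B(G)$ is the set of all such coefficients, over all $G$-Hilbert bundles. $C^*(G)$ is the (full) groupoid $C^*$-algebra of $G$, the enveloping $C^*$-algebra of the convolution $*$-algebra $C_c(G)$, and $\pi:C_c(G)\to C^*(G)$ is the canonical map. For $\phi\in B(G)$, $T_\phi:\pi(C_c(G))\to\pi(C_c(G))$ is $T_\phi\pi(f)=\pi(\phi f)$ (pointwise product); the assertion includes that $T_\phi$ extends to a completely bounded map on $C^*(G)$. *)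

theory Defs
  imports "HOL-Analysis.Analysis"
begin

section \<open>Complex Hilbert spaces with explicit carrier\<close>

text \<open>
  The fibres of a bundle are different Hilbert spaces, so a Hilbert space is a record of
  operations on a carrier set. Inner products are conjugate linear in the first variable.
\<close>

record 'h hilbert =
  hcar :: "'h set"
  hzero :: 'h
  hadd :: "'h \<Rightarrow> 'h \<Rightarrow> 'h"
  hscale :: "complex \<Rightarrow> 'h \<Rightarrow> 'h"
  hip :: "'h \<Rightarrow> 'h \<Rightarrow> complex"

definition hnorm :: "('h, 'm) hilbert_scheme \<Rightarrow> 'h \<Rightarrow> real" where
  "hnorm H x = sqrt (Re (hip H x x))"

definition hdist :: "('h, 'm) hilbert_scheme \<Rightarrow> 'h \<Rightarrow> 'h \<Rightarrow> real" where
  "hdist H x y = hnorm H (hadd H x (hscale H (- 1) y))"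

locale hilbert_space =
  fixes H :: "'h hilbert"
  assumes zero_closed: "hzero H \<in> hcar H"
    and add_closed: "\<lbrakk>x \<in> hcar H; y \<in> hcar H\<rbrakk> \<Longrightarrow> hadd H x y \<in> hcar H"
    and scale_closed: "x \<in> hcar H \<Longrightarrow> hscale H c x \<in> hcar H"
    and add_assoc: "\<lbrakk>x \<in> hcar H; y \<in> hcar H; z \<in> hcar H\<rbrakk>
          \<Longrightarrow> hadd H (hadd H x y) z = hadd H x (hadd H y z)"
    and add_commute: "\<lbrakk>x \<in> hcar H; y \<in> hcar H\<rbrakk> \<Longrightarrow> hadd H x y = hadd H y x"
    and add_zero: "x \<in> hcar H \<Longrightarrow> hadd H x (hzero H) = x"
    and add_neg: "x \<in> hcar H \<Longrightarrow> hadd H x (hscale H (- 1) x) = hzero H"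
    and scale_one: "x \<in> hcar H \<Longrightarrow> hscale H 1 x = x"
    and scale_scale: "x \<in> hcar H \<Longrightarrow> hscale H c (hscale H d x) = hscale H (c * d) x"
    and scale_add: "\<lbrakk>x \<in> hcar H; y \<in> hcar H\<rbrakk>
          \<Longrightarrow> hscale H c (hadd H x y) = hadd H (hscale H c x) (hscale H c y)"
    and add_scale: "x \<in> hcar H
          \<Longrightarrow> hscale H (c + d) x = hadd H (hscale H c x) (hscale H d x)"
    and ip_commute: "\<lbrakk>x \<in> hcar H; y \<in> hcar H\<rbrakk> \<Longrightarrow> hip H x y = cnj (hip H y x)"
    and ip_add: "\<lbrakk>x \<in> hcar H; y \<in> hcar H; z \<in> hcar H\<rbrakk>
          \<Longrightarrow> hip H x (hadd H y z) = hip H x y + hip H x z"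
    and ip_scale: "\<lbrakk>x \<in> hcar H; y \<in> hcar H\<rbrakk> \<Longrightarrow> hip H x (hscale H c y) = c * hip H x y"
    and ip_nonneg: "x \<in> hcar H \<Longrightarrow> 0 \<le> Re (hip H x x)"
    and ip_definite: "\<lbrakk>x \<in> hcar H; hip H x x = 0\<rbrakk> \<Longrightarrow> x = hzero H"
    and complete: "\<lbrakk>\<And>n. X n \<in> hcar H;
          \<And>e. e > 0 \<Longrightarrow> \<exists>N. \<forall>m\<ge>N. \<forall>n\<ge>N. hdist H (X m) (X n) < e\<rbrakk>
          \<Longrightarrow> \<exists>x\<in>hcar H. (\<lambda>n. hdist H (X n) x) \<longlonglongrightarrow> 0"

definition hilbert_sum :: "'i set \<Rightarrow> ('i \<Rightarrow> 'h hilbert) \<Rightarrow> ('i \<Rightarrow> 'h) hilbert" where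
  "hilbert_sum I H = \<lparr>
     hcar = {x \<in> (\<Pi>\<^sub>E i\<in>I. hcar (H i)). (\<lambda>i. (hnorm (H i) (x i))\<^sup>2) summable_on I},
     hzero = (\<lambda>i\<in>I. hzero (H i)),
     hadd = (\<lambda>x y. \<lambda>i\<in>I. hadd (H i) (x i) (y i)),
     hscale = (\<lambda>c x. \<lambda>i\<in>I. hscale (H i) c (x i)),
     hip = (\<lambda>x y. \<Sum>\<^sub>\<infinity>i\<in>I. hip (H i) (x i) (y i))\<rparr>"

primrec hsum :: "'h hilbert \<Rightarrow> (nat \<Rightarrow> 'h) \<Rightarrow> nat \<Rightarrow> 'h" where
  "hsum H x 0 = hzero H"
| "hsum H x (Suc n) = hadd H (hsum H x n) (x n)"

definition hlinear :: "'h hilbert \<Rightarrow> 'k hilbert \<Rightarrow> ('h \<Rightarrow> 'k) \<Rightarrow> bool" where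
  "hlinear H K a \<longleftrightarrow> a \<in> hcar H \<rightarrow> hcar K
     \<and> (\<forall>x\<in>hcar H. \<forall>y\<in>hcar H. a (hadd H x y) = hadd K (a x) (a y))
     \<and> (\<forall>c. \<forall>x\<in>hcar H. a (hscale H c x) = hscale K c (a x))"


section \<open>Operator spaces and completely bounded maps\<close>

definition bounded_ops :: "'h hilbert \<Rightarrow> ('h \<Rightarrow> 'h) set" where
  "bounded_ops H = {a \<in> extensional (hcar H). hlinear H H a
     \<and> (\<exists>C. \<forall>x\<in>hcar H. hnorm H (a x) \<le> C * hnorm H x)}"

definition op_add :: "'h hilbert \<Rightarrow> ('h \<Rightarrow> 'h) \<Rightarrow> ('h \<Rightarrow> 'h) \<Rightarrow> ('h \<Rightarrow> 'h)" where
  "op_add H a b = (\<lambda>x\<in>hcar H. hadd H (a x) (b x))"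

definition op_scale :: "'h hilbert \<Rightarrow> complex \<Rightarrow> ('h \<Rightarrow> 'h) \<Rightarrow> ('h \<Rightarrow> 'h)" where
  "op_scale H c a = (\<lambda>x\<in>hcar H. hscale H c (a x))"

definition op_norm :: "'h hilbert \<Rightarrow> ('h \<Rightarrow> 'h) \<Rightarrow> real" where
  "op_norm H a = (SUP x\<in>{x \<in> hcar H. hnorm H x \<le> 1}. hnorm H (a x))"

definition op_closure :: "'h hilbert \<Rightarrow> ('h \<Rightarrow> 'h) set \<Rightarrow> ('h \<Rightarrow> 'h) set" where
  "op_closure H S = {a \<in> bounded_ops H.
     \<forall>e>0. \<exists>b\<in>S. op_norm H (op_add H a (op_scale H (- 1) b)) < e}"

definition hpower :: "'h hilbert \<Rightarrow> nat \<Rightarrow> (nat \<Rightarrow> 'h) hilbert" where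
  "hpower H n = hilbert_sum {..<n} (\<lambda>_. H)"

definition matrix_op :: "'h hilbert \<Rightarrow> nat \<Rightarrow> (nat \<Rightarrow> nat \<Rightarrow> 'h \<Rightarrow> 'h)
    \<Rightarrow> (nat \<Rightarrow> 'h) \<Rightarrow> (nat \<Rightarrow> 'h)" where
  "matrix_op H n a = (\<lambda>x\<in>hcar (hpower H n). \<lambda>i\<in>{..<n}. hsum H (\<lambda>j. a i j (x j)) n)"

definition matrix_norm :: "'h hilbert \<Rightarrow> nat \<Rightarrow> (nat \<Rightarrow> nat \<Rightarrow> 'h \<Rightarrow> 'h) \<Rightarrow> real" where
  "matrix_norm H n a = op_norm (hpower H n) (matrix_op H n a)"

definition op_linear_on :: "'h hilbert \<Rightarrow> ('h \<Rightarrow> 'h) set \<Rightarrow> (('h \<Rightarrow> 'h) \<Rightarrow> ('h \<Rightarrow> 'h)) \<Rightarrow> bool" where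
  "op_linear_on H A T \<longleftrightarrow>
     (\<forall>a\<in>A. \<forall>b\<in>A. T (op_add H a b) = op_add H (T a) (T b))
     \<and> (\<forall>c. \<forall>a\<in>A. T (op_scale H c a) = op_scale H c (T a))"

text \<open>
  The completely bounded norm of a map \<open>T\<close> on a space \<open>A\<close> of operators on \<open>H\<close>, where \<open>M\<^sub>n(A)\<close>
  carries the norm of operators on \<open>H\<^sup>n\<close>. It is \<open>\<infinity>\<close> if \<open>T\<close> is not completely bounded.
\<close>

definition cb_norm :: "'h hilbert \<Rightarrow> ('h \<Rightarrow> 'h) set \<Rightarrow> (('h \<Rightarrow> 'h) \<Rightarrow> ('h \<Rightarrow> 'h)) \<Rightarrow> ennreal" where
  "cb_norm H A T =
     (SUP n. SUP a\<in>{a. (\<forall>i<n. \<forall>j<n. a i j \<in> A) \<and> matrix_norm H n a \<le> 1}.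
        ennreal (matrix_norm H n (\<lambda>i j. T (a i j))))"

definition completely_bounded :: "'h hilbert \<Rightarrow> ('h \<Rightarrow> 'h) set
    \<Rightarrow> (('h \<Rightarrow> 'h) \<Rightarrow> ('h \<Rightarrow> 'h)) \<Rightarrow> bool" where
  "completely_bounded H A T \<longleftrightarrow> op_linear_on H A T \<and> cb_norm H A T < \<infinity>"


section \<open>Locally compact groupoids with Haar systems\<close>

text \<open>The product \<open>gmult G x y\<close> is meaningful only if \<open>src G x = rng G y\<close>.\<close>

record 'g groupoid =
  rng :: "'g \<Rightarrow> 'g"
  src :: "'g \<Rightarrow> 'g"
  gmult :: "'g \<Rightarrow> 'g \<Rightarrow> 'g"
  ginv :: "'g \<Rightarrow> 'g"

definition units :: "'g groupoid \<Rightarrow> 'g set" where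
  "units G = range (rng G)"

definition rfibre :: "'g groupoid \<Rightarrow> 'g \<Rightarrow> 'g set" where
  "rfibre G u = {x. rng G x = u}"

locale groupoid =
  fixes G :: "'g groupoid"
  assumes rng_rng: "rng G (rng G x) = rng G x"
    and src_rng: "src G (rng G x) = rng G x"
    and rng_src: "rng G (src G x) = src G x"
    and src_src: "src G (src G x) = src G x"
    and rng_mult: "src G x = rng G y \<Longrightarrow> rng G (gmult G x y) = rng G x"
    and src_mult: "src G x = rng G y \<Longrightarrow> src G (gmult G x y) = src G y"
    and mult_assoc: "\<lbrakk>src G x = rng G y; src G y = rng G z\<rbrakk>
          \<Longrightarrow> gmult G (gmult G x y) z = gmult G x (gmult G y z)"
    and rng_mult_self: "gmult G (rng G x) x = x"
    and mult_src_self: "gmult G x (src G x) = x"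
    and rng_inv: "rng G (ginv G x) = src G x"
    and src_inv: "src G (ginv G x) = rng G x"
    and mult_inv: "gmult G x (ginv G x) = rng G x"
    and inv_mult: "gmult G (ginv G x) x = src G x"

text \<open>Continuity of \<open>rng G\<close> and \<open>src G\<close> follows from that of product and inverse.\<close>

locale locally_compact_groupoid = groupoid G
  for G :: "'g::{t2_space, second_countable_topology} groupoid" +
  assumes locally_compact: "locally_compact_space (euclidean :: 'g topology)"
    and continuous_mult:
      "continuous_on {(x, y). src G x = rng G y} (\<lambda>(x, y). gmult G x y)"
    and continuous_inv: "continuous_on UNIV (ginv G)"

definition Cc :: "('g::topological_space \<Rightarrow> complex) set" where
  "Cc = {f. continuous_on UNIV f \<and> compact (closure {x. f x \<noteq> 0})}"

definition measure_support :: "'g::topological_space measure \<Rightarrow> 'g set" where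
  "measure_support M = {x. \<forall>V. open V \<and> x \<in> V \<longrightarrow> emeasure M V > 0}"

text \<open>
  Regularity of the measures is automatic: on a second countable locally compact Hausdorff
  space every Borel measure that is finite on compact sets is regular. Integrands that
  involve the partial product are restricted to the fibre on which it is defined.
\<close>

locale left_haar_system =
  fixes G :: "'g::{t2_space, second_countable_topology} groupoid" and lam :: "'g \<Rightarrow> 'g measure"
  assumes borel: "u \<in> units G \<Longrightarrow> sets (lam u) = sets borel"
    and finite_on_compact: "\<lbrakk>u \<in> units G; compact K\<rbrakk> \<Longrightarrow> emeasure (lam u) K < \<infinity>"
    and support: "u \<in> units G \<Longrightarrow> measure_support (lam u) = rfibre G u"
    and continuous_integral:
      "f \<in> Cc \<Longrightarrow> continuous_on (units G) (\<lambda>u. (LINT x|lam u. f x))"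
    and left_invariant: "f \<in> Cc \<Longrightarrow>
      (LINT y:rfibre G (src G x)|lam (src G x). f (gmult G x y)) = (LINT y|lam (rng G x). f y)"


section \<open>The full groupoid \<open>C\<^sup>*\<close>-algebra\<close>

definition convol :: "'g::topological_space groupoid \<Rightarrow> ('g \<Rightarrow> 'g measure)
    \<Rightarrow> ('g \<Rightarrow> complex) \<Rightarrow> ('g \<Rightarrow> complex) \<Rightarrow> 'g \<Rightarrow> complex" where
  "convol G lam f g x =
     (LINT y:rfibre G (rng G x)|lam (rng G x). f y * g (gmult G (ginv G y) x))"

definition involution :: "'g groupoid \<Rightarrow> ('g \<Rightarrow> complex) \<Rightarrow> 'g \<Rightarrow> complex" where
  "involution G f x = cnj (f (ginv G x))"

definition I_norm :: "'g::topological_space groupoid \<Rightarrow> ('g \<Rightarrow> 'g measure)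
    \<Rightarrow> ('g \<Rightarrow> complex) \<Rightarrow> real" where
  "I_norm G lam f = max (SUP u\<in>units G. LINT x|lam u. cmod (f x))
                        (SUP u\<in>units G. LINT x|lam u. cmod (f (ginv G x)))"

text \<open>
  Representations of \<open>C\<^sub>c(G)\<close> are \<open>*\<close>-homomorphisms into the bounded operators of a Hilbert
  space that are bounded by the \<open>I\<close>-norm. Nondegeneracy is not required: it does not affect
  the supremum of the norms.
\<close>

definition Cc_representation :: "'g::topological_space groupoid \<Rightarrow> ('g \<Rightarrow> 'g measure)
    \<Rightarrow> 'k hilbert \<Rightarrow> (('g \<Rightarrow> complex) \<Rightarrow> 'k \<Rightarrow> 'k) \<Rightarrow> bool" where
  "Cc_representation G lam K \<rho> \<longleftrightarrow>
     hilbert_space K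
     \<and> (\<forall>f\<in>Cc. \<rho> f \<in> bounded_ops K)
     \<and> (\<forall>f\<in>Cc. \<forall>g\<in>Cc. \<rho> (\<lambda>x. f x + g x) = op_add K (\<rho> f) (\<rho> g))
     \<and> (\<forall>c. \<forall>f\<in>Cc. \<rho> (\<lambda>x. c * f x) = op_scale K c (\<rho> f))
     \<and> (\<forall>f\<in>Cc. \<forall>g\<in>Cc. \<rho> (convol G lam f g) = compose (hcar K) (\<rho> f) (\<rho> g))
     \<and> (\<forall>f\<in>Cc. \<forall>v\<in>hcar K. \<forall>w\<in>hcar K. hip K (\<rho> f v) w = hip K v (\<rho> (involution G f) w))
     \<and> (\<forall>f\<in>Cc. op_norm K (\<rho> f) \<le> I_norm G lam f)"

text \<open>
  The universal representation is the Hilbert sum of all representations on Hilbert spaces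
  with carrier in the type below. This type is large enough for every cyclic representation,
  up to unitary equivalence: its space is a Hausdorff completion of \<open>C\<^sub>c(G)\<close>, so its points
  are equivalence classes of sequences in \<open>C\<^sub>c(G)\<close> (a point \<open>w\<close> of a representation \<open>\<rho>\<close> with
  cyclic vector \<open>v\<close> corresponds to the set of all sequences \<open>f\<close> in \<open>C\<^sub>c(G)\<close> with
  \<open>\<rho> (f n) v \<longlonglongrightarrow> w\<close>). Hence the norm of \<open>universal_rep G lam f\<close> is the largest norm of \<open>f\<close> in
  any representation.
\<close>

type_synonym 'g cyclic_point = "(nat \<Rightarrow> 'g \<Rightarrow> complex) set"

type_synonym 'g rep =
  "'g cyclic_point hilbert \<times> (('g \<Rightarrow> complex) \<Rightarrow> 'g cyclic_point \<Rightarrow> 'g cyclic_point)"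

definition Reps :: "'g::topological_space groupoid \<Rightarrow> ('g \<Rightarrow> 'g measure) \<Rightarrow> 'g rep set" where
  "Reps G lam = {(K, \<rho>). Cc_representation G lam K \<rho>}"

definition universal_space :: "'g::topological_space groupoid \<Rightarrow> ('g \<Rightarrow> 'g measure)
    \<Rightarrow> ('g rep \<Rightarrow> 'g cyclic_point) hilbert" where
  "universal_space G lam = hilbert_sum (Reps G lam) fst"

definition universal_rep :: "'g::topological_space groupoid \<Rightarrow> ('g \<Rightarrow> 'g measure)
    \<Rightarrow> ('g \<Rightarrow> complex) \<Rightarrow> ('g rep \<Rightarrow> 'g cyclic_point) \<Rightarrow> ('g rep \<Rightarrow> 'g cyclic_point)" where
  "universal_rep G lam f =
     (\<lambda>v\<in>hcar (universal_space G lam). \<lambda>R\<in>Reps G lam. snd R f (v R))"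

definition Cstar :: "'g::topological_space groupoid \<Rightarrow> ('g \<Rightarrow> 'g measure)
    \<Rightarrow> (('g rep \<Rightarrow> 'g cyclic_point) \<Rightarrow> ('g rep \<Rightarrow> 'g cyclic_point)) set" where
  "Cstar G lam = op_closure (universal_space G lam) (universal_rep G lam ` Cc)"


section \<open>Hilbert bundles over a groupoid\<close>

text \<open>
  Continuous fields of Hilbert spaces over the subspace \<open>X\<close> in the sense of Dixmier;
  \<open>\<Gamma>\<close> is the space of continuous sections. Values of sections outside \<open>X\<close> are irrelevant.
\<close>

locale continuous_field =
  fixes X :: "'g::topological_space set" and H :: "'g \<Rightarrow> 'h hilbert" and \<Gamma> :: "('g \<Rightarrow> 'h) set"
  assumes hilbert: "u \<in> X \<Longrightarrow> hilbert_space (H u)"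
    and section_in_fibre: "\<lbrakk>\<xi> \<in> \<Gamma>; u \<in> X\<rbrakk> \<Longrightarrow> \<xi> u \<in> hcar (H u)"
    and zero_section: "(\<lambda>u. hzero (H u)) \<in> \<Gamma>"
    and add_section: "\<lbrakk>\<xi> \<in> \<Gamma>; \<eta> \<in> \<Gamma>\<rbrakk> \<Longrightarrow> (\<lambda>u. hadd (H u) (\<xi> u) (\<eta> u)) \<in> \<Gamma>"
    and scale_section: "\<xi> \<in> \<Gamma> \<Longrightarrow> (\<lambda>u. hscale (H u) c (\<xi> u)) \<in> \<Gamma>"
    and dense_values: "\<lbrakk>u \<in> X; v \<in> hcar (H u); e > 0\<rbrakk> \<Longrightarrow> \<exists>\<xi>\<in>\<Gamma>. hdist (H u) v (\<xi> u) < e"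
    and continuous_norm: "\<xi> \<in> \<Gamma> \<Longrightarrow> continuous_on X (\<lambda>u. hnorm (H u) (\<xi> u))"
    and locally_uniformly_closed:
      "\<lbrakk>\<And>u. u \<in> X \<Longrightarrow> \<xi> u \<in> hcar (H u);
        \<And>u e. \<lbrakk>u \<in> X; e > 0\<rbrakk> \<Longrightarrow>
          \<exists>\<xi>'\<in>\<Gamma>. \<exists>V. open V \<and> u \<in> V \<and> (\<forall>w\<in>V \<inter> X. hdist (H w) (\<xi> w) (\<xi>' w) \<le> e)\<rbrakk>
       \<Longrightarrow> \<xi> \<in> \<Gamma>"

definition bounded_sections :: "'g set \<Rightarrow> ('g \<Rightarrow> 'h hilbert) \<Rightarrow> ('g \<Rightarrow> 'h) set \<Rightarrow> ('g \<Rightarrow> 'h) set" where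
  "bounded_sections X H \<Gamma> = {\<xi> \<in> \<Gamma>. bdd_above ((\<lambda>u. hnorm (H u) (\<xi> u)) ` X)}"

definition section_norm :: "'g set \<Rightarrow> ('g \<Rightarrow> 'h hilbert) \<Rightarrow> ('g \<Rightarrow> 'h) \<Rightarrow> real" where
  "section_norm X H \<xi> = (SUP u\<in>X. hnorm (H u) (\<xi> u))"

definition coefficient :: "'g groupoid \<Rightarrow> ('g \<Rightarrow> 'h hilbert) \<Rightarrow> ('g \<Rightarrow> 'h \<Rightarrow> 'h)
    \<Rightarrow> ('g \<Rightarrow> 'h) \<Rightarrow> ('g \<Rightarrow> 'h) \<Rightarrow> 'g \<Rightarrow> complex" where
  "coefficient G H L \<xi> \<eta> x = hip (H (rng G x)) (L x (\<xi> (src G x))) (\<eta> (rng G x))"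

locale hilbert_bundle = continuous_field "units G" H \<Gamma>
  for G :: "'g::topological_space groupoid" and H :: "'g \<Rightarrow> 'h hilbert"
    and \<Gamma> :: "('g \<Rightarrow> 'h) set" +
  fixes L :: "'g \<Rightarrow> 'h \<Rightarrow> 'h"
  assumes linear: "hlinear (H (src G x)) (H (rng G x)) (L x)"
    and isometry: "v \<in> hcar (H (src G x)) \<Longrightarrow> hnorm (H (rng G x)) (L x v) = hnorm (H (src G x)) v"
    and surjective: "L x ` hcar (H (src G x)) = hcar (H (rng G x))"
    and multiplicative: "\<lbrakk>src G x = rng G y; v \<in> hcar (H (src G y))\<rbrakk>
          \<Longrightarrow> L (gmult G x y) v = L x (L y v)"
    and continuous_coefficient:
      "\<lbrakk>\<xi> \<in> bounded_sections (units G) H \<Gamma>; \<eta> \<in> bounded_sections (units G) H \<Gamma>\<rbrakk>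
       \<Longrightarrow> continuous_on UNIV (coefficient G H L \<xi> \<eta>)"

end

theory Submission
  imports Defs
begin

text \<open>
  Let \<open>\<rho>\<close> be a representation of \<open>C\<^sub>c(G)\<close> on \<open>K\<close>. Tensoring \<open>K\<close> with the bundle over the unit
  space should give a representation \<open>\<sigma>\<close> in which \<open>\<xi>\<close> and \<open>\<eta>\<close> become operators with
  \<open>\<langle>w, \<rho>(\<phi> f) v\<rangle> = \<langle>\<eta> \<otimes> w, \<sigma>(f) (\<xi> \<otimes> v)\<rangle>\<close>. This is arranged without disintegrating \<open>\<rho>\<close>: for
  \<open>v = \<rho>(g) v'\<close> the inner products of the vectors \<open>\<xi> \<otimes> v\<close> and \<open>\<sigma>(f) (\<xi> \<otimes> v)\<close> can be written down
  in terms of \<open>\<rho>\<close>, and \<open>\<sigma>\<close> is the GNS representation of the resulting form on the unitization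
  of \<open>C\<^sub>c(G)\<close>. The form is positive because, by partitions of unity, the sections involved are
  uniformly approximated by finite sums \<open>\<Sum>\<^sub>m \<alpha>\<^sub>m(x) e\<^sub>m(r(x))\<close> and the Gram matrices of the \<open>e\<^sub>m\<close> by
  matrices that are locally constant on the unit space, where Schur's product theorem applies.
\<close>

section \<open>Pre-Hilbert spaces\<close>

text \<open>The constant is the product of the tensor estimates \<open>\<parallel>\<xi> \<otimes>
  v\<parallel> \<le> \<parallel>\<xi>\<parallel> \<parallel>v\<parallel>\<close> and
  \<open>\<parallel>\<eta> \<otimes> w\<parallel> \<le> \<parallel>\<eta>\<parallel>
  \<parallel>w\<parallel>\<close>. Cauchy-Schwarz combines them; and since \<open>\<sigma>\<close>
  is itself a representation, a matrix over \<open>Cc\<close> has in \<open>\<sigma>\<close> at most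
  its norm in the universal representation. Everything is done for columns of vectors, so all matrix
  sizes are treated at once. What shapes the construction is that \<open>\<rho>\<close> is given
  only on \<open>Cc\<close>. The norm of \<open>\<xi> \<otimes> v\<close> involves the function
  \<open>\<parallel>\<xi>(u)\<parallel>\<^sup>2\<close> on the unit space. A priori this function
  acts only on vectors \<open>\<rho>(g) v'\<close>, through multiplication of \<open>g\<close> by
  its pullback along the range map; hence the detour through the range of \<open>\<rho>\<close>. Nor
  need \<open>Cc\<close> contain a unit, so the vectors \<open>\<xi> \<otimes> v\<close> have to be
  produced by an adjoined one. The resulting form may be degenerate and its space incomplete, which
  is why the elementary inequalities are proved for semidefinite forms.\<close>

locale pre_hilbert =
  fixes H :: "'h hilbert"
  assumes zero_closed: "hzero H \<in> hcar H"
    and add_closed: "\<lbrakk>x \<in> hcar H; y \<in> hcar H\<rbrakk> \<Longrightarrow> hadd H x y \<in> hcar H"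
    and scale_closed: "x \<in> hcar H \<Longrightarrow> hscale H c x \<in> hcar H"
    and add_assoc: "\<lbrakk>x \<in> hcar H; y \<in> hcar H; z \<in> hcar H\<rbrakk>
          \<Longrightarrow> hadd H (hadd H x y) z = hadd H x (hadd H y z)"
    and add_commute: "\<lbrakk>x \<in> hcar H; y \<in> hcar H\<rbrakk> \<Longrightarrow> hadd H x y = hadd H y x"
    and add_zero: "x \<in> hcar H \<Longrightarrow> hadd H x (hzero H) = x"
    and add_neg: "x \<in> hcar H \<Longrightarrow> hadd H x (hscale H (- 1) x) = hzero H"
    and scale_one: "x \<in> hcar H \<Longrightarrow> hscale H 1 x = x"
    and scale_scale: "x \<in> hcar H \<Longrightarrow> hscale H c (hscale H d x) = hscale H (c * d) x"
    and scale_add: "\<lbrakk>x \<in> hcar H; y \<in> hcar H\<rbrakk>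
          \<Longrightarrow> hscale H c (hadd H x y) = hadd H (hscale H c x) (hscale H c y)"
    and add_scale: "x \<in> hcar H
          \<Longrightarrow> hscale H (c + d) x = hadd H (hscale H c x) (hscale H d x)"
    and ip_commute: "\<lbrakk>x \<in> hcar H; y \<in> hcar H\<rbrakk> \<Longrightarrow> hip H x y = cnj (hip H y x)"
    and ip_add: "\<lbrakk>x \<in> hcar H; y \<in> hcar H; z \<in> hcar H\<rbrakk>
          \<Longrightarrow> hip H x (hadd H y z) = hip H x y + hip H x z"
    and ip_scale: "\<lbrakk>x \<in> hcar H; y \<in> hcar H\<rbrakk> \<Longrightarrow> hip H x (hscale H c y) = c * hip H x y"
    and ip_nonneg: "x \<in> hcar H \<Longrightarrow> 0 \<le> Re (hip H x x)"

lemma (in hilbert_space) pre_hilbert: "pre_hilbert H"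
  by (unfold_locales; fact zero_closed add_closed scale_closed add_assoc add_commute add_zero
      add_neg scale_one scale_scale scale_add add_scale ip_commute ip_add ip_scale ip_nonneg)

sublocale hilbert_space \<subseteq> pre_hilbert
  by (rule pre_hilbert)

lemma hilbert_spaceI:
  assumes "pre_hilbert H"
    and "\<And>x. \<lbrakk>x \<in> hcar H; hip H x x = 0\<rbrakk> \<Longrightarrow> x = hzero H"
    and "\<And>X :: nat \<Rightarrow> _. \<lbrakk>\<And>n. X n \<in> hcar H;
          \<And>e. e > 0 \<Longrightarrow> \<exists>N. \<forall>m\<ge>N. \<forall>n\<ge>N. hdist H (X m) (X n) < e\<rbrakk>
          \<Longrightarrow> \<exists>x\<in>hcar H. (\<lambda>n. hdist H (X n) x) \<longlonglongrightarrow> 0"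
  shows "hilbert_space H"
proof -
  interpret pre_hilbert H by fact
  show ?thesis
    by (unfold_locales; fact zero_closed add_closed scale_closed add_assoc add_commute add_zero
      add_neg scale_one scale_scale scale_add add_scale ip_commute ip_add ip_scale ip_nonneg assms(2,3))
qed

definition hsub :: "'h hilbert \<Rightarrow> 'h \<Rightarrow> 'h \<Rightarrow> 'h" where
  "hsub H x y = hadd H x (hscale H (- 1) y)"

lemma hdist_hsub: "hdist H x y = hnorm H (hsub H x y)"
  by (simp add: hdist_def hsub_def)

context pre_hilbert
begin

lemma sub_closed: "\<lbrakk>x \<in> hcar H; y \<in> hcar H\<rbrakk> \<Longrightarrow> hsub H x y \<in> hcar H"
  by (simp add: hsub_def add_closed scale_closed)

lemmas closed = zero_closed add_closed scale_closed sub_closed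

lemma ip_sub: "\<lbrakk>x \<in> hcar H; y \<in> hcar H; z \<in> hcar H\<rbrakk> \<Longrightarrow> hip H x (hsub H y z) = hip H x y - hip H x z"
  by (simp add: hsub_def ip_add ip_scale closed)

lemma ip_zero: "x \<in> hcar H \<Longrightarrow> hip H x (hzero H) = 0"
  using add_neg[OF zero_closed] ip_sub[of x "hzero H" "hzero H"] by (simp add: hsub_def closed)

lemma ip_add_left: "\<lbrakk>x \<in> hcar H; y \<in> hcar H; z \<in> hcar H\<rbrakk> \<Longrightarrow> hip H (hadd H x y) z = hip H x z + hip H y z"
  using ip_commute[of "hadd H x y" z] ip_commute[of x z] ip_commute[of y z] by (simp add: ip_add closed)

lemma ip_scale_left: "\<lbrakk>x \<in> hcar H; y \<in> hcar H\<rbrakk> \<Longrightarrow> hip H (hscale H c x) y = cnj c * hip H x y"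
  using ip_commute[of "hscale H c x" y] ip_commute[of x y] by (simp add: ip_scale closed)

lemma ip_sub_left: "\<lbrakk>x \<in> hcar H; y \<in> hcar H; z \<in> hcar H\<rbrakk> \<Longrightarrow> hip H (hsub H x y) z = hip H x z - hip H y z"
  by (simp add: hsub_def ip_add_left ip_scale_left closed)

lemma ip_zero_left: "x \<in> hcar H \<Longrightarrow> hip H (hzero H) x = 0"
  using ip_commute[of "hzero H" x] by (simp add: ip_zero closed)

lemmas ip_simps = ip_add ip_scale ip_sub ip_zero ip_add_left ip_scale_left ip_sub_left ip_zero_left

lemma ip_self: "x \<in> hcar H \<Longrightarrow> hip H x x = complex_of_real ((hnorm H x)\<^sup>2)"
proof -
  assume x: "x \<in> hcar H"
  have "Im (hip H x x) = 0" using arg_cong[OF ip_commute[OF x x], of Im] by simp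
  then show ?thesis using ip_nonneg[OF x] by (simp add: hnorm_def complex_eq_iff)
qed

lemma norm_nonneg [simp]: "0 \<le> hnorm H x" if "x \<in> hcar H"
  using that by (simp add: hnorm_def ip_nonneg)

lemma norm_sq: "x \<in> hcar H \<Longrightarrow> (hnorm H x)\<^sup>2 = Re (hip H x x)"
  by (simp add: hnorm_def ip_nonneg)

lemma norm_zero: "hnorm H (hzero H) = 0"
  by (simp add: hnorm_def ip_zero closed)

lemma norm_scale: "x \<in> hcar H \<Longrightarrow> hnorm H (hscale H c x) = cmod c * hnorm H x"
proof -
  assume x: "x \<in> hcar H"
  have "hip H (hscale H c x) (hscale H c x) = (c * cnj c) * hip H x x"
    using x by (simp add: ip_simps closed)
  also have "\<dots> = complex_of_real ((cmod c * hnorm H x)\<^sup>2)"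
    using ip_self[OF x] by (simp add: power_mult_distrib complex_mult_cnj cmod_power2)
  finally have "(hnorm H (hscale H c x))\<^sup>2 = (cmod c * hnorm H x)\<^sup>2"
    using x by (simp add: norm_sq closed del: of_real_power of_real_mult)
  then show ?thesis by (rule power2_eq_imp_eq) (use x in \<open>simp_all add: closed\<close>)
qed

lemma norm_add_sq: "\<lbrakk>x \<in> hcar H; y \<in> hcar H\<rbrakk> \<Longrightarrow>
   (hnorm H (hadd H x y))\<^sup>2 = (hnorm H x)\<^sup>2 + (hnorm H y)\<^sup>2 + 2 * Re (hip H x y)"
  using ip_commute[of y x] by (simp add: norm_sq ip_simps closed)

lemma norm_sub_sq: "\<lbrakk>x \<in> hcar H; y \<in> hcar H\<rbrakk> \<Longrightarrow>
   (hnorm H (hsub H x y))\<^sup>2 = (hnorm H x)\<^sup>2 + (hnorm H y)\<^sup>2 - 2 * Re (hip H x y)"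
  using ip_commute[of y x] by (simp add: norm_sq ip_simps closed)

text \<open>A quadratic in real \<open>t\<close>, obtained from the squared norm of a multiple of
  \<open>x\<close> minus \<open>y\<close>, is nonnegative; \<open>t = cmod c / a\<close> is its
  minimum. The case \<open>a = 0\<close> needs its own argument because a nonzero vector may have
  norm zero.\<close>

lemma cauchy_schwarz:
  assumes x: "x \<in> hcar H" and y: "y \<in> hcar H"
  shows "cmod (hip H x y) \<le> hnorm H x * hnorm H y"
proof -
  define a b c where "a = (hnorm H x)\<^sup>2" and "b = (hnorm H y)\<^sup>2" and "c = hip H x y"
  have key: "0 \<le> a * t\<^sup>2 + b - 2 * t * (cmod c)" for t :: real
  proof -
    \<comment> \<open>The phase of \<open>c\<close> turns the cross term into the real number
      \<open>t * cmod c\<close>.\<close>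
    define z where "z = complex_of_real t * sgn c"
    have ux: "hscale H z x \<in> hcar H" using x by (simp add: closed)
    have "0 \<le> (hnorm H (hsub H (hscale H z x) y))\<^sup>2" by simp
    also have "\<dots> = (cmod z)\<^sup>2 * a + b - 2 * Re (cnj z * c)"
      using x y by (simp add: norm_sub_sq[OF ux y] norm_scale ip_simps a_def b_def c_def power_mult_distrib)
    also have "cnj z * c = complex_of_real (t * cmod c)"
    proof (cases "c = 0")
      case False
      have "cnj (sgn c) * c = complex_of_real (cmod c)"
        using False complex_norm_square[of c]
        by (simp add: sgn_eq field_simps power2_eq_square)
      then show ?thesis by (simp add: z_def)
    qed (simp add: z_def)
    also have "(cmod z)\<^sup>2 * a \<le> t\<^sup>2 * a"
      using mult_right_mono[of "(cmod z)\<^sup>2" "t\<^sup>2" a]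
      by (auto simp: z_def norm_mult power_mult_distrib a_def norm_sgn)
    finally show ?thesis by (simp add: algebra_simps)
  qed
  have "(cmod c)\<^sup>2 \<le> a * b"
  proof (cases "a = 0")
    case True
    have "cmod c = 0"
    proof (rule ccontr)
      assume "cmod c \<noteq> 0"
      then have "0 < cmod c" by simp
      \<comment> \<open>With \<open>a = 0\<close> the quadratic is affine in \<open>t\<close>; this
        \<open>t\<close> pushes its value down to \<open>- b - 2\<close>.\<close>
      moreover have "0 \<le> b - 2 * ((b + 1) / cmod c) * cmod c" using key[of "(b + 1) / cmod c"] True by simp
      ultimately have "0 \<le> b - 2 * (b + 1)" by simp
      moreover have "0 \<le> b" by (simp add: b_def)
      ultimately show False by simp
    qed
    then show ?thesis using True by simp
  next
    case False
    then have a: "a > 0" by (simp add: a_def)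
    have "0 \<le> a * (cmod c / a)\<^sup>2 + b - 2 * (cmod c / a) * cmod c" by (rule key)
    then have "0 \<le> (b - (cmod c)\<^sup>2 / a)" using a by (simp add: power2_eq_square field_simps)
    then show ?thesis using a by (simp add: field_simps)
  qed
  also have "a * b = (hnorm H x * hnorm H y)\<^sup>2" by (simp add: a_def b_def power_mult_distrib)
  finally show ?thesis
    unfolding c_def by (rule power2_le_imp_le) (use x y in simp)
qed

lemma Re_ip_le: "\<lbrakk>x \<in> hcar H; y \<in> hcar H\<rbrakk> \<Longrightarrow> Re (hip H x y) \<le> hnorm H x * hnorm H y"
  using cauchy_schwarz complex_Re_le_cmod order_trans by blast

lemma norm_triangle: "\<lbrakk>x \<in> hcar H; y \<in> hcar H\<rbrakk> \<Longrightarrow> hnorm H (hadd H x y) \<le> hnorm H x + hnorm H y"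
  using Re_ip_le[of x y] norm_add_sq[of x y]
  by (intro power2_le_imp_le[of "hnorm H (hadd H x y)"]) (auto simp: power2_sum)

text \<open>Rearrangements of sums are checked through inner products, which \<open>ip_simps\<close>
  expands mechanically. In a degenerate space this does not give equality of the vectors, but norms
  are all that is needed there.\<close>

lemma norm_eq_if_ip_eq:
  assumes "x \<in> hcar H" "y \<in> hcar H" "\<And>z. z \<in> hcar H \<Longrightarrow> hip H z x = hip H z y"
  shows "hnorm H x = hnorm H y"
  using assms(3)[of x] assms(3)[of y] ip_commute[OF assms(1,2)] assms(1,2)
  by (simp add: hnorm_def)

lemma sub_self: "x \<in> hcar H \<Longrightarrow> hsub H x x = hzero H"
  by (simp add: hsub_def add_neg)

lemma dist_self: "x \<in> hcar H \<Longrightarrow> hdist H x x = 0"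
  by (simp add: hdist_hsub sub_self norm_zero)

lemma dist_commute: "\<lbrakk>x \<in> hcar H; y \<in> hcar H\<rbrakk> \<Longrightarrow> hdist H x y = hdist H y x"
  unfolding hdist_hsub
  by (rule power2_eq_imp_eq) (use norm_sub_sq[of x y] norm_sub_sq[of y x] ip_commute[of x y] in \<open>auto simp: sub_closed\<close>)

lemma dist_triangle:
  assumes "x \<in> hcar H" "y \<in> hcar H" "z \<in> hcar H"
  shows "hdist H x z \<le> hdist H x y + hdist H y z"
proof -
  have "hnorm H (hsub H x z) = hnorm H (hadd H (hsub H x y) (hsub H y z))"
    by (rule norm_eq_if_ip_eq) (use assms in \<open>simp_all add: closed ip_simps\<close>)
  then show ?thesis using assms norm_triangle[of "hsub H x y" "hsub H y z"] by (simp add: hdist_hsub closed)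
qed

lemma dist_nonneg [simp]: "\<lbrakk>x \<in> hcar H; y \<in> hcar H\<rbrakk> \<Longrightarrow> 0 \<le> hdist H x y"
  by (simp add: hdist_hsub closed)

lemma norm_diff_le_dist: "\<lbrakk>x \<in> hcar H; y \<in> hcar H\<rbrakk> \<Longrightarrow> \<bar>hnorm H x - hnorm H y\<bar> \<le> hdist H x y"
proof -
  have *: "hnorm H x - hnorm H y \<le> hdist H x y" if "x \<in> hcar H" "y \<in> hcar H" for x y
  proof -
    have "hnorm H x = hnorm H (hadd H (hsub H x y) y)"
      by (rule norm_eq_if_ip_eq) (use that in \<open>simp_all add: closed ip_simps\<close>)
    then show ?thesis using norm_triangle[of "hsub H x y" y] that by (simp add: closed hdist_hsub)
  qed
  assume "x \<in> hcar H" "y \<in> hcar H"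
  then show ?thesis using *[of x y] *[of y x] dist_commute[of x y] by (simp add: abs_le_iff)
qed

lemma ip_diff_le_dist: "\<lbrakk>x \<in> hcar H; y \<in> hcar H; x' \<in> hcar H; y' \<in> hcar H\<rbrakk> \<Longrightarrow>
   cmod (hip H x y - hip H x' y') \<le> hdist H x x' * hnorm H y + hnorm H x' * hdist H y y'"
proof -
  assume a: "x \<in> hcar H" "y \<in> hcar H" "x' \<in> hcar H" "y' \<in> hcar H"
  have "hip H x y - hip H x' y' = hip H (hsub H x x') y + hip H x' (hsub H y y')"
    using a by (simp add: ip_simps closed)
  also have "cmod \<dots> \<le> hnorm H (hsub H x x') * hnorm H y + hnorm H x' * hnorm H (hsub H y y')"
    using a by (intro order_trans[OF norm_triangle_ineq] add_mono cauchy_schwarz closed)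
  finally show ?thesis by (simp add: hdist_hsub)
qed

lemma norm_zero_ip: "\<lbrakk>x \<in> hcar H; y \<in> hcar H; hnorm H x = 0\<rbrakk> \<Longrightarrow> hip H y x = 0"
  using cauchy_schwarz[of y x] by simp

text \<open>Describes a linear combination over an arbitrary finite index set by its inner products
  alone; \<open>hsum\<close> only covers initial segments of the naturals.\<close>

lemma lincomb_exists:
  assumes "finite S" "\<And>s. s \<in> S \<Longrightarrow> w s \<in> hcar H"
  shows "\<exists>v\<in>hcar H. \<forall>z\<in>hcar H. hip H z v = (\<Sum>s\<in>S. c s * hip H z (w s))"
  using assms
proof (induction S)
  case empty
  then show ?case by (intro bexI[of _ "hzero H"]) (auto simp: closed ip_simps)
next
  case (insert s S)
  then obtain v where "v \<in> hcar H" "\<forall>z\<in>hcar H. hip H z v = (\<Sum>s\<in>S. c s * hip H z (w s))" by auto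
  with insert show ?case by (intro bexI[of _ "hadd H (hscale H (c s) (w s)) v"]) (auto simp: closed ip_simps)
qed

lemma hsum_closed: "(\<And>i. i < n \<Longrightarrow> x i \<in> hcar H) \<Longrightarrow> hsum H x n \<in> hcar H"
  by (induction n) (auto simp: closed)

lemma ip_hsum: "\<lbrakk>\<And>i. i < n \<Longrightarrow> x i \<in> hcar H; z \<in> hcar H\<rbrakk> \<Longrightarrow> hip H z (hsum H x n) = (\<Sum>i<n. hip H z (x i))"
  by (induction n) (auto simp: closed ip_simps hsum_closed)

lemma ip_hsum_left: "\<lbrakk>\<And>i. i < n \<Longrightarrow> x i \<in> hcar H; z \<in> hcar H\<rbrakk> \<Longrightarrow> hip H (hsum H x n) z = (\<Sum>i<n. hip H (x i) z)"
  by (induction n) (auto simp: closed ip_simps hsum_closed)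

lemma norm_hsum_le: "(\<And>i. i < n \<Longrightarrow> x i \<in> hcar H) \<Longrightarrow> hnorm H (hsum H x n) \<le> (\<Sum>i<n. hnorm H (x i))"
proof (induction n)
  case (Suc n)
  then show ?case using norm_triangle[of "hsum H x n" "x n"] by (force simp: hsum_closed)
qed (simp add: norm_zero)

end

context hilbert_space
begin

lemma eq_if_dist_zero: "\<lbrakk>x \<in> hcar H; y \<in> hcar H; hdist H x y = 0\<rbrakk> \<Longrightarrow> x = y"
proof -
  assume a: "x \<in> hcar H" "y \<in> hcar H" and d: "hdist H x y = 0"
  have "hsub H x y = hzero H"
    using a d ip_self[of "hsub H x y"] by (intro ip_definite) (auto simp: closed hdist_hsub)
  then have "hadd H (hadd H x (hscale H (-1) y)) y = hadd H (hzero H) y" by (simp add: hsub_def)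
  moreover have "hadd H (hadd H x (hscale H (-1) y)) y = hadd H x (hadd H y (hscale H (-1) y))"
    using a add_commute[of "hadd H x (hscale H (-1) y)" y] add_commute[of x y] add_assoc[of y x "hscale H (-1) y"] add_assoc[of x y "hscale H (-1) y"]
    by (metis add_assoc add_commute scale_closed)
  ultimately show "x = y" using a add_commute[of "hzero H" y] by (simp add: add_neg add_zero closed)
qed

text \<open>The definite counterpart of \<open>norm_eq_if_ip_eq\<close>, and the standard way to
  prove operator identities below.\<close>

lemma ip_ext:
  assumes "x \<in> hcar H" "y \<in> hcar H" "\<And>z. z \<in> hcar H \<Longrightarrow> hip H z x = hip H z y"
  shows "x = y"
proof (rule eq_if_dist_zero[OF assms(1,2)])
  have "hip H (hsub H x y) (hsub H x y) = 0" using assms by (simp add: ip_simps closed)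
  then show "hdist H x y = 0" by (simp add: hdist_hsub hnorm_def)
qed

lemma eq_zero_if_norm_zero: "\<lbrakk>x \<in> hcar H; hnorm H x = 0\<rbrakk> \<Longrightarrow> x = hzero H"
  using ip_definite ip_self by force

lemma limit_unique:
  assumes "\<And>n. X n \<in> hcar H" "x \<in> hcar H" "y \<in> hcar H"
    "(\<lambda>n. hdist H (X n) x) \<longlonglongrightarrow> 0" "(\<lambda>n. hdist H (X n) y) \<longlonglongrightarrow> 0"
  shows "x = y"
proof (rule eq_if_dist_zero[OF assms(2,3)])
  have "(\<lambda>n. hdist H (X n) x + hdist H (X n) y) \<longlonglongrightarrow> 0" using tendsto_add[OF assms(4,5)] by simp
  moreover have "hdist H x y \<le> hdist H (X n) x + hdist H (X n) y" for n
    using dist_triangle[of x "X n" y] dist_commute[of x "X n"] assms by simp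
  ultimately have "hdist H x y \<le> 0" by (meson LIMSEQ_le_const)
  then show "hdist H x y = 0" using assms dist_nonneg[of x y] by linarith
qed

end

section \<open>Hilbert sums and bounded operators\<close>

locale hilbert_family =
  fixes I :: "'i set" and H :: "'i \<Rightarrow> 'h hilbert"
  assumes fibre: "i \<in> I \<Longrightarrow> hilbert_space (H i)"
begin

abbreviation "S \<equiv> hilbert_sum I H"

lemma fibre_pre: "i \<in> I \<Longrightarrow> pre_hilbert (H i)"
  by (rule hilbert_space.pre_hilbert[OF fibre])

lemma sum_simps:
  "hzero S = (\<lambda>i\<in>I. hzero (H i))"
  "hadd S x y = (\<lambda>i\<in>I. hadd (H i) (x i) (y i))"
  "hscale S c x = (\<lambda>i\<in>I. hscale (H i) c (x i))"
  "hip S x y = (\<Sum>\<^sub>\<infinity>i\<in>I. hip (H i) (x i) (y i))"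
  "hsub S x y = (\<lambda>i\<in>I. hsub (H i) (x i) (y i))"
  by (auto simp: hilbert_sum_def hsub_def)

lemma sum_mem: "x \<in> hcar S \<longleftrightarrow> x \<in> (\<Pi>\<^sub>E i\<in>I. hcar (H i)) \<and> (\<lambda>i. (hnorm (H i) (x i))\<^sup>2) summable_on I"
  by (auto simp: hilbert_sum_def)

lemma component: "\<lbrakk>x \<in> hcar S; i \<in> I\<rbrakk> \<Longrightarrow> x i \<in> hcar (H i)"
  by (auto simp: sum_mem)

lemma norm_sq_summable: "x \<in> hcar S \<Longrightarrow> (\<lambda>i. (hnorm (H i) (x i))\<^sup>2) summable_on I"
  by (simp add: sum_mem)

lemma ip_summable:
  assumes "x \<in> hcar S" "y \<in> hcar S"
  shows "(\<lambda>i. hip (H i) (x i) (y i)) summable_on I"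
proof -
  have "(\<lambda>i. (hnorm (H i) (x i))\<^sup>2 + (hnorm (H i) (y i))\<^sup>2) summable_on I"
    using assms by (intro summable_on_add norm_sq_summable)
  then have "(\<lambda>i. norm (hip (H i) (x i) (y i))) summable_on I"
  proof (rule summable_on_comparison_test)
    fix i assume i: "i \<in> I"
    interpret pre_hilbert "H i" using fibre_pre[OF i] .
    have "cmod (hip (H i) (x i) (y i)) \<le> hnorm (H i) (x i) * hnorm (H i) (y i)"
      using assms i by (intro cauchy_schwarz component)
    also have "\<dots> \<le> (hnorm (H i) (x i))\<^sup>2 + (hnorm (H i) (y i))\<^sup>2"
      using sum_squares_bound[of "hnorm (H i) (x i)" "hnorm (H i) (y i)"]
        zero_le_power2[of "hnorm (H i) (x i)"] zero_le_power2[of "hnorm (H i) (y i)"] by linarith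
    finally show "norm (hip (H i) (x i) (y i)) \<le> \<dots>" .
  qed auto
  then show ?thesis by (rule abs_summable_summable)
qed

lemma zero_mem: "hzero S \<in> hcar S"
proof -
  have "(\<lambda>i. (hnorm (H i) (hzero S i))\<^sup>2) summable_on I \<longleftrightarrow> (\<lambda>i. 0 :: real) summable_on I"
    using fibre_pre by (intro summable_on_cong) (simp add: sum_simps pre_hilbert.norm_zero)
  then show ?thesis using fibre_pre by (auto simp: sum_mem sum_simps pre_hilbert.zero_closed)
qed

lemma scale_mem: "x \<in> hcar S \<Longrightarrow> hscale S c x \<in> hcar S"
proof -
  assume x: "x \<in> hcar S"
  have "(\<lambda>i. (hnorm (H i) (hscale S c x i))\<^sup>2) summable_on I \<longleftrightarrow> (\<lambda>i. (cmod c)\<^sup>2 * (hnorm (H i) (x i))\<^sup>2) summable_on I"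
    using fibre_pre x by (intro summable_on_cong) (simp add: sum_simps pre_hilbert.norm_scale component power_mult_distrib)
  then show ?thesis using fibre_pre x
    by (auto simp: sum_mem sum_simps intro: summable_on_cmult_right pre_hilbert.scale_closed)
qed

lemma add_mem: "\<lbrakk>x \<in> hcar S; y \<in> hcar S\<rbrakk> \<Longrightarrow> hadd S x y \<in> hcar S"
proof -
  assume x: "x \<in> hcar S" and y: "y \<in> hcar S"
  have "(\<lambda>i. 2 * (hnorm (H i) (x i))\<^sup>2 + 2 * (hnorm (H i) (y i))\<^sup>2) summable_on I"
    using x y by (intro summable_on_add summable_on_cmult_right norm_sq_summable)
  then have "(\<lambda>i. (hnorm (H i) (hadd S x y i))\<^sup>2) summable_on I"
  proof (rule summable_on_comparison_test)
    fix i assume i: "i \<in> I"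
    interpret pre_hilbert "H i" using fibre_pre[OF i] .
    have xi: "x i \<in> hcar (H i)" "y i \<in> hcar (H i)" using x y i by (auto intro: component)
    \<comment> \<open>The parallelogram law, with the squared norm of the difference
      dropped.\<close>
    show "(hnorm (H i) (hadd S x y i))\<^sup>2 \<le> 2 * (hnorm (H i) (x i))\<^sup>2 + 2 * (hnorm (H i) (y i))\<^sup>2"
      using i norm_add_sq[OF xi] norm_sub_sq[OF xi] zero_le_power2[of "hnorm (H i) (hsub (H i) (x i) (y i))"]
      by (simp add: sum_simps)
  qed auto
  then show ?thesis using fibre_pre x y
    by (auto simp: sum_mem sum_simps intro: pre_hilbert.add_closed)
qed

lemma sum_ip_self:
  assumes x: "x \<in> hcar S"
  shows "hip S x x = complex_of_real (\<Sum>\<^sub>\<infinity>i\<in>I. (hnorm (H i) (x i))\<^sup>2)"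
proof -
  have "hip S x x = (\<Sum>\<^sub>\<infinity>i\<in>I. complex_of_real ((hnorm (H i) (x i))\<^sup>2))"
    unfolding sum_simps using x by (intro infsum_cong) (simp add: pre_hilbert.ip_self[OF fibre_pre component])
  also have "\<dots> = complex_of_real (\<Sum>\<^sub>\<infinity>i\<in>I. (hnorm (H i) (x i))\<^sup>2)"
    using x by (intro infsumI has_sum_of_real_iff[THEN iffD2] has_sum_infsum norm_sq_summable)
  finally show ?thesis .
qed

lemma sum_pre_hilbert: "pre_hilbert S"
proof
  fix x y z c d
  show "hzero S \<in> hcar S" by (rule zero_mem)
  show "\<And>x y. \<lbrakk>x \<in> hcar S; y \<in> hcar S\<rbrakk> \<Longrightarrow> hadd S x y \<in> hcar S" by (rule add_mem)
  show "\<And>x c. x \<in> hcar S \<Longrightarrow> hscale S c x \<in> hcar S" by (rule scale_mem)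
  assume x: "x \<in> hcar S"
  note f = fibre_pre
  note c = component
  have xE: "x \<in> extensional I" using x by (auto simp: sum_mem PiE_def)
  show "hadd S x (hzero S) = x"
    using x xE by (auto simp: sum_simps fun_eq_iff extensional_def pre_hilbert.add_zero[OF f c])
  show "hadd S x (hscale S (- 1) x) = hzero S"
    using x xE by (auto simp: sum_simps fun_eq_iff extensional_def pre_hilbert.add_neg[OF f c])
  show "hscale S 1 x = x"
    using x xE by (auto simp: sum_simps fun_eq_iff extensional_def pre_hilbert.scale_one[OF f c])
  show "hscale S c (hscale S d x) = hscale S (c * d) x"
    using x xE by (auto simp: sum_simps fun_eq_iff extensional_def pre_hilbert.scale_scale[OF f c])
  show "hscale S (c + d) x = hadd S (hscale S c x) (hscale S d x)"
    using x xE by (auto simp: sum_simps fun_eq_iff extensional_def pre_hilbert.add_scale[OF f c])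
  show "0 \<le> Re (hip S x x)" using x by (simp add: sum_ip_self infsum_nonneg)
  assume y: "y \<in> hcar S"
  show "hadd S x y = hadd S y x"
    using x y by (auto simp: sum_simps fun_eq_iff pre_hilbert.add_commute[OF f c c])
  show "hscale S c (hadd S x y) = hadd S (hscale S c x) (hscale S c y)"
    using x y by (auto simp: sum_simps fun_eq_iff pre_hilbert.scale_add[OF f c c])
  have "hip S x y = (\<Sum>\<^sub>\<infinity>i\<in>I. cnj (hip (H i) (y i) (x i)))"
    unfolding sum_simps using x y by (intro infsum_cong) (metis pre_hilbert.ip_commute[OF f c c])
  then show "hip S x y = cnj (hip S y x)" by (simp add: sum_simps)
  show "hip S x (hscale S c y) = c * hip S x y"
    using x y by (simp add: sum_simps infsum_cmult_right' flip: infsum_cmult_right')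
       (rule infsum_cong, simp add: pre_hilbert.ip_scale[OF f c c])
  assume z: "z \<in> hcar S"
  show "hadd S (hadd S x y) z = hadd S x (hadd S y z)"
    using x y z by (auto simp: sum_simps fun_eq_iff pre_hilbert.add_assoc[OF f c c c])
  have "hip S x (hadd S y z) = (\<Sum>\<^sub>\<infinity>i\<in>I. hip (H i) (x i) (y i) + hip (H i) (x i) (z i))"
    unfolding sum_simps using x y z by (intro infsum_cong) (simp add: pre_hilbert.ip_add[OF f c c c])
  also have "\<dots> = hip S x y + hip S x z"
    unfolding sum_simps using x y z by (intro infsum_add ip_summable)
  finally show "hip S x (hadd S y z) = hip S x y + hip S x z" .
qed

lemma sum_norm_sq: "x \<in> hcar S \<Longrightarrow> (hnorm S x)\<^sup>2 = (\<Sum>\<^sub>\<infinity>i\<in>I. (hnorm (H i) (x i))\<^sup>2)"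
proof -
  assume x: "x \<in> hcar S"
  show ?thesis using pre_hilbert.norm_sq[OF sum_pre_hilbert x] x by (simp add: sum_ip_self)
qed

lemma component_norm_le: "\<lbrakk>x \<in> hcar S; i \<in> I\<rbrakk> \<Longrightarrow> hnorm (H i) (x i) \<le> hnorm S x"
proof (rule power2_le_imp_le)
  assume x: "x \<in> hcar S" and i: "i \<in> I"
  have "(\<Sum>j\<in>{i}. (hnorm (H j) (x j))\<^sup>2) \<le> (\<Sum>\<^sub>\<infinity>i\<in>I. (hnorm (H i) (x i))\<^sup>2)"
    using x i by (intro finite_sum_le_infsum norm_sq_summable) auto
  then show "(hnorm (H i) (x i))\<^sup>2 \<le> (hnorm S x)\<^sup>2" using x by (simp add: sum_norm_sq)
qed (simp add: pre_hilbert.norm_nonneg[OF sum_pre_hilbert])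

lemma component_dist_le:
  "\<lbrakk>x \<in> hcar S; y \<in> hcar S; i \<in> I\<rbrakk> \<Longrightarrow> hdist (H i) (x i) (y i) \<le> hdist S x y"
  using component_norm_le[of "hsub S x y" i] pre_hilbert.sub_closed[OF sum_pre_hilbert, of x y]
  by (simp add: hdist_hsub) (simp add: sum_simps)

text \<open>The usual completeness proof for square-summable families: limits exist in each
  component, and a Cauchy estimate that holds on every finite set of components survives both the
  limit in the sequence and the growth of the finite set.\<close>

lemma sum_hilbert_space: "hilbert_space S"
proof -
  interpret pre_hilbert S by (rule sum_pre_hilbert)
  show ?thesis
  proof (rule hilbert_spaceI[OF sum_pre_hilbert])
    fix x assume x: "x \<in> hcar S" and 0: "hip S x x = 0"
    have "(\<Sum>\<^sub>\<infinity>i\<in>I. (hnorm (H i) (x i))\<^sup>2) = 0" using x 0 by (simp add: norm_sq flip: sum_norm_sq)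
    then have "(hnorm (H i) (x i))\<^sup>2 = 0" if "i \<in> I" for i
      using that x by (intro nonneg_infsum_le_0D[of "\<lambda>i. (hnorm (H i) (x i))\<^sup>2" I i]) (auto intro: norm_sq_summable)
    then have "x i = hzero S i" if "i \<in> I" for i
      using that hilbert_space.eq_zero_if_norm_zero[OF fibre component[OF x]] by (simp add: sum_simps)
    moreover have "x \<in> extensional I" using x by (auto simp: sum_mem PiE_def)
    ultimately show "x = hzero S" by (auto simp: fun_eq_iff sum_simps extensional_def)
  next
    fix X assume X: "\<And>n::nat. X n \<in> hcar S"
      and Cau: "\<And>e. e > 0 \<Longrightarrow> \<exists>N. \<forall>m\<ge>N. \<forall>n\<ge>N. hdist S (X m) (X n) < e"
    have "\<exists>y\<in>hcar (H i). (\<lambda>n. hdist (H i) (X n i) y) \<longlonglongrightarrow> 0" if i: "i \<in> I" for i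
    proof (rule hilbert_space.complete[OF fibre[OF i]])
      show "X n i \<in> hcar (H i)" for n using X i component by auto
      fix e :: real assume "e > 0"
      with Cau obtain N where N: "\<forall>m\<ge>N. \<forall>n\<ge>N. hdist S (X m) (X n) < e" by blast
      then show "\<exists>N. \<forall>m\<ge>N. \<forall>n\<ge>N. hdist (H i) (X m i) (X n i) < e"
        using component_dist_le[OF X X i] by (meson le_less_trans)
    qed
    then obtain y where y: "\<And>i. i \<in> I \<Longrightarrow> y i \<in> hcar (H i)"
      and lim: "\<And>i. i \<in> I \<Longrightarrow> (\<lambda>n. hdist (H i) (X n i) (y i)) \<longlonglongrightarrow> 0" by metis
    define D where "D n = (\<lambda>i\<in>I. hsub (H i) (X n i) (y i))" for n
    have D: "D n \<in> hcar S \<and> hnorm S (D n) \<le> e"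
      if e: "e > 0" and N: "\<forall>m\<ge>N. \<forall>n\<ge>N. hdist S (X m) (X n) < e" and n: "n \<ge> N" for e N n
    proof -
      \<comment> \<open>On finitely many components the limit in the second index can be taken term
        by term.\<close>
      have fin: "(\<Sum>i\<in>F. (hnorm (H i) (D n i))\<^sup>2) \<le> e\<^sup>2" if F: "finite F" "F \<subseteq> I" for F
      proof -
        have "(\<lambda>m. \<Sum>i\<in>F. (hdist (H i) (X n i) (X m i))\<^sup>2) \<longlonglongrightarrow> (\<Sum>i\<in>F. (hdist (H i) (X n i) (y i))\<^sup>2)"
        proof (intro tendsto_sum tendsto_power)
          fix i assume "i \<in> F" then have i: "i \<in> I" using F by auto
          interpret Hi: hilbert_space "H i" using fibre[OF i] .
          have Xi: "X m i \<in> hcar (H i)" for m using X i component by auto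
          show "(\<lambda>m. hdist (H i) (X n i) (X m i)) \<longlonglongrightarrow> hdist (H i) (X n i) (y i)"
          proof (rule LIM_zero_cancel, rule tendsto_0_le[OF lim[OF i], where K = 1], rule always_eventually, rule allI)
            fix m
            show "norm (hdist (H i) (X n i) (X m i) - hdist (H i) (X n i) (y i)) \<le> norm (hdist (H i) (X m i) (y i)) * 1"
              using Hi.dist_triangle[OF Xi[of n] Xi[of m] y[OF i]] Hi.dist_triangle[OF Xi[of n] y[OF i] Xi[of m]]
                Hi.dist_commute[OF Xi[of m] y[OF i]] by simp
          qed
        qed
        moreover have "(\<Sum>i\<in>F. (hdist (H i) (X n i) (X m i))\<^sup>2) \<le> e\<^sup>2" if m: "m \<ge> N" for m
        proof -
          have d: "hsub S (X n) (X m) \<in> hcar S" using X by (simp add: sub_closed)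
          have "(\<Sum>i\<in>F. (hdist (H i) (X n i) (X m i))\<^sup>2) = (\<Sum>i\<in>F. (hnorm (H i) (hsub S (X n) (X m) i))\<^sup>2)"
            using F by (intro sum.cong) (auto simp: sum_simps hdist_hsub)
          also have "\<dots> \<le> (\<Sum>\<^sub>\<infinity>i\<in>I. (hnorm (H i) (hsub S (X n) (X m) i))\<^sup>2)"
            using F d by (intro finite_sum_le_infsum norm_sq_summable) auto
          also have "\<dots> = (hdist S (X n) (X m))\<^sup>2" using d by (simp add: sum_norm_sq hdist_hsub)
          also have "\<dots> \<le> e\<^sup>2" using N n m X by (intro power_mono) (auto simp: less_imp_le)
          finally show ?thesis .
        qed
        ultimately have "(\<Sum>i\<in>F. (hdist (H i) (X n i) (y i))\<^sup>2) \<le> e\<^sup>2"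
          by (intro LIMSEQ_le_const2) blast+
        moreover have "(\<Sum>i\<in>F. (hnorm (H i) (D n i))\<^sup>2) = (\<Sum>i\<in>F. (hdist (H i) (X n i) (y i))\<^sup>2)"
          using F by (intro sum.cong) (auto simp: D_def hdist_hsub)
        ultimately show ?thesis by simp
      qed
      have sm: "(\<lambda>i. (hnorm (H i) (D n i))\<^sup>2) summable_on I"
        using fin by (intro nonneg_bdd_above_summable_on bdd_aboveI2[where M = "e\<^sup>2"]) auto
      have "D n \<in> (\<Pi>\<^sub>E i\<in>I. hcar (H i))"
        using y component[OF X] pre_hilbert.sub_closed[OF fibre_pre] by (auto simp: D_def)
      with sm have m: "D n \<in> hcar S" by (simp add: sum_mem)
      have "(hnorm S (D n))\<^sup>2 \<le> e\<^sup>2" unfolding sum_norm_sq[OF m]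
        using fin sm by (intro infsum_le_finite_sums) auto
      then have "hnorm S (D n) \<le> e" by (rule power2_le_imp_le) (use e in simp)
      with m show ?thesis by simp
    qed
    obtain N where N: "\<forall>m\<ge>N. \<forall>n\<ge>N. hdist S (X m) (X n) < 1" using Cau[of 1] by auto
    define x where "x = (\<lambda>i\<in>I. y i)"
    \<comment> \<open>The componentwise limit is square summable because it is a difference of two
      members of the sum.\<close>
    have "x = hsub S (X N) (D N)"
    proof
      fix i
      show "x i = hsub S (X N) (D N) i"
      proof (cases "i \<in> I")
        case i: True
        interpret Hi: hilbert_space "H i" using fibre[OF i] .
        have Xi: "X N i \<in> hcar (H i)" using X i component by auto
        have "y i = hsub (H i) (X N i) (hsub (H i) (X N i) (y i))"
          by (rule Hi.ip_ext) (use y[OF i] Xi in \<open>auto simp: Hi.closed Hi.ip_simps\<close>)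
        then show ?thesis using i by (simp add: x_def D_def sum_simps)
      qed (simp add: x_def sum_simps)
    qed
    then have x: "x \<in> hcar S" using D[OF _ N order_refl] X by (simp add: sub_closed)
    have "hsub S (X n) x = D n" for n by (auto simp: fun_eq_iff sum_simps D_def x_def)
    then have dD: "hdist S (X n) x = hnorm S (D n)" for n by (simp add: hdist_hsub)
    have "(\<lambda>n. hdist S (X n) x) \<longlonglongrightarrow> 0"
    proof (rule LIMSEQ_I)
      fix r :: real assume r: "0 < r"
      then obtain N where N: "\<forall>m\<ge>N. \<forall>n\<ge>N. hdist S (X m) (X n) < r / 2" using Cau[of "r/2"] by auto
      show "\<exists>no. \<forall>n\<ge>no. norm (hdist S (X n) x - 0) < r"
      proof (intro exI[of _ N] allI impI)
        fix n assume "n \<ge> N"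
        then have "hdist S (X n) x \<le> r / 2" using D[OF _ N] r by (simp add: dD)
        then show "norm (hdist S (X n) x - 0) < r" using r dist_nonneg[OF X[of n] x] by simp
      qed
    qed
    with x show "\<exists>x\<in>hcar S. (\<lambda>n. hdist S (X n) x) \<longlonglongrightarrow> 0" by blast
  qed
qed

end

section \<open>Bounded operators and the operator norm\<close>

context hilbert_space
begin

lemma opD:
  assumes "a \<in> bounded_ops H"
  shows "x \<in> hcar H \<Longrightarrow> a x \<in> hcar H"
    and "\<lbrakk>x \<in> hcar H; y \<in> hcar H\<rbrakk> \<Longrightarrow> a (hadd H x y) = hadd H (a x) (a y)"
    and "x \<in> hcar H \<Longrightarrow> a (hscale H c x) = hscale H c (a x)"
    and "x \<in> hcar H \<Longrightarrow> y \<in> hcar H \<Longrightarrow> a (hsub H x y) = hsub H (a x) (a y)"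
    and "a \<in> extensional (hcar H)"
  using assms unfolding bounded_ops_def hlinear_def by (auto simp: hsub_def closed)

lemma op_zero: "a \<in> bounded_ops H \<Longrightarrow> a (hzero H) = hzero H"
proof -
  assume a: "a \<in> bounded_ops H"
  have "a (hzero H) = a (hsub H (hzero H) (hzero H))" by (simp add: sub_self closed)
  also have "\<dots> = hsub H (a (hzero H)) (a (hzero H))" using a zero_closed by (simp only: opD)
  also have "\<dots> = hzero H" using a by (simp add: opD closed sub_self)
  finally show ?thesis .
qed

lemma op_hsum: "a \<in> bounded_ops H \<Longrightarrow> (\<And>i. i < n \<Longrightarrow> x i \<in> hcar H) \<Longrightarrow>
   a (hsum H x n) = hsum H (\<lambda>i. a (x i)) n"
  by (induction n) (simp_all add: opD hsum_closed op_zero)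

lemma op_norm_bdd:
  assumes a: "a \<in> bounded_ops H"
  shows "bdd_above ((\<lambda>x. hnorm H (a x)) ` {x \<in> hcar H. hnorm H x \<le> 1})"
proof -
  obtain C where C: "\<And>x. x \<in> hcar H \<Longrightarrow> hnorm H (a x) \<le> C * hnorm H x"
    using a by (auto simp: bounded_ops_def)
  show ?thesis
  proof (rule bdd_aboveI2[where M = "\<bar>C\<bar>"])
    fix x assume "x \<in> {x \<in> hcar H. hnorm H x \<le> 1}"
    then have x: "x \<in> hcar H" "hnorm H x \<le> 1" by auto
    have "C * hnorm H x \<le> \<bar>C\<bar> * 1" using x by (intro mult_mono) auto
    then show "hnorm H (a x) \<le> \<bar>C\<bar>" using C[OF x(1)] by simp
  qed
qed

lemma op_norm_bound:
  assumes a: "a \<in> bounded_ops H" and x: "x \<in> hcar H"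
  shows "hnorm H (a x) \<le> op_norm H a * hnorm H x"
proof -
  obtain C where C: "\<And>x. x \<in> hcar H \<Longrightarrow> hnorm H (a x) \<le> C * hnorm H x"
    using a by (auto simp: bounded_ops_def)
  note bdd = op_norm_bdd[OF a]
  show ?thesis
  proof (cases "hnorm H x = 0")
    case True
    then show ?thesis using C[OF x] by simp
  next
    case False
    then have p: "hnorm H x > 0" using x norm_nonneg[OF x] by linarith
    define c where "c = complex_of_real (1 / hnorm H x)"
    have "hnorm H (a (hscale H c x)) \<le> op_norm H a"
      unfolding op_norm_def using p x
      by (intro cSUP_upper bdd) (auto simp: closed norm_scale c_def norm_divide)
    moreover have "hnorm H (a (hscale H c x)) = hnorm H (a x) / hnorm H x"
      using p a x by (simp add: opD norm_scale c_def norm_divide)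
    ultimately show ?thesis using p by (simp add: field_simps)
  qed
qed

lemma op_norm_le:
  assumes "\<And>x. x \<in> hcar H \<Longrightarrow> hnorm H (a x) \<le> c * hnorm H x" "0 \<le> c"
  shows "op_norm H a \<le> c"
  unfolding op_norm_def
proof (rule cSUP_least)
  show "{x \<in> hcar H. hnorm H x \<le> 1} \<noteq> {}" using norm_zero zero_closed by force
  fix x assume "x \<in> {x \<in> hcar H. hnorm H x \<le> 1}"
  then show "hnorm H (a x) \<le> c" using assms(1)[of x] mult_left_mono[of "hnorm H x" 1 c] assms(2) by auto
qed

lemma op_norm_nonneg: "a \<in> bounded_ops H \<Longrightarrow> 0 \<le> op_norm H a"
proof -
  assume a: "a \<in> bounded_ops H"
  have "hnorm H (a (hzero H)) \<le> op_norm H a"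
    unfolding op_norm_def by (intro cSUP_upper op_norm_bdd a) (auto simp: closed norm_zero)
  then show ?thesis using a by (simp add: op_zero norm_zero)
qed

lemma op_add_apply: "x \<in> hcar H \<Longrightarrow> op_add H a b x = hadd H (a x) (b x)"
  and op_scale_apply: "x \<in> hcar H \<Longrightarrow> op_scale H c a x = hscale H c (a x)"
  by (simp_all add: op_add_def op_scale_def)

lemma bounded_opsI:
  assumes "a \<in> extensional (hcar H)" "\<And>x. x \<in> hcar H \<Longrightarrow> a x \<in> hcar H"
    "\<And>x y. \<lbrakk>x \<in> hcar H; y \<in> hcar H\<rbrakk> \<Longrightarrow> a (hadd H x y) = hadd H (a x) (a y)"
    "\<And>c x. x \<in> hcar H \<Longrightarrow> a (hscale H c x) = hscale H c (a x)"
    "\<And>x. x \<in> hcar H \<Longrightarrow> hnorm H (a x) \<le> C * hnorm H x"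
  shows "a \<in> bounded_ops H"
proof -
  have "\<exists>C. \<forall>x\<in>hcar H. hnorm H (a x) \<le> C * hnorm H x" using assms(5) by (intro exI ballI)
  moreover have "hlinear H H a" using assms(2-4) unfolding hlinear_def by simp
  ultimately show ?thesis using assms(1) unfolding bounded_ops_def by simp
qed

lemma op_add_closed: "\<lbrakk>a \<in> bounded_ops H; b \<in> bounded_ops H\<rbrakk> \<Longrightarrow> op_add H a b \<in> bounded_ops H"
proof (rule bounded_opsI[where C = "op_norm H a + op_norm H b"])
  assume ab: "a \<in> bounded_ops H" "b \<in> bounded_ops H"
  fix x assume x: "x \<in> hcar H"
  show "op_add H a b x \<in> hcar H" using ab x by (simp add: op_add_apply opD closed)
  show "hnorm H (op_add H a b x) \<le> (op_norm H a + op_norm H b) * hnorm H x"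
    using norm_triangle[of "a x" "b x"] op_norm_bound[OF ab(1) x] op_norm_bound[OF ab(2) x] ab x
    by (simp add: op_add_apply opD algebra_simps)
  show "op_add H a b (hscale H c x) = hscale H c (op_add H a b x)" for c
    using ab x by (simp add: op_add_apply opD closed scale_add)
  fix y assume y: "y \<in> hcar H"
  show "op_add H a b (hadd H x y) = hadd H (op_add H a b x) (op_add H a b y)"
    by (rule ip_ext) (use ab x y in \<open>auto simp: op_add_apply opD closed ip_simps\<close>)
qed (simp add: op_add_def)

lemma op_scale_closed: "a \<in> bounded_ops H \<Longrightarrow> op_scale H c a \<in> bounded_ops H"
proof (rule bounded_opsI[where C = "cmod c * op_norm H a"])
  assume a: "a \<in> bounded_ops H"
  fix x assume x: "x \<in> hcar H"
  show "op_scale H c a x \<in> hcar H" using a x by (simp add: op_scale_apply opD closed)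
  show "hnorm H (op_scale H c a x) \<le> (cmod c * op_norm H a) * hnorm H x"
    using mult_left_mono[OF op_norm_bound[OF a x], of "cmod c"] a x
    by (simp add: op_scale_apply opD norm_scale algebra_simps)
  show "op_scale H c a (hscale H d x) = hscale H d (op_scale H c a x)" for d
    using a x by (simp add: op_scale_apply opD closed scale_scale mult.commute)
  fix y assume y: "y \<in> hcar H"
  show "op_scale H c a (hadd H x y) = hadd H (op_scale H c a x) (op_scale H c a y)"
    by (rule ip_ext) (use a x y in \<open>auto simp: op_scale_apply opD closed ip_simps distrib_left\<close>)
qed (simp add: op_scale_def)

lemma op_ext: "\<lbrakk>a \<in> bounded_ops H; b \<in> bounded_ops H; \<And>x. x \<in> hcar H \<Longrightarrow> a x = b x\<rbrakk> \<Longrightarrow> a = b"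
  by (rule extensionalityI[of _ "hcar H"]) (auto simp: opD)

end

definition op_sub :: "'h hilbert \<Rightarrow> ('h \<Rightarrow> 'h) \<Rightarrow> ('h \<Rightarrow> 'h) \<Rightarrow> ('h \<Rightarrow> 'h)" where
  "op_sub H a b = op_add H a (op_scale H (- 1) b)"

context hilbert_space
begin

lemma op_sub_apply: "x \<in> hcar H \<Longrightarrow> op_sub H a b x = hsub H (a x) (b x)"
  by (simp add: op_sub_def op_add_apply op_scale_apply hsub_def)

lemma op_sub_closed: "\<lbrakk>a \<in> bounded_ops H; b \<in> bounded_ops H\<rbrakk> \<Longrightarrow> op_sub H a b \<in> bounded_ops H"
  by (simp add: op_sub_def op_add_closed op_scale_closed)

lemma op_norm_sub_bound: "\<lbrakk>a \<in> bounded_ops H; b \<in> bounded_ops H; x \<in> hcar H\<rbrakk> \<Longrightarrow>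
  hdist H (a x) (b x) \<le> op_norm H (op_sub H a b) * hnorm H x"
  using op_norm_bound[OF op_sub_closed, of a b x] by (simp add: op_sub_apply hdist_hsub)

lemma op_norm_triangle: 
  assumes "a \<in> bounded_ops H" "b \<in> bounded_ops H"
  shows "op_norm H (op_add H a b) \<le> op_norm H a + op_norm H b"
proof (rule op_norm_le)
  fix x assume x: "x \<in> hcar H"
  show "hnorm H (op_add H a b x) \<le> (op_norm H a + op_norm H b) * hnorm H x"
    using norm_triangle[of "a x" "b x"] op_norm_bound[OF assms(1) x] op_norm_bound[OF assms(2) x] assms x
    by (simp add: op_add_apply opD algebra_simps)
qed (use assms op_norm_nonneg in simp)

lemma op_norm_cong:
  assumes "a \<in> bounded_ops H" "b \<in> bounded_ops H" "\<And>x. x \<in> hcar H \<Longrightarrow> hnorm H (a x) = hnorm H (b x)"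
  shows "op_norm H a = op_norm H b"
  unfolding op_norm_def using assms by (intro SUP_cong) auto

lemma op_norm_scale: "a \<in> bounded_ops H \<Longrightarrow> op_norm H (op_scale H c a) \<le> cmod c * op_norm H a"
  using mult_left_mono[OF op_norm_bound, of a _ "cmod c"]
  by (intro op_norm_le) (auto simp: op_scale_apply norm_scale opD op_norm_nonneg algebra_simps)

lemma op_norm_sub_commute:
  "\<lbrakk>a \<in> bounded_ops H; b \<in> bounded_ops H\<rbrakk> \<Longrightarrow> op_norm H (op_sub H a b) = op_norm H (op_sub H b a)"
  by (intro op_norm_cong op_sub_closed) (auto simp: op_sub_apply dist_commute opD simp flip: hdist_hsub)

lemma op_norm_sub_triangle:
  assumes "a \<in> bounded_ops H" "b \<in> bounded_ops H" "c \<in> bounded_ops H"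
  shows "op_norm H (op_sub H a c) \<le> op_norm H (op_sub H a b) + op_norm H (op_sub H b c)"
proof -
  have "op_sub H a c = op_add H (op_sub H a b) (op_sub H b c)"
  proof (intro op_ext op_add_closed op_sub_closed assms)
    fix x assume "x \<in> hcar H"
    then show "op_sub H a c x = op_add H (op_sub H a b) (op_sub H b c) x"
      by (intro ip_ext) (use assms in \<open>auto simp: op_sub_apply op_add_apply opD closed ip_simps\<close>)
  qed
  then show ?thesis using assms by (simp add: op_norm_triangle op_sub_closed)
qed

text \<open>Pointwise limits exist by completeness of \<open>H\<close>, and the uniform Cauchy
  estimate passes to them. This supplies the values of the extended multiplier on limits of elements
  of the convolution algebra.\<close>

lemma bounded_ops_complete:
  assumes b: "\<And>n. b n \<in> bounded_ops H"
    and Cau: "\<And>e. e > 0 \<Longrightarrow> \<exists>N. \<forall>m\<ge>N. \<forall>n\<ge>N. op_norm H (op_sub H (b m) (b n)) < e"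
  shows "\<exists>a\<in>bounded_ops H. (\<lambda>n. op_norm H (op_sub H (b n) a)) \<longlonglongrightarrow> 0"
proof -
  have "\<exists>y\<in>hcar H. (\<lambda>n. hdist H (b n x) y) \<longlonglongrightarrow> 0" if x: "x \<in> hcar H" for x
  proof (rule complete)
    fix e :: real assume e: "e > 0"
    \<comment> \<open>Adding 1 keeps the quotient meaningful when \<open>x\<close> has norm
      zero.\<close>
    then obtain N where N: "\<forall>m\<ge>N. \<forall>n\<ge>N. op_norm H (op_sub H (b m) (b n)) < e / (hnorm H x + 1)"
      using Cau[of "e / (hnorm H x + 1)"] norm_nonneg[OF x] by auto
    have "hdist H (b m x) (b n x) < e" if "m \<ge> N" "n \<ge> N" for m n
    proof -
      have p: "hnorm H x + 1 > 0" using norm_nonneg[OF x] by linarith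
      have "hdist H (b m x) (b n x) \<le> op_norm H (op_sub H (b m) (b n)) * hnorm H x"
        by (rule op_norm_sub_bound[OF b b x])
      also have "\<dots> \<le> e / (hnorm H x + 1) * hnorm H x"
        using N that x by (intro mult_right_mono) (auto simp: less_imp_le)
      also have "\<dots> < e" using p e by (simp add: field_simps)
      finally show ?thesis .
    qed
    then show "\<exists>N. \<forall>m\<ge>N. \<forall>n\<ge>N. hdist H (b m x) (b n x) < e" by blast
  qed (use b x opD in auto)
  then obtain l where l: "\<And>x. x \<in> hcar H \<Longrightarrow> l x \<in> hcar H"
    and lim: "\<And>x. x \<in> hcar H \<Longrightarrow> (\<lambda>n. hdist H (b n x) (l x)) \<longlonglongrightarrow> 0" by metis
  define a where "a = restrict l (hcar H)"
  have ax: "a x = l x" if "x \<in> hcar H" for x using that by (simp add: a_def)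
  have bc: "b n x \<in> hcar H" if "x \<in> hcar H" for n x using that b opD by auto
  have key: "hdist H (b n x) (a x) \<le> e * hnorm H x"
    if N: "\<forall>m\<ge>N. \<forall>n\<ge>N. op_norm H (op_sub H (b m) (b n)) < e" and n: "n \<ge> N" and x: "x \<in> hcar H" for e N n x
  proof -
    have "(\<lambda>m. e * hnorm H x + hdist H (b m x) (l x)) \<longlonglongrightarrow> e * hnorm H x"
      using tendsto_add[OF tendsto_const lim[OF x]] by simp
    moreover have "hdist H (b n x) (a x) \<le> e * hnorm H x + hdist H (b m x) (l x)" if "m \<ge> N" for m
    proof -
      have "hdist H (b n x) (a x) \<le> hdist H (b n x) (b m x) + hdist H (b m x) (l x)"
        using x by (simp add: ax dist_triangle bc l)
      moreover have "hdist H (b n x) (b m x) \<le> op_norm H (op_sub H (b n) (b m)) * hnorm H x"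
        using b x by (intro op_norm_sub_bound)
      moreover have "op_norm H (op_sub H (b n) (b m)) * hnorm H x \<le> e * hnorm H x"
        using N n that x by (intro mult_right_mono) (auto simp: less_imp_le)
      ultimately show ?thesis by linarith
    qed
    ultimately show ?thesis by (meson LIMSEQ_le_const)
  qed
  \<comment> \<open>A single late term of the sequence already bounds the limit operator.\<close>
  obtain N1 where N1: "\<forall>m\<ge>N1. \<forall>n\<ge>N1. op_norm H (op_sub H (b m) (b n)) < 1" using Cau[of 1] by auto
  have a: "a \<in> bounded_ops H"
  proof (rule bounded_opsI[where C = "op_norm H (b N1) + 1"])
    show "a \<in> extensional (hcar H)" by (simp add: a_def)
    fix x assume x: "x \<in> hcar H"
    show "a x \<in> hcar H" using x by (simp add: ax l)
    have "hnorm H (a x) \<le> hnorm H (b N1 x) + hdist H (b N1 x) (a x)"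
      using norm_diff_le_dist[of "b N1 x" "a x"] x by (auto simp: bc ax l)
    moreover have "hdist H (b N1 x) (a x) \<le> 1 * hnorm H x" using key[OF N1 order_refl x] .
    moreover have "hnorm H (b N1 x) \<le> op_norm H (b N1) * hnorm H x" using op_norm_bound[OF b x] .
    ultimately show "hnorm H (a x) \<le> (op_norm H (b N1) + 1) * hnorm H x" by (simp add: algebra_simps)
    show "a (hscale H c x) = hscale H c (a x)" for c
    proof (rule limit_unique[of "\<lambda>n. b n (hscale H c x)"])
      have "hdist H (b n (hscale H c x)) (hscale H c (a x)) = cmod c * hdist H (b n x) (l x)" for n
      proof -
        have "hdist H (b n (hscale H c x)) (hscale H c (a x)) = hnorm H (hscale H c (hsub H (b n x) (a x)))"
          unfolding hdist_hsub
          by (rule norm_eq_if_ip_eq) (use x b in \<open>auto simp: closed opD ip_simps ax l algebra_simps\<close>)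
        then show ?thesis using x b by (simp add: norm_scale closed opD ax l hdist_hsub)
      qed
      then show "(\<lambda>n. hdist H (b n (hscale H c x)) (hscale H c (a x))) \<longlonglongrightarrow> 0"
        using tendsto_mult_left[OF lim[OF x], of "cmod c"] by simp
    qed (use x l lim in \<open>auto simp: closed bc ax\<close>)
    fix y assume y: "y \<in> hcar H"
    show "a (hadd H x y) = hadd H (a x) (a y)"
    proof (rule limit_unique[of "\<lambda>n. b n (hadd H x y)"])
      have "hdist H (b n (hadd H x y)) (hadd H (a x) (a y)) \<le> hdist H (b n x) (l x) + hdist H (b n y) (l y)" for n
      proof -
        have "hdist H (b n (hadd H x y)) (hadd H (a x) (a y)) =
           hnorm H (hadd H (hsub H (b n x) (a x)) (hsub H (b n y) (a y)))"
          unfolding hdist_hsub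
          by (rule norm_eq_if_ip_eq) (use x y b in \<open>auto simp: closed opD ip_simps ax l algebra_simps\<close>)
        then show ?thesis using x y b norm_triangle[of "hsub H (b n x) (a x)" "hsub H (b n y) (a y)"]
          by (simp add: closed opD ax l hdist_hsub)
      qed
      then have "norm (hdist H (b n (hadd H x y)) (hadd H (a x) (a y))) \<le> hdist H (b n x) (l x) + hdist H (b n y) (l y)" for n
        using x y by (simp add: closed bc ax l)
      moreover have "(\<lambda>n. hdist H (b n x) (l x) + hdist H (b n y) (l y)) \<longlonglongrightarrow> 0"
        using tendsto_add[OF lim[OF x] lim[OF y]] by simp
      ultimately show "(\<lambda>n. hdist H (b n (hadd H x y)) (hadd H (a x) (a y))) \<longlonglongrightarrow> 0"
        by (rule Lim_null_comparison[OF always_eventually[OF allI]])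
    qed (use x y l lim in \<open>auto simp: closed bc ax\<close>)
  qed
  have "(\<lambda>n. op_norm H (op_sub H (b n) a)) \<longlonglongrightarrow> 0"
  proof (rule LIMSEQ_I)
    fix r :: real assume r: "0 < r"
    then obtain N where N: "\<forall>m\<ge>N. \<forall>n\<ge>N. op_norm H (op_sub H (b m) (b n)) < r / 2" using Cau[of "r/2"] by auto
    have "op_norm H (op_sub H (b n) a) \<le> r / 2" if "n \<ge> N" for n
      using key[OF N that] r by (intro op_norm_le) (auto simp: op_sub_apply hdist_hsub)
    then show "\<exists>no. \<forall>n\<ge>no. norm (op_norm H (op_sub H (b n) a) - 0) < r"
      using r op_norm_nonneg[OF op_sub_closed[OF b a]] by (intro exI[of _ N]) force
  qed
  with a show ?thesis by blast
qed

section \<open>Finite powers and matrix norms\<close>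

lemma power_family: "hilbert_family {..<n} (\<lambda>_. H)"
  by (simp add: hilbert_family_def hilbert_space_axioms)

lemma power_hilbert_space: "hilbert_space (hpower H n)"
  unfolding hpower_def by (rule hilbert_family.sum_hilbert_space[OF power_family])

lemma power_mem: "x \<in> hcar (hpower H n) \<longleftrightarrow> x \<in> extensional {..<n} \<and> (\<forall>i<n. x i \<in> hcar H)"
  unfolding hpower_def hilbert_family.sum_mem[OF power_family] by (auto simp: PiE_iff)

lemma power_norm: "x \<in> hcar (hpower H n) \<Longrightarrow> (hnorm (hpower H n) x)\<^sup>2 = (\<Sum>i<n. (hnorm H (x i))\<^sup>2)"
  unfolding hpower_def using hilbert_family.sum_norm_sq[OF power_family, of x n] by simp

lemma power_component_norm_le: "\<lbrakk>x \<in> hcar (hpower H n); i < n\<rbrakk> \<Longrightarrow> hnorm H (x i) \<le> hnorm (hpower H n) x"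
  unfolding hpower_def using hilbert_family.component_norm_le[OF power_family] by simp

lemma power_simps:
  "hadd (hpower H n) x y = (\<lambda>i\<in>{..<n}. hadd H (x i) (y i))"
  "hscale (hpower H n) c x = (\<lambda>i\<in>{..<n}. hscale H c (x i))"
  by (simp_all add: hpower_def hilbert_sum_def)

lemma power_norm_le_sum: "x \<in> hcar (hpower H n) \<Longrightarrow> hnorm (hpower H n) x \<le> (\<Sum>i<n. hnorm H (x i))"
proof (rule power2_le_imp_le)
  assume x: "x \<in> hcar (hpower H n)"
  have "(\<Sum>i<n. (hnorm H (x i))\<^sup>2) \<le> (\<Sum>i<n. hnorm H (x i))\<^sup>2"
  proof -
    have "(\<Sum>i<m. (hnorm H (x i))\<^sup>2) \<le> (\<Sum>i<m. hnorm H (x i))\<^sup>2 \<and> 0 \<le> (\<Sum>i<m. hnorm H (x i))" if "m \<le> n" for m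
      using that
    proof (induction m)
      case (Suc m)
      then have "0 \<le> hnorm H (x m)" using x by (simp add: power_mem)
      moreover from this Suc have "0 \<le> 2 * (\<Sum>i<m. hnorm H (x i)) * hnorm H (x m)" by simp
      ultimately show ?case using Suc zero_le_power2[of "hnorm H (x m)"] by (auto simp: power2_sum intro: add_increasing2)
    qed simp
    then show ?thesis by simp
  qed
  then show "(hnorm (hpower H n) x)\<^sup>2 \<le> (\<Sum>i<n. hnorm H (x i))\<^sup>2" using x by (simp add: power_norm)
  show "0 \<le> (\<Sum>i<n. hnorm H (x i))" using x by (intro sum_nonneg) (auto simp: power_mem)
qed

context
  fixes n :: nat and a :: "nat \<Rightarrow> nat \<Rightarrow> 'h \<Rightarrow> 'h"
  assumes a: "\<And>i j. \<lbrakk>i < n; j < n\<rbrakk> \<Longrightarrow> a i j \<in> bounded_ops H"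
begin

lemma matrix_row_closed: "\<lbrakk>i < n; \<And>j. j < n \<Longrightarrow> x j \<in> hcar H\<rbrakk> \<Longrightarrow> hsum H (\<lambda>j. a i j (x j)) n \<in> hcar H"
  using a opD by (intro hsum_closed) auto

lemma matrix_op_closed: "x \<in> hcar (hpower H n) \<Longrightarrow> matrix_op H n a x \<in> hcar (hpower H n)"
  by (auto simp: power_mem matrix_op_def intro!: matrix_row_closed)

text \<open>A crude bound, good enough for two purposes: matrices of bounded operators are bounded,
  and matrix norms depend continuously on the entries.\<close>

lemma matrix_op_norm_sum_bound:
  assumes x: "x \<in> hcar (hpower H n)"
  shows "hnorm (hpower H n) (matrix_op H n a x) \<le> (\<Sum>i<n. \<Sum>j<n. op_norm H (a i j)) * hnorm (hpower H n) x"
proof -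
  have xc: "j < n \<Longrightarrow> x j \<in> hcar H" for j using x by (simp add: power_mem)
  have "hnorm (hpower H n) (matrix_op H n a x) \<le> (\<Sum>i<n. hnorm H (matrix_op H n a x i))"
    using x by (intro power_norm_le_sum matrix_op_closed)
  also have "\<dots> = (\<Sum>i<n. hnorm H (hsum H (\<lambda>j. a i j (x j)) n))"
    using x by (simp add: matrix_op_def)
  also have "\<dots> \<le> (\<Sum>i<n. \<Sum>j<n. op_norm H (a i j) * hnorm (hpower H n) x)"
  proof (intro sum_mono order_trans[OF norm_hsum_le])
    fix i j assume ij: "i \<in> {..<n}" "j \<in> {..<n}"
    have "hnorm H (a i j (x j)) \<le> op_norm H (a i j) * hnorm H (x j)"
      using a ij xc by (intro op_norm_bound) auto
    also have "\<dots> \<le> op_norm H (a i j) * hnorm (hpower H n) x"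
      using ij x a by (intro mult_left_mono power_component_norm_le op_norm_nonneg) auto
    finally show "hnorm H (a i j (x j)) \<le> op_norm H (a i j) * hnorm (hpower H n) x" .
  qed (use a xc opD in auto)
  also have "\<dots> = (\<Sum>i<n. \<Sum>j<n. op_norm H (a i j)) * hnorm (hpower H n) x"
    by (simp add: sum_distrib_right)
  finally show ?thesis .
qed

lemma matrix_op_bounded: "matrix_op H n a \<in> bounded_ops (hpower H n)"
proof (rule hilbert_space.bounded_opsI[OF power_hilbert_space, where C = "(\<Sum>i<n. \<Sum>j<n. op_norm H (a i j))"])
  interpret P: hilbert_space "hpower H n" by (rule power_hilbert_space)
  show "matrix_op H n a \<in> extensional (hcar (hpower H n))" by (simp add: matrix_op_def)
  fix x assume x: "x \<in> hcar (hpower H n)"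
  have xc: "j < n \<Longrightarrow> x j \<in> hcar H" for j using x by (simp add: power_mem)
  show "matrix_op H n a x \<in> hcar (hpower H n)" using x by (rule matrix_op_closed)
  show "hnorm (hpower H n) (matrix_op H n a x) \<le> (\<Sum>i<n. \<Sum>j<n. op_norm H (a i j)) * hnorm (hpower H n) x"
    using x by (rule matrix_op_norm_sum_bound)
  have cl: "i < n \<Longrightarrow> j < n \<Longrightarrow> y \<in> hcar H \<Longrightarrow> a i j y \<in> hcar H" for i j y using a opD by auto
  show "matrix_op H n a (hscale (hpower H n) c x) = hscale (hpower H n) c (matrix_op H n a x)" for c
  proof -
    have "hsum H (\<lambda>j. a i j (hscale (hpower H n) c x j)) n = hscale H c (hsum H (\<lambda>j. a i j (x j)) n)" if i: "i < n" for i
      by (rule ip_ext) (use i a xc in \<open>simp_all add: power_simps closed hsum_closed cl ip_hsum ip_simps opD sum_distrib_left\<close>)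
    moreover have "hscale (hpower H n) c x \<in> hcar (hpower H n)" using x by (rule P.scale_closed)
    ultimately show ?thesis using x by (auto simp: matrix_op_def fun_eq_iff power_simps)
  qed
  fix y assume y: "y \<in> hcar (hpower H n)"
  have yc: "j < n \<Longrightarrow> y j \<in> hcar H" for j using y by (simp add: power_mem)
  show "matrix_op H n a (hadd (hpower H n) x y) = hadd (hpower H n) (matrix_op H n a x) (matrix_op H n a y)"
  proof -
    have "hsum H (\<lambda>j. a i j (hadd (hpower H n) x y j)) n = hadd H (hsum H (\<lambda>j. a i j (x j)) n) (hsum H (\<lambda>j. a i j (y j)) n)" if i: "i < n" for i
      by (rule ip_ext) (use i a xc yc in \<open>simp_all add: power_simps closed hsum_closed cl ip_hsum ip_simps opD sum.distrib\<close>)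
    moreover have "hadd (hpower H n) x y \<in> hcar (hpower H n)" using x y by (rule P.add_closed)
    ultimately show ?thesis using x y by (auto simp: matrix_op_def fun_eq_iff power_simps)
  qed
qed

lemma matrix_norm_nonneg: "0 \<le> matrix_norm H n a"
  unfolding matrix_norm_def by (rule hilbert_space.op_norm_nonneg[OF power_hilbert_space matrix_op_bounded])

text \<open>The norm inequality in terms of sums of squares, so that \<open>x\<close> may be any
  family with values in \<open>H\<close> and need not be an extensional member of
  \<open>hpower H n\<close>. The converse direction is \<open>matrix_norm_le\<close>.\<close>

lemma matrix_norm_bound:
  assumes x: "\<And>j. j < n \<Longrightarrow> x j \<in> hcar H"
  shows "(\<Sum>i<n. (hnorm H (hsum H (\<lambda>j. a i j (x j)) n))\<^sup>2) \<le> (matrix_norm H n a)\<^sup>2 * (\<Sum>j<n. (hnorm H (x j))\<^sup>2)"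
proof -
  interpret P: hilbert_space "hpower H n" by (rule power_hilbert_space)
  define y where "y = restrict x {..<n}"
  have y: "y \<in> hcar (hpower H n)" using x by (auto simp: y_def power_mem)
  have "hsum H (\<lambda>j. a i j (y j)) m = hsum H (\<lambda>j. a i j (x j)) m" if "m \<le> n" for i m
    using that by (induction m) (auto simp: y_def)
  then have "(\<Sum>i<n. (hnorm H (hsum H (\<lambda>j. a i j (x j)) n))\<^sup>2) = (\<Sum>i<n. (hnorm H (matrix_op H n a y i))\<^sup>2)"
    using y by (simp add: matrix_op_def)
  also have "\<dots> = (hnorm (hpower H n) (matrix_op H n a y))\<^sup>2" using y by (simp add: power_norm matrix_op_closed)
  also have "\<dots> \<le> (matrix_norm H n a * hnorm (hpower H n) y)\<^sup>2"
    unfolding matrix_norm_def using y by (intro power_mono P.op_norm_bound matrix_op_bounded P.norm_nonneg matrix_op_closed)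
  also have "\<dots> = (matrix_norm H n a)\<^sup>2 * (\<Sum>j<n. (hnorm H (x j))\<^sup>2)"
    using y by (simp add: power_mult_distrib power_norm) (simp add: y_def)
  finally show ?thesis .
qed

lemma matrix_norm_le:
  assumes "\<And>x. (\<And>j. j < n \<Longrightarrow> x j \<in> hcar H) \<Longrightarrow>
     (\<Sum>i<n. (hnorm H (hsum H (\<lambda>j. a i j (x j)) n))\<^sup>2) \<le> c\<^sup>2 * (\<Sum>j<n. (hnorm H (x j))\<^sup>2)" and c: "0 \<le> c"
  shows "matrix_norm H n a \<le> c"
  unfolding matrix_norm_def
proof (rule hilbert_space.op_norm_le[OF power_hilbert_space _ c])
  interpret P: hilbert_space "hpower H n" by (rule power_hilbert_space)
  fix x assume x: "x \<in> hcar (hpower H n)"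
  have "(hnorm (hpower H n) (matrix_op H n a x))\<^sup>2 = (\<Sum>i<n. (hnorm H (hsum H (\<lambda>j. a i j (x j)) n))\<^sup>2)"
    unfolding power_norm[OF matrix_op_closed[OF x]] using x by (simp add: matrix_op_def)
  also have "\<dots> \<le> c\<^sup>2 * (\<Sum>j<n. (hnorm H (x j))\<^sup>2)" using x assms(1)[of x] by (simp add: power_mem)
  also have "\<dots> = (c * hnorm (hpower H n) x)\<^sup>2" using x by (simp add: power_norm power_mult_distrib)
  finally show "hnorm (hpower H n) (matrix_op H n a x) \<le> c * hnorm (hpower H n) x"
    by (rule power2_le_imp_le) (use x c in simp)
qed

end

text \<open>Entrywise approximation controls the matrix norm. This carries estimates from the image
  of \<open>Cc\<close> over to its closure.\<close>

lemma matrix_norm_perturb: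
  assumes a: "\<And>i j. \<lbrakk>i < n; j < n\<rbrakk> \<Longrightarrow> a i j \<in> bounded_ops H"
    and b: "\<And>i j. \<lbrakk>i < n; j < n\<rbrakk> \<Longrightarrow> b i j \<in> bounded_ops H"
  shows "matrix_norm H n b \<le> matrix_norm H n a + (\<Sum>i<n. \<Sum>j<n. op_norm H (op_sub H (b i j) (a i j)))"
proof -
  interpret P: hilbert_space "hpower H n" by (rule power_hilbert_space)
  define d where "d i j = op_sub H (b i j) (a i j)" for i j
  have d: "\<lbrakk>i < n; j < n\<rbrakk> \<Longrightarrow> d i j \<in> bounded_ops H" for i j using a b by (simp add: d_def op_sub_closed)
  have D: "0 \<le> (\<Sum>i<n. \<Sum>j<n. op_norm H (d i j))" using d by (intro sum_nonneg op_norm_nonneg) auto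
  show ?thesis unfolding matrix_norm_def[of H n b]
  proof (rule P.op_norm_le)
    fix x assume x: "x \<in> hcar (hpower H n)"
    have xc: "j < n \<Longrightarrow> x j \<in> hcar H" for j using x by (simp add: power_mem)
    have "hsum H (\<lambda>j. b i j (x j)) n = hadd H (hsum H (\<lambda>j. a i j (x j)) n) (hsum H (\<lambda>j. d i j (x j)) n)" if i: "i < n" for i
      by (rule ip_ext)
        (use i a b d xc in \<open>simp_all add: hsum_closed closed opD ip_hsum ip_simps d_def op_sub_apply flip: sum.distrib\<close>)
    then have "matrix_op H n b x = hadd (hpower H n) (matrix_op H n a x) (matrix_op H n d x)"
      using x by (auto simp: matrix_op_def fun_eq_iff power_simps)
    then have "hnorm (hpower H n) (matrix_op H n b x) \<le> hnorm (hpower H n) (matrix_op H n a x) + hnorm (hpower H n) (matrix_op H n d x)"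
      using x a d by (simp add: P.norm_triangle matrix_op_closed)
    also have "\<dots> \<le> matrix_norm H n a * hnorm (hpower H n) x + (\<Sum>i<n. \<Sum>j<n. op_norm H (d i j)) * hnorm (hpower H n) x"
      unfolding matrix_norm_def using x a d by (intro add_mono P.op_norm_bound matrix_op_bounded matrix_op_norm_sum_bound)
    finally show "hnorm (hpower H n) (matrix_op H n b x) \<le> (matrix_norm H n a + (\<Sum>i<n. \<Sum>j<n. op_norm H (op_sub H (b i j) (a i j)))) * hnorm (hpower H n) x"
      by (simp add: d_def algebra_simps)
  qed (use matrix_norm_nonneg[of n a] a D in \<open>simp add: d_def\<close>)
qed

end

section \<open>Completion of a pre-Hilbert space\<close>

text \<open>The injection \<open>J\<close> codes sequences in \<open>Q\<close> by points of a freely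
  chosen type. Classes of Cauchy sequences become sets of codes, so the completion can be placed
  inside the type over which the universal representation ranges.\<close>

locale completion = pre_hilbert Q for Q :: "'p hilbert" +
  fixes J :: "(nat \<Rightarrow> 'p) \<Rightarrow> 'q"
  assumes inj_J: "inj J"
begin

definition cau :: "(nat \<Rightarrow> 'p) set" where
  "cau = {s. (\<forall>n. s n \<in> hcar Q) \<and> (\<forall>e>0. \<exists>N. \<forall>m\<ge>N. \<forall>n\<ge>N. hdist Q (s m) (s n) < e)}"

definition eqv :: "(nat \<Rightarrow> 'p) \<Rightarrow> (nat \<Rightarrow> 'p) \<Rightarrow> bool" where
  "eqv s t \<longleftrightarrow> (\<lambda>n. hdist Q (s n) (t n)) \<longlonglongrightarrow> 0"

definition cls :: "(nat \<Rightarrow> 'p) \<Rightarrow> 'q set" where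
  "cls s = J ` {t \<in> cau. eqv s t}"

definition rep :: "'q set \<Rightarrow> nat \<Rightarrow> 'p" where
  "rep X = (SOME s. s \<in> cau \<and> X = cls s)"

text \<open>The operations use chosen representatives; \<open>ip_K\<close>, \<open>add_K\<close> and
  \<open>scale_K\<close> show that any Cauchy sequence of the class may be used instead.\<close>

definition completed :: "'q set hilbert" where
  "completed = \<lparr>hcar = cls ` cau, hzero = cls (\<lambda>_. hzero Q),
     hadd = (\<lambda>X Y. cls (\<lambda>n. hadd Q (rep X n) (rep Y n))),
     hscale = (\<lambda>c X. cls (\<lambda>n. hscale Q c (rep X n))),
     hip = (\<lambda>X Y. lim (\<lambda>n. hip Q (rep X n) (rep Y n)))\<rparr>"

abbreviation "K \<equiv> completed"

lemma cau_mem: "s \<in> cau \<Longrightarrow> s n \<in> hcar Q"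
  by (simp add: cau_def)

lemma eqv_refl: "s \<in> cau \<Longrightarrow> eqv s s"
  by (simp add: eqv_def dist_self cau_mem)

lemma eqv_sym: "\<lbrakk>s \<in> cau; t \<in> cau; eqv s t\<rbrakk> \<Longrightarrow> eqv t s"
  by (simp add: eqv_def dist_commute[of "t _" "s _"] cau_mem)

lemma eqv_trans: 
  assumes "s \<in> cau" "t \<in> cau" "u \<in> cau" "eqv s t" "eqv t u"
  shows "eqv s u"
  unfolding eqv_def
proof (rule Lim_null_comparison[OF always_eventually[OF allI]])
  show "norm (hdist Q (s n) (u n)) \<le> hdist Q (s n) (t n) + hdist Q (t n) (u n)" for n
    using assms by (simp add: cau_mem dist_triangle)
  show "(\<lambda>n. hdist Q (s n) (t n) + hdist Q (t n) (u n)) \<longlonglongrightarrow> 0"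
    using tendsto_add[of _ 0 _ _ 0] assms by (simp add: eqv_def)
qed

lemma cls_eq_iff: "\<lbrakk>s \<in> cau; t \<in> cau\<rbrakk> \<Longrightarrow> cls s = cls t \<longleftrightarrow> eqv s t"
proof
  assume st: "s \<in> cau" "t \<in> cau"
  { assume "cls s = cls t"
    moreover have "J t \<in> cls t" using st eqv_refl by (auto simp: cls_def)
    ultimately have "J t \<in> cls s" by simp
    then show "eqv s t" using inj_J by (auto simp: cls_def inj_def) }
  assume e: "eqv s t"
  have "{u \<in> cau. eqv s u} = {u \<in> cau. eqv t u}"
    using st e eqv_trans eqv_sym by blast
  then show "cls s = cls t" by (simp add: cls_def)
qed

lemma rep_cls: "s \<in> cau \<Longrightarrow> rep (cls s) \<in> cau" and eqv_rep_cls: "s \<in> cau \<Longrightarrow> eqv (rep (cls s)) s"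
proof -
  have "s \<in> cau \<Longrightarrow> rep (cls s) \<in> cau \<and> cls s = cls (rep (cls s))"
    unfolding rep_def by (rule someI[of _ s]) simp
  then show "s \<in> cau \<Longrightarrow> rep (cls s) \<in> cau" and "s \<in> cau \<Longrightarrow> eqv (rep (cls s)) s"
    using cls_eq_iff eqv_sym by blast+
qed

lemma cauI:
  assumes "\<And>n. s n \<in> hcar Q" "\<And>e. e > 0 \<Longrightarrow> \<exists>N. \<forall>m\<ge>N. \<forall>n\<ge>N. hdist Q (s m) (s n) < e"
  shows "s \<in> cau"
  using assms by (simp add: cau_def)

lemma cauD: "\<lbrakk>s \<in> cau; e > 0\<rbrakk> \<Longrightarrow> \<exists>N. \<forall>m\<ge>N. \<forall>n\<ge>N. hdist Q (s m) (s n) < e"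
  by (simp add: cau_def)

lemma const_cau: "p \<in> hcar Q \<Longrightarrow> (\<lambda>_. p) \<in> cau"
  by (auto simp: cau_def dist_self)

lemma dist_add_le:
  assumes "x \<in> hcar Q" "y \<in> hcar Q" "x' \<in> hcar Q" "y' \<in> hcar Q"
  shows "hdist Q (hadd Q x y) (hadd Q x' y') \<le> hdist Q x x' + hdist Q y y'"
proof -
  have "hdist Q (hadd Q x y) (hadd Q x' y') = hnorm Q (hadd Q (hsub Q x x') (hsub Q y y'))"
    unfolding hdist_hsub by (rule norm_eq_if_ip_eq) (use assms in \<open>auto simp: closed ip_simps\<close>)
  then show ?thesis using assms norm_triangle[of "hsub Q x x'" "hsub Q y y'"] by (simp add: hdist_hsub closed)
qed

lemma dist_scale:
  assumes "x \<in> hcar Q" "y \<in> hcar Q"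
  shows "hdist Q (hscale Q c x) (hscale Q c y) = cmod c * hdist Q x y"
proof -
  have "hdist Q (hscale Q c x) (hscale Q c y) = hnorm Q (hscale Q c (hsub Q x y))"
    unfolding hdist_hsub by (rule norm_eq_if_ip_eq) (use assms in \<open>auto simp: closed ip_simps algebra_simps\<close>)
  then show ?thesis using assms by (simp add: hdist_hsub closed norm_scale)
qed

lemma add_cau:
  assumes "s \<in> cau" "t \<in> cau"
  shows "(\<lambda>n. hadd Q (s n) (t n)) \<in> cau"
proof (rule cauI)
  fix e :: real assume "e > 0"
  then obtain M N where M: "\<forall>m\<ge>M. \<forall>n\<ge>M. hdist Q (s m) (s n) < e / 2"
    and N: "\<forall>m\<ge>N. \<forall>n\<ge>N. hdist Q (t m) (t n) < e / 2"
    using cauD[OF assms(1), of "e/2"] cauD[OF assms(2), of "e/2"] by auto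
  have "hdist Q (hadd Q (s m) (t m)) (hadd Q (s n) (t n)) < e" if "m \<ge> max M N" "n \<ge> max M N" for m n
  proof -
    have "hdist Q (s m) (s n) < e / 2" "hdist Q (t m) (t n) < e / 2" using M N that by auto
    then show ?thesis using dist_add_le[of "s m" "t m" "s n" "t n"] assms by (simp add: cau_mem)
  qed
  then show "\<exists>N. \<forall>m\<ge>N. \<forall>n\<ge>N. hdist Q (hadd Q (s m) (t m)) (hadd Q (s n) (t n)) < e" by blast
qed (use assms in \<open>simp add: cau_mem closed\<close>)

text \<open>Together with \<open>lipschitz_eqv\<close> this lets a Lipschitz map act termwise on
  classes; it serves both scalar multiplication and the extension of bounded operators.\<close>

lemma lipschitz_cau:
  assumes s: "s \<in> cau" and A: "\<And>x. x \<in> hcar Q \<Longrightarrow> A x \<in> hcar Q"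
    and lip: "\<And>x y. \<lbrakk>x \<in> hcar Q; y \<in> hcar Q\<rbrakk> \<Longrightarrow> hdist Q (A x) (A y) \<le> c * hdist Q x y"
  shows "(\<lambda>n. A (s n)) \<in> cau"
proof (rule cauI)
  fix e :: real assume e: "e > 0"
  then obtain N where N: "\<forall>m\<ge>N. \<forall>n\<ge>N. hdist Q (s m) (s n) < e / (\<bar>c\<bar> + 1)"
    using cauD[OF s, of "e / (\<bar>c\<bar> + 1)"] by auto
  have "hdist Q (A (s m)) (A (s n)) < e" if "m \<ge> N" "n \<ge> N" for m n
  proof -
    have "hdist Q (A (s m)) (A (s n)) \<le> c * hdist Q (s m) (s n)" using s by (intro lip cau_mem)
    also have "\<dots> \<le> \<bar>c\<bar> * (e / (\<bar>c\<bar> + 1))"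
      using s N that by (intro mult_mono) (auto simp: cau_mem less_imp_le)
    also have "\<dots> < e" using e by (simp add: field_simps)
    finally show ?thesis .
  qed
  then show "\<exists>N. \<forall>m\<ge>N. \<forall>n\<ge>N. hdist Q (A (s m)) (A (s n)) < e" by blast
qed (use s A in \<open>simp add: cau_mem\<close>)

lemma scale_cau: "s \<in> cau \<Longrightarrow> (\<lambda>n. hscale Q c (s n)) \<in> cau"
  by (rule lipschitz_cau[where c = "cmod c"]) (auto simp: closed dist_scale)

lemma norm_bounded:
  assumes "s \<in> cau"
  shows "\<exists>B. \<forall>n. hnorm Q (s n) \<le> B"
proof -
  obtain N where N: "\<forall>m\<ge>N. \<forall>n\<ge>N. hdist Q (s m) (s n) < 1" using cauD[OF assms, of 1] by auto
  have "hnorm Q (s n) \<le> (\<Sum>i\<le>N. hnorm Q (s i)) + 1" for n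
  proof (cases "n \<le> N")
    case True
    have "hnorm Q (s n) \<le> (\<Sum>i\<le>N. hnorm Q (s i))"
      using assms True by (intro member_le_sum) (auto simp: cau_mem)
    then show ?thesis by simp
  next
    case False
    have "hnorm Q (s n) \<le> hnorm Q (s N) + hdist Q (s n) (s N)"
      using norm_diff_le_dist[of "s n" "s N"] assms by (simp add: cau_mem)
    moreover have "hdist Q (s n) (s N) < 1" using N False by auto
    moreover have "hnorm Q (s N) \<le> (\<Sum>i\<le>N. hnorm Q (s i))"
      using assms by (intro member_le_sum) (auto simp: cau_mem)
    ultimately show ?thesis by linarith
  qed
  then show ?thesis by blast
qed

lemma ip_Cauchy:
  assumes s: "s \<in> cau" and t: "t \<in> cau"
  shows "Cauchy (\<lambda>n. hip Q (s n) (t n))"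
proof (rule CauchyI)
  fix e :: real assume e: "e > 0"
  obtain B where B: "\<And>n. hnorm Q (s n) \<le> B" using norm_bounded[OF s] by blast
  obtain C where C: "\<And>n. hnorm Q (t n) \<le> C" using norm_bounded[OF t] by blast
  have BC: "0 \<le> B" "0 \<le> C"
    using order_trans[OF norm_nonneg[OF cau_mem[OF s]] B] order_trans[OF norm_nonneg[OF cau_mem[OF t]] C] by auto
  define d where "d = e / (B + C + 1)"
  have d: "d > 0" using e BC by (simp add: d_def)
  obtain M N where M: "\<forall>m\<ge>M. \<forall>n\<ge>M. hdist Q (s m) (s n) < d"
    and N: "\<forall>m\<ge>N. \<forall>n\<ge>N. hdist Q (t m) (t n) < d"
    using cauD[OF s d] cauD[OF t d] by auto
  have "norm (hip Q (s m) (t m) - hip Q (s n) (t n)) < e" if "m \<ge> max M N" "n \<ge> max M N" for m n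
  proof -
    have "norm (hip Q (s m) (t m) - hip Q (s n) (t n)) \<le> hdist Q (s m) (s n) * hnorm Q (t m) + hnorm Q (s n) * hdist Q (t m) (t n)"
      using s t by (intro ip_diff_le_dist cau_mem)
    also have "\<dots> \<le> d * C + B * d"
      using s t B C M N that BC d by (intro add_mono mult_mono) (auto simp: cau_mem less_imp_le)
    also have "\<dots> < (B + C + 1) * d" using d by (simp add: algebra_simps)
    also have "\<dots> = e" using BC by (simp add: d_def)
    finally show ?thesis .
  qed
  then show "\<exists>M. \<forall>m\<ge>M. \<forall>n\<ge>M. norm (hip Q (s m) (t m) - hip Q (s n) (t n)) < e" by blast
qed

lemma ip_diff_null:
  assumes "s \<in> cau" "t \<in> cau" "s' \<in> cau" "t' \<in> cau" "eqv s' s" "eqv t' t"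
  shows "(\<lambda>n. hip Q (s' n) (t' n) - hip Q (s n) (t n)) \<longlonglongrightarrow> 0"
proof -
  obtain B where B: "\<And>n. hnorm Q (s n) \<le> B" using norm_bounded assms by blast
  obtain C where C: "\<And>n. hnorm Q (t' n) \<le> C" using norm_bounded assms by blast
  show ?thesis
  proof (rule Lim_null_comparison[OF always_eventually[OF allI]])
    fix n
    have "norm (hip Q (s' n) (t' n) - hip Q (s n) (t n)) \<le> hdist Q (s' n) (s n) * hnorm Q (t' n) + hnorm Q (s n) * hdist Q (t' n) (t n)"
      using assms by (intro ip_diff_le_dist cau_mem)
    also have "\<dots> \<le> hdist Q (s' n) (s n) * C + B * hdist Q (t' n) (t n)"
      using assms B C by (intro add_mono mult_left_mono mult_right_mono) (auto simp: cau_mem)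
    finally show "norm (hip Q (s' n) (t' n) - hip Q (s n) (t n)) \<le> \<dots>" .
  next
    show "(\<lambda>n. hdist Q (s' n) (s n) * C + B * hdist Q (t' n) (t n)) \<longlonglongrightarrow> 0"
      using assms by (auto simp: eqv_def intro!: tendsto_add_zero tendsto_mult_left_zero tendsto_mult_right_zero)
  qed
qed

lemma car_K: "hcar K = cls ` cau" and zero_K: "hzero K = cls (\<lambda>_. hzero Q)"
  by (simp_all add: completed_def)

lemma ip_K:
  assumes "s \<in> cau" "t \<in> cau"
  shows "(\<lambda>n. hip Q (s n) (t n)) \<longlonglongrightarrow> hip K (cls s) (cls t)"
proof -
  have c: "(\<lambda>n. hip Q (rep (cls s) n) (rep (cls t) n)) \<longlonglongrightarrow> hip K (cls s) (cls t)"
    using Cauchy_convergent[OF ip_Cauchy[OF rep_cls rep_cls]] assms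
    by (simp add: completed_def convergent_LIMSEQ_iff)
  have "(\<lambda>n. hip Q (rep (cls s) n) (rep (cls t) n) - (hip Q (rep (cls s) n) (rep (cls t) n) - hip Q (s n) (t n)))
     \<longlonglongrightarrow> hip K (cls s) (cls t) - 0"
    using assms by (intro tendsto_diff c ip_diff_null rep_cls eqv_rep_cls)
  then show ?thesis by simp
qed

lemma add_K:
  assumes "s \<in> cau" "t \<in> cau"
  shows "hadd K (cls s) (cls t) = cls (\<lambda>n. hadd Q (s n) (t n))"
proof -
  have "eqv (\<lambda>n. hadd Q (rep (cls s) n) (rep (cls t) n)) (\<lambda>n. hadd Q (s n) (t n))"
    unfolding eqv_def
  proof (rule Lim_null_comparison[OF always_eventually[OF allI]])
    show "norm (hdist Q (hadd Q (rep (cls s) n) (rep (cls t) n)) (hadd Q (s n) (t n)))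
       \<le> hdist Q (rep (cls s) n) (s n) + hdist Q (rep (cls t) n) (t n)" for n
      using assms dist_add_le[of "rep (cls s) n" "rep (cls t) n" "s n" "t n"] by (simp add: cau_mem rep_cls closed)
    show "(\<lambda>n. hdist Q (rep (cls s) n) (s n) + hdist Q (rep (cls t) n) (t n)) \<longlonglongrightarrow> 0"
      using eqv_rep_cls assms by (intro tendsto_add_zero) (auto simp: eqv_def)
  qed
  then show ?thesis using assms by (simp add: completed_def cls_eq_iff add_cau rep_cls)
qed

lemma lipschitz_eqv:
  assumes st: "s \<in> cau" "t \<in> cau" "eqv s t" and A: "\<And>x. x \<in> hcar Q \<Longrightarrow> A x \<in> hcar Q"
    and lip: "\<And>x y. \<lbrakk>x \<in> hcar Q; y \<in> hcar Q\<rbrakk> \<Longrightarrow> hdist Q (A x) (A y) \<le> c * hdist Q x y"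
  shows "eqv (\<lambda>n. A (s n)) (\<lambda>n. A (t n))"
  unfolding eqv_def
proof (rule Lim_null_comparison[OF always_eventually[OF allI]])
  show "norm (hdist Q (A (s n)) (A (t n))) \<le> c * hdist Q (s n) (t n)" for n
    using st lip A by (simp add: cau_mem)
  show "(\<lambda>n. c * hdist Q (s n) (t n)) \<longlonglongrightarrow> 0"
    using st by (auto simp: eqv_def intro: tendsto_mult_right_zero)
qed

lemma scale_K: "s \<in> cau \<Longrightarrow> hscale K c (cls s) = cls (\<lambda>n. hscale Q c (s n))"
  using lipschitz_eqv[OF rep_cls _ eqv_rep_cls, of s "hscale Q c" "cmod c"]
  by (simp add: completed_def cls_eq_iff scale_cau rep_cls closed dist_scale)

lemmas K_simps = car_K zero_K add_K scale_K

lemma pre_hilbert_K: "pre_hilbert K"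
proof
  have z: "(\<lambda>_. hzero Q) \<in> cau" by (simp add: const_cau closed)
  show "hzero K \<in> hcar K" using z by (simp add: K_simps)
  fix x y w c d
  assume "x \<in> hcar K"
  then obtain s where s: "s \<in> cau" "x = cls s" by (auto simp: car_K)
  show "hscale K c x \<in> hcar K" using s by (simp add: K_simps scale_cau)
  show "hadd K x (hzero K) = x" using s z by (simp add: K_simps add_zero cau_mem)
  show "hadd K x (hscale K (- 1) x) = hzero K" using s z by (simp add: K_simps add_neg cau_mem scale_cau)
  show "hscale K 1 x = x" using s by (simp add: K_simps scale_one cau_mem)
  show "hscale K c (hscale K d x) = hscale K (c * d) x" using s by (simp add: K_simps scale_scale cau_mem scale_cau)
  show "hscale K (c + d) x = hadd K (hscale K c x) (hscale K d x)" using s by (simp add: K_simps add_scale cau_mem scale_cau)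
  show "0 \<le> Re (hip K x x)"
    using tendsto_Re[OF ip_K[OF s(1) s(1)]] s by (intro LIMSEQ_le_const) (auto simp: ip_nonneg cau_mem)
  assume "y \<in> hcar K"
  then obtain t where t: "t \<in> cau" "y = cls t" by (auto simp: car_K)
  show "hadd K x y \<in> hcar K" using s t by (simp add: K_simps add_cau)
  show "hadd K x y = hadd K y x" using s t by (simp add: K_simps add_commute[of "s _"] cau_mem)
  show "hscale K c (hadd K x y) = hadd K (hscale K c x) (hscale K c y)"
    using s t by (simp add: K_simps scale_add cau_mem add_cau scale_cau)
  have "(\<lambda>n. cnj (hip Q (t n) (s n))) \<longlonglongrightarrow> cnj (hip K y x)"
    using ip_K[OF t(1) s(1)] s t by (intro tendsto_cnj) simp
  moreover have "(\<lambda>n. cnj (hip Q (t n) (s n))) = (\<lambda>n. hip Q (s n) (t n))"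
    using s t by (simp add: ip_commute[of "s _"] cau_mem)
  ultimately show "hip K x y = cnj (hip K y x)"
    using ip_K[OF s(1) t(1)] s t LIMSEQ_unique by auto
  have "(\<lambda>n. hip Q (s n) (hscale Q c (t n))) \<longlonglongrightarrow> hip K x (hscale K c y)"
    using ip_K[OF s(1) scale_cau[OF t(1), of c]] s t by (simp add: K_simps)
  moreover have "(\<lambda>n. hip Q (s n) (hscale Q c (t n))) = (\<lambda>n. c * hip Q (s n) (t n))"
    using s t by (simp add: ip_scale cau_mem)
  moreover have "(\<lambda>n. c * hip Q (s n) (t n)) \<longlonglongrightarrow> c * hip K x y"
    using ip_K[OF s(1) t(1)] s t by (intro tendsto_mult_left) simp
  ultimately show "hip K x (hscale K c y) = c * hip K x y"
    using LIMSEQ_unique by auto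
  assume "w \<in> hcar K"
  then obtain u where u: "u \<in> cau" "w = cls u" by (auto simp: car_K)
  show "hadd K (hadd K x y) w = hadd K x (hadd K y w)"
    using s t u by (simp add: K_simps add_cau add_assoc cau_mem)
  have "(\<lambda>n. hip Q (s n) (hadd Q (t n) (u n))) \<longlonglongrightarrow> hip K x (hadd K y w)"
    using ip_K[OF s(1) add_cau[OF t(1) u(1)]] s t u by (simp add: K_simps)
  moreover have "(\<lambda>n. hip Q (s n) (hadd Q (t n) (u n))) = (\<lambda>n. hip Q (s n) (t n) + hip Q (s n) (u n))"
    using s t u by (simp add: ip_add cau_mem)
  moreover have "(\<lambda>n. hip Q (s n) (t n) + hip Q (s n) (u n)) \<longlonglongrightarrow> hip K x y + hip K x w"
    using ip_K[OF s(1) t(1)] ip_K[OF s(1) u(1)] s t u by (intro tendsto_add) simp_all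
  ultimately show "hip K x (hadd K y w) = hip K x y + hip K x w"
    using LIMSEQ_unique by auto
qed

lemma norm_K: "s \<in> cau \<Longrightarrow> (\<lambda>n. hnorm Q (s n)) \<longlonglongrightarrow> hnorm K (cls s)"
  unfolding hnorm_def by (intro tendsto_real_sqrt tendsto_Re ip_K)

lemma sub_K: "\<lbrakk>s \<in> cau; t \<in> cau\<rbrakk> \<Longrightarrow> hsub K (cls s) (cls t) = cls (\<lambda>n. hsub Q (s n) (t n))"
  by (simp add: hsub_def K_simps scale_cau)

lemma sub_cau: "\<lbrakk>s \<in> cau; t \<in> cau\<rbrakk> \<Longrightarrow> (\<lambda>n. hsub Q (s n) (t n)) \<in> cau"
  by (simp add: hsub_def add_cau scale_cau)

lemma dist_K: "\<lbrakk>s \<in> cau; t \<in> cau\<rbrakk> \<Longrightarrow> (\<lambda>n. hdist Q (s n) (t n)) \<longlonglongrightarrow> hdist K (cls s) (cls t)"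
  unfolding hdist_hsub using norm_K[OF sub_cau] by (simp add: sub_K)

definition emb :: "'p \<Rightarrow> 'q set" where "emb p = cls (\<lambda>_. p)"

lemma emb_closed: "p \<in> hcar Q \<Longrightarrow> emb p \<in> hcar K"
  by (simp add: emb_def car_K const_cau)

lemma ip_emb: "\<lbrakk>p \<in> hcar Q; q \<in> hcar Q\<rbrakk> \<Longrightarrow> hip K (emb p) (emb q) = hip Q p q"
  using ip_K[OF const_cau const_cau, of p q] LIMSEQ_const_iff unfolding emb_def by metis

lemma dist_emb: "\<lbrakk>p \<in> hcar Q; q \<in> hcar Q\<rbrakk> \<Longrightarrow> hdist K (emb p) (emb q) = hdist Q p q"
  using dist_K[OF const_cau const_cau, of p q] LIMSEQ_const_iff unfolding emb_def by metis

lemma dist_emb_le: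
  assumes s: "s \<in> cau" and N: "\<forall>m\<ge>N. \<forall>n\<ge>N. hdist Q (s m) (s n) < e" and n: "n \<ge> N"
  shows "hdist K (cls s) (emb (s n)) \<le> e"
proof -
  have "(\<lambda>m. hdist Q (s m) (s n)) \<longlonglongrightarrow> hdist K (cls s) (emb (s n))"
    unfolding emb_def using s by (intro dist_K const_cau cau_mem)
  then show ?thesis by (rule LIMSEQ_le_const2) (use N n in \<open>auto intro!: exI[of _ N] less_imp_le\<close>)
qed

text \<open>A Cauchy sequence of classes is replaced by a sequence in \<open>Q\<close> that follows
  it at distance at most \<open>1 / Suc k\<close>. That sequence is Cauchy, and its class is the
  limit.\<close>

lemma hilbert_space_K: "hilbert_space K"
proof (rule hilbert_spaceI[OF pre_hilbert_K])
  interpret K: pre_hilbert K by (rule pre_hilbert_K)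
  fix x assume "x \<in> hcar K" and 0: "hip K x x = 0"
  then obtain s where s: "s \<in> cau" "x = cls s" by (auto simp: car_K)
  have "(\<lambda>n. hnorm Q (s n)) \<longlonglongrightarrow> 0" using norm_K[OF s(1)] s 0 by (simp add: hnorm_def)
  moreover have "hdist Q (s n) (hzero Q) = hnorm Q (s n)" for n
    unfolding hdist_hsub by (rule norm_eq_if_ip_eq) (use s in \<open>auto simp: closed cau_mem ip_simps\<close>)
  ultimately have "eqv s (\<lambda>_. hzero Q)" by (simp add: eqv_def)
  then show "x = hzero K" using s by (simp add: zero_K cls_eq_iff const_cau closed)
next
  interpret K: pre_hilbert K by (rule pre_hilbert_K)
  fix X :: "nat \<Rightarrow> 'q set"
  assume X: "\<And>n. X n \<in> hcar K" and C: "\<And>e. e > 0 \<Longrightarrow> \<exists>N. \<forall>m\<ge>N. \<forall>n\<ge>N. hdist K (X m) (X n) < e"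
  \<comment> \<open>A far enough term of any sequence in the class \<open>X k\<close> approximates
    it.\<close>
  have "\<exists>p\<in>hcar Q. hdist K (X k) (emb p) \<le> 1 / real (Suc k)" for k
  proof -
    obtain s where s: "s \<in> cau" "X k = cls s" using X[of k] by (auto simp: car_K)
    then obtain N where "\<forall>m\<ge>N. \<forall>n\<ge>N. hdist Q (s m) (s n) < 1 / real (Suc k)"
      using cauD[of s "1 / real (Suc k)"] by auto
    then have "hdist K (X k) (emb (s N)) \<le> 1 / real (Suc k)" using dist_emb_le[OF s(1), of N _ N] s(2) by simp
    then show ?thesis using cau_mem[OF s(1)] by blast
  qed
  then obtain t where t: "\<And>k. t k \<in> hcar Q" and tX: "\<And>k. hdist K (X k) (emb (t k)) \<le> 1 / real (Suc k)" by metis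
  have small: "\<exists>N. \<forall>k\<ge>N. 1 / real (Suc k) < e" if "e > 0" for e
    using LIMSEQ_D[OF LIMSEQ_inverse_real_of_nat that] by (auto simp: inverse_eq_divide)
  have tc: "t \<in> cau"
  proof (rule cauI)
    fix e :: real assume e: "e > 0"
    obtain M where M: "\<forall>k\<ge>M. 1 / real (Suc k) < e / 3" using small[of "e/3"] e by auto
    obtain N where N: "\<forall>m\<ge>N. \<forall>n\<ge>N. hdist K (X m) (X n) < e / 3" using C[of "e/3"] e by auto
    have "hdist Q (t m) (t n) < e" if "m \<ge> max M N" "n \<ge> max M N" for m n
    proof -
      have "hdist Q (t m) (t n) = hdist K (emb (t m)) (emb (t n))" using t by (simp add: dist_emb)
      also have "\<dots> \<le> hdist K (emb (t m)) (X m) + hdist K (X m) (emb (t n))"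
        by (intro K.dist_triangle emb_closed X t)
      also have "\<dots> \<le> hdist K (X m) (emb (t m)) + (hdist K (X m) (X n) + hdist K (X n) (emb (t n)))"
        using K.dist_triangle[OF X[of m] X[of n] emb_closed[OF t[of n]]] K.dist_commute[OF X[of m] emb_closed[OF t[of m]]] by linarith
      also have "\<dots> < e"
      proof -
        have "m \<ge> M" "n \<ge> M" "m \<ge> N" "n \<ge> N" using that by auto
        then have "1 / real (Suc m) < e / 3" "1 / real (Suc n) < e / 3" "hdist K (X m) (X n) < e / 3"
          using M N by blast+
        with tX[of m] tX[of n] show ?thesis by linarith
      qed
      finally show ?thesis .
    qed
    then show "\<exists>N. \<forall>m\<ge>N. \<forall>n\<ge>N. hdist Q (t m) (t n) < e" by blast
  qed (rule t)
  have clst: "cls t \<in> hcar K" using tc by (simp add: car_K)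
  have "(\<lambda>n. hdist K (X n) (cls t)) \<longlonglongrightarrow> 0"
  proof (rule LIMSEQ_I)
    fix e :: real assume e: "e > 0"
    obtain M where M: "\<forall>k\<ge>M. 1 / real (Suc k) < e / 2" using small[of "e/2"] e by auto
    obtain N where N: "\<forall>m\<ge>N. \<forall>n\<ge>N. hdist Q (t m) (t n) < e / 2" using cauD[OF tc, of "e/2"] e by auto
    have "norm (hdist K (X n) (cls t) - 0) < e" if "n \<ge> max M N" for n
    proof -
      have "hdist K (X n) (cls t) \<le> hdist K (X n) (emb (t n)) + hdist K (emb (t n)) (cls t)"
        by (intro K.dist_triangle X emb_closed t clst)
      moreover have "hdist K (emb (t n)) (cls t) \<le> e / 2"
        using dist_emb_le[OF tc N, of n] that K.dist_commute[OF clst emb_closed[OF t[of n]]] by simp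
      moreover have "hdist K (X n) (emb (t n)) < e / 2"
      proof (rule le_less_trans[OF tX])
        show "1 / real (Suc n) < e / 2" using M that by (simp del: of_nat_Suc)
      qed
      ultimately show ?thesis using K.dist_nonneg[OF X[of n] clst] by simp
    qed
    then show "\<exists>no. \<forall>n\<ge>no. norm (hdist K (X n) (cls t) - 0) < e" by blast
  qed
  then show "\<exists>x\<in>hcar K. (\<lambda>n. hdist K (X n) x) \<longlonglongrightarrow> 0" using clst by blast
qed

section \<open>Extension of bounded operators to the completion\<close>

definition ext_op :: "('p \<Rightarrow> 'p) \<Rightarrow> 'q set \<Rightarrow> 'q set" where
  "ext_op A = (\<lambda>X\<in>hcar K. cls (\<lambda>n. A (rep X n)))"

context
  fixes A :: "'p \<Rightarrow> 'p" and c :: real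
  assumes A: "hlinear Q Q A" and bound: "\<And>x. x \<in> hcar Q \<Longrightarrow> hnorm Q (A x) \<le> c * hnorm Q x"
begin

lemma op_lin: "x \<in> hcar Q \<Longrightarrow> A x \<in> hcar Q"
    "\<lbrakk>x \<in> hcar Q; y \<in> hcar Q\<rbrakk> \<Longrightarrow> A (hadd Q x y) = hadd Q (A x) (A y)"
    "x \<in> hcar Q \<Longrightarrow> A (hscale Q d x) = hscale Q d (A x)"
  using A by (auto simp: hlinear_def)

lemma op_lipschitz: "\<lbrakk>x \<in> hcar Q; y \<in> hcar Q\<rbrakk> \<Longrightarrow> hdist Q (A x) (A y) \<le> c * hdist Q x y"
  using bound[of "hsub Q x y"] by (simp add: hdist_hsub closed) (simp add: hsub_def op_lin closed)

lemma op_cau: "s \<in> cau \<Longrightarrow> (\<lambda>n. A (s n)) \<in> cau"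
  using lipschitz_cau op_lin(1) op_lipschitz by blast

lemma ext_op_cls: "s \<in> cau \<Longrightarrow> ext_op A (cls s) = cls (\<lambda>n. A (s n))"
  using lipschitz_eqv[OF rep_cls _ eqv_rep_cls, of s A c] op_lin(1) op_lipschitz
  by (simp add: ext_op_def car_K cls_eq_iff op_cau rep_cls)

lemma ext_op_emb: "p \<in> hcar Q \<Longrightarrow> ext_op A (emb p) = emb (A p)"
  unfolding emb_def by (rule ext_op_cls) (rule const_cau)

lemma ext_op_norm_bound: "x \<in> hcar K \<Longrightarrow> hnorm K (ext_op A x) \<le> c * hnorm K x"
proof -
  assume "x \<in> hcar K"
  then obtain s where s: "s \<in> cau" "x = cls s" by (auto simp: car_K)
  have "(\<lambda>n. hnorm Q (A (s n))) \<longlonglongrightarrow> hnorm K (ext_op A x)" using s norm_K[OF op_cau] by (simp add: ext_op_cls)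
  moreover have "(\<lambda>n. c * hnorm Q (s n)) \<longlonglongrightarrow> c * hnorm K x" using s norm_K by (intro tendsto_mult_left) simp
  ultimately show ?thesis by (rule LIMSEQ_le) (use s bound in \<open>auto simp: cau_mem\<close>)
qed

lemma ext_op_bounded: "ext_op A \<in> bounded_ops K"
proof (rule hilbert_space.bounded_opsI[OF hilbert_space_K])
  show "ext_op A \<in> extensional (hcar K)" by (simp add: ext_op_def)
  fix x assume x: "x \<in> hcar K"
  then obtain s where s: "s \<in> cau" "x = cls s" by (auto simp: car_K)
  show "ext_op A x \<in> hcar K" using s by (simp add: ext_op_cls car_K op_cau)
  show "ext_op A (hscale K d x) = hscale K d (ext_op A x)" for d
    using s by (simp add: ext_op_cls scale_K scale_cau op_cau op_lin cau_mem)
  show "hnorm K (ext_op A x) \<le> c * hnorm K x" using x by (rule ext_op_norm_bound)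
  fix y assume "y \<in> hcar K"
  then obtain t where t: "t \<in> cau" "y = cls t" by (auto simp: car_K)
  show "ext_op A (hadd K x y) = hadd K (ext_op A x) (ext_op A y)"
    using s t by (simp add: ext_op_cls add_K add_cau op_cau op_lin cau_mem)
qed

end

end

section \<open>Integration on the range fibres\<close>

text \<open>Convolution integrands are meaningful only on one range fibre. Continuity and vanishing
  are therefore required relative to \<open>S\<close>, and a compact set takes the place of the
  closed support, which would see values outside \<open>S\<close>.\<close>

definition Cc_on :: "'g::topological_space set \<Rightarrow> ('g \<Rightarrow> complex) set" where
  "Cc_on S = {f. continuous_on S f \<and> (\<exists>K. compact K \<and> (\<forall>x\<in>S - K. f x = 0))}"

lemma Cc_onI: "\<lbrakk>continuous_on S f; compact K; \<And>x. \<lbrakk>x \<in> S; x \<notin> K\<rbrakk> \<Longrightarrow> f x = 0\<rbrakk> \<Longrightarrow> f \<in> Cc_on S"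
  by (auto simp: Cc_on_def)

lemma Cc_onE:
  assumes "f \<in> Cc_on S"
  obtains K where "continuous_on S f" "compact K" "\<And>x. \<lbrakk>x \<in> S; x \<notin> K\<rbrakk> \<Longrightarrow> f x = 0"
  using assms by (auto simp: Cc_on_def)

lemma Cc_continuous: "f \<in> Cc \<Longrightarrow> continuous_on S f"
  by (auto simp: Cc_def intro: continuous_on_subset)

lemma Cc_support:
  assumes "f \<in> Cc"
  obtains K where "compact K" "\<And>x. x \<notin> K \<Longrightarrow> f x = 0"
proof (rule that[of "closure {x. f x \<noteq> 0}"])
  show "compact (closure {x. f x \<noteq> 0})" using assms by (simp add: Cc_def)
  show "x \<notin> closure {x. f x \<noteq> 0} \<Longrightarrow> f x = 0" for x using closure_subset[of "{x. f x \<noteq> 0}"] by auto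
qed

lemma CcI:
  fixes f :: "'g::t2_space \<Rightarrow> complex"
  assumes "continuous_on UNIV f" "compact K" "\<And>x. x \<notin> K \<Longrightarrow> f x = 0"
  shows "f \<in> Cc"
proof -
  have "closure {x. f x \<noteq> 0} \<subseteq> K"
    using assms by (intro closure_minimal compact_imp_closed) auto
  then have "compact (closure {x. f x \<noteq> 0})"
    using assms(2) by (metis closed_closure compact_Int_closed inf.absorb_iff2)
  with assms(1) show ?thesis by (simp add: Cc_def)
qed

lemma Cc_mult:
  fixes f :: "'g::t2_space \<Rightarrow> complex"
  assumes "f \<in> Cc" "continuous_on UNIV k"
  shows "(\<lambda>x. k x * f x) \<in> Cc"
proof -
  obtain K where "compact K" "\<And>x. x \<notin> K \<Longrightarrow> f x = 0" using Cc_support[OF assms(1)] by blast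
  then show ?thesis using assms by (intro CcI[of _ K] continuous_on_mult) (auto simp: Cc_continuous)
qed

lemma Cc_add:
  fixes f :: "'g::t2_space \<Rightarrow> complex"
  assumes "f \<in> Cc" "g \<in> Cc"
  shows "(\<lambda>x. f x + g x) \<in> Cc"
proof -
  obtain K where K: "compact K" "\<And>x. x \<notin> K \<Longrightarrow> f x = 0" using Cc_support[OF assms(1)] by blast
  obtain L where L: "compact L" "\<And>x. x \<notin> L \<Longrightarrow> g x = 0" using Cc_support[OF assms(2)] by blast
  show ?thesis using K L assms by (intro CcI[of _ "K \<union> L"] continuous_on_add compact_Un) (auto simp: Cc_continuous)
qed

lemma Cc_scale: "(f :: 'g::t2_space \<Rightarrow> complex) \<in> Cc \<Longrightarrow> (\<lambda>x. c * f x) \<in> Cc"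
  by (intro Cc_mult) auto

lemma Cc_zero: "(\<lambda>x :: 'g::t2_space. 0) \<in> Cc"
  by (rule CcI[of _ "{}"]) auto

lemma Cc_diff: "\<lbrakk>(f :: 'g::t2_space \<Rightarrow> complex) \<in> Cc; g \<in> Cc\<rbrakk> \<Longrightarrow> (\<lambda>x. f x - g x) \<in> Cc"
  using Cc_add[OF _ Cc_scale[of g "-1"], of f] by simp

lemma Cc_sum: "(\<And>i. i \<in> I \<Longrightarrow> (f i :: 'g::t2_space \<Rightarrow> complex) \<in> Cc) \<Longrightarrow> (\<lambda>x. \<Sum>i\<in>I. f i x) \<in> Cc"
  by (induction I rule: infinite_finite_induct) (auto simp: Cc_zero Cc_add)

lemma Cc_cmod: "(f :: 'g::t2_space \<Rightarrow> complex) \<in> Cc \<Longrightarrow> (\<lambda>x. complex_of_real (cmod (f x))) \<in> Cc"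
proof -
  assume f: "f \<in> Cc"
  obtain K where "compact K" "\<And>x. x \<notin> K \<Longrightarrow> f x = 0" using Cc_support[OF f] by blast
  then show ?thesis using f by (intro CcI[of _ K] continuous_intros) (auto simp: Cc_continuous)
qed

lemma Cc_on_if_Cc: "f \<in> Cc \<Longrightarrow> f \<in> Cc_on S"
  by (metis Cc_support Cc_onI Cc_continuous)

lemma Cc_on_mult:
  assumes "f \<in> Cc_on S" "continuous_on S k"
  shows "(\<lambda>x. k x * f x) \<in> Cc_on S"
proof -
  obtain K where "continuous_on S f" "compact K" "\<And>x. \<lbrakk>x \<in> S; x \<notin> K\<rbrakk> \<Longrightarrow> f x = 0" using Cc_onE[OF assms(1)] by blast
  then show ?thesis using assms by (intro Cc_onI[of _ _ K] continuous_on_mult) auto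
qed

lemma Hausdorff_euclidean_t2: "Hausdorff_space (euclidean :: 'g::t2_space topology)"
  unfolding Hausdorff_space_def using hausdorff by (fastforce simp: disjnt_def)

lemma second_countable_euclidean: "second_countable (euclidean :: 'g::second_countable_topology topology)"
proof -
  obtain B :: "'g set set" where B: "countable B" "topological_basis B" using ex_countable_basis by blast
  show ?thesis unfolding second_countable_def
  proof (intro exI[of _ B] conjI ballI allI impI)
    show "countable B" by (rule B)
    show "openin euclidean V" if "V \<in> B" for V using topological_basis_open[OF B(2) that] by simp
    fix U x assume "openin euclidean U \<and> x \<in> (U :: 'g set)"
    then have "open U" "x \<in> U" by auto
    then show "\<exists>V\<in>B. x \<in> V \<and> V \<subseteq> U" using topological_basisE[OF B(2)] by metis
  qed
qed

section \<open>Cut-off functions and algebra in a locally compact groupoid\<close>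

context locally_compact_groupoid
begin

text \<open>A locally compact Hausdorff space is regular, and second countability makes it Lindelof;
  together these give normality, as Tietze's theorem requires.\<close>

lemma normal_euclidean: "normal_space (euclidean :: 'g topology)"
  by (intro regular_Lindelof_imp_normal_space locally_compact_Hausdorff_imp_regular_space
      locally_compact Hausdorff_euclidean_t2 second_countable_imp_Lindelof_space second_countable_euclidean)

lemma tietze_complex:
  fixes S :: "'g set" and f :: "'g \<Rightarrow> complex"
  assumes "closed S" "continuous_on S f"
  obtains g where "continuous_on UNIV g" "\<And>x. x \<in> S \<Longrightarrow> g x = f x"
proof -
  have *: "\<exists>g. continuous_on UNIV g \<and> (\<forall>x\<in>S. g x = h x)" if "continuous_on S h" for h :: "'g \<Rightarrow> real"
    by (rule Tietze_extension_realinterval[OF normal_euclidean, of S UNIV h]) (use assms that in \<open>auto simp: continuous_map_iff_continuous\<close>)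
  obtain a where a: "continuous_on UNIV a" "\<forall>x\<in>S. a x = Re (f x)"
    using *[of "\<lambda>x. Re (f x)"] assms by (auto intro: continuous_on_Re)
  obtain b where b: "continuous_on UNIV b" "\<forall>x\<in>S. b x = Im (f x)"
    using *[of "\<lambda>x. Im (f x)"] assms by (auto intro: continuous_on_Im)
  show ?thesis
    by (rule that[of "\<lambda>x. complex_of_real (a x) + \<i> * complex_of_real (b x)"])
       (use a b complex_eq in \<open>auto intro!: continuous_intros\<close>)
qed

lemma compact_nbhd:
  fixes K :: "'g set"
  assumes K: "compact K"
  obtains U L where "open U" "compact L" "K \<subseteq> U" "U \<subseteq> L"
proof -
  have "\<exists>U C. open U \<and> compact C \<and> x \<in> U \<and> U \<subseteq> C" for x :: 'g
    using locally_compact unfolding locally_compact_space_def by (auto simp: compactin_euclidean_iff)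
  then obtain U C where UC: "\<And>x :: 'g. open (U x) \<and> compact (C x) \<and> x \<in> U x \<and> U x \<subseteq> C x" by metis
  have "\<exists>F \<subseteq> K. finite F \<and> K \<subseteq> (\<Union>x\<in>F. U x)"
    by (rule compactE_image[OF K, of K U]) (use UC in auto)
  then obtain F where "F \<subseteq> K" "finite F" "K \<subseteq> (\<Union>x\<in>F. U x)" by blast
  moreover have "(\<Union>x\<in>F. U x) \<subseteq> (\<Union>x\<in>F. C x)" using UC by (intro UN_mono) auto
  ultimately show ?thesis using UC by (intro that[of "\<Union>x\<in>F. U x" "\<Union>x\<in>F. C x"]) (auto intro!: compact_UN)
qed

lemma cutoff_exists:
  fixes K :: "'g set"
  assumes K: "compact K"
  obtains c where "c \<in> Cc" "\<And>x. x \<in> K \<Longrightarrow> c x = 1"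
proof -
  obtain U L where UL: "open U" "compact L" "K \<subseteq> U" "U \<subseteq> L" using compact_nbhd[OF K] by blast
  \<comment> \<open>Urysohn's lemma by way of Tietze: the function is 1 on \<open>K\<close> and 0
    off \<open>U\<close>, two disjoint closed sets.\<close>
  have "continuous_on (K \<union> - U) (\<lambda>x. if x \<in> K then 1 else 0 :: complex)"
    using UL compact_imp_closed[OF K] by (intro continuous_on_cases) auto
  then obtain g where "continuous_on UNIV g" "\<And>x. x \<in> K \<union> - U \<Longrightarrow> g x = (if x \<in> K then 1 else 0 :: complex)"
    by (rule tietze_complex[rotated]) (use UL K in \<open>auto intro: compact_imp_closed\<close>)
  moreover have "x \<notin> K \<and> x \<notin> U" if "x \<notin> L" for x using that UL by auto
  ultimately show ?thesis using UL by (intro that[of g] CcI[of _ L]) auto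
qed

text \<open>A Tietze extension times a cut-off. It makes the axioms of the Haar system, which speak
  of functions on the whole groupoid, available for functions that are continuous on one fibre
  only.\<close>

lemma Cc_on_extend:
  fixes S :: "'g set"
  assumes S: "closed S" and f: "f \<in> Cc_on S"
  obtains h where "h \<in> Cc" "\<And>x. x \<in> S \<Longrightarrow> h x = f x"
proof -
  obtain K where K: "continuous_on S f" "compact K" "\<And>x. \<lbrakk>x \<in> S; x \<notin> K\<rbrakk> \<Longrightarrow> f x = 0" using Cc_onE[OF f] by blast
  obtain g where g: "continuous_on UNIV g" "\<And>x. x \<in> S \<Longrightarrow> g x = f x" using tietze_complex[OF S K(1)] by blast
  obtain c where c: "c \<in> Cc" "\<And>x. x \<in> K \<Longrightarrow> c x = 1" using cutoff_exists[OF K(2)] by blast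
  have "g x * c x = f x" if "x \<in> S" for x using that g c K by (cases "x \<in> K") auto
  then show ?thesis using that[of "\<lambda>x. g x * c x"] Cc_mult[OF c(1) g(1)] by blast
qed

lemma continuous_rng: "continuous_on UNIV (rng G)"
proof -
  have "continuous_on UNIV ((\<lambda>(x, y). gmult G x y) \<circ> (\<lambda>x. (x, ginv G x)))"
    by (intro continuous_on_compose continuous_on_subset[OF continuous_mult] continuous_intros continuous_inv)
       (auto simp: rng_inv)
  then show ?thesis by (simp add: o_def mult_inv)
qed

lemma continuous_src: "continuous_on UNIV (src G)"
proof -
  have "continuous_on UNIV (rng G \<circ> ginv G)"
    by (intro continuous_on_compose continuous_inv continuous_on_subset[OF continuous_rng]) auto
  then show ?thesis by (simp add: o_def rng_inv)
qed

lemma continuous_on_rng [continuous_intros]: "continuous_on S f \<Longrightarrow> continuous_on S (\<lambda>x. rng G (f x))"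
  and continuous_on_src [continuous_intros]: "continuous_on S f \<Longrightarrow> continuous_on S (\<lambda>x. src G (f x))"
  and continuous_on_ginv [continuous_intros]: "continuous_on S f \<Longrightarrow> continuous_on S (\<lambda>x. ginv G (f x))"
  by (auto intro: continuous_on_compose2[OF continuous_rng] continuous_on_compose2[OF continuous_src]
      continuous_on_compose2[OF continuous_inv])

lemma continuous_on_gmult [continuous_intros]:
  assumes "continuous_on S f" "continuous_on S g" "\<And>x. x \<in> S \<Longrightarrow> src G (f x) = rng G (g x)"
  shows "continuous_on S (\<lambda>x. gmult G (f x) (g x))"
  using continuous_on_compose2[OF continuous_mult continuous_on_Pair[OF assms(1,2)]] assms(3) by auto

lemma rng_unit [simp]: "rng G x \<in> units G" and src_unit [simp]: "src G x \<in> units G"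
  by (auto simp: units_def) (metis rng_src rangeI)

lemma unit_rng: "u \<in> units G \<Longrightarrow> rng G u = u" and unit_src: "u \<in> units G \<Longrightarrow> src G u = u"
  by (auto simp: units_def rng_rng src_rng)

lemma closed_rfibre: "closed (rfibre G u)"
  unfolding rfibre_def using continuous_rng by (auto intro!: closed_Collect_eq)

lemma rfibre_iff [simp]: "x \<in> rfibre G u \<longleftrightarrow> rng G x = u"
  by (simp add: rfibre_def)

lemma inv_inv: "ginv G (ginv G x) = x"
proof -
  have "ginv G (ginv G x) = gmult G (ginv G (ginv G x)) (gmult G (ginv G x) x)"
    using mult_src_self[of "ginv G (ginv G x)"] by (simp add: inv_mult src_inv rng_inv)
  also have "\<dots> = gmult G (gmult G (ginv G (ginv G x)) (ginv G x)) x"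
    by (rule mult_assoc[symmetric]) (simp_all add: src_inv rng_inv)
  also have "\<dots> = x" using inv_mult[of "ginv G x"] rng_mult_self[of x] by (simp add: src_inv)
  finally show ?thesis .
qed

lemma inv_mult_cancel: "rng G x = rng G y \<Longrightarrow> gmult G x (gmult G (ginv G x) y) = y"
  using mult_assoc[of x "ginv G x" y] by (simp add: rng_inv src_inv mult_inv rng_mult_self)

lemma mult_inv_cancel: "src G x = rng G y \<Longrightarrow> gmult G (ginv G x) (gmult G x y) = y"
  using mult_assoc[of "ginv G x" x y] by (simp add: src_inv inv_mult rng_mult_self)

lemma inv_gmult:
  assumes "src G x = rng G y"
  shows "ginv G (gmult G x y) = gmult G (ginv G y) (ginv G x)"
proof -
  have a: "gmult G (gmult G x y) (gmult G (ginv G y) (ginv G x)) = rng G x"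
  proof -
    have "gmult G (gmult G x y) (gmult G (ginv G y) (ginv G x)) = gmult G x (gmult G y (gmult G (ginv G y) (ginv G x)))"
      using assms by (intro mult_assoc) (auto simp: rng_mult src_inv rng_inv)
    also have "\<dots> = gmult G x (ginv G x)" using assms by (subst inv_mult_cancel) (auto simp: rng_inv)
    finally show ?thesis by (simp add: mult_inv)
  qed
  have b: "gmult G (ginv G (gmult G x y)) (gmult G (gmult G x y) (gmult G (ginv G y) (ginv G x))) = gmult G (ginv G y) (ginv G x)"
    using assms by (intro mult_inv_cancel) (simp add: src_mult rng_mult src_inv rng_inv)
  have "src G (ginv G (gmult G x y)) = rng G x" using assms by (simp add: src_inv rng_mult)
  then have "gmult G (ginv G (gmult G x y)) (rng G x) = ginv G (gmult G x y)"
    using mult_src_self[of "ginv G (gmult G x y)"] by simp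
  with a b show ?thesis by simp
qed

lemmas grp = rng_inv src_inv rng_mult src_mult rng_rng src_rng rng_src src_src

lemma Cc_inv: 
  assumes "f \<in> Cc" shows "(\<lambda>x. f (ginv G x)) \<in> Cc"
proof -
  obtain K where K: "compact K" "\<And>x. x \<notin> K \<Longrightarrow> f x = 0" using Cc_support[OF assms] by blast
  have "compact (ginv G ` K)" using K by (intro compact_continuous_image continuous_on_subset[OF continuous_inv]) auto
  moreover have "f (ginv G x) = 0" if "x \<notin> ginv G ` K" for x
    using that K(2)[of "ginv G x"] inv_inv[of x] by (metis image_eqI)
  moreover have "continuous_on UNIV (\<lambda>x. f (ginv G x))"
    by (rule continuous_on_compose2[OF Cc_continuous[OF assms, of UNIV] continuous_inv]) simp
  ultimately show ?thesis by (rule CcI[rotated])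
qed

lemma Cc_involution: "f \<in> Cc \<Longrightarrow> involution G f \<in> Cc"
proof -
  assume f: "f \<in> Cc"
  have e: "involution G f = (\<lambda>x. cnj (f (ginv G x)))" by (simp add: involution_def fun_eq_iff)
  obtain K where "compact K" "\<And>x. x \<notin> K \<Longrightarrow> f (ginv G x) = 0" using Cc_support[OF Cc_inv[OF f]] by blast
  then show ?thesis unfolding e
    by (intro CcI[of _ K] continuous_on_cnj Cc_continuous[OF Cc_inv[OF f]]) auto
qed

end

section \<open>Integration against the Haar system\<close>

locale haar_groupoid = locally_compact_groupoid G + left_haar_system G lam
  for G :: "'g::{t2_space, second_countable_topology} groupoid" and lam :: "'g \<Rightarrow> 'g measure"
begin

context
  fixes u assumes u: "u \<in> units G"
begin

lemma sets_lam [measurable_cong, simp]: "sets (lam u) = sets borel" using borel[OF u] .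

lemma space_lam [simp]: "space (lam u) = UNIV" using sets_eq_imp_space_eq[OF sets_lam] by simp

lemma borel_lam: "f \<in> borel_measurable borel \<Longrightarrow> f \<in> borel_measurable (lam u)"
  by (simp add: measurable_cong_sets[OF sets_lam refl])

lemma compact_sets: "compact K \<Longrightarrow> K \<in> sets (lam u)"
  by (simp add: borel_closed compact_imp_closed)

lemma sigma_finite_lam: "sigma_finite_measure (lam u)"
proof
  have "\<exists>U C. open U \<and> compact C \<and> x \<in> U \<and> U \<subseteq> C" for x :: 'g
    using locally_compact unfolding locally_compact_space_def by (auto simp: compactin_euclidean_iff)
  then obtain U C where UC: "\<And>x :: 'g. open (U x) \<and> compact (C x) \<and> x \<in> U x \<and> U x \<subseteq> C x" by metis
  obtain F where F: "F \<subseteq> range U" "countable F" "\<Union>F = \<Union>(range U)"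
    by (rule Lindelof[of "range U"]) (use UC in auto)
  then obtain A where A: "countable A" "F = U ` A" by (meson countable_subset_image)
  show "\<exists>A. countable A \<and> A \<subseteq> sets (lam u) \<and> \<Union> A = space (lam u) \<and> (\<forall>a\<in>A. emeasure (lam u) a \<noteq> \<infinity>)"
  proof (intro exI[of _ "C ` A"] conjI)
    have "UNIV = \<Union>F" using F UC by auto
    also have "\<dots> \<subseteq> \<Union>(C ` A)" using A UC by auto
    finally show "\<Union>(C ` A) = space (lam u)" by auto
    show "\<forall>a\<in>C ` A. emeasure (lam u) a \<noteq> \<infinity>" using finite_on_compact[OF u] UC by (auto simp: less_top)
  qed (use A UC compact_sets in auto)
qed

text \<open>Every point off the support has an open neighbourhood of measure zero, and countably
  many of these cover the complement by the Lindelof property.\<close>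

lemma AE_rfibre: "AE x in lam u. rng G x = u"
proof (rule AE_I')
  let ?\<F> = "{V. open V \<and> emeasure (lam u) V = 0}"
  obtain F where F: "F \<subseteq> ?\<F>" "countable F" "\<Union>F = \<Union>?\<F>" by (rule Lindelof[of ?\<F>]) auto
  have "(\<Union>V\<in>F. V) \<in> null_sets (lam u)" using F by (intro null_sets_UN' ) (auto simp: null_sets_def)
  then show "\<Union>?\<F> \<in> null_sets (lam u)" using F by simp
  show "{x \<in> space (lam u). rng G x \<noteq> u} \<subseteq> \<Union>?\<F>"
  proof
    fix x assume "x \<in> {x \<in> space (lam u). rng G x \<noteq> u}"
    then have "x \<notin> measure_support (lam u)" using support[OF u] by simp
    then show "x \<in> \<Union>?\<F>" unfolding measure_support_def by (auto simp: not_gr_zero)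
  qed
qed

lemma integrable_Cc: 
  assumes f: "f \<in> Cc" shows "integrable (lam u) f"
proof -
  obtain K where K: "compact K" "\<And>x. x \<notin> K \<Longrightarrow> f x = 0" using Cc_support[OF f] by blast
  have "compact (f ` K)" using K f by (intro compact_continuous_image Cc_continuous)
  then obtain B where B: "\<And>x. x \<in> K \<Longrightarrow> norm (f x) \<le> B" using compact_imp_bounded bounded_iff by (metis imageI)
  show ?thesis
    by (rule integrableI_bounded_set[of K _ _ B])
       (use K B u f finite_on_compact in \<open>auto simp: borel_compact intro!: borel_lam borel_measurable_continuous_onI Cc_continuous\<close>)
qed

text \<open>Bridges two conventions: continuity of the Haar system concerns integrals over the whole
  space, convolution integrates over a fibre.\<close>

lemma set_integral_full: "f \<in> borel_measurable borel \<Longrightarrow> (LINT x:rfibre G u|lam u. f x) = (LINT x|lam u. (f x :: 'b :: {banach, second_countable_topology}))"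
  unfolding set_lebesgue_integral_def
  by (rule integral_cong_AE)
     (use AE_rfibre closed_rfibre in \<open>auto intro!: borel_lam borel_measurable_scaleR borel_measurable_indicator simp: borel_closed elim!: eventually_mono\<close>)

lemma set_integral_Cc: "f \<in> Cc \<Longrightarrow> (LINT x:rfibre G u|lam u. f x) = (LINT x|lam u. f x)"
  by (intro set_integral_full borel_measurable_continuous_onI Cc_continuous)

lemma set_integrable_Cc_on:
  assumes "f \<in> Cc_on (rfibre G u)"
  shows "set_integrable (lam u) (rfibre G u) f"
proof -
  obtain h where h: "h \<in> Cc" "\<And>x. x \<in> rfibre G u \<Longrightarrow> h x = f x" using Cc_on_extend[OF closed_rfibre assms] by blast
  have "set_integrable (lam u) (rfibre G u) h"
    unfolding set_integrable_def using closed_rfibre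
    by (intro integrable_mult_indicator integrable_Cc h) (simp add: borel_closed)
  moreover have "set_integrable (lam u) (rfibre G u) h = set_integrable (lam u) (rfibre G u) f"
    by (rule set_integrable_cong) (use h in auto)
  ultimately show ?thesis by simp
qed

lemma set_integral_norm_bound:
  assumes "set_integrable (lam u) (rfibre G u) f" "set_integrable (lam u) (rfibre G u) g"
    "\<And>x. rng G x = u \<Longrightarrow> norm (f x :: complex) \<le> (g x :: real)"
  shows "norm (LINT x:rfibre G u|lam u. f x) \<le> (LINT x:rfibre G u|lam u. g x)"
proof -
  have "norm (LINT x:rfibre G u|lam u. f x) \<le> (LINT x|lam u. norm (indicator (rfibre G u) x *\<^sub>R f x))"
    unfolding set_lebesgue_integral_def by (rule integral_norm_bound)
  also have "\<dots> \<le> (LINT x:rfibre G u|lam u. g x)"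
    unfolding set_lebesgue_integral_def
  proof (rule integral_mono)
    show "integrable (lam u) (\<lambda>x. norm (indicator (rfibre G u) x *\<^sub>R f x))"
      using assms(1) unfolding set_integrable_def by (rule integrable_norm)
    show "integrable (lam u) (\<lambda>x. indicator (rfibre G u) x *\<^sub>R g x)"
      using assms(2) unfolding set_integrable_def .
  qed (use assms(3) in \<open>auto simp: indicator_def\<close>)
  finally show ?thesis .
qed

text \<open>The integrand is controlled only on the product of the fibres. That product is closed,
  so extension by zero is Borel; being bounded and carried by \<open>K \<times> L\<close>, a set of
  finite measure, it is integrable.\<close>

lemma fubini_Cc:
  assumes F: "continuous_on (rfibre G u \<times> rfibre G u) F" and K: "compact K" and L: "compact L"
    and 0: "\<And>y z. \<lbrakk>rng G y = u; rng G z = u; (y, z) \<notin> K \<times> L\<rbrakk> \<Longrightarrow> F (y, z) = (0 :: complex)"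
  shows "(LINT y:rfibre G u|lam u. LINT z:rfibre G u|lam u. F (y, z)) = (LINT z:rfibre G u|lam u. LINT y:rfibre G u|lam u. F (y, z))"
proof -
  interpret s: sigma_finite_measure "lam u" by (rule sigma_finite_lam)
  interpret p: pair_sigma_finite "lam u" "lam u" ..
  let ?S = "rfibre G u"
  define H where "H p = indicator (?S \<times> ?S) p *\<^sub>R F p" for p
  have cS: "closed (?S \<times> ?S)" by (intro closed_Times closed_rfibre)
  have "H \<in> borel_measurable borel"
    unfolding H_def using F cS by (intro borel_measurable_continuous_on_indicator) (auto simp: borel_closed)
  \<comment> \<open>Second countability identifies the product of the Borel algebras with the Borel
    algebra of the product.\<close>
  moreover have sp: "sets (lam u \<Otimes>\<^sub>M lam u) = sets borel"
    using sets_pair_measure_cong[OF sets_lam sets_lam] unfolding borel_prod .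
  ultimately have Hm: "H \<in> borel_measurable (lam u \<Otimes>\<^sub>M lam u)" by (simp add: measurable_cong_sets[OF sp refl])
  have "compact ((?S \<times> ?S) \<inter> (K \<times> L))" using cS by (intro closed_Int_compact compact_Times K L)
  then have "compact (F ` ((?S \<times> ?S) \<inter> (K \<times> L)))"
    using F by (intro compact_continuous_image continuous_on_subset[OF F]) auto
  then obtain B where B: "\<And>p. p \<in> (?S \<times> ?S) \<inter> (K \<times> L) \<Longrightarrow> norm (F p) \<le> B"
    using compact_imp_bounded bounded_iff by (metis imageI)
  have Hi: "integrable (lam u \<Otimes>\<^sub>M lam u) H"
  proof (rule integrableI_bounded_set[where A = "K \<times> L" and B = "max B 0"])
    show "K \<times> L \<in> sets (lam u \<Otimes>\<^sub>M lam u)" using K L by (intro pair_measureI compact_sets)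
    have "emeasure (lam u \<Otimes>\<^sub>M lam u) (K \<times> L) = emeasure (lam u) K * emeasure (lam u) L"
      using K L by (intro s.emeasure_pair_measure_Times compact_sets)
    then show "emeasure (lam u \<Otimes>\<^sub>M lam u) (K \<times> L) < \<infinity>"
      using finite_on_compact[OF u K] finite_on_compact[OF u L] by (simp add: ennreal_mult_less_top)
    show "AE p in lam u \<Otimes>\<^sub>M lam u. p \<in> K \<times> L \<longrightarrow> norm (H p) \<le> max B 0"
      using B by (intro AE_I2) (auto simp: H_def indicator_def le_max_iff_disj)
    have "H p = 0" if "p \<notin> K \<times> L" for p
      using 0[of "fst p" "snd p"] that by (cases p) (auto simp: H_def indicator_def)
    then show "AE p in lam u \<Otimes>\<^sub>M lam u. p \<notin> K \<times> L \<longrightarrow> H p = 0" by simp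
  qed (rule Hm)
  have "(LINT z|lam u. LINT y|lam u. H (y, z)) = (LINT y|lam u. LINT z|lam u. H (y, z))"
    using Hi by (intro p.Fubini_integral) simp
  moreover have "(LINT z|lam u. H (y, z)) = indicator ?S y *\<^sub>R (LINT z:?S|lam u. F (y, z))" for y
    by (auto simp: H_def set_lebesgue_integral_def indicator_def)
  moreover have "(LINT y|lam u. H (y, z)) = indicator ?S z *\<^sub>R (LINT y:?S|lam u. F (y, z))" for z
    by (cases "z \<in> ?S") (auto simp: H_def set_lebesgue_integral_def indicator_def)
  ultimately show ?thesis by (simp add: set_lebesgue_integral_def)
qed

end

text \<open>Left translation by \<open>x\<close> maps the fibre over \<open>src G x\<close> into the
  fibre over \<open>rng G x\<close>, so only the values of \<open>h\<close> on the latter matter and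
  it may be replaced by an extension in \<open>Cc\<close>.\<close>

lemma left_invariant_Cc_on:
  assumes h: "h \<in> Cc_on (rfibre G (rng G x))"
  shows "(LINT y:rfibre G (src G x)|lam (src G x). h (gmult G x y)) = (LINT y:rfibre G (rng G x)|lam (rng G x). h y)"
proof -
  obtain k where k: "k \<in> Cc" "\<And>y. y \<in> rfibre G (rng G x) \<Longrightarrow> k y = h y" using Cc_on_extend[OF closed_rfibre h] by blast
  have "(LINT y:rfibre G (src G x)|lam (src G x). h (gmult G x y)) = (LINT y:rfibre G (src G x)|lam (src G x). k (gmult G x y))"
    by (rule set_lebesgue_integral_cong) (use k closed_rfibre in \<open>auto simp: rng_mult borel_closed\<close>)
  also have "\<dots> = (LINT y|lam (rng G x). k y)" by (rule left_invariant[OF k(1)])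
  also have "\<dots> = (LINT y:rfibre G (rng G x)|lam (rng G x). k y)" using k(1) by (simp add: set_integral_Cc)
  also have "\<dots> = (LINT y:rfibre G (rng G x)|lam (rng G x). h y)"
    by (rule set_lebesgue_integral_cong) (use k closed_rfibre in \<open>auto simp: borel_closed\<close>)
  finally show ?thesis .
qed

text \<open>The integral of \<open>cmod \<circ> f\<close> is continuous on the unit space and
  vanishes off the compact image of the support under the range map. Without this bound the suprema
  in the \<open>I\<close>-norm would carry no information.\<close>

lemma integral_norm_bdd:
  assumes f: "f \<in> Cc"
  shows "bdd_above ((\<lambda>u. LINT x|lam u. cmod (f x)) ` units G)"
proof -
  have c: "continuous_on (units G) (\<lambda>u. LINT x|lam u. cmod (f x))"
    using continuous_on_Re[OF continuous_integral[OF Cc_cmod[OF f]]] by (simp add: integral_complex_of_real)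
  obtain K where K: "compact K" "\<And>x. x \<notin> K \<Longrightarrow> f x = 0" using Cc_support[OF f] by blast
  have "compact (rng G ` K)" using K by (intro compact_continuous_image continuous_on_subset[OF continuous_rng]) auto
  then have "compact ((\<lambda>u. LINT x|lam u. cmod (f x)) ` rng G ` K)"
    by (rule compact_continuous_image[rotated]) (rule continuous_on_subset[OF c], auto)
  then obtain B where B: "\<And>u. u \<in> rng G ` K \<Longrightarrow> (LINT x|lam u. cmod (f x)) \<le> B"
    using compact_imp_bounded bounded_iff by (metis imageI real_norm_def abs_le_D1)
  have "(LINT x|lam u. cmod (f x)) \<le> max B 0" if u: "u \<in> units G" for u
  proof (cases "u \<in> rng G ` K")
    case True then show ?thesis using B[OF True] by simp
  next
    case False
    have "(LINT x|lam u. cmod (f x)) = (LINT x|lam u. 0)"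
    proof (rule integral_cong_AE)
      show "AE x in lam u. cmod (f x) = 0"
        using AE_rfibre[OF u] False K by (auto elim!: eventually_mono)
    qed (use u f in \<open>auto intro!: borel_lam borel_measurable_continuous_onI continuous_on_norm Cc_continuous\<close>)
    then show ?thesis by simp
  qed
  then show ?thesis by (intro bdd_aboveI2)
qed

end

section \<open>Convolution and the I-norm\<close>

context haar_groupoid
begin

abbreviation conv :: "('g \<Rightarrow> complex) \<Rightarrow> ('g \<Rightarrow> complex) \<Rightarrow> 'g \<Rightarrow> complex" (infixl "\<star>" 70) where
  "f \<star> g \<equiv> convol G lam f g"

abbreviation st :: "('g \<Rightarrow> complex) \<Rightarrow> 'g \<Rightarrow> complex" where
  "st \<equiv> involution G"

lemma set_integrable_Cc_norm:
  assumes u: "u \<in> units G" and f: "f \<in> Cc"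
  shows "set_integrable (lam u) (rfibre G u) (\<lambda>x. cmod (f x))"
  using integrable_norm[OF integrable_Cc[OF u f]] u closed_rfibre unfolding set_integrable_def
  by (intro integrable_mult_indicator) (auto simp: borel_closed)

lemma set_integral_Cc_norm:
  assumes u: "u \<in> units G" and f: "f \<in> Cc"
  shows "(LINT x:rfibre G u|lam u. cmod (f x)) = (LINT x|lam u. cmod (f x))"
  using u f by (intro set_integral_full borel_measurable_continuous_onI continuous_on_norm Cc_continuous)

lemma norm_integral_bound:
  assumes f: "f \<in> Cc"
  obtains B where "\<And>u. u \<in> units G \<Longrightarrow> (LINT x:rfibre G u|lam u. cmod (f x)) \<le> B" "0 \<le> B"
proof -
  obtain B where "\<And>u. u \<in> units G \<Longrightarrow> (LINT x|lam u. cmod (f x)) \<le> B"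
    using integral_norm_bdd[OF f] by (auto simp: bdd_above_def)
  then show ?thesis using f by (intro that[of "max B 0"]) (auto simp: set_integral_Cc_norm le_max_iff_disj)
qed

lemma set_integral_cong_rfibre:
  "(\<And>y. rng G y = u \<Longrightarrow> f y = g y) \<Longrightarrow> (LINT y:rfibre G u|M. f y) = (LINT y:rfibre G u|M. (g y :: 'b :: {banach, second_countable_topology}))"
  unfolding set_lebesgue_integral_def by (rule Bochner_Integration.integral_cong) (auto simp: indicator_def)

text \<open>The Haar axiom gives continuity only for a fixed integrand. At \<open>x0\<close> the
  integrand is therefore frozen as \<open>H\<close>, whose integrals vary continuously; the
  difference between \<open>F (x, _)\<close> and \<open>H\<close> is uniformly small for
  \<open>x\<close> near \<open>x0\<close>, and the integrals of a cut-off are bounded independently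
  of the fibre.\<close>

lemma continuous_fibre_integral:
  fixes F :: "'g \<times> 'g \<Rightarrow> complex"
  assumes F: "continuous_on {(x, y). rng G x = rng G y} F" and K: "compact K"
    and 0: "\<And>x y. \<lbrakk>rng G x = rng G y; y \<notin> K\<rbrakk> \<Longrightarrow> F (x, y) = 0"
  shows "continuous_on UNIV (\<lambda>x. LINT y:rfibre G (rng G x)|lam (rng G x). F (x, y))"
proof (intro continuous_at_imp_continuous_on ballI)
  fix x0 :: 'g
  let ?f = "\<lambda>x. LINT y:rfibre G (rng G x)|lam (rng G x). F (x, y)"
  have Fx: "(\<lambda>y. F (x, y)) \<in> Cc_on (rfibre G (rng G x))" for x
    by (rule Cc_onI[of _ _ K], rule continuous_on_compose2[OF F])
       (use K 0 in \<open>auto intro!: continuous_intros\<close>)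
  obtain H where H: "H \<in> Cc" "\<And>y. y \<in> rfibre G (rng G x0) \<Longrightarrow> H y = F (x0, y)"
    using Cc_on_extend[OF closed_rfibre Fx[of x0]] by blast
  obtain L where L: "compact L" "\<And>x. x \<notin> L \<Longrightarrow> H x = 0" using Cc_support[OF H(1)] by blast
  obtain c where c: "c \<in> Cc" "\<And>y. y \<in> K \<union> L \<Longrightarrow> c y = 1" using cutoff_exists[OF compact_Un[OF K L(1)]] by blast
  obtain B where B: "\<And>u. u \<in> units G \<Longrightarrow> (LINT y:rfibre G u|lam u. cmod (c y)) \<le> B" "0 \<le> B"
    using norm_integral_bound[OF c(1)] by blast
  let ?h = "\<lambda>x. LINT y:rfibre G (rng G x)|lam (rng G x). H y"
  have h: "continuous_on UNIV ?h"
  proof -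
    have "continuous_on UNIV (\<lambda>x. LINT y|lam (rng G x). H y)"
      by (rule continuous_on_compose2[OF continuous_integral[OF H(1)] continuous_rng]) auto
    then show ?thesis by (simp add: set_integral_Cc H(1))
  qed
  have hf: "?h x0 = ?f x0" by (rule set_integral_cong_rfibre) (use H in auto)
  have "(?f \<longlongrightarrow> ?f x0) (at x0)"
  proof (rule tendstoI)
    fix e :: real assume e: "0 < e"
    define d where "d = e / (2 * (B + 1))"
    have d: "d > 0" using e B by (simp add: d_def)
    let ?C = "{(x, y). rng G x = rng G y}"
    have C: "closed ?C"
      unfolding case_prod_beta using continuous_rng
      by (intro closed_Collect_eq) (auto intro!: continuous_intros)
    have "closed (?C \<inter> (\<lambda>p. cmod (F p - H (snd p))) -` {d..})"
    proof (rule continuous_closed_preimage[OF _ C])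
      show "continuous_on ?C (\<lambda>p. cmod (F p - H (snd p)))"
        by (intro continuous_on_norm continuous_on_diff F continuous_on_compose2[OF Cc_continuous[OF H(1)] continuous_on_snd[OF continuous_on_id]]) auto
    qed simp
    then have opW: "open (- (?C \<inter> (\<lambda>p. cmod (F p - H (snd p))) -` {d..}))" by (rule open_Compl)
    have subW: "{x0} \<times> (K \<union> L) \<subseteq> - (?C \<inter> (\<lambda>p. cmod (F p - H (snd p))) -` {d..})"
      using H d by (auto simp: eq_commute)
    obtain X where X: "x0 \<in> X" "open X" "X \<times> (K \<union> L) \<subseteq> - (?C \<inter> (\<lambda>p. cmod (F p - H (snd p))) -` {d..})"
      using Elementary_Topology.tube_lemma[OF compact_Un[OF K L(1)] opW subW] by (elim exE conjE) (rule that)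
    have close: "dist (?f x) (?h x) < e / 2" if x: "x \<in> X" for x
    proof -
      let ?u = "rng G x" let ?S = "rfibre G ?u"
      have iF: "set_integrable (lam ?u) ?S (\<lambda>y. F (x, y))" by (intro set_integrable_Cc_on Fx) simp
      have iH: "set_integrable (lam ?u) ?S H" by (intro set_integrable_Cc_on Cc_on_if_Cc H) simp
      have "?f x - ?h x = (LINT y:?S|lam ?u. F (x, y) - H y)"
        using iF iH by (rule set_integral_diff(2)[symmetric])
      also have "cmod \<dots> \<le> (LINT y:?S|lam ?u. d * cmod (c y))"
      proof (rule set_integral_norm_bound)
        show "set_integrable (lam ?u) ?S (\<lambda>y. F (x, y) - H y)" using iF iH by (rule set_integral_diff(1))
        show "set_integrable (lam ?u) ?S (\<lambda>y. d * cmod (c y))"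
          by (intro set_integrable_mult_right set_integrable_Cc_norm c) simp
        fix y assume y: "rng G y = ?u"
        \<comment> \<open>On \<open>K \<union> L\<close> the cut-off is 1 and the tube gives the
          bound; elsewhere both functions vanish.\<close>
        show "cmod (F (x, y) - H y) \<le> d * cmod (c y)"
        proof (cases "y \<in> K \<union> L")
          case True
          then have "(x, y) \<in> X \<times> (K \<union> L)" using x by blast
          then have "(x, y) \<notin> ?C \<inter> (\<lambda>p. cmod (F p - H (snd p))) -` {d..}" using X(3) by blast
          then show ?thesis using y c(2)[OF True] by auto
        next
          case False
          then show ?thesis using 0[of x y] L y d by auto
        qed
      qed simp
      also have "\<dots> = d * (LINT y:?S|lam ?u. cmod (c y))" by simp
      also have "\<dots> \<le> d * B" using B d by (intro mult_left_mono) auto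
      also have "\<dots> < d * (B + 1)" using d by simp
      also have "\<dots> = e / 2" using B by (simp add: d_def field_simps)
      finally show ?thesis by (simp add: dist_norm)
    qed
    have "eventually (\<lambda>x. x \<in> X) (at x0)" using X by (auto simp: eventually_at_topological)
    moreover have "eventually (\<lambda>x. dist (?h x) (?h x0) < e / 2) (at x0)"
      using h e by (intro tendstoD) (auto simp: continuous_on_eq_continuous_at isCont_def)
    ultimately show "eventually (\<lambda>x. dist (?f x) (?f x0) < e) (at x0)"
    proof eventually_elim
      case (elim x)
      then show ?case using close[OF elim(1)] dist_triangle[of "?f x" "?f x0" "?h x"] unfolding hf by (simp add: hf dist_commute)
    qed
  qed
  then show "isCont ?f x0" by (simp add: isCont_def)
qed

text \<open>\<open>M\<close> is the product set of \<open>K\<close> and \<open>L\<close>, the image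
  of a compact set because the composable pairs are closed. It contains the support of a
  convolution.\<close>

lemma compact_prod_set:
  assumes K: "compact K" and L: "compact L"
  obtains M where "compact M" "\<And>x y. \<lbrakk>rng G y = rng G x; y \<in> K; gmult G (ginv G y) x \<in> L\<rbrakk> \<Longrightarrow> x \<in> M"
proof
  let ?C = "{(x, y). src G x = rng G y}"
  have "closed ?C"
    unfolding case_prod_beta using continuous_rng continuous_src
    by (intro closed_Collect_eq) (auto intro!: continuous_intros)
  then show "compact ((\<lambda>(x, y). gmult G x y) ` (?C \<inter> (K \<times> L)))"
    by (intro compact_continuous_image closed_Int_compact compact_Times K L continuous_on_subset[OF continuous_mult]) auto
  fix x y assume a: "rng G y = rng G x" "y \<in> K" "gmult G (ginv G y) x \<in> L"
  then have "(y, gmult G (ginv G y) x) \<in> ?C \<inter> (K \<times> L)" by (auto simp: grp)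
  then show "x \<in> (\<lambda>(x, y). gmult G x y) ` (?C \<inter> (K \<times> L))"
    using inv_mult_cancel[OF a(1)] by force
qed

lemma conv_kernel_continuous:
  assumes g: "g \<in> Cc"
  shows "continuous_on (rfibre G u \<times> rfibre G u) (\<lambda>(y, x). g (gmult G (ginv G y) x))"
  unfolding case_prod_beta
  by (rule continuous_on_compose2[OF Cc_continuous[OF g, of UNIV]]) (auto intro!: continuous_intros simp: grp)

lemma conv_integrand:
  assumes f: "f \<in> Cc" and g: "g \<in> Cc"
  shows "(\<lambda>y. f y * g (gmult G (ginv G y) x)) \<in> Cc_on (rfibre G (rng G x))"
proof -
  have "continuous_on (rfibre G (rng G x)) (\<lambda>y. g (gmult G (ginv G y) x))"
    by (rule continuous_on_compose2[OF Cc_continuous[OF g, of UNIV]]) (auto intro!: continuous_intros simp: grp)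
  from Cc_on_mult[OF Cc_on_if_Cc[OF f] this] show ?thesis by (simp add: mult.commute)
qed

lemma conv_integrable: "\<lbrakk>f \<in> Cc; g \<in> Cc\<rbrakk> \<Longrightarrow>
   set_integrable (lam (rng G x)) (rfibre G (rng G x)) (\<lambda>y. f y * g (gmult G (ginv G y) x))"
  by (intro set_integrable_Cc_on conv_integrand) auto

lemma conv_Cc:
  assumes f: "f \<in> Cc" and g: "g \<in> Cc"
  shows "f \<star> g \<in> Cc"
proof -
  obtain K where K: "compact K" "\<And>x. x \<notin> K \<Longrightarrow> f x = 0" using Cc_support[OF f] by blast
  obtain L where L: "compact L" "\<And>x. x \<notin> L \<Longrightarrow> g x = 0" using Cc_support[OF g] by blast
  obtain M where M: "compact M" "\<And>x y. \<lbrakk>rng G y = rng G x; y \<in> K; gmult G (ginv G y) x \<in> L\<rbrakk> \<Longrightarrow> x \<in> M"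
    using compact_prod_set[OF K(1) L(1)] by blast
  show ?thesis
  proof (rule CcI[OF _ M(1)])
    have "continuous_on UNIV (\<lambda>x. LINT y:rfibre G (rng G x)|lam (rng G x). (\<lambda>(x, y). f y * g (gmult G (ginv G y) x)) (x, y))"
    proof (rule continuous_fibre_integral[OF _ K(1)])
      show "continuous_on {(x, y). rng G x = rng G y} (\<lambda>(x, y). f y * g (gmult G (ginv G y) x))"
        unfolding case_prod_beta
        by (intro continuous_on_mult continuous_on_compose2[OF Cc_continuous[OF f, of UNIV]] continuous_on_compose2[OF Cc_continuous[OF g, of UNIV]])
           (auto intro!: continuous_intros simp: grp)
    qed (use K in auto)
    then show "continuous_on UNIV (f \<star> g)" by (simp add: convol_def[abs_def])
    fix x assume "x \<notin> M"
    then have "f y * g (gmult G (ginv G y) x) = 0" if "rng G y = rng G x" for y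
      using M(2)[OF that] K(2)[of y] L(2)[of "gmult G (ginv G y) x"] by auto
    then have "(f \<star> g) x = (LINT y:rfibre G (rng G x)|lam (rng G x). 0)"
      unfolding convol_def by (intro set_integral_cong_rfibre)
    then show "(f \<star> g) x = 0" by simp
  qed
qed

lemma conv_add_left:
  assumes "f \<in> Cc" "f' \<in> Cc" "g \<in> Cc"
  shows "(\<lambda>x. f x + f' x) \<star> g = (\<lambda>x. (f \<star> g) x + (f' \<star> g) x)"
proof
  fix x
  show "((\<lambda>x. f x + f' x) \<star> g) x = (f \<star> g) x + (f' \<star> g) x"
    unfolding convol_def distrib_right
    using assms by (intro set_integral_add(2) conv_integrable)
qed

lemma conv_add_right:
  assumes "f \<in> Cc" "g' \<in> Cc" "g \<in> Cc"
  shows "f \<star> (\<lambda>x. g x + g' x) = (\<lambda>x. (f \<star> g) x + (f \<star> g') x)"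
proof
  fix x
  show "(f \<star> (\<lambda>x. g x + g' x)) x = (f \<star> g) x + (f \<star> g') x"
    unfolding convol_def distrib_left
    using assms by (intro set_integral_add(2) conv_integrable)
qed

lemma conv_scale_left: "(\<lambda>x. c * f x) \<star> g = (\<lambda>x. c * (f \<star> g) x)"
  by (simp add: convol_def fun_eq_iff mult.assoc)

lemma conv_scale_right: "f \<star> (\<lambda>x. c * g x) = (\<lambda>x. c * (f \<star> g) x)"
  by (simp add: convol_def fun_eq_iff mult.left_commute)

lemma st_st: "st (st f) = f"
  by (simp add: involution_def fun_eq_iff inv_inv)

lemma st_add: "st (\<lambda>x. f x + g x) = (\<lambda>x. st f x + st g x)"
  and st_scale: "st (\<lambda>x. c * f x) = (\<lambda>x. cnj c * st f x)"
  by (simp_all add: involution_def fun_eq_iff)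

lemma set_integral_cnj: "(LINT y:A|M. cnj (f y)) = cnj (LINT y:A|M. f y)"
  unfolding set_lebesgue_integral_def by (simp flip: integral_cnj complex_cnj_scaleR)

text \<open>Left invariance substitutes \<open>gmult G x y\<close> for the integration variable; the
  two factors then change places.\<close>

lemma st_conv:
  assumes f: "f \<in> Cc" and g: "g \<in> Cc"
  shows "st (f \<star> g) = st g \<star> st f"
proof
  fix x
  let ?h = "\<lambda>z. st g z * st f (gmult G (ginv G z) x)"
  have "(st g \<star> st f) x = (LINT z:rfibre G (rng G x)|lam (rng G x). ?h z)" by (simp add: convol_def)
  also have "\<dots> = (LINT y:rfibre G (src G x)|lam (src G x). ?h (gmult G x y))"
    by (rule left_invariant_Cc_on[symmetric]) (intro conv_integrand Cc_involution f g)
  also have "\<dots> = (LINT y:rfibre G (src G x)|lam (src G x). cnj (f y * g (gmult G (ginv G y) (ginv G x))))"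
  proof (rule set_integral_cong_rfibre)
    fix y assume y: "rng G y = src G x"
    have "ginv G (gmult G (ginv G (gmult G x y)) x) = gmult G (ginv G x) (gmult G x y)"
      using y by (subst inv_gmult) (auto simp: grp inv_inv)
    also have "\<dots> = y" using y by (intro mult_inv_cancel) simp
    finally show "?h (gmult G x y) = cnj (f y * g (gmult G (ginv G y) (ginv G x)))"
      using y by (simp add: involution_def inv_gmult)
  qed
  also have "\<dots> = st (f \<star> g) x"
    by (simp add: involution_def convol_def grp set_integral_cnj flip: complex_cnj_mult)
  finally show "st (f \<star> g) x = (st g \<star> st f) x" by simp
qed

lemma shift_integral:
  assumes b: "b \<in> Cc_on (rfibre G (src G y))"
  shows "(LINT x:rfibre G (rng G y)|lam (rng G y). b (gmult G (ginv G y) x)) = (LINT x:rfibre G (src G y)|lam (src G y). b x)"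
  using left_invariant_Cc_on[of b "ginv G y"] b by (simp add: grp)

text \<open>After Fubini the inner integral is translated by \<open>y\<close> through left
  invariance. The set \<open>M\<close> bounds the second variable where the integrand does not
  vanish, as \<open>fubini_Cc\<close> demands.\<close>

lemma conv_assoc:
  assumes f: "f \<in> Cc" and g: "g \<in> Cc" and h: "h \<in> Cc"
  shows "(f \<star> g) \<star> h = f \<star> (g \<star> h)"
proof
  fix x
  let ?u = "rng G x" let ?S = "rfibre G ?u"
  obtain K where K: "compact K" "\<And>x. x \<notin> K \<Longrightarrow> f x = 0" using Cc_support[OF f] by blast
  obtain L where L: "compact L" "\<And>x. x \<notin> L \<Longrightarrow> g x = 0" using Cc_support[OF g] by blast
  obtain M where M: "compact M" "\<And>x y. \<lbrakk>rng G y = rng G x; y \<in> K; gmult G (ginv G y) x \<in> L\<rbrakk> \<Longrightarrow> x \<in> M"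
    using compact_prod_set[OF K(1) L(1)] by blast
  let ?F = "\<lambda>(y, z). f y * g (gmult G (ginv G y) z) * h (gmult G (ginv G z) x)"
  have "((f \<star> g) \<star> h) x = (LINT z:?S|lam ?u. (f \<star> g) z * h (gmult G (ginv G z) x))" by (simp add: convol_def)
  also have "\<dots> = (LINT z:?S|lam ?u. LINT y:?S|lam ?u. ?F (y, z))"
    by (rule set_integral_cong_rfibre) (simp add: convol_def)
  also have "\<dots> = (LINT y:?S|lam ?u. LINT z:?S|lam ?u. ?F (y, z))"
  proof (rule fubini_Cc[symmetric, OF _ _ K(1) M(1)])
    have "continuous_on (?S \<times> ?S) (\<lambda>p. f (fst p) * (case p of (y, x) \<Rightarrow> g (gmult G (ginv G y) x)) * h (gmult G (ginv G (snd p)) x))"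
      by (intro continuous_on_mult conv_kernel_continuous g continuous_on_compose2[OF Cc_continuous[OF f, of UNIV]] continuous_on_compose2[OF Cc_continuous[OF h, of UNIV]])
         (auto intro!: continuous_intros simp: grp)
    then show "continuous_on (?S \<times> ?S) ?F" by (simp add: case_prod_beta)
    fix y z assume a: "rng G y = ?u" "rng G z = ?u" "(y, z) \<notin> K \<times> M"
    then have "y \<notin> K \<or> gmult G (ginv G y) z \<notin> L" using M(2)[of y z] by auto
    then show "?F (y, z) = 0" using K(2) L(2) by auto
  qed simp
  also have "\<dots> = (LINT y:?S|lam ?u. f y * (g \<star> h) (gmult G (ginv G y) x))"
  proof (rule set_integral_cong_rfibre)
    fix y assume y: "rng G y = ?u"
    let ?x = "gmult G (ginv G y) x"
    have rx: "rng G ?x = src G y" using y by (simp add: grp)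
    have "(g \<star> h) ?x = (LINT w:rfibre G (src G y)|lam (src G y). g w * h (gmult G (ginv G w) ?x))"
      by (simp add: convol_def rx)
    also have "\<dots> = (LINT z:?S|lam ?u. g (gmult G (ginv G y) z) * h (gmult G (ginv G (gmult G (ginv G y) z)) ?x))"
      using shift_integral[of "\<lambda>w. g w * h (gmult G (ginv G w) ?x)" y] conv_integrand[OF g h, of ?x] rx y by simp
    also have "\<dots> = (LINT z:?S|lam ?u. g (gmult G (ginv G y) z) * h (gmult G (ginv G z) x))"
    proof (rule set_integral_cong_rfibre)
      fix z assume z: "rng G z = ?u"
      have "gmult G (ginv G (gmult G (ginv G y) z)) ?x = gmult G (gmult G (ginv G z) y) ?x"
        using y z by (simp add: inv_gmult grp inv_inv)
      also have "\<dots> = gmult G (ginv G z) (gmult G y ?x)"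
        using y z by (intro mult_assoc) (simp_all add: grp)
      also have "gmult G y ?x = x" using y by (intro inv_mult_cancel)
      finally show "g (gmult G (ginv G y) z) * h (gmult G (ginv G (gmult G (ginv G y) z)) ?x) = g (gmult G (ginv G y) z) * h (gmult G (ginv G z) x)" by simp
    qed
    finally show "(LINT z:?S|lam ?u. ?F (y, z)) = f y * (g \<star> h) ?x" by (simp add: mult.assoc)
  qed
  finally show "((f \<star> g) \<star> h) x = (f \<star> (g \<star> h)) x" by (simp add: convol_def)
qed

section \<open>Submultiplicativity of the I-norm\<close>

abbreviation I :: "('g \<Rightarrow> complex) \<Rightarrow> real" where "I \<equiv> I_norm G lam"

abbreviation N :: "('g \<Rightarrow> complex) \<Rightarrow> 'g \<Rightarrow> real" where "N f u \<equiv> (LINT x:rfibre G u|lam u. cmod (f x))"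

lemma units_nonempty: "units G \<noteq> {}" by (auto simp: units_def)

lemma I_alt: "f \<in> Cc \<Longrightarrow> I f = max (SUP u\<in>units G. N f u) (SUP u\<in>units G. N (st f) u)"
proof -
  assume f: "f \<in> Cc"
  have "cmod (f (ginv G x)) = cmod (st f x)" for x by (simp add: involution_def)
  then show ?thesis unfolding I_norm_def using f Cc_involution[OF f] by (simp add: set_integral_Cc_norm)
qed

lemma N_bdd: "f \<in> Cc \<Longrightarrow> bdd_above (N f ` units G)"
  by (erule norm_integral_bound) (rule bdd_aboveI2)

lemma N_le_I: "\<lbrakk>f \<in> Cc; u \<in> units G\<rbrakk> \<Longrightarrow> N f u \<le> I f"
  by (simp add: I_alt le_max_iff_disj cSUP_upper[OF _ N_bdd])

lemma N_st_le_I: "\<lbrakk>f \<in> Cc; u \<in> units G\<rbrakk> \<Longrightarrow> N (st f) u \<le> I f"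
  by (simp add: I_alt le_max_iff_disj cSUP_upper[OF _ N_bdd] Cc_involution)

lemma I_le:
  assumes "f \<in> Cc" "\<And>u. u \<in> units G \<Longrightarrow> N f u \<le> c" "\<And>u. u \<in> units G \<Longrightarrow> N (st f) u \<le> c"
  shows "I f \<le> c"
  using assms units_nonempty by (auto simp: I_alt intro!: cSUP_least)

lemma N_nonneg: "0 \<le> N f u"
  unfolding set_lebesgue_integral_def by (rule integral_nonneg_AE) auto

lemma I_nonneg: "f \<in> Cc \<Longrightarrow> 0 \<le> I f"
  by (rule order_trans[OF N_nonneg N_le_I[OF _ rng_unit]])

lemma I_st: "f \<in> Cc \<Longrightarrow> I (st f) = I f"
  by (simp add: I_alt Cc_involution st_st max.commute)

lemma N_mono:
  assumes u: "u \<in> units G" and fg: "f \<in> Cc" "g \<in> Cc" and le: "\<And>x. rng G x = u \<Longrightarrow> cmod (f x) \<le> c * cmod (g x)"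
  shows "N f u \<le> c * N g u"
proof -
  have "N f u \<le> (LINT x:rfibre G u|lam u. c * cmod (g x))"
    unfolding set_lebesgue_integral_def
    using set_integrable_Cc_norm[OF u fg(1)] set_integrable_mult_right[OF set_integrable_Cc_norm[OF u fg(2)], of c] le
    by (intro integral_mono) (auto simp: set_integrable_def indicator_def)
  then show ?thesis by simp
qed

lemma I_mono:
  assumes "f \<in> Cc" "g \<in> Cc" "\<And>x. cmod (f x) \<le> c * cmod (g x)" "0 \<le> c"
  shows "I f \<le> c * I g"
proof (rule I_le[OF assms(1)])
  fix u assume u: "u \<in> units G"
  show "N f u \<le> c * I g"
    using N_mono[OF u assms(1,2) assms(3)] mult_left_mono[OF N_le_I[OF assms(2) u] assms(4)] by linarith
  have "N (st f) u \<le> c * N (st g) u"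
    by (rule N_mono[OF u Cc_involution[OF assms(1)] Cc_involution[OF assms(2)]]) (simp add: involution_def assms(3))
  then show "N (st f) u \<le> c * I g"
    using mult_left_mono[OF N_st_le_I[OF assms(2) u] assms(4)] by linarith
qed

lemma N_add: "\<lbrakk>u \<in> units G; f \<in> Cc; g \<in> Cc\<rbrakk> \<Longrightarrow> N (\<lambda>x. f x + g x) u \<le> N f u + N g u"
proof -
  assume a: "u \<in> units G" "f \<in> Cc" "g \<in> Cc"
  have "N (\<lambda>x. f x + g x) u \<le> (LINT x:rfibre G u|lam u. cmod (f x) + cmod (g x))"
    unfolding set_lebesgue_integral_def
    using set_integrable_Cc_norm[OF a(1) Cc_add[OF a(2,3)]]
      set_integral_add(1)[OF set_integrable_Cc_norm[OF a(1,2)] set_integrable_Cc_norm[OF a(1,3)]]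
    by (intro integral_mono) (auto simp: set_integrable_def indicator_def norm_triangle_ineq)
  also have "\<dots> = N f u + N g u" using a by (intro set_integral_add(2) set_integrable_Cc_norm)
  finally show ?thesis .
qed

lemma I_add: "\<lbrakk>f \<in> Cc; g \<in> Cc\<rbrakk> \<Longrightarrow> I (\<lambda>x. f x + g x) \<le> I f + I g"
proof (rule I_le)
  assume a: "f \<in> Cc" "g \<in> Cc"
  then show "(\<lambda>x. f x + g x) \<in> Cc" by (rule Cc_add)
  fix u assume u: "u \<in> units G"
  show "N (\<lambda>x. f x + g x) u \<le> I f + I g"
    using N_add[OF u a] N_le_I[OF a(1) u] N_le_I[OF a(2) u] by linarith
  show "N (st (\<lambda>x. f x + g x)) u \<le> I f + I g"
    unfolding st_add using N_add[OF u Cc_involution[OF a(1)] Cc_involution[OF a(2)]] N_st_le_I[OF a(1) u] N_st_le_I[OF a(2) u] by linarith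
qed

lemma I_scale: "f \<in> Cc \<Longrightarrow> I (\<lambda>x. c * f x) \<le> cmod c * I f"
  by (rule I_mono) (auto simp: Cc_scale norm_mult)

abbreviation ab :: "('g \<Rightarrow> complex) \<Rightarrow> 'g \<Rightarrow> complex" where "ab f \<equiv> (\<lambda>x. complex_of_real (cmod (f x)))"

lemma conv_ab_real:
  assumes "f \<in> Cc" "g \<in> Cc"
  shows "(ab f \<star> ab g) x = complex_of_real (LINT y:rfibre G (rng G x)|lam (rng G x). cmod (f y * g (gmult G (ginv G y) x)))"
  unfolding convol_def by (simp add: norm_mult flip: of_real_mult set_integral_complex_of_real)

lemma conv_norm_le:
  assumes "f \<in> Cc" "g \<in> Cc"
  shows "cmod ((f \<star> g) x) \<le> cmod ((ab f \<star> ab g) x)"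
proof -
  have "cmod ((f \<star> g) x) \<le> (LINT y:rfibre G (rng G x)|lam (rng G x). cmod (f y * g (gmult G (ginv G y) x)))"
    unfolding convol_def
    by (rule set_integral_norm_bound)
       (use conv_integrable[OF assms, of x] integrable_norm in \<open>force simp: set_integrable_def indicator_def\<close>)+
  also have "\<dots> \<le> cmod ((ab f \<star> ab g) x)"
    unfolding conv_ab_real[OF assms] norm_of_real by (rule abs_ge_self)
  finally show ?thesis .
qed

text \<open>With \<open>f\<close> and \<open>g\<close> replaced by their absolute values the order
  of integration may be changed, and left invariance turns the inner integral into
  \<open>N g (src G y)\<close>, which is at most \<open>I g\<close>.\<close>

lemma N_conv_le:
  assumes u: "u \<in> units G" and f: "f \<in> Cc" and g: "g \<in> Cc"
  shows "N (f \<star> g) u \<le> N f u * I g"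
proof -
  let ?S = "rfibre G u"
  define a b where "a = ab f" and "b = ab g"
  have a: "a \<in> Cc" and b: "b \<in> Cc" using f g by (auto simp: a_def b_def Cc_cmod)
  obtain K where K: "compact K" "\<And>x. x \<notin> K \<Longrightarrow> a x = 0" using Cc_support[OF a] by blast
  obtain L where L: "compact L" "\<And>x. x \<notin> L \<Longrightarrow> b x = 0" using Cc_support[OF b] by blast
  obtain M where M: "compact M" "\<And>x y. \<lbrakk>rng G y = rng G x; y \<in> K; gmult G (ginv G y) x \<in> L\<rbrakk> \<Longrightarrow> x \<in> M"
    using compact_prod_set[OF K(1) L(1)] by blast
  let ?F = "\<lambda>(y, x). a y * b (gmult G (ginv G y) x)"
  have "N (f \<star> g) u \<le> 1 * N (a \<star> b) u"
  proof (rule N_mono[OF u conv_Cc[OF f g] conv_Cc[OF a b]])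
    show "cmod ((f \<star> g) x) \<le> 1 * cmod ((a \<star> b) x)" for x
      using conv_norm_le[OF f g, of x] unfolding a_def b_def by simp
  qed
  \<comment> \<open>The integrand is nonnegative, so the absolute value can be moved outside and
    Fubini applies to a complex-valued integral.\<close>
  also have "1 * N (a \<star> b) u = cmod (LINT x:?S|lam u. (a \<star> b) x)"
  proof -
    have "(LINT x:?S|lam u. (a \<star> b) x) = (LINT x:?S|lam u. complex_of_real (cmod ((a \<star> b) x)))"
    proof (rule set_integral_cong_rfibre)
      fix x
      have "0 \<le> (LINT y:rfibre G (rng G x)|lam (rng G x). cmod (f y * g (gmult G (ginv G y) x)))"
        unfolding set_lebesgue_integral_def by (rule integral_nonneg_AE) auto
      then show "(a \<star> b) x = complex_of_real (cmod ((a \<star> b) x))"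
        unfolding a_def b_def conv_ab_real[OF f g] by simp
    qed
    also have "\<dots> = complex_of_real (N (a \<star> b) u)" by (rule set_integral_complex_of_real)
    finally show ?thesis using N_nonneg[of u "a \<star> b"] by simp
  qed
  also have "(LINT x:?S|lam u. (a \<star> b) x) = (LINT x:?S|lam u. LINT y:?S|lam u. ?F (y, x))"
    by (rule set_integral_cong_rfibre) (simp add: convol_def)
  also have "\<dots> = (LINT y:?S|lam u. LINT x:?S|lam u. ?F (y, x))"
  proof (rule fubini_Cc[symmetric, OF u _ K(1) M(1)])
    have "continuous_on (?S \<times> ?S) (\<lambda>p. a (fst p) * (case p of (y, x) \<Rightarrow> b (gmult G (ginv G y) x)))"
      by (intro continuous_on_mult conv_kernel_continuous b continuous_on_compose2[OF Cc_continuous[OF a, of UNIV]])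
         (auto intro!: continuous_intros simp: grp)
    then show "continuous_on (?S \<times> ?S) ?F" by (simp add: case_prod_beta)
    fix y z assume "rng G y = u" "rng G z = u" "(y, z) \<notin> K \<times> M"
    then have "y \<notin> K \<or> gmult G (ginv G y) z \<notin> L" using M(2)[of y z] by auto
    then show "?F (y, z) = 0" using K(2) L(2) by auto
  qed
  also have "\<dots> = (LINT y:?S|lam u. a y * (LINT x|lam (src G y). b x))"
  proof (rule set_integral_cong_rfibre)
    fix y assume y: "rng G y = u"
    have "(LINT x:?S|lam u. b (gmult G (ginv G y) x)) = (LINT x:rfibre G (src G y)|lam (src G y). b x)"
      using shift_integral[OF Cc_on_if_Cc[OF b], of y] y by simp
    also have "\<dots> = (LINT x|lam (src G y). b x)" using b by (simp add: set_integral_Cc)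
    finally show "(LINT x:?S|lam u. ?F (y, x)) = a y * (LINT x|lam (src G y). b x)" by simp
  qed
  also have "cmod \<dots> \<le> (LINT y:?S|lam u. cmod (f y) * I g)"
  proof (rule set_integral_norm_bound[OF u])
    have "continuous_on UNIV (\<lambda>y. LINT x|lam (src G y). b x)"
      by (rule continuous_on_compose2[OF continuous_integral[OF b] continuous_src]) auto
    from Cc_mult[OF a this] have "(\<lambda>y. a y * (LINT x|lam (src G y). b x)) \<in> Cc" by (simp add: mult.commute)
    then show "set_integrable (lam u) ?S (\<lambda>y. a y * (LINT x|lam (src G y). b x))"
      by (intro set_integrable_Cc_on Cc_on_if_Cc u)
    show "set_integrable (lam u) ?S (\<lambda>y. cmod (f y) * I g)"
      by (intro set_integrable_mult_left set_integrable_Cc_norm u f)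
    fix y
    have "cmod (LINT x|lam (src G y). b x) \<le> (LINT x|lam (src G y). cmod (b x))" by (rule integral_norm_bound)
    also have "\<dots> = N g (src G y)" using g by (simp add: b_def set_integral_Cc_norm)
    also have "\<dots> \<le> I g" using g by (simp add: N_le_I)
    finally show "cmod (a y * (LINT x|lam (src G y). b x)) \<le> cmod (f y) * I g"
      by (simp add: norm_mult a_def mult_left_mono)
  qed
  also have "\<dots> = N f u * I g" by simp
  finally show ?thesis .
qed

text \<open>The involution exchanges the two suprema in the \<open>I\<close>-norm and reverses
  products, so the one-sided estimate yields both halves.\<close>

lemma I_conv_le:
  assumes f: "f \<in> Cc" and g: "g \<in> Cc"
  shows "I (f \<star> g) \<le> I f * I g"
proof (rule I_le[OF conv_Cc[OF f g]])
  fix u assume u: "u \<in> units G"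
  show "N (f \<star> g) u \<le> I f * I g"
    using N_conv_le[OF u f g] mult_right_mono[OF N_le_I[OF f u] I_nonneg[OF g]] by linarith
  have "N (st g \<star> st f) u \<le> N (st g) u * I (st f)"
    by (rule N_conv_le[OF u Cc_involution[OF g] Cc_involution[OF f]])
  also have "\<dots> \<le> I g * I f"
    using mult_right_mono[OF N_st_le_I[OF g u] I_nonneg[OF f]] by (simp add: I_st f)
  finally show "N (st (f \<star> g)) u \<le> I f * I g" by (simp add: st_conv f g mult.commute)
qed

end

section \<open>Positivity of matrices of functions on the unit space\<close>

text \<open>The double sum is the squared norm of the linear combination of the \<open>w s\<close>
  with coefficients \<open>a s\<close>.\<close>

lemma (in pre_hilbert) lincomb_positive:
  assumes "finite S" "\<And>s. s \<in> S \<Longrightarrow> w s \<in> hcar H"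
  shows "0 \<le> Re (\<Sum>s\<in>S. \<Sum>t\<in>S. cnj (a s) * a t * hip H (w s) (w t))"
proof -
  obtain v where v: "v \<in> hcar H" "\<And>z. z \<in> hcar H \<Longrightarrow> hip H z v = (\<Sum>s\<in>S. a s * hip H z (w s))"
    using lincomb_exists[OF assms(1), of w a] assms(2) by auto
  have vw: "hip H v (w s) = cnj (\<Sum>t\<in>S. a t * hip H (w s) (w t))" if "s \<in> S" for s
    using ip_commute[OF v(1) assms(2)[OF that]] v(2)[OF assms(2)[OF that]] by simp
  have "cnj (hip H v v) = (\<Sum>s\<in>S. cnj (a s) * cnj (hip H v (w s)))"
    using v(2)[OF v(1)] by simp
  also have "\<dots> = (\<Sum>s\<in>S. \<Sum>t\<in>S. cnj (a s) * a t * hip H (w s) (w t))"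
    by (intro sum.cong refl) (simp add: vw sum_distrib_left mult.assoc)
  finally have "Re (\<Sum>s\<in>S. \<Sum>t\<in>S. cnj (a s) * a t * hip H (w s) (w t)) = Re (hip H v v)"
    by (metis cnj.sel(1))
  then show ?thesis using ip_nonneg[OF v(1)] by simp
qed

text \<open>Schur's product theorem by Gram-Schmidt. Subtracting from every \<open>e s\<close> its
  component along \<open>e z\<close> splits the Gram matrix of \<open>e\<close> into a rank-one
  matrix, handled by \<open>lincomb_positive\<close>, and the Gram matrix of vectors
  \<open>f s\<close> with \<open>f z\<close> of norm zero, to which the induction hypothesis
  applies. The swapped arguments of \<open>hip H\<close> give the conjugate Gram matrix.\<close>

lemma tensor_positive:
  assumes H: "pre_hilbert H" and K: "pre_hilbert K" and S: "finite S"
    and e: "\<And>s. s \<in> S \<Longrightarrow> e s \<in> hcar H" and w: "\<And>s. s \<in> S \<Longrightarrow> w s \<in> hcar K"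
  shows "0 \<le> Re (\<Sum>s\<in>S. \<Sum>t\<in>S. hip H (e t) (e s) * hip K (w s) (w t))"
  using S e w
proof (induction S arbitrary: e)
  case empty
  then show ?case by simp
next
  case (insert z S)
  interpret H: pre_hilbert H by fact
  interpret K: pre_hilbert K by fact
  \<comment> \<open>A vector of norm zero is orthogonal to everything, so the row and the column of
    \<open>z\<close> disappear.\<close>
  have drop: "(\<Sum>s\<in>insert z S. \<Sum>t\<in>insert z S. hip H (f t) (f s) * hip K (w s) (w t))
      = (\<Sum>s\<in>S. \<Sum>t\<in>S. hip H (f t) (f s) * hip K (w s) (w t))"
    if f: "\<And>s. s \<in> insert z S \<Longrightarrow> f s \<in> hcar H" and z0: "hnorm H (f z) = 0" for f
  proof -
    have 1: "hip H (f t) (f z) = 0" if "t \<in> insert z S" for t using f that z0 by (intro H.norm_zero_ip) auto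
    have 2: "hip H (f z) (f t) = 0" if "t \<in> insert z S" for t
      using 1[OF that] H.ip_commute[of "f z" "f t"] f that by simp
    show ?thesis using insert.hyps 1 2 by simp
  qed
  have IH: "0 \<le> Re (\<Sum>s\<in>S. \<Sum>t\<in>S. hip H (f t) (f s) * hip K (w s) (w t))"
    if "\<And>s. s \<in> insert z S \<Longrightarrow> f s \<in> hcar H" for f
    using that insert.prems by (intro insert.IH) auto
  show ?case
  proof (cases "hnorm H (e z) = 0")
    case True
    then show ?thesis using drop[of e] IH[of e] insert.prems by simp
  next
    case False
    define n where "n = hip H (e z) (e z)"
    have nr: "n = complex_of_real ((hnorm H (e z))\<^sup>2)" unfolding n_def using insert.prems by (intro H.ip_self) auto
    have n0: "n \<noteq> 0" using False by (simp add: nr)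
    have nc: "cnj n = n" by (simp add: nr)
    \<comment> \<open>Coefficient of the projection of \<open>e s\<close> onto the line through
      \<open>e z\<close>.\<close>
    define c where "c s = hip H (e z) (e s) / n" for s
    define f where "f s = hsub H (e s) (hscale H (c s) (e z))" for s
    have ec: "s \<in> insert z S \<Longrightarrow> e s \<in> hcar H" for s using insert.prems by simp
    have eo: "e z \<in> hcar H" using ec by simp
    have fc: "s \<in> insert z S \<Longrightarrow> f s \<in> hcar H" for s using ec eo by (simp add: f_def H.closed)
    have A: "hip H (e z) (e s) = c s * n" for s using n0 by (simp add: c_def)
    have B: "hip H (e s) (e z) = cnj (c s) * n" if "s \<in> insert z S" for s
      using H.ip_commute[OF ec[OF that] eo] A[of s] nc by simp
    have cz: "c z = 1" using n0 by (simp add: c_def n_def)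
    have ff: "hip H (f t) (f s) = hip H (e t) (e s) - cnj (c t) * c s * n" if "s \<in> insert z S" "t \<in> insert z S" for s t
      using that ec eo A B cz by (simp add: f_def H.ip_simps H.closed algebra_simps)
    have "hip H (f z) (f z) = 0" using ff[of z z] A[of z] cz by simp
    then have fo: "hnorm H (f z) = 0" by (simp add: hnorm_def)
    have "(\<Sum>s\<in>insert z S. \<Sum>t\<in>insert z S. hip H (e t) (e s) * hip K (w s) (w t))
      = (\<Sum>s\<in>insert z S. \<Sum>t\<in>insert z S. hip H (f t) (f s) * hip K (w s) (w t))
        + n * (\<Sum>s\<in>insert z S. \<Sum>t\<in>insert z S. c s * cnj (c t) * hip K (w s) (w t))"
    proof -
      have "hip H (e t) (e s) * k = hip H (f t) (f s) * k + n * (c s * cnj (c t) * k)"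
        if "s \<in> insert z S" "t \<in> insert z S" for s t k
      proof -
        have eq: "hip H (e t) (e s) = hip H (f t) (f s) + n * (c s * cnj (c t))" using ff[OF that] by (simp add: algebra_simps)
        show ?thesis unfolding eq by (simp only: distrib_right mult.assoc)
      qed
      then have "(\<Sum>s\<in>insert z S. \<Sum>t\<in>insert z S. hip H (e t) (e s) * hip K (w s) (w t))
        = (\<Sum>s\<in>insert z S. \<Sum>t\<in>insert z S. hip H (f t) (f s) * hip K (w s) (w t) + n * (c s * cnj (c t) * hip K (w s) (w t)))"
        by (intro sum.cong refl)
      then show ?thesis by (simp only: sum.distrib sum_distrib_left)
    qed
    moreover have "0 \<le> Re (n * (\<Sum>s\<in>insert z S. \<Sum>t\<in>insert z S. c s * cnj (c t) * hip K (w s) (w t)))"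
      using K.lincomb_positive[of "insert z S" w "\<lambda>s. cnj (c s)"] insert.prems insert.hyps by (simp add: nr)
    moreover have "0 \<le> Re (\<Sum>s\<in>insert z S. \<Sum>t\<in>insert z S. hip H (f t) (f s) * hip K (w s) (w t))"
      using drop[of f] IH[of f] fc fo by simp
    ultimately show ?thesis by simp
  qed
qed

text \<open>\<open>D y x\<close> measures how badly data sampled at \<open>y\<close> describe the
  point \<open>x\<close>; the weight of \<open>y\<close> vanishes where this error reaches
  \<open>d\<close>. The last clause, that weights depend on \<open>x\<close> only through the
  errors, is what makes them invariant under the range map later.\<close>

lemma partition_of_unity_on_compact:
  fixes D :: "'g::topological_space \<Rightarrow> 'g \<Rightarrow> real"
  assumes C: "compact C" and d: "0 < d" and D: "\<And>y. y \<in> C \<Longrightarrow> continuous_on UNIV (D y)" "\<And>y. y \<in> C \<Longrightarrow> D y y < d / 2"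
  shows "\<exists>F p. finite F \<and> F \<subseteq> C \<and> (\<forall>y\<in>F. continuous_on UNIV (p y)) \<and> (\<forall>y x. 0 \<le> (p y x :: real))
    \<and> (\<forall>x\<in>C. (\<Sum>y\<in>F. p y x) = 1) \<and> (\<forall>y\<in>F. \<forall>x. p y x \<noteq> 0 \<longrightarrow> D y x < d)
    \<and> (\<forall>x x'. (\<forall>y\<in>C. D y x = D y x') \<longrightarrow> (\<forall>y\<in>F. p y x = p y x'))"
proof -
  have op: "open {x. D y x < d / 2}" if "y \<in> C" for y
    using D(1)[OF that] by (intro open_Collect_less) auto
  have "\<exists>F \<subseteq> C. finite F \<and> C \<subseteq> (\<Union>y\<in>F. {x. D y x < d / 2})"
    by (rule compactE_image[OF C, of C "\<lambda>y. {x. D y x < d / 2}"]) (use op D(2) in auto)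
  then obtain F where F: "F \<subseteq> C" "finite F" "C \<subseteq> (\<Union>y\<in>F. {x. D y x < d / 2})" by blast
  define f where "f y x = max 0 (d - D y x)" for y x
  \<comment> \<open>The floor \<open>d / 2\<close> keeps the denominator positive everywhere. On
    \<open>C\<close> it is inactive, since some sample point has error below \<open>d / 2\<close>
    there, and the weights sum to 1.\<close>
  define p where "p y x = f y x / max (d / 2) (\<Sum>y\<in>F. f y x)" for y x
  have f0: "0 \<le> f y x" for y x by (simp add: f_def)
  have m0: "0 < max (d / 2) (\<Sum>y\<in>F. f y x)" for x using d by (simp add: less_max_iff_disj)
  have fc: "continuous_on UNIV (f y)" if "y \<in> F" for y
    unfolding f_def[abs_def] using D(1)[of y] F that by (intro continuous_intros) auto
  have "\<forall>y\<in>F. continuous_on UNIV (p y)"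
      unfolding p_def[abs_def] using m0 by (intro ballI continuous_intros fc) (auto simp: less_le)
  moreover have "0 \<le> p y x" for y x using f0[of y x] m0[of x] by (simp add: p_def)
  moreover have "D y x < d" if "p y x \<noteq> 0" for y x using that by (auto simp: p_def f_def max_def split: if_splits)
  moreover have "\<forall>x x'. (\<forall>y\<in>C. D y x = D y x') \<longrightarrow> (\<forall>y\<in>F. p y x = p y x')"
    proof (intro allI impI)
      fix x x' assume "\<forall>y\<in>C. D y x = D y x'"
      then have "\<forall>y\<in>F. f y x = f y x'" using F by (auto simp: f_def)
      then show "\<forall>y\<in>F. p y x = p y x'" by (simp add: p_def cong: sum.cong)
    qed
  moreover have "(\<Sum>y\<in>F. p y x) = 1" if "x \<in> C" for x
  proof -
    obtain y where y: "y \<in> F" "D y x < d / 2" using F \<open>x \<in> C\<close> by auto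
    have "d / 2 \<le> d - D y x" using y by simp
    also have "\<dots> \<le> f y x" by (simp add: f_def)
    also have "\<dots> \<le> (\<Sum>y\<in>F. f y x)" using y F f0 by (intro member_le_sum) auto
    finally have "d / 2 \<le> (\<Sum>y\<in>F. f y x)" .
    then show ?thesis using d by (simp add: p_def max_def flip: sum_divide_distrib)
  qed
  ultimately show ?thesis using F by (intro exI[of _ F] exI[of _ p]) auto
qed

section \<open>Representations and functions on the unit space\<close>

locale cc_rep = haar_groupoid G lam
  for G :: "'g::{t2_space, second_countable_topology} groupoid" and lam :: "'g \<Rightarrow> 'g measure" +
  fixes K :: "'k hilbert" and \<rho> :: "('g \<Rightarrow> complex) \<Rightarrow> 'k \<Rightarrow> 'k"
  assumes rep: "Cc_representation G lam K \<rho>"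
begin

sublocale K: hilbert_space K
  using rep by (simp add: Cc_representation_def)

lemma rep_bounded: "f \<in> Cc \<Longrightarrow> \<rho> f \<in> bounded_ops K"
  using rep by (simp add: Cc_representation_def)

lemma rep_closed: "\<lbrakk>f \<in> Cc; v \<in> hcar K\<rbrakk> \<Longrightarrow> \<rho> f v \<in> hcar K"
  by (rule K.opD(1)[OF rep_bounded])

lemma rep_add: "\<lbrakk>f \<in> Cc; g \<in> Cc; v \<in> hcar K\<rbrakk> \<Longrightarrow> \<rho> (\<lambda>x. f x + g x) v = hadd K (\<rho> f v) (\<rho> g v)"
  using rep by (simp add: Cc_representation_def K.op_add_apply)

lemma rep_scale: "\<lbrakk>f \<in> Cc; v \<in> hcar K\<rbrakk> \<Longrightarrow> \<rho> (\<lambda>x. c * f x) v = hscale K c (\<rho> f v)"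
  using rep by (simp add: Cc_representation_def K.op_scale_apply)

lemma rep_conv: "\<lbrakk>f \<in> Cc; g \<in> Cc; v \<in> hcar K\<rbrakk> \<Longrightarrow> \<rho> (f \<star> g) v = \<rho> f (\<rho> g v)"
  using rep by (simp add: Cc_representation_def compose_def)

lemma rep_adj: "\<lbrakk>f \<in> Cc; v \<in> hcar K; w \<in> hcar K\<rbrakk> \<Longrightarrow> hip K (\<rho> f v) w = hip K v (\<rho> (st f) w)"
  using rep by (simp add: Cc_representation_def)

lemma rep_norm: "\<lbrakk>f \<in> Cc; v \<in> hcar K\<rbrakk> \<Longrightarrow> hnorm K (\<rho> f v) \<le> I f * hnorm K v"
proof -
  assume f: "f \<in> Cc" and v: "v \<in> hcar K"
  have "op_norm K (\<rho> f) \<le> I f" using rep f by (simp add: Cc_representation_def)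
  then show ?thesis
    by (rule order_trans[OF K.op_norm_bound[OF rep_bounded[OF f] v] mult_right_mono]) (use v in simp)
qed

lemma ip_rep_bound: "\<lbrakk>f \<in> Cc; v \<in> hcar K; w \<in> hcar K\<rbrakk> \<Longrightarrow> cmod (hip K w (\<rho> f v)) \<le> hnorm K w * (I f * hnorm K v)"
  by (rule order_trans[OF K.cauchy_schwarz mult_left_mono[OF rep_norm]]) (auto simp: rep_closed)

lemma ip_rep_add: "\<lbrakk>f \<in> Cc; g \<in> Cc; v \<in> hcar K; w \<in> hcar K\<rbrakk> \<Longrightarrow>
   hip K w (\<rho> (\<lambda>x. f x + g x) v) = hip K w (\<rho> f v) + hip K w (\<rho> g v)"
  by (simp add: rep_add rep_closed K.ip_add)

lemma ip_rep_scale: "\<lbrakk>f \<in> Cc; v \<in> hcar K; w \<in> hcar K\<rbrakk> \<Longrightarrow> hip K w (\<rho> (\<lambda>x. c * f x) v) = c * hip K w (\<rho> f v)"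
  by (simp add: rep_scale rep_closed K.ip_scale)

lemma ip_rep_diff: "\<lbrakk>f \<in> Cc; g \<in> Cc; v \<in> hcar K; w \<in> hcar K\<rbrakk> \<Longrightarrow>
   hip K w (\<rho> (\<lambda>x. f x - g x) v) = hip K w (\<rho> f v) - hip K w (\<rho> g v)"
  using ip_rep_add[of f "\<lambda>x. -1 * g x" v w] ip_rep_scale[of g v w "-1"] Cc_scale[of g "-1"] by simp

lemma ip_rep_sum:
  assumes "finite J" "\<And>j. j \<in> J \<Longrightarrow> f j \<in> Cc" "v \<in> hcar K" "w \<in> hcar K"
  shows "hip K w (\<rho> (\<lambda>x. \<Sum>j\<in>J. f j x) v) = (\<Sum>j\<in>J. hip K w (\<rho> (f j) v))"
  using assms(1,2)
proof (induction J)
  case empty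
  show ?case using ip_rep_scale[OF Cc_zero assms(3,4), of 0] by simp
next
  case (insert j J)
  then show ?case using ip_rep_add[of "f j" "\<lambda>x. \<Sum>j\<in>J. f j x" v w] Cc_sum[of J f] assms by simp
qed

lemma ip_rep_conv: "\<lbrakk>f \<in> Cc; g \<in> Cc; v \<in> hcar K; w \<in> hcar K\<rbrakk> \<Longrightarrow>
   hip K v (\<rho> (st f \<star> g) w) = hip K (\<rho> f v) (\<rho> g w)"
  by (simp add: rep_conv rep_adj Cc_involution rep_closed)

text \<open>In \<open>st (k f) \<star> g\<close> the factor \<open>k\<close> is evaluated at
  \<open>ginv G y\<close>, whose range equals that of \<open>gmult G (ginv G y) x\<close>, so it can
  be transferred to \<open>g\<close>. This is the substitute for an action of functions on the unit
  space by normal operators with adjoint \<open>cnj k\<close>.\<close>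

lemma ip_rng_function:
  assumes f: "f \<in> Cc" and g: "g \<in> Cc" and k: "continuous_on UNIV k" and kr: "\<And>x. k (rng G x) = k x"
    and v: "v \<in> hcar K" and w: "w \<in> hcar K"
  shows "hip K (\<rho> (\<lambda>x. k x * f x) v) (\<rho> g w) = hip K (\<rho> f v) (\<rho> (\<lambda>x. cnj (k x) * g x) w)"
proof -
  have kf: "(\<lambda>x. k x * f x) \<in> Cc" by (rule Cc_mult[OF f k])
  have kg: "(\<lambda>x. cnj (k x) * g x) \<in> Cc" by (intro Cc_mult[OF g] continuous_on_cnj k)
  have "st (\<lambda>x. k x * f x) \<star> g = st f \<star> (\<lambda>x. cnj (k x) * g x)"
  proof
    fix x
    show "(st (\<lambda>x. k x * f x) \<star> g) x = (st f \<star> (\<lambda>x. cnj (k x) * g x)) x"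
      unfolding convol_def
    proof (rule set_integral_cong_rfibre)
      fix y assume y: "rng G y = rng G x"
      have "k (ginv G y) = k (gmult G (ginv G y) x)"
        using kr[of "ginv G y"] kr[of "gmult G (ginv G y) x"] y by (simp add: grp)
      then show "st (\<lambda>x. k x * f x) y * g (gmult G (ginv G y) x) = st f y * (cnj (k (gmult G (ginv G y) x)) * g (gmult G (ginv G y) x))"
        by (simp add: involution_def)
    qed
  qed
  then show ?thesis using ip_rep_conv[OF kf g v w] ip_rep_conv[OF f kg v w] by simp
qed

text \<open>The double sum is the formal squared norm of the sum of the tensors of
  \<open>e s\<close> with \<open>\<rho> (\<beta> s) (v s)\<close>. Freezing the Gram matrices at
  finitely many sample points \<open>y\<close>, with weights \<open>p y\<close>, turns it into a sum
  over \<open>y\<close> of Schur products, each nonnegative by \<open>tensor_positive\<close>; the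
  error is at most \<open>d * M\<close> by the \<open>I\<close>-norm bound.\<close>

lemma positive_matrix:
  fixes H :: "'g \<Rightarrow> 'h hilbert" and \<beta> :: "'i \<Rightarrow> 'g \<Rightarrow> complex" and v :: "'i \<Rightarrow> 'k" and e :: "'i \<Rightarrow> 'g \<Rightarrow> 'h"
  assumes S: "finite S" and \<beta>: "\<And>s. s \<in> S \<Longrightarrow> \<beta> s \<in> Cc" and v: "\<And>s. s \<in> S \<Longrightarrow> v s \<in> hcar K"
    and H: "\<And>u. u \<in> units G \<Longrightarrow> pre_hilbert (H u)"
    and e: "\<And>s u. \<lbrakk>s \<in> S; u \<in> units G\<rbrakk> \<Longrightarrow> e s u \<in> hcar (H u)"
    and A: "\<And>s t. A s t = (\<lambda>x. hip (H (rng G x)) (e t (rng G x)) (e s (rng G x)))"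
    and cA: "\<And>s t. \<lbrakk>s \<in> S; t \<in> S\<rbrakk> \<Longrightarrow> continuous_on UNIV (A s t)"
  shows "0 \<le> Re (\<Sum>s\<in>S. \<Sum>t\<in>S. hip K (\<rho> (\<beta> s) (v s)) (\<rho> (\<lambda>x. A s t x * \<beta> t x) (v t)))"
proof -
  define X where "X s t = hip K (\<rho> (\<beta> s) (v s)) (\<rho> (\<lambda>x. A s t x * \<beta> t x) (v t))" for s t
  have "\<exists>L. compact L \<and> (\<forall>x. x \<notin> L \<longrightarrow> \<beta> s x = 0)" if "s \<in> S" for s
    using Cc_support[OF \<beta>[OF that]] by metis
  then obtain L where L: "\<And>s. s \<in> S \<Longrightarrow> compact (L s)" "\<And>s x. \<lbrakk>s \<in> S; x \<notin> L s\<rbrakk> \<Longrightarrow> \<beta> s x = 0" by metis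
  define C where "C = (\<Union>s\<in>S. L s)"
  have C: "compact C" unfolding C_def using S L by (intro compact_UN) auto
  have \<beta>0: "\<beta> s x = 0" if "s \<in> S" "x \<notin> C" for s x using that L by (auto simp: C_def)
  define M where "M = (\<Sum>s\<in>S. \<Sum>t\<in>S. hnorm K (\<rho> (\<beta> s) (v s)) * (I (\<beta> t) * hnorm K (v t)))"
  have rc: "s \<in> S \<Longrightarrow> \<rho> (\<beta> s) (v s) \<in> hcar K" for s using \<beta> v by (intro rep_closed)
  have lower: "- (d * M) \<le> Re (\<Sum>s\<in>S. \<Sum>t\<in>S. X s t)" if d: "d > 0" for d
  proof -
    \<comment> \<open>One error function for all entries, so that a single partition serves the
      whole matrix.\<close>
    define D where "D y x = (\<Sum>s\<in>S. \<Sum>t\<in>S. cmod (A s t x - A s t y))" for y x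
    have Dc: "continuous_on UNIV (D y)" for y
      unfolding D_def[abs_def] using cA by (intro continuous_intros) auto
    have DD: "D y y < d / 2" for y using d by (simp add: D_def)
    obtain F and p :: "'g \<Rightarrow> 'g \<Rightarrow> real" where F: "finite F" "F \<subseteq> C"
      and pc: "\<forall>y\<in>F. continuous_on UNIV (p y)" and p0': "\<forall>y x. 0 \<le> p y x"
      and p1': "\<forall>x\<in>C. (\<Sum>y\<in>F. p y x) = 1" and pD': "\<forall>y\<in>F. \<forall>x. p y x \<noteq> 0 \<longrightarrow> D y x < d"
      and pinv: "\<forall>x x'. (\<forall>y\<in>C. D y x = D y x') \<longrightarrow> (\<forall>y\<in>F. p y x = p y x')"
      using partition_of_unity_on_compact[OF C d Dc DD] by (elim exE conjE) (rule that)
    note pc = pc[rule_format] and p0 = p0'[rule_format] and p1 = p1'[rule_format] and pD = pD'[rule_format]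
    have Ar: "A s t (rng G x) = A s t x" for s t x by (simp add: A rng_rng)
    have pr: "p y (rng G x) = p y x" if "y \<in> F" for y x using pinv[rule_format, of "rng G x" x y] that by (simp add: D_def Ar)
    \<comment> \<open>Square roots let the weight be shared between both sides of the inner product;
      invariance of \<open>p\<close> under the range map allows the transfer by
      \<open>ip_rng_function\<close>.\<close>
    define b where "b y x = complex_of_real (sqrt (p y x))" for y x
    have bc: "continuous_on UNIV (b y)" if "y \<in> F" for y
      unfolding b_def[abs_def] using pc[OF that] by (intro continuous_intros)
    have bb: "cnj (b y x) * (b y x * z) = complex_of_real (p y x) * z" for y x z
      using p0[of y x] by (simp add: b_def flip: of_real_mult mult.assoc)
    define W where "W y s = \<rho> (\<lambda>x. b y x * \<beta> s x) (v s)" for y s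
    have bCc: "(\<lambda>x. b y x * \<beta> s x) \<in> Cc" if "y \<in> F" "s \<in> S" for y s using that by (intro Cc_mult \<beta> bc)
    have pCc: "(\<lambda>x. complex_of_real (p y x) * \<beta> s x) \<in> Cc" if "y \<in> F" "s \<in> S" for y s
      using that by (intro Cc_mult \<beta> continuous_on_of_real pc)
    have ACc: "(\<lambda>x. A s t x * \<beta> t x) \<in> Cc" if "s \<in> S" "t \<in> S" for s t using that by (intro Cc_mult \<beta> cA)
    define Y where "Y s t = (\<Sum>y\<in>F. A s t y * hip K (W y s) (W y t))" for s t
    have est: "cmod (X s t - Y s t) \<le> d * (hnorm K (\<rho> (\<beta> s) (v s)) * (I (\<beta> t) * hnorm K (v t)))"
      if st: "s \<in> S" "t \<in> S" for s t
    proof -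
      have WW: "hip K (W y s) (W y t) = hip K (\<rho> (\<beta> s) (v s)) (\<rho> (\<lambda>x. complex_of_real (p y x) * \<beta> t x) (v t))" if "y \<in> F" for y
        unfolding W_def using ip_rng_function[OF \<beta>[OF st(1)] bCc[OF that st(2)] bc[OF that] _ v[OF st(1)] v[OF st(2)]] pr[OF that]
        by (simp add: bb) (simp add: b_def)
      define R where "R x = (\<Sum>y\<in>F. A s t y * (complex_of_real (p y x) * \<beta> t x))" for x
      have Rc: "R \<in> Cc" unfolding R_def using st pCc by (intro Cc_sum Cc_scale) auto
      have "Y s t = (\<Sum>y\<in>F. hip K (\<rho> (\<beta> s) (v s)) (\<rho> (\<lambda>x. A s t y * (complex_of_real (p y x) * \<beta> t x)) (v t)))"
        unfolding Y_def using st rc v by (intro sum.cong refl) (simp add: WW ip_rep_scale pCc)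
      also have "\<dots> = hip K (\<rho> (\<beta> s) (v s)) (\<rho> R (v t))"
        unfolding R_def using st rc v F pCc by (intro ip_rep_sum[symmetric] Cc_scale) auto
      finally have "X s t - Y s t = hip K (\<rho> (\<beta> s) (v s)) (\<rho> (\<lambda>x. A s t x * \<beta> t x - R x) (v t))"
        unfolding X_def using st rc v Rc ACc by (simp add: ip_rep_diff)
      also have "cmod \<dots> \<le> hnorm K (\<rho> (\<beta> s) (v s)) * (I (\<lambda>x. A s t x * \<beta> t x - R x) * hnorm K (v t))"
        using st rc v Rc ACc by (intro ip_rep_bound Cc_diff) auto
      also have "\<dots> \<le> hnorm K (\<rho> (\<beta> s) (v s)) * ((d * I (\<beta> t)) * hnorm K (v t))"
      proof (intro mult_left_mono mult_right_mono)
        show "I (\<lambda>x. A s t x * \<beta> t x - R x) \<le> d * I (\<beta> t)"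
        proof (rule I_mono[OF Cc_diff[OF ACc[OF st] Rc] \<beta>[OF st(2)]])
          fix x
          show "cmod (A s t x * \<beta> t x - R x) \<le> d * cmod (\<beta> t x)"
          proof (cases "x \<in> C")
            case True
            have "A s t x = (\<Sum>y\<in>F. complex_of_real (p y x) * A s t x)"
              using p1[OF True] by (simp flip: sum_distrib_right of_real_sum)
            then have "A s t x * \<beta> t x - R x = (\<Sum>y\<in>F. complex_of_real (p y x) * (A s t x - A s t y)) * \<beta> t x"
              unfolding R_def by (simp add: sum_distrib_right left_diff_distrib right_diff_distrib sum_subtractf mult.assoc mult.left_commute)
            then have "cmod (A s t x * \<beta> t x - R x) = cmod (\<Sum>y\<in>F. complex_of_real (p y x) * (A s t x - A s t y)) * cmod (\<beta> t x)"
              by (simp add: norm_mult)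
            also have "cmod (\<Sum>y\<in>F. complex_of_real (p y x) * (A s t x - A s t y)) \<le> (\<Sum>y\<in>F. p y x * d)"
            proof (rule sum_norm_le)
              fix y assume y: "y \<in> F"
              show "cmod (complex_of_real (p y x) * (A s t x - A s t y)) \<le> p y x * d"
              proof (cases "p y x = 0")
                case False
                have "cmod (A s t x - A s t y) \<le> (\<Sum>t\<in>S. cmod (A s t x - A s t y))"
                  using st S by (intro member_le_sum) auto
                also have "\<dots> \<le> D y x"
                  unfolding D_def using st S by (intro member_le_sum[of s S "\<lambda>s. \<Sum>t\<in>S. cmod (A s t x - A s t y)"] sum_nonneg) auto
                also have "\<dots> \<le> d" using pD[OF y False] by simp
                finally show ?thesis using p0[of y x] by (simp add: norm_mult mult_left_mono)
              qed simp
            qed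
            also have "\<dots> = d" using p1[OF True] by (simp flip: sum_distrib_right)
            finally show ?thesis by (simp add: mult_right_mono)
          next
            case False
            then show ?thesis using st \<beta>0 by (simp add: R_def)
          qed
        qed (use d in simp)
        show "0 \<le> hnorm K (v t)" using v[OF st(2)] by simp
        show "0 \<le> hnorm K (\<rho> (\<beta> s) (v s))" using rc[OF st(1)] by simp
      qed
      finally show ?thesis by (simp add: algebra_simps)
    qed
    have "0 \<le> Re (\<Sum>s\<in>S. \<Sum>t\<in>S. A s t y * hip K (W y s) (W y t))" if "y \<in> F" for y
      unfolding A
      by (rule tensor_positive[OF H K.pre_hilbert S]) (use e that bCc v in \<open>auto simp: W_def intro!: rep_closed\<close>)
    then have "0 \<le> (\<Sum>y\<in>F. Re (\<Sum>s\<in>S. \<Sum>t\<in>S. A s t y * hip K (W y s) (W y t)))"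
      by (rule sum_nonneg)
    then have "0 \<le> Re (\<Sum>y\<in>F. \<Sum>s\<in>S. \<Sum>t\<in>S. A s t y * hip K (W y s) (W y t))"
      by (simp only: Re_sum)
    also have "(\<Sum>y\<in>F. \<Sum>s\<in>S. \<Sum>t\<in>S. A s t y * hip K (W y s) (W y t)) = (\<Sum>s\<in>S. \<Sum>t\<in>S. Y s t)"
      unfolding Y_def by (subst sum.swap) (intro sum.cong refl sum.swap)
    finally have Y0: "0 \<le> Re (\<Sum>s\<in>S. \<Sum>t\<in>S. Y s t)" .
    have "cmod ((\<Sum>s\<in>S. \<Sum>t\<in>S. X s t) - (\<Sum>s\<in>S. \<Sum>t\<in>S. Y s t)) = cmod (\<Sum>s\<in>S. \<Sum>t\<in>S. X s t - Y s t)"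
      by (simp add: sum_subtractf)
    also have "\<dots> \<le> d * M"
      unfolding M_def sum_distrib_left by (intro sum_norm_le est)
    finally have "Re ((\<Sum>s\<in>S. \<Sum>t\<in>S. Y s t) - (\<Sum>s\<in>S. \<Sum>t\<in>S. X s t)) \<le> d * M"
      using complex_Re_le_cmod norm_minus_commute order_trans by metis
    then show ?thesis using Y0 by simp
  qed
  have M0: "0 \<le> M" unfolding M_def using rc \<beta> v by (intro sum_nonneg mult_nonneg_nonneg I_nonneg) auto
  have "0 \<le> Re (\<Sum>s\<in>S. \<Sum>t\<in>S. X s t)"
  proof (rule field_le_epsilon)
    fix e :: real assume e: "0 < e"
    have "e / (M + 1) * M \<le> e" using M0 e by (simp add: field_simps)
    then show "0 \<le> Re (\<Sum>s\<in>S. \<Sum>t\<in>S. X s t) + e" using lower[of "e / (M + 1)"] M0 e by simp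
  qed
  then show ?thesis by (simp add: X_def)
qed

end

section \<open>Hilbert bundles: unitarity and bounded sections\<close>

locale bundle_groupoid = haar_groupoid G lam + hilbert_bundle G H \<Gamma> L
  for G :: "'g::{t2_space, second_countable_topology} groupoid" and lam :: "'g \<Rightarrow> 'g measure"
    and H :: "'g \<Rightarrow> 'h hilbert" and \<Gamma> :: "('g \<Rightarrow> 'h) set" and L :: "'g \<Rightarrow> 'h \<Rightarrow> 'h"
begin

abbreviation "bs \<equiv> bounded_sections (units G) H \<Gamma>"

lemma fibre_pre: "u \<in> units G \<Longrightarrow> pre_hilbert (H u)"
  by (rule hilbert_space.pre_hilbert[OF hilbert])

lemma bs_closed: "\<lbrakk>\<xi> \<in> bs; u \<in> units G\<rbrakk> \<Longrightarrow> \<xi> u \<in> hcar (H u)"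
  by (auto simp: bounded_sections_def section_in_fibre)

lemma L_closed: "v \<in> hcar (H (src G x)) \<Longrightarrow> L x v \<in> hcar (H (rng G x))"
  using linear[of x] by (auto simp: hlinear_def)

text \<open>\<open>L u\<close> is idempotent because \<open>u\<close> is, and it is surjective, so
  it fixes every vector.\<close>

lemma L_unit: "\<lbrakk>u \<in> units G; v \<in> hcar (H u)\<rbrakk> \<Longrightarrow> L u v = v"
proof -
  assume u: "u \<in> units G" and v: "v \<in> hcar (H u)"
  have su: "src G u = u" "rng G u = u" using u by (auto simp: unit_rng unit_src)
  obtain w where w: "w \<in> hcar (H u)" "v = L u w" using surjective[of u] v su by auto
  have "gmult G u u = u" using mult_src_self[of u] su by simp
  then show ?thesis using multiplicative[of u u w] w su by simp
qed

text \<open>Polarization: real parts come from the norms of sums, imaginary parts from replacing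
  \<open>w\<close> by \<open>\<i> w\<close>.\<close>

lemma L_ip:
  assumes v: "v \<in> hcar (H (src G x))" and w: "w \<in> hcar (H (src G x))"
  shows "hip (H (rng G x)) (L x v) (L x w) = hip (H (src G x)) v w"
proof -
  interpret S: pre_hilbert "H (src G x)" by (rule fibre_pre) simp
  interpret R: pre_hilbert "H (rng G x)" by (rule fibre_pre) simp
  have Re: "Re (hip (H (rng G x)) (L x v) (L x w)) = Re (hip (H (src G x)) v w)" if w: "w \<in> hcar (H (src G x))" for w
  proof -
    have "L x (hadd (H (src G x)) v w) = hadd (H (rng G x)) (L x v) (L x w)"
      using linear[of x] v w by (auto simp: hlinear_def)
    then show ?thesis
      using S.norm_add_sq[OF v w] R.norm_add_sq[OF L_closed[OF v] L_closed[OF w]]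
        isometry[OF v] isometry[OF w] isometry[OF S.add_closed[OF v w]] by simp
  qed
  have "L x (hscale (H (src G x)) \<i> w) = hscale (H (rng G x)) \<i> (L x w)"
    using linear[of x] w by (auto simp: hlinear_def)
  then have "Im (hip (H (rng G x)) (L x v) (L x w)) = Im (hip (H (src G x)) v w)"
    using Re[OF S.scale_closed[OF w, of \<i>]] v w by (simp add: S.ip_simps R.ip_simps L_closed)
  with Re[OF w] show ?thesis by (simp add: complex_eq_iff)
qed

lemma L_inv: "v \<in> hcar (H (src G x)) \<Longrightarrow> L (ginv G x) (L x v) = v"
  using multiplicative[of "ginv G x" x v] by (simp add: grp inv_mult L_unit)

text \<open>Obtained from continuity of the coefficient by evaluating it at units, where
  \<open>L\<close> is the identity.\<close>

lemma continuous_ip: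
  assumes "\<xi> \<in> bs" "\<eta> \<in> bs"
  shows "continuous_on UNIV (\<lambda>x. hip (H (rng G x)) (\<xi> (rng G x)) (\<eta> (rng G x)))"
proof -
  have "continuous_on UNIV (\<lambda>x. coefficient G H L \<xi> \<eta> (rng G x))"
    by (rule continuous_on_compose2[OF continuous_coefficient[OF assms] continuous_rng]) simp
  then show ?thesis using assms by (simp add: coefficient_def grp L_unit bs_closed)
qed

text \<open>Near \<open>u\<close> the scalar function is almost constant, so the scaled section is
  locally close to a constant multiple of \<open>e\<close>; the field is closed under such
  approximation.\<close>

lemma scale_section_continuous:
  assumes e: "e \<in> \<Gamma>" and g: "continuous_on (units G) (g :: 'g \<Rightarrow> real)"
  shows "(\<lambda>w. hscale (H w) (complex_of_real (g w)) (e w)) \<in> \<Gamma>"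
proof (rule locally_uniformly_closed)
  show "u \<in> units G \<Longrightarrow> hscale (H u) (complex_of_real (g u)) (e u) \<in> hcar (H u)" for u
    by (intro pre_hilbert.scale_closed fibre_pre section_in_fibre e)
  fix u \<epsilon> :: _ assume u: "u \<in> units G" and \<epsilon>: "(0::real) < \<epsilon>"
  have c: "continuous_on (units G) (\<lambda>w. \<bar>g w - g u\<bar> * hnorm (H w) (e w))"
    by (intro continuous_intros g continuous_norm e)
  have "\<bar>g u - g u\<bar> * hnorm (H u) (e u) \<in> {..<\<epsilon>}" using \<epsilon> by simp
  then obtain V where V: "open V" "u \<in> V" "\<forall>w\<in>units G. w \<in> V \<longrightarrow> \<bar>g w - g u\<bar> * hnorm (H w) (e w) \<in> {..<\<epsilon>}"
    using c u unfolding continuous_on_topological by (metis open_lessThan)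
  have "hdist (H w) (hscale (H w) (complex_of_real (g w)) (e w)) (hscale (H w) (complex_of_real (g u)) (e w)) \<le> \<epsilon>"
    if w: "w \<in> V \<inter> units G" for w
  proof -
    interpret W: pre_hilbert "H w" using w by (intro fibre_pre) simp
    have ew: "e w \<in> hcar (H w)" using w e by (intro section_in_fibre) auto
    have "hsub (H w) (hscale (H w) (complex_of_real (g w)) (e w)) (hscale (H w) (complex_of_real (g u)) (e w))
       = hscale (H w) (complex_of_real (g w - g u)) (e w)"
      using W.add_scale[OF ew, of "complex_of_real (g w)" "- complex_of_real (g u)"] ew by (simp add: hsub_def W.scale_scale)
    then have "hdist (H w) (hscale (H w) (complex_of_real (g w)) (e w)) (hscale (H w) (complex_of_real (g u)) (e w)) = \<bar>g w - g u\<bar> * hnorm (H w) (e w)"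
      using ew by (simp add: hdist_hsub W.norm_scale flip: of_real_diff)
    also have "\<dots> < \<epsilon>" using V(3) w by auto
    finally show ?thesis by simp
  qed
  then show "\<exists>\<xi>'\<in>\<Gamma>. \<exists>V. open V \<and> u \<in> V \<and>
      (\<forall>w\<in>V \<inter> units G. hdist (H w) (hscale (H w) (complex_of_real (g w)) (e w)) (\<xi>' w) \<le> \<epsilon>)"
    using V by (intro bexI[OF _ scale_section[OF e, of "complex_of_real (g u)"]] exI[of _ V]) auto
qed

text \<open>Values are dense for all continuous sections, whereas coefficients are continuous for
  bounded ones. Damping a section closes the gap without changing its value at
  \<open>u\<close>.\<close>

lemma bounded_dense:
  assumes u: "u \<in> units G" and v: "v \<in> hcar (H u)" and d: "0 < d"
  obtains e where "e \<in> bs" "hdist (H u) v (e u) < d"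
proof -
  obtain e where e: "e \<in> \<Gamma>" "hdist (H u) v (e u) < d" using dense_values[OF u v d] by blast
  \<comment> \<open>Equal to 1 at \<open>u\<close>, and bounding the scaled section since
    \<open>t \<le> 1 + t\<^sup>2\<close>.\<close>
  define g where "g w = (1 + (hnorm (H u) (e u))\<^sup>2) / (1 + (hnorm (H w) (e w))\<^sup>2)" for w
  define e' where "e' w = hscale (H w) (complex_of_real (g w)) (e w)" for w
  have pos: "0 < 1 + t\<^sup>2" for t :: real by (simp add: add_pos_nonneg)
  have "e' \<in> \<Gamma>" unfolding e'_def g_def
    by (intro scale_section_continuous e continuous_intros continuous_norm) (use pos in \<open>auto simp: less_le\<close>)
  moreover have "hnorm (H w) (e' w) \<le> 1 + (hnorm (H u) (e u))\<^sup>2" if w: "w \<in> units G" for w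
  proof -
    interpret W: pre_hilbert "H w" using w by (rule fibre_pre)
    have ew: "e w \<in> hcar (H w)" using w e by (intro section_in_fibre) auto
    let ?t = "hnorm (H w) (e w)"
    have t: "?t / (1 + ?t\<^sup>2) \<le> 1"
    proof -
      have "?t \<le> 1 + ?t\<^sup>2" using zero_le_power2[of "?t - 1/2"] by (simp add: power2_diff field_simps)
      then show ?thesis using pos[of ?t] by (simp add: divide_le_eq)
    qed
    have "hnorm (H w) (e' w) = (1 + (hnorm (H u) (e u))\<^sup>2) * (?t / (1 + ?t\<^sup>2))"
    proof -
      have "0 \<le> g w" using pos less_imp_le unfolding g_def by (intro divide_nonneg_nonneg) auto
      then have "hnorm (H w) (e' w) = g w * ?t" using ew by (simp add: e'_def W.norm_scale)
      then show ?thesis by (simp add: g_def)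
    qed
    also have "\<dots> \<le> (1 + (hnorm (H u) (e u))\<^sup>2) * 1" using t pos less_imp_le by (intro mult_left_mono) auto
    finally show ?thesis by simp
  qed
  ultimately have "e' \<in> bs" unfolding bounded_sections_def by (auto intro!: bdd_aboveI2)
  moreover have "e' u = e u"
    using pre_hilbert.scale_one[OF fibre_pre[OF u] section_in_fibre[OF e(1) u]] pos[of "hnorm (H u) (e u)"]
    by (simp add: e'_def g_def)
  ultimately show ?thesis using that e by simp
qed

end

section \<open>Positivity of coefficient kernels\<close>

lemma set_integral_sum:
  fixes f :: "'i \<Rightarrow> 'a \<Rightarrow> 'b::{banach, second_countable_topology}"
  assumes "finite J" "\<And>j. j \<in> J \<Longrightarrow> set_integrable M A (f j)"
  shows "set_integrable M A (\<lambda>x. \<Sum>j\<in>J. f j x)" and "(LINT x:A|M. \<Sum>j\<in>J. f j x) = (\<Sum>j\<in>J. LINT x:A|M. f j x)"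
proof -
  have "set_integrable M A (\<lambda>x. \<Sum>j\<in>J. f j x) \<and> (LINT x:A|M. \<Sum>j\<in>J. f j x) = (\<Sum>j\<in>J. LINT x:A|M. f j x)"
    using assms
  proof (induction J)
    case empty
    then show ?case by (simp add: set_integrable_def)
  next
    case (insert j J)
    then show ?case using set_integral_add[of M A "f j" "\<lambda>x. \<Sum>j\<in>J. f j x"] by simp
  qed
  then show "set_integrable M A (\<lambda>x. \<Sum>j\<in>J. f j x)" and "(LINT x:A|M. \<Sum>j\<in>J. f j x) = (\<Sum>j\<in>J. LINT x:A|M. f j x)" by auto
qed

locale bundle_rep = bundle_groupoid G lam H \<Gamma> L + cc_rep G lam K \<rho>
  for G :: "'g::{t2_space, second_countable_topology} groupoid" and lam :: "'g \<Rightarrow> 'g measure"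
    and H :: "'g \<Rightarrow> 'h hilbert" and \<Gamma> :: "('g \<Rightarrow> 'h) set" and L :: "'g \<Rightarrow> 'h \<Rightarrow> 'h"
    and K :: "'k hilbert" and \<rho> :: "('g \<Rightarrow> complex) \<Rightarrow> 'k \<Rightarrow> 'k"
begin

text \<open>\<open>l a\<close> is a section of the bundle pulled back along the range map, and
  \<open>q a b\<close> is the convolution of \<open>st (F a)\<close> and \<open>F b\<close> weighted
  by inner products of \<open>l\<close>; both arguments have range \<open>src G y\<close>, so these
  live in one fibre. If \<open>l a x\<close> were a finite sum of scalars times sections at
  \<open>rng G x\<close>, this would be an instance of \<open>positive_matrix\<close>; a partition
  of unity produces such sums up to an error controlled in the \<open>I\<close>-norm.\<close>

lemma positive_kernel:
  fixes S :: "'i set" and F :: "'i \<Rightarrow> 'g \<Rightarrow> complex" and v :: "'i \<Rightarrow> 'k" and l :: "'i \<Rightarrow> 'g \<Rightarrow> 'h"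
  assumes S: "finite S" and F: "\<And>a. a \<in> S \<Longrightarrow> F a \<in> Cc" and v: "\<And>a. a \<in> S \<Longrightarrow> v a \<in> hcar K"
    and lc: "\<And>a x. a \<in> S \<Longrightarrow> l a x \<in> hcar (H (rng G x))"
    and ln: "\<And>a. a \<in> S \<Longrightarrow> continuous_on UNIV (\<lambda>x. hnorm (H (rng G x)) (l a x))"
    and lb: "\<And>a x. a \<in> S \<Longrightarrow> hnorm (H (rng G x)) (l a x) \<le> R"
    and le: "\<And>a e. \<lbrakk>a \<in> S; e \<in> bs\<rbrakk> \<Longrightarrow> continuous_on UNIV (\<lambda>x. hip (H (rng G x)) (l a x) (e (rng G x)))"
    and qC: "\<And>a b. \<lbrakk>a \<in> S; b \<in> S\<rbrakk> \<Longrightarrow> q a b \<in> Cc"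
    and qi: "\<And>a b x. \<lbrakk>a \<in> S; b \<in> S\<rbrakk> \<Longrightarrow> set_integrable (lam (rng G x)) (rfibre G (rng G x))
      (\<lambda>y. cnj (F a (ginv G y)) * F b (gmult G (ginv G y) x) * hip (H (src G y)) (l b (gmult G (ginv G y) x)) (l a (ginv G y)))"
    and qe: "\<And>a b x. \<lbrakk>a \<in> S; b \<in> S\<rbrakk> \<Longrightarrow> q a b x = (LINT y:rfibre G (rng G x)|lam (rng G x).
      cnj (F a (ginv G y)) * F b (gmult G (ginv G y) x) * hip (H (src G y)) (l b (gmult G (ginv G y) x)) (l a (ginv G y)))"
  shows "0 \<le> Re (\<Sum>a\<in>S. \<Sum>b\<in>S. hip K (v a) (\<rho> (q a b) (v b)))"
proof -
  have "\<exists>T. compact T \<and> (\<forall>x. x \<notin> T \<longrightarrow> F a x = 0)" if "a \<in> S" for a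
    using Cc_support[OF F[OF that]] by metis
  then obtain T where T: "\<And>a. a \<in> S \<Longrightarrow> compact (T a)" "\<And>a x. \<lbrakk>a \<in> S; x \<notin> T a\<rbrakk> \<Longrightarrow> F a x = 0" by metis
  define C where "C = (\<Union>a\<in>S. T a)"
  have C: "compact C" unfolding C_def using S T by (intro compact_UN) auto
  have F0: "F a x = 0" if "a \<in> S" "x \<notin> C" for a x using that T by (auto simp: C_def)
  \<comment> \<open>For empty \<open>S\<close> nothing forces \<open>R\<close> to be
    nonnegative.\<close>
  define R' where "R' = max R 0"
  have R': "0 \<le> R'" and lb': "\<And>a x. a \<in> S \<Longrightarrow> hnorm (H (rng G x)) (l a x) \<le> R'"
    using lb by (auto simp: R'_def le_max_iff_disj)
  define M where "M = (\<Sum>a\<in>S. \<Sum>b\<in>S. hnorm K (v a) * (((2 * R' + 1) * (I (st (F a)) * I (F b))) * hnorm K (v b)))"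
  have lower: "- (d * M) \<le> Re (\<Sum>a\<in>S. \<Sum>b\<in>S. hip K (v a) (\<rho> (q a b) (v b)))" if d: "0 < d" "d < 1" for d
  proof -
    \<comment> \<open>Small enough for the total error over all of \<open>S\<close> at a sample
      point to stay below \<open>d / 2\<close>.\<close>
    define d' where "d' = d / (2 * (real (card S) + 1))"
    have d': "0 < d'" using d by (simp add: d'_def add_pos_nonneg)
    have "\<exists>e. e \<in> bs \<and> hdist (H (rng G x)) (l a x) (e (rng G x)) < d'" if "a \<in> S" for a x
      using bounded_dense[OF rng_unit lc[OF that] d', of x] by blast
    then obtain e where e: "\<And>a x. a \<in> S \<Longrightarrow> e a x \<in> bs"
      and ed: "\<And>a x. a \<in> S \<Longrightarrow> hdist (H (rng G x)) (l a x) (e a x (rng G x)) < d'" by metis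
    \<comment> \<open>At the sample point \<open>m\<close> the section \<open>e a m\<close> nearly
      has the value \<open>l a m\<close>; the sum over \<open>a\<close> allows one partition for all
      of them.\<close>
    define D where "D m x = (\<Sum>a\<in>S. hdist (H (rng G x)) (l a x) (e a m (rng G x)))" for m x
    have hdist_c: "continuous_on UNIV (\<lambda>x. hdist (H (rng G x)) (l a x) (e a m (rng G x)))" if a: "a \<in> S" for a m
    proof -
      have eq: "hdist (H (rng G x)) (l a x) (e a m (rng G x)) =
        sqrt ((hnorm (H (rng G x)) (l a x))\<^sup>2 + (hnorm (H (rng G x)) (e a m (rng G x)))\<^sup>2 - 2 * Re (hip (H (rng G x)) (l a x) (e a m (rng G x))))" for x
      proof -
        interpret pre_hilbert "H (rng G x)" by (rule fibre_pre) simp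
        have "e a m (rng G x) \<in> hcar (H (rng G x))" using e[OF a] by (intro bs_closed) auto
        then show ?thesis using norm_sub_sq[OF lc[OF a, of x]] sub_closed[OF lc[OF a, of x]]
          by (simp add: hdist_hsub flip: norm_sub_sq[OF lc[OF a, of x]])
      qed
      have "e a m \<in> \<Gamma>" using e[OF a] by (simp add: bounded_sections_def)
      then have "continuous_on UNIV (\<lambda>x. hnorm (H (rng G x)) (e a m (rng G x)))"
        using continuous_on_compose2[OF continuous_norm continuous_rng] by (simp add: image_subset_iff)
      then show ?thesis unfolding eq using a e by (intro continuous_intros ln le) auto
    qed
    have Dc: "continuous_on UNIV (D m)" for m
      unfolding D_def[abs_def] by (intro continuous_on_sum hdist_c)
    have DD: "D m m < d / 2" for m
    proof -
      have "D m m \<le> (\<Sum>a\<in>S. d')" unfolding D_def using ed by (intro sum_mono less_imp_le)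
      also have "\<dots> = d / 2 * (real (card S) / (real (card S) + 1))" by (simp add: d'_def)
      also have "\<dots> < d / 2 * 1" using d by (intro mult_strict_left_mono) auto
      finally show ?thesis by simp
    qed
    obtain E and p :: "'g \<Rightarrow> 'g \<Rightarrow> real" where E: "finite E" "E \<subseteq> C"
      and pc': "\<forall>y\<in>E. continuous_on UNIV (p y)" and p0': "\<forall>y x. 0 \<le> p y x"
      and p1': "\<forall>x\<in>C. (\<Sum>y\<in>E. p y x) = 1" and pD': "\<forall>y\<in>E. \<forall>x. p y x \<noteq> 0 \<longrightarrow> D y x < d"
      and "\<forall>x x'. (\<forall>y\<in>C. D y x = D y x') \<longrightarrow> (\<forall>y\<in>E. p y x = p y x')"
      using partition_of_unity_on_compact[OF C d(1) Dc DD] by (elim exE conjE) (rule that)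
    note pc = pc'[rule_format] and p0 = p0'[rule_format] and p1 = p1'[rule_format] and pD = pD'[rule_format]
    define A where "A s t = (\<lambda>x. hip (H (rng G x)) (e (fst t) (snd t) (rng G x)) (e (fst s) (snd s) (rng G x)))" for s t
    define \<beta> where "\<beta> s x = complex_of_real (p (snd s) x) * F (fst s) x" for s x
    have \<beta>C: "\<beta> s \<in> Cc" if "s \<in> S \<times> E" for s
      unfolding \<beta>_def[abs_def] using that by (intro Cc_mult F continuous_on_of_real pc) auto
    have Ac: "continuous_on UNIV (A s t)" if "s \<in> S \<times> E" "t \<in> S \<times> E" for s t
      unfolding A_def using that by (intro continuous_ip e) auto
    have ABC: "(\<lambda>x. A s t x * \<beta> t x) \<in> Cc" if "s \<in> S \<times> E" "t \<in> S \<times> E" for s t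
      using that by (intro Cc_mult \<beta>C Ac)
    have pos: "0 \<le> Re (\<Sum>s\<in>S \<times> E. \<Sum>t\<in>S \<times> E. hip K (\<rho> (\<beta> s) (v (fst s))) (\<rho> (\<lambda>x. A s t x * \<beta> t x) (v (fst t))))"
    proof (rule positive_matrix[where H = H and e = "\<lambda>s. e (fst s) (snd s)"])
      show "finite (S \<times> E)" using S E by simp
      show "\<And>s u. s \<in> S \<times> E \<Longrightarrow> u \<in> units G \<Longrightarrow> e (fst s) (snd s) u \<in> hcar (H u)" using e by (auto intro: bs_closed)
    qed (use \<beta>C v Ac in \<open>auto simp: A_def fibre_pre\<close>)
    \<comment> \<open>The kernel \<open>q\<close> with each \<open>l a\<close> replaced by its
      approximation, expanded over pairs of sample points.\<close>
    define Q where "Q a b = (\<lambda>x. \<Sum>r\<in>E \<times> E. (st (\<beta> (a, fst r)) \<star> (\<lambda>x. A (a, fst r) (b, snd r) x * \<beta> (b, snd r) x)) x)" for a b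
    have QC1: "(st (\<beta> (a, fst r)) \<star> (\<lambda>x. A (a, fst r) (b, snd r) x * \<beta> (b, snd r) x)) \<in> Cc" if "a \<in> S" "b \<in> S" "r \<in> E \<times> E" for a b r
      using that by (intro conv_Cc Cc_involution \<beta>C ABC) auto
    have QC: "Q a b \<in> Cc" if "a \<in> S" "b \<in> S" for a b
      unfolding Q_def using that by (intro Cc_sum QC1)
    have "(\<Sum>s\<in>S \<times> E. \<Sum>t\<in>S \<times> E. hip K (\<rho> (\<beta> s) (v (fst s))) (\<rho> (\<lambda>x. A s t x * \<beta> t x) (v (fst t))))
      = (\<Sum>a\<in>S. \<Sum>m\<in>E. \<Sum>b\<in>S. \<Sum>m'\<in>E. hip K (\<rho> (\<beta> (a, m)) (v a)) (\<rho> (\<lambda>x. A (a, m) (b, m') x * \<beta> (b, m') x) (v b)))"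
      by (simp add: sum.cartesian_product' split_def)
    also have "\<dots> = (\<Sum>a\<in>S. \<Sum>b\<in>S. \<Sum>m\<in>E. \<Sum>m'\<in>E. hip K (\<rho> (\<beta> (a, m)) (v a)) (\<rho> (\<lambda>x. A (a, m) (b, m') x * \<beta> (b, m') x) (v b)))"
      by (intro sum.cong refl sum.swap)
    also have "\<dots> = (\<Sum>a\<in>S. \<Sum>b\<in>S. hip K (v a) (\<rho> (Q a b) (v b)))"
    proof (intro sum.cong refl)
      fix a b assume ab: "a \<in> S" "b \<in> S"
      have "hip K (v a) (\<rho> (Q a b) (v b)) = (\<Sum>r\<in>E \<times> E. hip K (v a) (\<rho> (st (\<beta> (a, fst r)) \<star> (\<lambda>x. A (a, fst r) (b, snd r) x * \<beta> (b, snd r) x)) (v b)))"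
        unfolding Q_def using ab v E QC1 by (intro ip_rep_sum) auto
      also have "\<dots> = (\<Sum>r\<in>E \<times> E. hip K (\<rho> (\<beta> (a, fst r)) (v a)) (\<rho> (\<lambda>x. A (a, fst r) (b, snd r) x * \<beta> (b, snd r) x) (v b)))"
        using ab v by (intro sum.cong refl ip_rep_conv \<beta>C ABC) auto
      finally show "(\<Sum>m\<in>E. \<Sum>m'\<in>E. hip K (\<rho> (\<beta> (a, m)) (v a)) (\<rho> (\<lambda>x. A (a, m) (b, m') x * \<beta> (b, m') x) (v b))) = hip K (v a) (\<rho> (Q a b) (v b))"
        by (simp add: sum.cartesian_product split_def)
    qed
    finally have posQ: "0 \<le> Re (\<Sum>a\<in>S. \<Sum>b\<in>S. hip K (v a) (\<rho> (Q a b) (v b)))" using pos by simp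
    have est: "cmod (q a b x - Q a b x) \<le> (d * (2 * R' + 1)) * cmod ((ab (st (F a)) \<star> ab (F b)) x)" if a: "a \<in> S" and b: "b \<in> S" for a b x
    proof -
      let ?u = "rng G x" let ?S = "rfibre G (rng G x)"
      define f where "f y = cnj (F a (ginv G y)) * F b (gmult G (ginv G y) x) * hip (H (src G y)) (l b (gmult G (ginv G y) x)) (l a (ginv G y))" for y
      define h where "h y = (\<Sum>r\<in>E \<times> E. st (\<beta> (a, fst r)) y * (A (a, fst r) (b, snd r) (gmult G (ginv G y) x) * \<beta> (b, snd r) (gmult G (ginv G y) x)))" for y
      have fi: "set_integrable (lam ?u) ?S f" unfolding f_def by (rule qi[OF a b])
      have hi: "set_integrable (lam ?u) ?S h" and hQ: "(LINT y:?S|lam ?u. h y) = Q a b x"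
      proof -
        have i: "set_integrable (lam ?u) ?S (\<lambda>y. st (\<beta> (a, fst r)) y * (A (a, fst r) (b, snd r) (gmult G (ginv G y) x) * \<beta> (b, snd r) (gmult G (ginv G y) x)))"
          if "r \<in> E \<times> E" for r
          using that a b by (intro conv_integrable Cc_involution \<beta>C ABC) auto
        have fE: "finite (E \<times> E)" using E by simp
        show "set_integrable (lam ?u) ?S h" unfolding h_def by (rule set_integral_sum(1)[OF fE i])
        show "(LINT y:?S|lam ?u. h y) = Q a b x" unfolding h_def Q_def convol_def by (rule set_integral_sum(2)[OF fE i])
      qed
      have "q a b x - Q a b x = (LINT y:?S|lam ?u. f y - h y)"
        unfolding hQ[symmetric] qe[OF a b] f_def[symmetric] using fi hi by (rule set_integral_diff(2)[symmetric])
      also have "cmod \<dots> \<le> (LINT y:?S|lam ?u. (d * (2 * R' + 1)) * cmod (st (F a) y * F b (gmult G (ginv G y) x)))"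
      proof (rule set_integral_norm_bound)
        show "set_integrable (lam ?u) ?S (\<lambda>y. f y - h y)" using fi hi by (rule set_integral_diff(1))
        have "set_integrable (lam ?u) ?S (\<lambda>y. st (F a) y * F b (gmult G (ginv G y) x))"
          using a b by (intro conv_integrable Cc_involution F)
        then have "set_integrable (lam ?u) ?S (\<lambda>y. cmod (st (F a) y * F b (gmult G (ginv G y) x)))"
          using integrable_norm unfolding set_integrable_def by fastforce
        then show "set_integrable (lam ?u) ?S (\<lambda>y. (d * (2 * R' + 1)) * cmod (st (F a) y * F b (gmult G (ginv G y) x)))"
          by (rule set_integrable_mult_right)
        fix y assume y: "rng G y = ?u"
        define w z u where "w = ginv G y" and "z = gmult G (ginv G y) x" and "u = src G y"
        have zw: "gmult G w x = z" by (simp add: w_def z_def)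
        have wz: "rng G w = u" "rng G z = u" using y by (auto simp: w_def z_def u_def grp)
        interpret Hu: pre_hilbert "H u" by (rule fibre_pre) (simp add: u_def)
        have lz: "l b z \<in> hcar (H u)" and lw: "l a w \<in> hcar (H u)" using lc[OF b, of z] lc[OF a, of w] wz by auto
        have ec: "c \<in> S \<Longrightarrow> e c m u \<in> hcar (H u)" for c m using e by (intro bs_closed) (auto simp: u_def)
        have fy: "f y = cnj (F a w) * F b z * hip (H u) (l b z) (l a w)" by (simp add: f_def w_def z_def u_def)
        have hy: "h y = cnj (F a w) * F b z * (\<Sum>r\<in>E \<times> E. complex_of_real (p (fst r) w * p (snd r) z) * hip (H u) (e b (snd r) u) (e a (fst r) u))"
          unfolding h_def sum_distrib_left using wz
          by (intro sum.cong refl) (simp add: involution_def A_def \<beta>_def zw flip: w_def)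
        have key: "cmod (hip (H u) (l b z) (l a w) - (\<Sum>r\<in>E \<times> E. complex_of_real (p (fst r) w * p (snd r) z) * hip (H u) (e b (snd r) u) (e a (fst r) u))) \<le> d * (2 * R' + 1)"
          if wC: "w \<in> C" and zC: "z \<in> C"
        proof -
          \<comment> \<open>Products of weights at \<open>w\<close> and at \<open>z\<close> again
            sum to 1, so the approximation is a convex combination of nearby inner products.\<close>
          have one: "(\<Sum>r\<in>E \<times> E. p (fst r) w * p (snd r) z) = 1"
          proof -
            have "(\<Sum>r\<in>E \<times> E. p (fst r) w * p (snd r) z) = (\<Sum>m\<in>E. p m w) * (\<Sum>m\<in>E. p m z)"
              by (simp add: sum_product sum.cartesian_product split_def)
            then show ?thesis using p1[OF wC] p1[OF zC] by simp
          qed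
          have "hip (H u) (l b z) (l a w) = complex_of_real (\<Sum>r\<in>E \<times> E. p (fst r) w * p (snd r) z) * hip (H u) (l b z) (l a w)" unfolding one by simp
          then have "hip (H u) (l b z) (l a w) - (\<Sum>r\<in>E \<times> E. complex_of_real (p (fst r) w * p (snd r) z) * hip (H u) (e b (snd r) u) (e a (fst r) u))
            = (\<Sum>r\<in>E \<times> E. complex_of_real (p (fst r) w * p (snd r) z) * (hip (H u) (l b z) (l a w) - hip (H u) (e b (snd r) u) (e a (fst r) u)))"
            by (simp only: of_real_sum sum_distrib_right right_diff_distrib sum_subtractf)
          also have "cmod \<dots> \<le> (\<Sum>r\<in>E \<times> E. p (fst r) w * p (snd r) z * (d * (2 * R' + 1)))"
          proof (rule sum_norm_le)
            fix r assume r: "r \<in> E \<times> E"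
            show "cmod (complex_of_real (p (fst r) w * p (snd r) z) * (hip (H u) (l b z) (l a w) - hip (H u) (e b (snd r) u) (e a (fst r) u))) \<le> p (fst r) w * p (snd r) z * (d * (2 * R' + 1))"
            proof (cases "p (fst r) w * p (snd r) z = 0")
              case False
              have single: "hdist (H (rng G x)) (l c x) (e c m (rng G x)) < d" if "D m x < d" "c \<in> S" for c m x
              proof -
                interpret pre_hilbert "H (rng G x)" by (rule fibre_pre) simp
                have "hdist (H (rng G x)) (l c x) (e c m (rng G x)) \<le> D m x"
                  unfolding D_def
                proof (rule member_le_sum[of c S "\<lambda>a. hdist (H (rng G x)) (l a x) (e a m (rng G x))"])
                  show "0 \<le> hdist (H (rng G x)) (l a x) (e a m (rng G x))" if "a \<in> S - {c}" for a
                    using that by (intro dist_nonneg lc bs_closed e) auto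
                qed (use that S in auto)
                then show ?thesis using that by simp
              qed
              have "D (fst r) w < d" "D (snd r) z < d" using False r by (auto intro!: pD)
              then have dw: "hdist (H u) (l a w) (e a (fst r) u) < d" and dz: "hdist (H u) (l b z) (e b (snd r) u) < d"
                using single[of "fst r" w a] single[of "snd r" z b] a b wz by auto
              have ez: "hnorm (H u) (e b (snd r) u) \<le> R' + d"
                using Hu.norm_diff_le_dist[OF lz ec[OF b, of "snd r"]] dz lb'[OF b, of z] wz by auto
              have "cmod (hip (H u) (l b z) (l a w) - hip (H u) (e b (snd r) u) (e a (fst r) u))
                 \<le> hdist (H u) (l b z) (e b (snd r) u) * hnorm (H u) (l a w) + hnorm (H u) (e b (snd r) u) * hdist (H u) (l a w) (e a (fst r) u)"
                using lz lw ec a b by (intro Hu.ip_diff_le_dist)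
              also have "\<dots> \<le> d * R' + (R' + d) * d"
                using dw dz ez lb'[OF a, of w] wz lz lw ec a b R' d by (intro add_mono mult_mono) auto
              \<comment> \<open>Here \<open>d < 1\<close> absorbs the quadratic term in
                \<open>d\<close>.\<close>
              also have "\<dots> \<le> d * (2 * R' + 1)"
                using d mult_left_mono[of d 1 d] by (simp add: algebra_simps)
              finally show ?thesis
                using p0[of "fst r" w] p0[of "snd r" z] by (simp add: norm_mult abs_mult mult_left_mono)
            qed auto
          qed
          also have "\<dots> = d * (2 * R' + 1)" using one by (simp flip: sum_distrib_right)
          finally show ?thesis .
        qed
        have "f y - h y = cnj (F a w) * F b z * (hip (H u) (l b z) (l a w) - (\<Sum>r\<in>E \<times> E. complex_of_real (p (fst r) w * p (snd r) z) * hip (H u) (e b (snd r) u) (e a (fst r) u)))"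
          unfolding fy hy by (simp only: right_diff_distrib)
        then have eqn: "cmod (f y - h y) = cmod (F a w) * cmod (F b z) * cmod (hip (H u) (l b z) (l a w) - (\<Sum>r\<in>E \<times> E. complex_of_real (p (fst r) w * p (snd r) z) * hip (H u) (e b (snd r) u) (e a (fst r) u)))"
          by (simp only: norm_mult complex_mod_cnj)
        have "cmod (f y - h y) \<le> cmod (F a w) * cmod (F b z) * (d * (2 * R' + 1))"
        proof (cases "w \<in> C \<and> z \<in> C")
          case True
          then show ?thesis unfolding eqn using key by (intro mult_left_mono) auto
        next
          case False
          then have "F a w = 0 \<or> F b z = 0" using F0 a b by blast
          then show ?thesis unfolding eqn by auto
        qed
        also have "\<dots> = (d * (2 * R' + 1)) * cmod (st (F a) y * F b (gmult G (ginv G y) x))"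
          by (simp add: involution_def norm_mult w_def z_def)
        finally show "cmod (f y - h y) \<le> (d * (2 * R' + 1)) * cmod (st (F a) y * F b (gmult G (ginv G y) x))" .
      qed simp
      also have "\<dots> = (d * (2 * R' + 1)) * (LINT y:?S|lam ?u. cmod (st (F a) y * F b (gmult G (ginv G y) x)))" by simp
      also have "\<dots> \<le> (d * (2 * R' + 1)) * cmod ((ab (st (F a)) \<star> ab (F b)) x)"
        unfolding conv_ab_real[OF Cc_involution[OF F[OF a]] F[OF b]] norm_of_real using d R' by (intro mult_left_mono abs_ge_self) auto
      finally show ?thesis .
    qed
    have Iab: "I (ab f) \<le> I f" if "f \<in> Cc" for f using I_mono[OF Cc_cmod[OF that] that, of 1] by simp
    have "cmod ((\<Sum>a\<in>S. \<Sum>b\<in>S. hip K (v a) (\<rho> (q a b) (v b))) - (\<Sum>a\<in>S. \<Sum>b\<in>S. hip K (v a) (\<rho> (Q a b) (v b))))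
      = cmod (\<Sum>a\<in>S. \<Sum>b\<in>S. hip K (v a) (\<rho> (\<lambda>x. q a b x - Q a b x) (v b)))"
      using qC QC v by (simp add: ip_rep_diff sum_subtractf)
    also have "\<dots> \<le> d * M"
      unfolding M_def sum_distrib_left
    proof (intro sum_norm_le)
      fix a b assume a: "a \<in> S" and b: "b \<in> S"
      have "I (\<lambda>x. q a b x - Q a b x) \<le> (d * (2 * R' + 1)) * I (ab (st (F a)) \<star> ab (F b))"
        using a b d R' by (intro I_mono Cc_diff qC QC conv_Cc Cc_cmod Cc_involution F est) auto
      also have "I (ab (st (F a)) \<star> ab (F b)) \<le> I (ab (st (F a))) * I (ab (F b))"
        using a b by (intro I_conv_le Cc_cmod Cc_involution F)
      also have "\<dots> \<le> I (st (F a)) * I (F b)"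
        using a b by (intro mult_mono Iab Cc_involution F I_nonneg Cc_cmod)
      finally have Iq: "I (\<lambda>x. q a b x - Q a b x) \<le> (d * (2 * R' + 1)) * (I (st (F a)) * I (F b))" using d R' by (simp add: mult_left_mono)
      have "cmod (hip K (v a) (\<rho> (\<lambda>x. q a b x - Q a b x) (v b))) \<le> hnorm K (v a) * (I (\<lambda>x. q a b x - Q a b x) * hnorm K (v b))"
        using a b v qC QC by (intro ip_rep_bound Cc_diff) auto
      also have "\<dots> \<le> hnorm K (v a) * (((d * (2 * R' + 1)) * (I (st (F a)) * I (F b))) * hnorm K (v b))"
        using Iq a b v by (intro mult_left_mono mult_right_mono) auto
      also have "\<dots> = d * (hnorm K (v a) * ((2 * R' + 1) * (I (st (F a)) * I (F b)) * hnorm K (v b)))" by (simp only: ac_simps)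
      finally show "cmod (hip K (v a) (\<rho> (\<lambda>x. q a b x - Q a b x) (v b))) \<le> d * (hnorm K (v a) * ((2 * R' + 1) * (I (st (F a)) * I (F b)) * hnorm K (v b)))" .
    qed
    finally have "Re ((\<Sum>a\<in>S. \<Sum>b\<in>S. hip K (v a) (\<rho> (Q a b) (v b))) - (\<Sum>a\<in>S. \<Sum>b\<in>S. hip K (v a) (\<rho> (q a b) (v b)))) \<le> d * M"
      by (intro order_trans[OF complex_Re_le_cmod]) (simp only: norm_minus_commute)
    then show ?thesis using posQ by simp
  qed
  have M0: "0 \<le> M" unfolding M_def using F v R'
    by (intro sum_nonneg mult_nonneg_nonneg I_nonneg Cc_involution K.norm_nonneg) auto
  show ?thesis
  proof (rule field_le_epsilon)
    fix e :: real assume e: "0 < e"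
    \<comment> \<open>The cap \<open>1 / 2\<close> meets the requirement \<open>d < 1\<close> of
      \<open>lower\<close>.\<close>
    define d where "d = min (1 / 2) (e / (M + 1))"
    have "d * M \<le> e / (M + 1) * M" unfolding d_def using M0 by (intro mult_right_mono) auto
    also have "\<dots> \<le> e" using M0 e by (simp add: field_simps)
    finally have "d * M \<le> e" .
    moreover have "0 < d" "d < 1" using e M0 by (auto simp: d_def)
    ultimately show "0 \<le> Re (\<Sum>a\<in>S. \<Sum>b\<in>S. hip K (v a) (\<rho> (q a b) (v b))) + e" using lower[of d] by simp
  qed
qed

end

section \<open>The GNS construction on the unitization\<close>

text \<open>After division by \<open>m\<close> the hypothesis says that squaring
  \<open>b k / m\<close> stays below \<open>b (Suc k) / m\<close>. If \<open>t = b 0 / (m r)\<close>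
  exceeded 1, its powers with exponents \<open>2 ^ k\<close> would be unbounded but also at most
  \<open>C / m\<close>.\<close>

lemma squaring_bound:
  fixes b :: "nat \<Rightarrow> real"
  assumes m: "0 \<le> m" and r: "0 \<le> r" and b0: "\<And>k. 0 \<le> b k"
    and sq: "\<And>k. (b k)\<^sup>2 \<le> m * b (Suc k)" and bd: "\<And>k. b k \<le> C * r ^ (2 ^ k)"
  shows "b 0 \<le> m * r"
proof (cases "m = 0")
  case True
  then show ?thesis using sq[of 0] by simp
next
  case False
  then have m: "0 < m" using m by simp
  have pw: "(b 0 / m) ^ (2 ^ k) \<le> b k / m" for k
  proof (induction k)
    case (Suc k)
    have "(b 0 / m) ^ (2 ^ Suc k) = ((b 0 / m) ^ (2 ^ k))\<^sup>2" by (simp add: power_mult[symmetric] mult.commute)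
    also have "\<dots> \<le> (b k / m)\<^sup>2" using Suc b0 m by (intro power_mono) auto
    also have "\<dots> \<le> b (Suc k) / m" using sq[of k] m by (simp add: power_divide power2_eq_square field_simps)
    finally show ?case .
  qed simp
  have "b 0 / m \<le> r"
  proof (rule ccontr)
    assume c: "\<not> b 0 / m \<le> r"
    show False
    proof (cases "r = 0")
      case True
      have "b 1 \<le> 0" using bd[of 1] True by simp
      then have "(b 0)\<^sup>2 \<le> 0" using sq[of 0] b0[of 1] by simp
      then show False using c True by simp
    next
      case False
      then have r: "0 < r" using r by simp
      define t where "t = b 0 / m / r"
      have t: "1 < t" using c r divide_strict_right_mono[of r "b 0 / m" r] by (simp add: t_def)
      have up: "t ^ n \<le> C / m" if "n = 2 ^ k" for n k
      proof -
        have "(b 0 / m) ^ n \<le> C * r ^ n / m" using pw[of k] bd[of k] m that by (smt (verit) divide_right_mono)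
        then show ?thesis using r m by (simp add: t_def power_divide field_simps)
      qed
      obtain n where n: "C / m < t ^ n" using real_arch_pow[OF t] by blast
      have "t ^ n \<le> t ^ (2 ^ n)" using t by (intro power_increasing) (auto simp: less_imp_le)
      then show False using n up[of "2 ^ n" n] by simp
    qed
  qed
  then show ?thesis using m by (simp add: field_simps)
qed

section \<open>The unitization: a pair is a scalar multiple of the unit plus a function\<close>

type_synonym 'g uel = "complex \<times> ('g \<Rightarrow> complex)"

definition ucar :: "'g::topological_space uel set" where
  "ucar = {x. snd x \<in> Cc}"

definition uadd :: "'g uel \<Rightarrow> 'g uel \<Rightarrow> 'g uel" where
  "uadd x y = (fst x + fst y, \<lambda>z. snd x z + snd y z)"

definition uscale :: "complex \<Rightarrow> 'g uel \<Rightarrow> 'g uel" where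
  "uscale c x = (c * fst x, \<lambda>z. c * snd x z)"

lemma ucar_add: "\<lbrakk>x \<in> ucar; y \<in> ucar\<rbrakk> \<Longrightarrow> uadd x y \<in> (ucar :: 'g::t2_space uel set)"
  and ucar_scale: "x \<in> ucar \<Longrightarrow> uscale c x \<in> (ucar :: 'g::t2_space uel set)"
  by (simp_all add: ucar_def uadd_def uscale_def Cc_add Cc_scale)

context haar_groupoid
begin

definition umul :: "'g uel \<Rightarrow> 'g uel \<Rightarrow> 'g uel" where
  "umul x y = (fst x * fst y, \<lambda>z. fst x * snd y z + fst y * snd x z + (snd x \<star> snd y) z)"

definition ustar :: "'g uel \<Rightarrow> 'g uel" where
  "ustar x = (cnj (fst x), st (snd x))"

lemma ucar_mul: "\<lbrakk>x \<in> ucar; y \<in> ucar\<rbrakk> \<Longrightarrow> umul x y \<in> ucar"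
  by (simp add: ucar_def umul_def Cc_add Cc_scale conv_Cc)

lemma ucar_star: "x \<in> ucar \<Longrightarrow> ustar x \<in> ucar"
  by (simp add: ucar_def ustar_def Cc_involution)

lemma umul_add_right: "\<lbrakk>x \<in> ucar; y \<in> ucar; z \<in> ucar\<rbrakk> \<Longrightarrow> umul x (uadd y z) = uadd (umul x y) (umul x z)"
  by (simp add: ucar_def umul_def uadd_def conv_add_right fun_eq_iff algebra_simps)

lemma umul_scale_right: "umul x (uscale c y) = uscale c (umul x y)"
  by (simp add: umul_def uscale_def conv_scale_right fun_eq_iff algebra_simps)

lemma ustar_ustar: "ustar (ustar x) = x"
  by (simp add: ustar_def st_st)

lemma ustar_umul: "\<lbrakk>x \<in> ucar; y \<in> ucar\<rbrakk> \<Longrightarrow> ustar (umul x y) = umul (ustar y) (ustar x)"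
  by (simp add: ucar_def ustar_def umul_def st_add st_scale st_conv fun_eq_iff algebra_simps)

lemma umul_assoc:
  assumes "x \<in> ucar" "y \<in> ucar" "z \<in> ucar"
  shows "umul (umul x y) z = umul x (umul y z)"
proof -
  obtain a f b g c h where xyz: "x = (a, f)" "y = (b, g)" "z = (c, h)" by (metis surj_pair)
  have C: "f \<in> Cc" "g \<in> Cc" "h \<in> Cc" using assms by (auto simp: ucar_def xyz)
  note Cs = C Cc_scale[OF C(1)] Cc_scale[OF C(2)] Cc_scale[OF C(3)] conv_Cc[OF C(1,2)] conv_Cc[OF C(2,3)]
  have "(\<lambda>z. a * g z + b * f z + (f \<star> g) z) \<star> h = (\<lambda>z. a * (g \<star> h) z + b * (f \<star> h) z + ((f \<star> g) \<star> h) z)"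
    using Cs by (simp add: conv_add_left conv_scale_left Cc_add)
  moreover have "f \<star> (\<lambda>z. b * h z + c * g z + (g \<star> h) z) = (\<lambda>z. b * (f \<star> h) z + c * (f \<star> g) z + (f \<star> (g \<star> h)) z)"
    using Cs by (simp add: conv_add_right conv_scale_right Cc_add)
  ultimately show ?thesis
    using C by (simp add: umul_def xyz conv_assoc fun_eq_iff algebra_simps)
qed

definition unorm :: "'g uel \<Rightarrow> real" where
  "unorm x = cmod (fst x) + I (snd x)"

lemma unorm_nonneg: "x \<in> ucar \<Longrightarrow> 0 \<le> unorm x"
  by (simp add: unorm_def ucar_def I_nonneg)

text \<open>The functions form an ideal in the unitization; the estimate is what allows
  \<open>\<theta>\<close> to be bounded on this ideal only.\<close>

lemma umul_ideal_right:
  assumes x: "x \<in> ucar" and f: "f \<in> Cc"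
  obtains h where "umul x (0, f) = (0, h)" "h \<in> Cc" "I h \<le> unorm x * I f"
proof
  have xC: "snd x \<in> Cc" using x by (simp add: ucar_def)
  define h where "h z = fst x * f z + (snd x \<star> f) z" for z
  show "umul x (0, f) = (0, h)" by (simp add: umul_def h_def fun_eq_iff)
  show "h \<in> Cc" unfolding h_def[abs_def] using xC f by (intro Cc_add Cc_scale conv_Cc)
  have "I h \<le> I (\<lambda>z. fst x * f z) + I (snd x \<star> f)"
    unfolding h_def[abs_def] using xC f by (intro I_add Cc_scale conv_Cc)
  also have "\<dots> \<le> cmod (fst x) * I f + I (snd x) * I f"
    using xC f by (intro add_mono I_scale I_conv_le)
  finally show "I h \<le> unorm x * I f" by (simp add: unorm_def algebra_simps)
qed

lemma umul_ideal_left: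
  assumes x: "x \<in> ucar" and f: "f \<in> Cc"
  obtains h where "umul (0, f) x = (0, h)" "h \<in> Cc" "I h \<le> I f * unorm x"
proof
  have xC: "snd x \<in> Cc" using x by (simp add: ucar_def)
  define h where "h z = fst x * f z + (f \<star> snd x) z" for z
  show "umul (0, f) x = (0, h)" by (simp add: umul_def h_def fun_eq_iff)
  show "h \<in> Cc" unfolding h_def[abs_def] using xC f by (intro Cc_add Cc_scale conv_Cc)
  have "I h \<le> I (\<lambda>z. fst x * f z) + I (f \<star> snd x)"
    unfolding h_def[abs_def] using xC f by (intro I_add Cc_scale conv_Cc)
  also have "\<dots> \<le> cmod (fst x) * I f + I f * I (snd x)"
    using xC f by (intro add_mono I_scale I_conv_le)
  finally show "I h \<le> I f * unorm x" by (simp add: unorm_def algebra_simps)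
qed

lemma conv_zero_left: "(\<lambda>x. 0) \<star> g = (\<lambda>x. 0)"
  by (simp add: convol_def fun_eq_iff)

end

text \<open>\<open>\<theta> a b x\<close> is meant to become the inner product of
  \<open>\<omega> a\<close> with \<open>x\<close> applied to \<open>\<omega> b\<close>. Several
  vectors are treated together because their mutual inner products are needed in one space. The
  constants \<open>B0\<close> do not enter the final estimates, and countability of the index type
  serves \<open>encode\<close>.\<close>

locale gns = haar_groupoid G lam
  for G :: "'g::{t2_space, second_countable_topology} groupoid" and lam :: "'g \<Rightarrow> 'g measure" +
  fixes S :: "'i::countable set" and \<theta> :: "'i \<Rightarrow> 'i \<Rightarrow> 'g uel \<Rightarrow> complex" and B0 :: "'i \<Rightarrow> 'i \<Rightarrow> real"
  assumes S: "finite S"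
    and \<theta>_add: "\<lbrakk>x \<in> ucar; y \<in> ucar\<rbrakk> \<Longrightarrow> \<theta> a b (uadd x y) = \<theta> a b x + \<theta> a b y"
    and \<theta>_scale: "x \<in> ucar \<Longrightarrow> \<theta> a b (uscale c x) = c * \<theta> a b x"
    and \<theta>_star: "x \<in> ucar \<Longrightarrow> \<theta> a b (ustar x) = cnj (\<theta> b a x)"
    and \<theta>_bound: "f \<in> Cc \<Longrightarrow> cmod (\<theta> a b (0, f)) \<le> B0 a b * I f"
    and \<theta>_positive: "(\<And>a. p a \<in> ucar) \<Longrightarrow> 0 \<le> Re (\<Sum>a\<in>S. \<Sum>b\<in>S. \<theta> a b (umul (ustar (p a)) (p b)))"
begin

text \<open>A family \<open>p\<close> stands for the sum over \<open>S\<close> of \<open>p a\<close>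
  applied to \<open>\<omega> a\<close>. Coordinates outside \<open>S\<close> do not affect the form,
  and null vectors are only identified in the completion.\<close>

definition Q :: "('i \<Rightarrow> 'g uel) hilbert" where
  "Q = \<lparr>hcar = {p. \<forall>a. p a \<in> ucar}, hzero = (\<lambda>a. (0, \<lambda>x. 0)), hadd = (\<lambda>p q a. uadd (p a) (q a)),
     hscale = (\<lambda>c p a. uscale c (p a)), hip = (\<lambda>p q. \<Sum>a\<in>S. \<Sum>b\<in>S. \<theta> a b (umul (ustar (p a)) (q b)))\<rparr>"

lemma Q_simps: "p \<in> hcar Q \<longleftrightarrow> (\<forall>a. p a \<in> ucar)" "hzero Q = (\<lambda>a. (0, \<lambda>x. 0))" "hadd Q p q = (\<lambda>a. uadd (p a) (q a))"
  "hscale Q c p = (\<lambda>a. uscale c (p a))" "hip Q p q = (\<Sum>a\<in>S. \<Sum>b\<in>S. \<theta> a b (umul (ustar (p a)) (q b)))"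
  by (simp_all add: Q_def)

lemma ip_Q_commute:
  assumes "p \<in> hcar Q" "q \<in> hcar Q"
  shows "hip Q p q = cnj (hip Q q p)"
proof -
  have "cnj (hip Q q p) = (\<Sum>b\<in>S. \<Sum>a\<in>S. cnj (\<theta> b a (umul (ustar (q b)) (p a))))"
    by (simp add: Q_simps)
  also have "\<dots> = (\<Sum>b\<in>S. \<Sum>a\<in>S. \<theta> a b (umul (ustar (p a)) (q b)))"
    using assms by (intro sum.cong refl) (simp add: Q_simps ucar_mul ucar_star ustar_umul ustar_ustar flip: \<theta>_star)
  also have "\<dots> = hip Q p q" unfolding Q_simps by (rule sum.swap)
  finally show ?thesis by simp
qed

lemma pre_hilbert_Q: "pre_hilbert Q"
proof
  show "hzero Q \<in> hcar Q" by (simp add: Q_simps ucar_def Cc_zero)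
  fix p q r :: "'i \<Rightarrow> 'g uel" and c d :: complex
  assume p: "p \<in> hcar Q"
  show "hscale Q c p \<in> hcar Q" using p by (simp add: Q_simps ucar_scale)
  show "hadd Q p (hzero Q) = p" "hadd Q p (hscale Q (- 1) p) = hzero Q" "hscale Q 1 p = p"
    "hscale Q c (hscale Q d p) = hscale Q (c * d) p" "hscale Q (c + d) p = hadd Q (hscale Q c p) (hscale Q d p)"
    by (simp_all add: Q_simps uadd_def uscale_def algebra_simps)
  show "0 \<le> Re (hip Q p p)" unfolding Q_simps by (rule \<theta>_positive) (use p in \<open>simp add: Q_simps\<close>)
  assume q: "q \<in> hcar Q"
  show "hadd Q p q \<in> hcar Q" using p q by (simp add: Q_simps ucar_add)
  show "hadd Q p q = hadd Q q p" "hscale Q c (hadd Q p q) = hadd Q (hscale Q c p) (hscale Q c q)"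
    by (simp_all add: Q_simps uadd_def uscale_def algebra_simps)
  show "hip Q p q = cnj (hip Q q p)" using p q by (rule ip_Q_commute)
  show "hip Q p (hscale Q c q) = c * hip Q p q"
    using p q by (simp add: Q_simps umul_scale_right \<theta>_scale ucar_mul ucar_star sum_distrib_left)
  assume r: "r \<in> hcar Q"
  show "hadd Q (hadd Q p q) r = hadd Q p (hadd Q q r)" by (simp add: Q_simps uadd_def algebra_simps)
  show "hip Q p (hadd Q q r) = hip Q p q + hip Q p r"
    using p q r by (simp add: Q_simps umul_add_right \<theta>_add ucar_mul ucar_star sum.distrib)
qed

sublocale Q: pre_hilbert Q by (rule pre_hilbert_Q)

definition act :: "('g \<Rightarrow> complex) \<Rightarrow> ('i \<Rightarrow> 'g uel) \<Rightarrow> 'i \<Rightarrow> 'g uel" where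
  "act f p = (\<lambda>a. umul (0, f) (p a))"

lemma ucar_Cc: "f \<in> Cc \<Longrightarrow> (0, f) \<in> ucar"
  by (simp add: ucar_def)

lemma act_linear: "f \<in> Cc \<Longrightarrow> hlinear Q Q (act f)"
  unfolding hlinear_def by (auto simp: Q_simps act_def ucar_mul ucar_Cc umul_add_right umul_scale_right)

lemma act_closed: "\<lbrakk>f \<in> Cc; p \<in> hcar Q\<rbrakk> \<Longrightarrow> act f p \<in> hcar Q"
  by (simp add: Q_simps act_def ucar_mul ucar_Cc)

lemma act_conv: "\<lbrakk>f \<in> Cc; g \<in> Cc; p \<in> hcar Q\<rbrakk> \<Longrightarrow> act (f \<star> g) p = act f (act g p)"
proof -
  assume a: "f \<in> Cc" "g \<in> Cc" "p \<in> hcar Q"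
  have "umul (0, f) (0, g) = (0, f \<star> g)" by (simp add: umul_def)
  then show ?thesis using a umul_assoc[OF ucar_Cc[OF a(1)] ucar_Cc[OF a(2)]] by (simp add: act_def Q_simps)
qed

lemma act_adj:
  assumes f: "f \<in> Cc" and p: "p \<in> hcar Q" and q: "q \<in> hcar Q"
  shows "hip Q (act f p) q = hip Q p (act (st f) q)"
proof -
  have "ustar (0, f) = (0, st f)" by (simp add: ustar_def)
  then show ?thesis using p q ucar_Cc[OF f] ucar_Cc[OF Cc_involution[OF f]]
    by (simp add: Q_simps act_def ustar_umul umul_assoc ucar_star)
qed

text \<open>Multiplying \<open>f\<close> from both sides by coordinates of \<open>p\<close> stays in
  the ideal of functions, so the bounds on \<open>\<theta>\<close> apply. The constant is crude and
  depends on \<open>p\<close>.\<close>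

lemma act_ip_bound:
  assumes p: "p \<in> hcar Q"
  obtains C where "0 \<le> C" "\<And>f. f \<in> Cc \<Longrightarrow> cmod (hip Q p (act f p)) \<le> C * I f"
proof
  let ?C = "\<Sum>a\<in>S. \<Sum>b\<in>S. \<bar>B0 a b\<bar> * (unorm (ustar (p a)) * unorm (p b))"
  show "0 \<le> ?C" using p by (intro sum_nonneg mult_nonneg_nonneg unorm_nonneg ucar_star) (auto simp: Q_simps)
  fix f assume f: "f \<in> (Cc :: ('g \<Rightarrow> complex) set)"
  show "cmod (hip Q p (act f p)) \<le> ?C * I f"
    unfolding Q_simps(5) sum_distrib_right
  proof (intro sum_norm_le)
    fix a b
    have pc: "p c \<in> ucar" for c using p by (simp add: Q_simps)
    obtain h where h: "umul (0, f) (p b) = (0, h)" "h \<in> Cc" "I h \<le> I f * unorm (p b)"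
      using umul_ideal_left[OF pc f] by blast
    obtain k where k: "umul (ustar (p a)) (0, h) = (0, k)" "k \<in> Cc" "I k \<le> unorm (ustar (p a)) * I h"
      using umul_ideal_right[OF ucar_star[OF pc] h(2)] by blast
    have "cmod (\<theta> a b (umul (ustar (p a)) (act f p b))) \<le> B0 a b * I k"
      using \<theta>_bound[OF k(2), of a b] by (simp add: act_def h(1) k(1))
    also have "\<dots> \<le> \<bar>B0 a b\<bar> * I k" using I_nonneg[OF k(2)] by (simp add: mult_right_mono)
    also have "\<dots> \<le> \<bar>B0 a b\<bar> * (unorm (ustar (p a)) * (I f * unorm (p b)))"
      using h(3) k(3) unorm_nonneg[OF ucar_star[OF pc[of a]]]
      by (intro mult_left_mono order_trans[OF k(3)]) auto
    finally show "cmod (\<theta> a b (umul (ustar (p a)) (act f p b))) \<le> \<bar>B0 a b\<bar> * (unorm (ustar (p a)) * unorm (p b)) * I f"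
      by (simp add: ac_simps)
  qed
qed

primrec iter :: "('g \<Rightarrow> complex) \<Rightarrow> nat \<Rightarrow> 'g \<Rightarrow> complex" where
  "iter f 0 = st f \<star> f"
| "iter f (Suc k) = iter f k \<star> iter f k"

lemma iter_Cc: "f \<in> Cc \<Longrightarrow> iter f k \<in> Cc"
  by (induction k) (auto intro: conv_Cc Cc_involution)

lemma iter_st: "f \<in> Cc \<Longrightarrow> st (iter f k) = iter f k"
  by (induction k) (auto simp: st_conv Cc_involution st_st iter_Cc)

lemma iter_I: "f \<in> Cc \<Longrightarrow> I (iter f k) \<le> (I f * I f) ^ (2 ^ k)"
proof (induction k)
  case 0
  then show ?case using I_conv_le[OF Cc_involution[OF 0] 0] by (simp add: I_st)
next
  case (Suc k)
  have "I (iter f (Suc k)) \<le> I (iter f k) * I (iter f k)" using Suc.prems by (simp add: I_conv_le iter_Cc)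
  also have "\<dots> \<le> (I f * I f) ^ (2 ^ k) * (I f * I f) ^ (2 ^ k)"
    using Suc by (intro mult_mono I_nonneg iter_Cc) (auto simp: I_nonneg)
  also have "\<dots> = (I f * I f) ^ (2 ^ Suc k)" by (simp add: mult_2 flip: power_add)
  finally show ?case .
qed

text \<open>
  With \<open>h\<^sub>0 = f\<^sup>* \<star> f\<close> and \<open>h\<^bsub>k+1\<^esub> = h\<^sub>k \<star> h\<^sub>k\<close>, Cauchy--Schwarz gives
  \<open>\<langle>p, h\<^sub>k p\<rangle>\<^sup>2 \<le> \<parallel>p\<parallel>\<^sup>2 \<langle>p, h\<^bsub>k+1\<^esub> p\<rangle>\<close>. The \<open>I\<close>-norm only has to control \<open>\<langle>p, h\<^sub>k p\<rangle>\<close> up to a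
  constant depending on \<open>p\<close>, which disappears on taking \<open>2\<^sup>k\<close>-th roots.
\<close>

lemma act_bound:
  assumes f: "f \<in> Cc" and p: "p \<in> hcar Q"
  shows "hnorm Q (act f p) \<le> I f * hnorm Q p"
proof -
  define b where "b k = cmod (hip Q p (act (iter f k) p))" for k
  obtain C where C: "0 \<le> C" "\<And>g. g \<in> Cc \<Longrightarrow> cmod (hip Q p (act g p)) \<le> C * I g" using act_ip_bound[OF p] by blast
  note it = iter_Cc[OF f]
  have "b 0 \<le> (hnorm Q p)\<^sup>2 * (I f * I f)"
  proof (rule squaring_bound[where C = C])
    show "0 \<le> b k" for k by (simp add: b_def)
    fix k
    have ap: "act (iter f k) p \<in> hcar Q" by (rule act_closed[OF it p])
    have eq: "hip Q p (act (iter f (Suc k)) p) = complex_of_real ((hnorm Q (act (iter f k) p))\<^sup>2)"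
      using act_adj[OF it p ap, of k] by (simp add: act_conv it p iter_st f Q.ip_self[OF ap])
    have "b k \<le> hnorm Q p * hnorm Q (act (iter f k) p)" unfolding b_def by (rule Q.cauchy_schwarz[OF p ap])
    then have "(b k)\<^sup>2 \<le> (hnorm Q p * hnorm Q (act (iter f k) p))\<^sup>2" by (intro power_mono) (auto simp: b_def)
    also have "\<dots> = (hnorm Q p)\<^sup>2 * b (Suc k)" unfolding b_def eq norm_of_real by (simp add: power_mult_distrib)
    finally show "(b k)\<^sup>2 \<le> (hnorm Q p)\<^sup>2 * b (Suc k)" .
    have "b k \<le> C * I (iter f k)" unfolding b_def by (rule C(2)[OF it])
    also have "\<dots> \<le> C * (I f * I f) ^ 2 ^ k" using C f by (intro mult_left_mono iter_I)
    finally show "b k \<le> C * (I f * I f) ^ 2 ^ k" .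
  qed (use f in \<open>auto simp: I_nonneg\<close>)
  moreover have "b 0 = (hnorm Q (act f p))\<^sup>2"
  proof -
    have ap: "act f p \<in> hcar Q" by (rule act_closed[OF f p])
    have "hip Q p (act (iter f 0) p) = hip Q (act f p) (act f p)"
      using act_adj[OF f p ap] by (simp add: act_conv f p Cc_involution)
    then have "b 0 = cmod (complex_of_real ((hnorm Q (act f p))\<^sup>2))" unfolding b_def Q.ip_self[OF ap] by (rule arg_cong)
    then show ?thesis unfolding norm_of_real by simp
  qed
  ultimately have "(hnorm Q (act f p))\<^sup>2 \<le> (I f * hnorm Q p)\<^sup>2"
    by (simp add: power_mult_distrib power2_eq_square[of "I f"] mult.commute)
  then show ?thesis by (rule power2_le_imp_le) (use f p in \<open>simp add: I_nonneg\<close>)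
qed

text \<open>
  A sequence of families in the unitization is coded as one sequence of functions (scalars
  become constant functions), so that the completion has points of type \<open>cyclic_point\<close>.
\<close>

definition encode :: "(nat \<Rightarrow> 'i \<Rightarrow> 'g uel) \<Rightarrow> nat \<Rightarrow> 'g \<Rightarrow> complex" where
  "encode s k = (case from_nat k of (n, a, b) \<Rightarrow> if b then snd (s n a) else (\<lambda>_. fst (s n a)))"

lemma inj_encode: "inj encode"
proof (rule injI)
  fix s t :: "nat \<Rightarrow> 'i \<Rightarrow> 'g uel"
  assume eq: "encode s = encode t"
  have "s n a = t n a" for n a
    using fun_cong[OF eq, of "to_nat (n, a, True)"] fun_cong[OF eq, of "to_nat (n, a, False)"]
    by (simp add: encode_def prod_eq_iff fun_eq_iff)
  then show "s = t" by blast
qed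

sublocale Q: completion Q encode
  by unfold_locales (rule inj_encode)

definition \<sigma> :: "('g \<Rightarrow> complex) \<Rightarrow> 'g cyclic_point \<Rightarrow> 'g cyclic_point" where
  "\<sigma> f = Q.ext_op (act f)"

lemma \<sigma>_cls: "\<lbrakk>f \<in> Cc; s \<in> Q.cau\<rbrakk> \<Longrightarrow> \<sigma> f (Q.cls s) = Q.cls (\<lambda>n. act f (s n))"
  unfolding \<sigma>_def by (rule Q.ext_op_cls[OF act_linear act_bound])

lemma \<sigma>_bounded: "f \<in> Cc \<Longrightarrow> \<sigma> f \<in> bounded_ops Q.completed"
  unfolding \<sigma>_def by (rule Q.ext_op_bounded[OF act_linear act_bound])

lemma act_cau: "\<lbrakk>f \<in> Cc; s \<in> Q.cau\<rbrakk> \<Longrightarrow> (\<lambda>n. act f (s n)) \<in> Q.cau"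
  by (rule Q.op_cau[OF act_linear act_bound])

text \<open>Each \<open>\<sigma> f\<close> acts termwise on Cauchy sequences, so algebraic
  identities are inherited from \<open>act\<close> and the adjoint relation follows by uniqueness of
  limits; \<open>act_bound\<close> is what makes the norm at most \<open>I f\<close>.\<close>

lemma \<sigma>_representation: "Cc_representation G lam Q.completed \<sigma>"
proof -
  interpret C: hilbert_space Q.completed by (rule Q.hilbert_space_K)
  show ?thesis unfolding Cc_representation_def
  proof (intro conjI ballI allI)
    show "hilbert_space Q.completed" by (rule Q.hilbert_space_K)
    fix f :: "'g \<Rightarrow> complex" assume f: "f \<in> Cc"
    show "\<sigma> f \<in> bounded_ops Q.completed" by (rule \<sigma>_bounded[OF f])
    show "op_norm Q.completed (\<sigma> f) \<le> I f"
      by (rule C.op_norm_le) (use Q.ext_op_norm_bound[OF act_linear act_bound] f in \<open>auto simp: \<sigma>_def I_nonneg\<close>)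
    show "\<sigma> (\<lambda>x. c * f x) = op_scale Q.completed c (\<sigma> f)" for c
    proof (rule C.op_ext)
      fix X assume "X \<in> hcar Q.completed"
      then obtain s where s: "s \<in> Q.cau" "X = Q.cls s" by (auto simp: Q.car_K)
      have "act (\<lambda>x. c * f x) p = hscale Q c (act f p)" for p
        by (simp add: act_def Q_simps umul_def uscale_def conv_scale_left fun_eq_iff algebra_simps)
      then show "\<sigma> (\<lambda>x. c * f x) X = op_scale Q.completed c (\<sigma> f) X"
        using s f by (simp add: C.op_scale_apply Q.car_K \<sigma>_cls Cc_scale Q.scale_K act_cau)
    qed (use f in \<open>auto intro: \<sigma>_bounded Cc_scale C.op_scale_closed\<close>)
    fix v w assume "v \<in> hcar Q.completed" "w \<in> hcar Q.completed"
    then obtain s t where s: "s \<in> Q.cau" "v = Q.cls s" and t: "t \<in> Q.cau" "w = Q.cls t" by (auto simp: Q.car_K)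
    have "(\<lambda>n. hip Q (act f (s n)) (t n)) \<longlonglongrightarrow> hip Q.completed (\<sigma> f v) w"
      using Q.ip_K[OF act_cau[OF f s(1)] t(1)] s t f by (simp add: \<sigma>_cls)
    moreover have "(\<lambda>n. hip Q (s n) (act (st f) (t n))) \<longlonglongrightarrow> hip Q.completed v (\<sigma> (st f) w)"
      using Q.ip_K[OF s(1) act_cau[OF Cc_involution[OF f] t(1)]] s t f by (simp add: \<sigma>_cls Cc_involution)
    moreover have "hip Q (act f (s n)) (t n) = hip Q (s n) (act (st f) (t n))" for n
      using s t f by (intro act_adj Q.cau_mem)
    ultimately show "hip Q.completed (\<sigma> f v) w = hip Q.completed v (\<sigma> (st f) w)"
      by (simp add: LIMSEQ_unique)
  next
    fix f g :: "'g \<Rightarrow> complex" assume f: "f \<in> Cc" and g: "g \<in> Cc"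
    show "\<sigma> (\<lambda>x. f x + g x) = op_add Q.completed (\<sigma> f) (\<sigma> g)"
    proof (rule C.op_ext)
      fix X assume "X \<in> hcar Q.completed"
      then obtain s where s: "s \<in> Q.cau" "X = Q.cls s" by (auto simp: Q.car_K)
      have "act (\<lambda>x. f x + g x) p = hadd Q (act f p) (act g p)" if "p \<in> hcar Q" for p
        using that f g by (simp add: act_def Q_simps umul_def uadd_def ucar_def conv_add_left fun_eq_iff algebra_simps)
      then show "\<sigma> (\<lambda>x. f x + g x) X = op_add Q.completed (\<sigma> f) (\<sigma> g) X"
        using s f g by (simp add: C.op_add_apply Q.car_K \<sigma>_cls Cc_add Q.add_K act_cau Q.cau_mem)
    qed (use f g in \<open>auto intro: \<sigma>_bounded Cc_add C.op_add_closed\<close>)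
    show "\<sigma> (f \<star> g) = compose (hcar Q.completed) (\<sigma> f) (\<sigma> g)"
    proof (rule extensionalityI[of _ "hcar Q.completed"])
      show "\<sigma> (f \<star> g) \<in> extensional (hcar Q.completed)" by (rule C.opD(5)[OF \<sigma>_bounded[OF conv_Cc[OF f g]]])
      fix X assume X: "X \<in> hcar Q.completed"
      then obtain s where s: "s \<in> Q.cau" "X = Q.cls s" by (auto simp: Q.car_K)
      then show "\<sigma> (f \<star> g) X = compose (hcar Q.completed) (\<sigma> f) (\<sigma> g) X"
        using X f g by (simp add: compose_def \<sigma>_cls conv_Cc act_cau act_conv Q.cau_mem)
    qed simp
  qed
qed

text \<open>The unit placed in coordinate \<open>a\<close>: the cyclic vectors exist inside the
  space only because of the unitization.\<close>

definition gen :: "'i \<Rightarrow> 'i \<Rightarrow> 'g uel" where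
  "gen a b = (if b = a then (1, \<lambda>x. 0) else (0, \<lambda>x. 0))"

definition \<omega> :: "'i \<Rightarrow> 'g cyclic_point" where
  "\<omega> a = Q.emb (gen a)"

lemma gen_closed: "gen a \<in> hcar Q"
  by (simp add: gen_def Q_simps ucar_def Cc_zero)

lemma \<theta>_zero: "\<theta> a b (0, \<lambda>x. 0) = 0"
  using \<theta>_scale[of "(0, \<lambda>x. 0)" a b 0] by (simp add: uscale_def ucar_def Cc_zero)

lemma ip_gen: 
  assumes a: "a \<in> S" and q: "q \<in> hcar Q"
  shows "hip Q (gen a) q = (\<Sum>b\<in>S. \<theta> a b (q b))"
proof -
  have st0: "st (\<lambda>x. 0) = (\<lambda>x. 0)" by (simp add: involution_def fun_eq_iff)
  have "umul (ustar (gen a c)) x = (if c = a then x else (0, \<lambda>x. 0))" for c x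
    by (simp add: gen_def ustar_def umul_def st0 conv_zero_left)
  then have "hip Q (gen a) q = (\<Sum>c\<in>S. if c = a then \<Sum>b\<in>S. \<theta> a b (q b) else 0)"
    unfolding Q_simps(5) by (intro sum.cong refl) (auto simp: \<theta>_zero)
  then show ?thesis using S a by simp
qed

lemma \<omega>_closed: "\<omega> a \<in> hcar Q.completed"
  unfolding \<omega>_def by (rule Q.emb_closed[OF gen_closed])

lemma ip_\<omega>:
  assumes "a \<in> S" "b \<in> S"
  shows "hip Q.completed (\<omega> a) (\<omega> b) = \<theta> a b (1, \<lambda>x. 0)"
proof -
  have "hip Q.completed (\<omega> a) (\<omega> b) = (\<Sum>c\<in>S. \<theta> a c (gen b c))"
    unfolding \<omega>_def using assms by (simp add: Q.ip_emb gen_closed ip_gen)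
  also have "\<dots> = (\<Sum>c\<in>S. if c = b then \<theta> a b (1, \<lambda>x. 0) else 0)"
    by (intro sum.cong refl) (auto simp: gen_def \<theta>_zero)
  finally show ?thesis using S assms by simp
qed

lemma ip_\<sigma>_\<omega>:
  assumes "a \<in> S" "b \<in> S" "f \<in> Cc"
  shows "hip Q.completed (\<omega> a) (\<sigma> f (\<omega> b)) = \<theta> a b (0, f)"
proof -
  have "\<sigma> f (\<omega> b) = Q.emb (act f (gen b))"
    unfolding \<omega>_def \<sigma>_def using assms by (intro Q.ext_op_emb[OF act_linear act_bound] gen_closed)
  then have "hip Q.completed (\<omega> a) (\<sigma> f (\<omega> b)) = (\<Sum>c\<in>S. \<theta> a c (act f (gen b) c))"
    unfolding \<omega>_def using assms by (simp add: Q.ip_emb gen_closed act_closed ip_gen)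
  also have "\<dots> = (\<Sum>c\<in>S. if c = b then \<theta> a b (0, f) else 0)"
  proof (intro sum.cong refl)
    fix c
    have "f \<star> (\<lambda>x. 0) = (\<lambda>x. 0)" using conv_scale_right[of f 0 "\<lambda>x. 0"] by simp
    then show "\<theta> a c (act f (gen b) c) = (if c = b then \<theta> a b (0, f) else 0)"
      by (simp add: act_def gen_def umul_def \<theta>_zero)
  qed
  finally show ?thesis using S assms by simp
qed

end

section \<open>The tensor product with a Hilbert bundle\<close>

context bundle_groupoid
begin

abbreviation "sn \<equiv> section_norm (units G) H"

lemma sn_bound: "\<lbrakk>\<xi> \<in> bs; u \<in> units G\<rbrakk> \<Longrightarrow> hnorm (H u) (\<xi> u) \<le> sn \<xi>"
  unfolding section_norm_def by (rule cSUP_upper) (auto simp: bounded_sections_def)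

lemma sn_nonneg: "\<xi> \<in> bs \<Longrightarrow> 0 \<le> sn \<xi>"
  using sn_bound[OF _ rng_unit] pre_hilbert.norm_nonneg[OF fibre_pre[OF rng_unit] bs_closed[OF _ rng_unit]]
  by (rule order_trans[rotated])

lemma bs_section: "\<xi> \<in> bs \<Longrightarrow> \<xi> \<in> \<Gamma>"
  by (simp add: bounded_sections_def)

lemma coefficient_bound:
  assumes "\<xi> \<in> bs" "\<eta> \<in> bs"
  shows "cmod (coefficient G H L \<xi> \<eta> x) \<le> sn \<xi> * sn \<eta>"
proof -
  interpret pre_hilbert "H (rng G x)" by (rule fibre_pre) simp
  have c: "L x (\<xi> (src G x)) \<in> hcar (H (rng G x))" "\<eta> (rng G x) \<in> hcar (H (rng G x))"
    using L_closed[OF bs_closed[OF assms(1) src_unit]] bs_closed[OF assms(2) rng_unit] by auto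
  have "cmod (coefficient G H L \<xi> \<eta> x) \<le> hnorm (H (rng G x)) (L x (\<xi> (src G x))) * hnorm (H (rng G x)) (\<eta> (rng G x))"
    unfolding coefficient_def using c by (rule cauchy_schwarz)
  also have "\<dots> = hnorm (H (src G x)) (\<xi> (src G x)) * hnorm (H (rng G x)) (\<eta> (rng G x))"
    using assms by (simp add: isometry bs_closed)
  also have "\<dots> \<le> sn \<xi> * sn \<eta>"
    using assms c by (intro mult_mono sn_bound sn_nonneg) auto
  finally show ?thesis .
qed

text \<open>Unitarity: \<open>L (ginv G x)\<close> is the adjoint of \<open>L x\<close>.\<close>

lemma coefficient_inv:
  assumes "\<xi> \<in> bs" "\<eta> \<in> bs"
  shows "coefficient G H L \<xi> \<eta> (ginv G x) = cnj (coefficient G H L \<eta> \<xi> x)"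
proof -
  have c: "\<xi> (rng G x) \<in> hcar (H (rng G x))" "\<eta> (src G x) \<in> hcar (H (src G x))"
    using assms by (auto intro: bs_closed)
  have inv: "L x (L (ginv G x) (\<xi> (rng G x))) = \<xi> (rng G x)"
    using L_inv[of "\<xi> (rng G x)" "ginv G x"] c by (simp add: grp inv_inv)
  have lc: "L (ginv G x) (\<xi> (rng G x)) \<in> hcar (H (src G x))"
    using L_closed[of "\<xi> (rng G x)" "ginv G x"] c by (simp add: grp)
  have "coefficient G H L \<xi> \<eta> (ginv G x) = hip (H (src G x)) (L (ginv G x) (\<xi> (rng G x))) (\<eta> (src G x))"
    by (simp add: coefficient_def grp)
  also have "\<dots> = hip (H (rng G x)) (\<xi> (rng G x)) (L x (\<eta> (src G x)))"
    using L_ip[OF lc c(2)] inv by simp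
  also have "\<dots> = cnj (coefficient G H L \<eta> \<xi> x)"
    unfolding coefficient_def by (rule pre_hilbert.ip_commute[OF fibre_pre]) (use c L_closed in auto)
  finally show ?thesis .
qed

end

text \<open>An index \<open>a\<close> stands for the tensor of the section \<open>\<zeta> a\<close>
  with \<open>\<rho> (g a) (v' a)\<close>. The factorization of the second vector is part of the
  data, since functions on the unit space act by multiplying \<open>g a\<close>.\<close>

locale tensor_data = bundle_rep G lam H \<Gamma> L K \<rho>
  for G :: "'g::{t2_space, second_countable_topology} groupoid" and lam :: "'g \<Rightarrow> 'g measure"
    and H :: "'g \<Rightarrow> 'h hilbert" and \<Gamma> :: "('g \<Rightarrow> 'h) set" and L :: "'g \<Rightarrow> 'h \<Rightarrow> 'h"
    and K :: "'k hilbert" and \<rho> :: "('g \<Rightarrow> complex) \<Rightarrow> 'k \<Rightarrow> 'k" +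
  fixes S :: "'i::countable set" and \<zeta> :: "'i \<Rightarrow> 'g \<Rightarrow> 'h" and g :: "'i \<Rightarrow> 'g \<Rightarrow> complex" and v' :: "'i \<Rightarrow> 'k"
  assumes S: "finite S" and \<zeta>: "\<And>a. \<zeta> a \<in> bs" and g: "\<And>a. g a \<in> Cc" and v': "\<And>a. v' a \<in> hcar K"
begin

definition v :: "'i \<Rightarrow> 'k" where "v a = \<rho> (g a) (v' a)"

text \<open>
  Coefficients are conjugate linear in the first section, so the tensor product is really
  taken with the conjugate bundle. This is why the two sections are swapped here and in \<open>\<kappa>\<close>.
\<close>

definition \<phi> :: "'i \<Rightarrow> 'i \<Rightarrow> 'g \<Rightarrow> complex" where "\<phi> a b = coefficient G H L (\<zeta> b) (\<zeta> a)"

definition \<kappa> :: "'i \<Rightarrow> 'i \<Rightarrow> 'g \<Rightarrow> complex" where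
  "\<kappa> a b x = hip (H (rng G x)) (\<zeta> b (rng G x)) (\<zeta> a (rng G x))"

text \<open>The inner product of two tensors: that of the sections is a function on the unit space,
  pulled back to \<open>\<kappa> a b\<close> and absorbed by \<open>g b\<close>.\<close>

definition D :: "'i \<Rightarrow> 'i \<Rightarrow> complex" where "D a b = hip K (v a) (\<rho> (\<lambda>x. \<kappa> a b x * g b x) (v' b))"

definition \<theta> :: "'i \<Rightarrow> 'i \<Rightarrow> 'g uel \<Rightarrow> complex" where
  "\<theta> a b x = fst x * D a b + hip K (v a) (\<rho> (\<lambda>z. \<phi> a b z * snd x z) (v b))"

lemma v: "v a \<in> hcar K" unfolding v_def by (intro rep_closed g v')

lemma \<phi>_cont: "continuous_on UNIV (\<phi> a b)"
  unfolding \<phi>_def by (intro continuous_coefficient \<zeta>)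

lemma \<phi>C: "f \<in> Cc \<Longrightarrow> (\<lambda>x. \<phi> a b x * f x) \<in> Cc"
  by (intro Cc_mult \<phi>_cont)

lemma \<kappa>_cont: "continuous_on UNIV (\<kappa> a b)"
  unfolding \<kappa>_def[abs_def] by (intro continuous_ip \<zeta>)

lemma \<kappa>C: "f \<in> Cc \<Longrightarrow> (\<lambda>x. \<kappa> a b x * f x) \<in> Cc"
  by (intro Cc_mult \<kappa>_cont)

lemma \<kappa>_cnj: "cnj (\<kappa> a b x) = \<kappa> b a x"
  unfolding \<kappa>_def by (rule pre_hilbert.ip_commute[OF fibre_pre, symmetric]) (use \<zeta> in \<open>auto intro: bs_closed\<close>)

lemma \<kappa>_rng: "\<kappa> a b (rng G x) = \<kappa> a b x"
  by (simp add: \<kappa>_def grp)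

lemma \<phi>_star: "(\<lambda>x. \<phi> a b x * st f x) = st (\<lambda>x. \<phi> b a x * f x)"
  unfolding \<phi>_def using coefficient_inv[OF \<zeta> \<zeta>, of a b] by (simp add: involution_def fun_eq_iff)

text \<open>The definition treats the two vectors unequally; symmetry holds because
  \<open>\<kappa>\<close> depends on the range only and can be moved across by
  \<open>ip_rng_function\<close>.\<close>

lemma D_cnj: "D a b = cnj (D b a)"
proof -
  have "D a b = hip K (\<rho> (\<lambda>x. \<kappa> b a x * g a x) (v' a)) (v b)"
    using ip_rng_function[OF g[of a] g[of b] \<kappa>_cont[of b a] \<kappa>_rng[of b a] v'[of a] v'[of b]] by (simp add: D_def v_def \<kappa>_cnj)
  also have "\<dots> = cnj (D b a)"
    unfolding D_def by (intro K.ip_commute rep_closed \<kappa>C g v' v)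
  finally show ?thesis .
qed

text \<open>The common shape of the four cases in \<open>\<theta>_positive\<close>: an integrand
  that is a convolution integrand on the fibre up to a factor independent of the integration
  variable.\<close>

lemma kernel_case:
  assumes "f1 \<in> Cc" "f2 \<in> Cc" "\<And>y. rng G y = rng G x \<Longrightarrow> h y = c * (f1 y * f2 (gmult G (ginv G y) x))"
  shows "set_integrable (lam (rng G x)) (rfibre G (rng G x)) h"
    and "c * (f1 \<star> f2) x = (LINT y:rfibre G (rng G x)|lam (rng G x). h y)"
proof -
  have "set_integrable (lam (rng G x)) (rfibre G (rng G x)) (\<lambda>y. c * (f1 y * f2 (gmult G (ginv G y) x)))"
    by (intro set_integrable_mult_right conv_integrable assms)
  also have "set_integrable (lam (rng G x)) (rfibre G (rng G x)) (\<lambda>y. c * (f1 y * f2 (gmult G (ginv G y) x)))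
    = set_integrable (lam (rng G x)) (rfibre G (rng G x)) h"
    by (rule set_integrable_cong) (use assms(3) in auto)
  finally show "set_integrable (lam (rng G x)) (rfibre G (rng G x)) h" .
  have "(LINT y:rfibre G (rng G x)|lam (rng G x). h y) = (LINT y:rfibre G (rng G x)|lam (rng G x). c * (f1 y * f2 (gmult G (ginv G y) x)))"
    by (rule set_integral_cong_rfibre) (rule assms(3))
  also have "\<dots> = c * (f1 \<star> f2) x" unfolding convol_def by (rule set_integral_mult_right)
  finally show "c * (f1 \<star> f2) x = (LINT y:rfibre G (rng G x)|lam (rng G x). h y)" by simp
qed

text \<open>Each \<open>p a\<close> is split into its scalar and its function part, which doubles
  the index set. The scalar part contributes the tensor of \<open>\<zeta> a\<close> with
  \<open>\<rho> (c g) v'\<close>, the function part a formal integral of \<open>L x\<close> applied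
  to \<open>\<zeta> a\<close>. Unitarity and multiplicativity of \<open>L\<close> turn all mixed
  terms into one kernel to which \<open>positive_kernel\<close> applies.\<close>

lemma \<theta>_positive:
  assumes p: "\<And>a. p a \<in> ucar"
  shows "0 \<le> Re (\<Sum>a\<in>S. \<Sum>b\<in>S. \<theta> a b (umul (ustar (p a)) (p b)))"
proof -
  \<comment> \<open>\<open>True\<close> marks the function part; in the scalar part the scalar is
    absorbed into \<open>g\<close>, so that both are elements of \<open>Cc\<close>.\<close>
  define F where "F s = (if snd s then snd (p (fst s)) else (\<lambda>x. fst (p (fst s)) * g (fst s) x))" for s :: "'i \<times> bool"
  define w where "w s = (if snd s then v (fst s) else v' (fst s))" for s :: "'i \<times> bool"
  define l where "l s x = (if snd s then L x (\<zeta> (fst s) (src G x)) else \<zeta> (fst s) (rng G x))" for s :: "'i \<times> bool" and x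
  \<comment> \<open>The four kinds of products: unit with unit gives \<open>\<kappa>\<close>, the
    mixed ones give \<open>\<phi>\<close> inside a convolution factor, and two functions give
    \<open>\<phi>\<close> times their convolution.\<close>
  define q where "q s t = (case (s, t) of ((a, i), (b, j)) \<Rightarrow>
     if i then if j then (\<lambda>x. \<phi> a b x * (st (F s) \<star> F t) x) else (\<lambda>x. \<phi> a b x * st (F s) x) \<star> F t
     else if j then st (F s) \<star> (\<lambda>x. \<phi> a b x * F t x) else st (F s) \<star> (\<lambda>x. \<kappa> a b x * F t x))" for s t :: "'i \<times> bool"
  have pC: "snd (p a) \<in> Cc" for a using p by (simp add: ucar_def)
  have FC: "F s \<in> Cc" for s by (simp add: F_def pC Cc_scale g)
  have stC: "st (F s) \<in> Cc" for s by (intro Cc_involution FC)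
  have wc: "w s \<in> hcar K" for s by (simp add: w_def v v')
  have lc: "l s x \<in> hcar (H (rng G x))" for s x by (auto simp: l_def intro!: L_closed bs_closed \<zeta>)
  have ln: "hnorm (H (rng G x)) (l s x) = hnorm (H (if snd s then src G x else rng G x)) (\<zeta> (fst s) (if snd s then src G x else rng G x))" for s x
    by (simp add: l_def isometry bs_closed \<zeta>)
  have ker: "set_integrable (lam (rng G x)) (rfibre G (rng G x))
      (\<lambda>y. cnj (F s (ginv G y)) * F t (gmult G (ginv G y) x) * hip (H (src G y)) (l t (gmult G (ginv G y) x)) (l s (ginv G y))) \<and>
      q s t x = (LINT y:rfibre G (rng G x)|lam (rng G x).
      cnj (F s (ginv G y)) * F t (gmult G (ginv G y) x) * hip (H (src G y)) (l t (gmult G (ginv G y) x)) (l s (ginv G y)))" for s t x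
  proof -
    obtain a i b j where st: "s = (a, i)" "t = (b, j)" by (metis surj_pair)
    show ?thesis
    proof (cases i; cases j)
      assume ij: "\<not> i" "\<not> j"
      have "cnj (F s (ginv G y)) * F t (gmult G (ginv G y) x) * hip (H (src G y)) (l t (gmult G (ginv G y) x)) (l s (ginv G y))
        = 1 * (st (F s) y * (\<kappa> a b (gmult G (ginv G y) x) * F t (gmult G (ginv G y) x)))" if "rng G y = rng G x" for y
        using that by (simp add: l_def st ij involution_def \<kappa>_def grp)
      note k = kernel_case[OF stC \<kappa>C[OF FC] this]
      then show ?thesis using ij by (simp add: q_def st)
    next
      assume ij: "\<not> i" "j"
      have "cnj (F s (ginv G y)) * F t (gmult G (ginv G y) x) * hip (H (src G y)) (l t (gmult G (ginv G y) x)) (l s (ginv G y))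
        = 1 * (st (F s) y * (\<phi> a b (gmult G (ginv G y) x) * F t (gmult G (ginv G y) x)))" if "rng G y = rng G x" for y
        using that by (simp add: l_def st ij involution_def \<phi>_def coefficient_def grp)
      note k = kernel_case[OF stC \<phi>C[OF FC] this]
      then show ?thesis using ij by (simp add: q_def st)
    next
      assume ij: "i" "\<not> j"
      have "cnj (F s (ginv G y)) * F t (gmult G (ginv G y) x) * hip (H (src G y)) (l t (gmult G (ginv G y) x)) (l s (ginv G y))
        = 1 * ((\<phi> a b y * st (F s) y) * F t (gmult G (ginv G y) x))" if y: "rng G y = rng G x" for y
      proof -
        have b: "\<zeta> b (src G y) \<in> hcar (H (src G y))" and a: "\<zeta> a (rng G y) \<in> hcar (H (rng G y))" by (auto intro: bs_closed \<zeta>)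
        \<comment> \<open>Applying the unitary \<open>L (ginv G y)\<close> to both arguments moves
          this coefficient into the fibre over \<open>src G y\<close>.\<close>
        have "\<phi> a b y = hip (H (src G y)) (L (ginv G y) (L y (\<zeta> b (src G y)))) (L (ginv G y) (\<zeta> a (rng G y)))"
          using L_ip[of "L y (\<zeta> b (src G y))" "ginv G y" "\<zeta> a (rng G y)"] L_closed[OF b] a
          by (simp add: grp \<phi>_def coefficient_def)
        then show ?thesis using y L_inv[OF b] by (simp add: l_def st ij involution_def grp)
      qed
      note k = kernel_case[OF \<phi>C[OF stC] FC this]
      then show ?thesis using ij by (simp add: q_def st)
    next
      assume ij: "i" "j"
      have "cnj (F s (ginv G y)) * F t (gmult G (ginv G y) x) * hip (H (src G y)) (l t (gmult G (ginv G y) x)) (l s (ginv G y))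
        = \<phi> a b x * (st (F s) y * F t (gmult G (ginv G y) x))" if y: "rng G y = rng G x" for y
      proof -
        have b: "\<zeta> b (src G x) \<in> hcar (H (src G x))" and a: "\<zeta> a (rng G x) \<in> hcar (H (rng G x))" by (auto intro: bs_closed \<zeta>)
        \<comment> \<open>The same transport for all \<open>y\<close> in the fibre: by
          multiplicativity the kernel does not depend on \<open>y\<close> and leaves the integral as
          the factor \<open>\<phi> a b x\<close>.\<close>
        have "\<phi> a b x = hip (H (src G y)) (L (ginv G y) (L x (\<zeta> b (src G x)))) (L (ginv G y) (\<zeta> a (rng G x)))"
          using L_ip[of "L x (\<zeta> b (src G x))" "ginv G y" "\<zeta> a (rng G x)"] L_closed[OF b] a y
          by (simp add: grp \<phi>_def coefficient_def)
        moreover have "L (ginv G y) (L x (\<zeta> b (src G x))) = L (gmult G (ginv G y) x) (\<zeta> b (src G x))"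
          using multiplicative[of "ginv G y" x "\<zeta> b (src G x)"] b y by (simp add: grp)
        ultimately show ?thesis using y by (simp add: l_def st ij involution_def grp)
      qed
      note k = kernel_case[OF stC FC this]
      then show ?thesis using ij by (simp add: q_def st)
    qed
  qed
  have "0 \<le> Re (\<Sum>s\<in>S \<times> UNIV. \<Sum>t\<in>S \<times> UNIV. hip K (w s) (\<rho> (q s t) (w t)))"
  proof (rule positive_kernel[where F = F and l = l and R = "\<Sum>a\<in>S. sn (\<zeta> a)"])
    show "finite (S \<times> (UNIV :: bool set))" using S by simp
    fix s t :: "'i \<times> bool" assume s: "s \<in> S \<times> UNIV" and t: "t \<in> S \<times> UNIV"
    show "q s t \<in> Cc" by (auto simp: q_def split: prod.splits intro!: conv_Cc \<phi>C \<kappa>C stC FC)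
    fix x
    have "hnorm (H (rng G x)) (l s x) \<le> sn (\<zeta> (fst s))" unfolding ln by (simp add: sn_bound \<zeta>)
    also have "\<dots> \<le> (\<Sum>a\<in>S. sn (\<zeta> a))" using s S by (intro member_le_sum) (auto simp: sn_nonneg \<zeta>)
    finally show "hnorm (H (rng G x)) (l s x) \<le> (\<Sum>a\<in>S. sn (\<zeta> a))" .
  next
    fix s :: "'i \<times> bool" 
    have "continuous_on UNIV (\<lambda>x. hnorm (H (rng G x)) (\<zeta> (fst s) (rng G x)))"
      by (rule continuous_on_compose2[OF continuous_norm[OF bs_section[OF \<zeta>]] continuous_rng]) auto
    moreover have "continuous_on UNIV (\<lambda>x. hnorm (H (src G x)) (\<zeta> (fst s) (src G x)))"
      by (rule continuous_on_compose2[OF continuous_norm[OF bs_section[OF \<zeta>]] continuous_src]) auto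
    ultimately show "continuous_on UNIV (\<lambda>x. hnorm (H (rng G x)) (l s x))"
      unfolding ln by (cases "snd s") simp_all
    fix e assume e: "e \<in> bs"
    show "continuous_on UNIV (\<lambda>x. hip (H (rng G x)) (l s x) (e (rng G x)))"
      using continuous_coefficient[OF \<zeta> e, of "fst s"] continuous_ip[OF \<zeta> e, of "fst s"]
      unfolding l_def coefficient_def[abs_def] by (cases "snd s") simp_all
  qed (use FC wc lc ker in auto)
  also have "(\<Sum>s\<in>S \<times> UNIV. \<Sum>t\<in>S \<times> UNIV. hip K (w s) (\<rho> (q s t) (w t)))
    = (\<Sum>a\<in>S. \<Sum>b\<in>S. \<theta> a b (umul (ustar (p a)) (p b)))"
  proof -
    have "(\<Sum>s\<in>S \<times> UNIV. \<Sum>t\<in>S \<times> UNIV. hip K (w s) (\<rho> (q s t) (w t)))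
      = (\<Sum>a\<in>S. \<Sum>i\<in>UNIV. \<Sum>b\<in>S. \<Sum>j\<in>UNIV. hip K (w (a, i)) (\<rho> (q (a, i) (b, j)) (w (b, j))))"
      by (simp add: sum.cartesian_product' split_def)
    also have "\<dots> = (\<Sum>a\<in>S. \<Sum>b\<in>S. \<Sum>i\<in>UNIV. \<Sum>j\<in>UNIV. hip K (w (a, i)) (\<rho> (q (a, i) (b, j)) (w (b, j))))"
      by (intro sum.cong refl sum.swap)
    also have "\<dots> = (\<Sum>a\<in>S. \<Sum>b\<in>S. \<theta> a b (umul (ustar (p a)) (p b)))"
    proof (intro sum.cong refl)
      fix a b
      obtain c f where pa: "p a = (c, f)" by fastforce
      obtain d h where pb: "p b = (d, h)" by fastforce
      have f: "f \<in> Cc" and h: "h \<in> Cc" using pC[of a] pC[of b] pa pb by auto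
      note Cs = f h Cc_involution[OF f] conv_Cc[OF Cc_involution[OF f] h] g v v' \<phi>C \<kappa>C rep_closed Cc_scale Cc_add
      have "hip K (w (a, False)) (\<rho> (q (a, False) (b, False)) (w (b, False))) = hip K (v' a) (\<rho> (st (\<lambda>x. c * g a x) \<star> (\<lambda>x. d * (\<kappa> a b x * g b x))) (v' b))"
        by (simp add: w_def q_def F_def pa pb mult.left_commute)
      also have "\<dots> = cnj c * d * D a b"
        by (simp add: ip_rep_conv Cs rep_scale K.ip_simps K.closed D_def v_def)
      finally have 1: "hip K (w (a, False)) (\<rho> (q (a, False) (b, False)) (w (b, False))) = cnj c * d * D a b" .
      have "hip K (w (a, False)) (\<rho> (q (a, False) (b, True)) (w (b, True))) = hip K (v' a) (\<rho> (st (\<lambda>x. c * g a x) \<star> (\<lambda>x. \<phi> a b x * h x)) (v b))"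
        by (simp add: w_def q_def F_def pa pb)
      also have "\<dots> = cnj c * hip K (v a) (\<rho> (\<lambda>x. \<phi> a b x * h x) (v b))"
        by (simp add: ip_rep_conv Cs rep_scale K.ip_simps v_def[of a])
      finally have 2: "hip K (w (a, False)) (\<rho> (q (a, False) (b, True)) (w (b, True))) = cnj c * hip K (v a) (\<rho> (\<lambda>x. \<phi> a b x * h x) (v b))" .
      have "hip K (w (a, True)) (\<rho> (q (a, True) (b, False)) (w (b, False))) = hip K (v a) (\<rho> ((\<lambda>x. \<phi> a b x * st f x) \<star> (\<lambda>x. d * g b x)) (v' b))"
        by (simp add: w_def q_def F_def pa pb)
      also have "\<dots> = d * hip K (v a) (\<rho> (\<lambda>x. \<phi> a b x * st f x) (v b))"
        by (simp add: rep_conv Cs rep_scale K.ip_simps v_def[of b] K.opD(3)[OF rep_bounded])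
      finally have 3: "hip K (w (a, True)) (\<rho> (q (a, True) (b, False)) (w (b, False))) = d * hip K (v a) (\<rho> (\<lambda>x. \<phi> a b x * st f x) (v b))" .
      have 4: "hip K (w (a, True)) (\<rho> (q (a, True) (b, True)) (w (b, True))) = hip K (v a) (\<rho> (\<lambda>x. \<phi> a b x * (st f \<star> h) x) (v b))"
        by (simp add: w_def q_def F_def pa pb)
      have "\<theta> a b (umul (ustar (p a)) (p b)) = cnj c * d * D a b
         + hip K (v a) (\<rho> (\<lambda>z. cnj c * (\<phi> a b z * h z) + d * (\<phi> a b z * st f z) + \<phi> a b z * (st f \<star> h) z) (v b))"
        by (simp add: \<theta>_def umul_def ustar_def pa pb algebra_simps)
      also have "\<dots> = cnj c * d * D a b + (cnj c * hip K (v a) (\<rho> (\<lambda>x. \<phi> a b x * h x) (v b))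
         + d * hip K (v a) (\<rho> (\<lambda>x. \<phi> a b x * st f x) (v b)) + hip K (v a) (\<rho> (\<lambda>x. \<phi> a b x * (st f \<star> h) x) (v b)))"
        by (simp add: ip_rep_add ip_rep_scale Cs)
      finally show "(\<Sum>i\<in>UNIV. \<Sum>j\<in>UNIV. hip K (w (a, i)) (\<rho> (q (a, i) (b, j)) (w (b, j)))) = \<theta> a b (umul (ustar (p a)) (p b))"
        by (simp add: UNIV_bool 1 2 3 4)
    qed
    finally show ?thesis .
  qed
  finally show ?thesis .
qed

sublocale gns G lam S \<theta> "\<lambda>a b. hnorm K (v a) * (sn (\<zeta> b) * sn (\<zeta> a)) * hnorm K (v b)"
proof
  show "finite S" by (rule S)
  fix x y :: "'g uel" and a b :: 'i and c :: complex
  assume x: "x \<in> ucar"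
  then have xC: "snd x \<in> Cc" by (simp add: ucar_def)
  show "\<theta> a b (uscale c x) = c * \<theta> a b x"
  proof -
    have "(\<lambda>z. \<phi> a b z * snd (uscale c x) z) = (\<lambda>z. c * (\<phi> a b z * snd x z))" by (simp add: uscale_def fun_eq_iff)
    then have "hip K (v a) (\<rho> (\<lambda>z. \<phi> a b z * snd (uscale c x) z) (v b)) = c * hip K (v a) (\<rho> (\<lambda>z. \<phi> a b z * snd x z) (v b))"
      using ip_rep_scale[OF \<phi>C[OF xC] v v] by simp
    then show ?thesis by (simp add: \<theta>_def distrib_left) (simp add: uscale_def)
  qed
  show "\<theta> a b (ustar x) = cnj (\<theta> b a x)"
  proof -
    have "hip K (v a) (\<rho> (\<lambda>z. \<phi> a b z * st (snd x) z) (v b)) = hip K (\<rho> (\<lambda>z. \<phi> b a z * snd x z) (v a)) (v b)"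
      unfolding \<phi>_star using xC by (intro rep_adj[symmetric] \<phi>C v)
    also have "\<dots> = cnj (hip K (v b) (\<rho> (\<lambda>z. \<phi> b a z * snd x z) (v a)))"
      using xC by (intro K.ip_commute rep_closed \<phi>C v)
    finally show ?thesis using D_cnj[of a b] by (simp add: \<theta>_def ustar_def)
  qed
  assume y: "y \<in> ucar"
  then have yC: "snd y \<in> Cc" by (simp add: ucar_def)
  show "\<theta> a b (uadd x y) = \<theta> a b x + \<theta> a b y"
  proof -
    have "(\<lambda>z. \<phi> a b z * snd (uadd x y) z) = (\<lambda>z. \<phi> a b z * snd x z + \<phi> a b z * snd y z)" by (simp add: uadd_def fun_eq_iff algebra_simps)
    then have "hip K (v a) (\<rho> (\<lambda>z. \<phi> a b z * snd (uadd x y) z) (v b))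
      = hip K (v a) (\<rho> (\<lambda>z. \<phi> a b z * snd x z) (v b)) + hip K (v a) (\<rho> (\<lambda>z. \<phi> a b z * snd y z) (v b))"
      using ip_rep_add[OF \<phi>C[OF xC] \<phi>C[OF yC] v v] by simp
    then show ?thesis by (simp add: \<theta>_def) (simp add: uadd_def algebra_simps)
  qed
next
  fix f :: "'g \<Rightarrow> complex" and a b :: 'i assume f: "f \<in> Cc"
  have "I (\<lambda>x. \<phi> a b x * f x) \<le> (sn (\<zeta> b) * sn (\<zeta> a)) * I f"
    using coefficient_bound[OF \<zeta> \<zeta>, of b a] f
    by (intro I_mono \<phi>C) (auto simp: norm_mult \<phi>_def sn_nonneg \<zeta> intro!: mult_right_mono)
  then have "hnorm K (v a) * (I (\<lambda>x. \<phi> a b x * f x) * hnorm K (v b)) \<le> hnorm K (v a) * ((sn (\<zeta> b) * sn (\<zeta> a)) * I f * hnorm K (v b))"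
    using v by (intro mult_left_mono mult_right_mono) auto
  moreover have "cmod (\<theta> a b (0, f)) \<le> hnorm K (v a) * (I (\<lambda>x. \<phi> a b x * f x) * hnorm K (v b))"
    unfolding \<theta>_def using ip_rep_bound[OF \<phi>C[OF f] v v] by simp
  ultimately show "cmod (\<theta> a b (0, f)) \<le> hnorm K (v a) * (sn (\<zeta> b) * sn (\<zeta> a)) * hnorm K (v b) * I f"
    by (simp add: ac_simps)
next
  show "\<And>p. (\<And>a. p a \<in> ucar) \<Longrightarrow> 0 \<le> Re (\<Sum>a\<in>S. \<Sum>b\<in>S. \<theta> a b (umul (ustar (p a)) (p b)))"
    by (rule \<theta>_positive)
qed

lemma tensor_ip_\<omega>: "\<lbrakk>a \<in> S; b \<in> S\<rbrakk> \<Longrightarrow> hip Q.completed (\<omega> a) (\<omega> b) = D a b"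
  using ip_rep_scale[OF Cc_zero v[of b] v[of a], of 0] by (simp add: ip_\<omega> \<theta>_def)

lemma tensor_ip_\<sigma>_\<omega>: "\<lbrakk>a \<in> S; b \<in> S; f \<in> Cc\<rbrakk> \<Longrightarrow>
   hip Q.completed (\<omega> a) (\<sigma> f (\<omega> b)) = hip K (v a) (\<rho> (\<lambda>x. \<phi> a b x * f x) (v b))"
  by (simp add: ip_\<sigma>_\<omega> \<theta>_def)

end

section \<open>The multiplier estimate in a single representation\<close>

lemma (in pre_hilbert) ip_hsum_hsum:
  assumes "\<And>i. i < m \<Longrightarrow> x i \<in> hcar H" "\<And>i. i < n \<Longrightarrow> y i \<in> hcar H"
  shows "hip H (hsum H x m) (hsum H y n) = (\<Sum>i<m. \<Sum>j<n. hip H (x i) (y j))"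
proof -
  have "hip H (hsum H x m) (hsum H y n) = (\<Sum>i<m. hip H (x i) (hsum H y n))"
    using assms by (intro ip_hsum_left hsum_closed)
  also have "\<dots> = (\<Sum>i<m. \<Sum>j<n. hip H (x i) (y j))"
    using assms by (intro sum.cong refl ip_hsum) auto
  finally show ?thesis .
qed

lemma (in pre_hilbert) ip_sum_bound:
  assumes "\<And>i. i < n \<Longrightarrow> x i \<in> hcar H" "\<And>i. i < n \<Longrightarrow> y i \<in> hcar H"
  shows "cmod (\<Sum>i<n. hip H (x i) (y i)) \<le> L2_set (\<lambda>i. hnorm H (x i)) {..<n} * L2_set (\<lambda>i. hnorm H (y i)) {..<n}"
proof -
  have "cmod (\<Sum>i<n. hip H (x i) (y i)) \<le> (\<Sum>i<n. \<bar>hnorm H (x i)\<bar> * \<bar>hnorm H (y i)\<bar>)"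
    using assms by (intro sum_norm_le) (simp add: cauchy_schwarz)
  also have "\<dots> \<le> L2_set (\<lambda>i. hnorm H (x i)) {..<n} * L2_set (\<lambda>i. hnorm H (y i)) {..<n}"
    by (rule L2_set_mult_ineq)
  finally show ?thesis .
qed

lemma L2_set_sq: "(L2_set f A)\<^sup>2 = (\<Sum>i\<in>A. (f i)\<^sup>2)"
  by (simp add: L2_set_def sum_nonneg)

context bundle_rep
begin

text \<open>The square root \<open>b\<close> of \<open>(sn \<xi>)\<^sup>2\<close> minus the squared
  norm of \<open>\<xi>\<close> is a function of the range, and the difference of the two sides is
  the squared norm of the sum of the \<open>\<rho> (b g) u\<close>. In terms of tensors, this bounds
  the operator that tensors a vector with \<open>\<xi>\<close> by \<open>sn \<xi>\<close>.\<close>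

lemma multiplier_norm_bound:
  assumes J: "finite J" and \<xi>: "\<xi> \<in> bs" and g: "\<And>l. g l \<in> Cc" and u: "\<And>l. u l \<in> hcar K"
  shows "Re (\<Sum>l\<in>J. \<Sum>m\<in>J. hip K (\<rho> (g l) (u l)) (\<rho> (\<lambda>x. hip (H (rng G x)) (\<xi> (rng G x)) (\<xi> (rng G x)) * g m x) (u m)))
     \<le> (sn \<xi>)\<^sup>2 * Re (\<Sum>l\<in>J. \<Sum>m\<in>J. hip K (\<rho> (g l) (u l)) (\<rho> (g m) (u m)))"
proof -
  define k where "k x = hip (H (rng G x)) (\<xi> (rng G x)) (\<xi> (rng G x))" for x
  have kc: "continuous_on UNIV k" unfolding k_def[abs_def] by (intro continuous_ip \<xi>)
  define b where "b x = complex_of_real (sqrt ((sn \<xi>)\<^sup>2 - Re (k x)))" for x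
  have kr: "k x = complex_of_real (Re (k x))" and kle: "Re (k x) \<le> (sn \<xi>)\<^sup>2" for x
  proof -
    interpret pre_hilbert "H (rng G x)" by (rule fibre_pre) simp
    have c: "\<xi> (rng G x) \<in> hcar (H (rng G x))" using \<xi> by (auto intro: bs_closed)
    show "k x = complex_of_real (Re (k x))" unfolding k_def ip_self[OF c] by simp
    have "(hnorm (H (rng G x)) (\<xi> (rng G x)))\<^sup>2 \<le> (sn \<xi>)\<^sup>2"
      using c \<xi> by (intro power_mono sn_bound) auto
    then show "Re (k x) \<le> (sn \<xi>)\<^sup>2" unfolding k_def ip_self[OF c] by simp
  qed
  have bc: "continuous_on UNIV b" unfolding b_def[abs_def] by (intro continuous_intros kc)
  have br: "b (rng G x) = b x" for x by (simp add: b_def k_def grp)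
  have bb: "cnj (b x) * (b x * z) = (complex_of_real ((sn \<xi>)\<^sup>2) - k x) * z" for x z
  proof -
    have "cnj (b x) * b x = complex_of_real ((sn \<xi>)\<^sup>2 - Re (k x))"
      using kle[of x] by (simp add: b_def flip: of_real_mult)
    then have "cnj (b x) * b x = complex_of_real ((sn \<xi>)\<^sup>2) - k x" using kr[of x] by simp
    then show ?thesis by (simp flip: mult.assoc)
  qed
  have bC: "(\<lambda>x. b x * g l x) \<in> Cc" for l by (intro Cc_mult g bc)
  have kC: "(\<lambda>x. k x * g l x) \<in> Cc" for l by (intro Cc_mult g kc)
  have eq: "hip K (\<rho> (\<lambda>x. b x * g l x) (u l)) (\<rho> (\<lambda>x. b x * g m x) (u m)) =
     complex_of_real ((sn \<xi>)\<^sup>2) * hip K (\<rho> (g l) (u l)) (\<rho> (g m) (u m)) - hip K (\<rho> (g l) (u l)) (\<rho> (\<lambda>x. k x * g m x) (u m))" for l m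
  proof -
    have "hip K (\<rho> (\<lambda>x. b x * g l x) (u l)) (\<rho> (\<lambda>x. b x * g m x) (u m)) =
      hip K (\<rho> (g l) (u l)) (\<rho> (\<lambda>x. cnj (b x) * (b x * g m x)) (u m))"
      by (rule ip_rng_function[OF g bC bc br u u])
    also have "(\<lambda>x. cnj (b x) * (b x * g m x)) = (\<lambda>x. complex_of_real ((sn \<xi>)\<^sup>2) * g m x - k x * g m x)"
      unfolding bb by (simp add: left_diff_distrib)
    also have "hip K (\<rho> (g l) (u l)) (\<rho> (\<lambda>x. complex_of_real ((sn \<xi>)\<^sup>2) * g m x - k x * g m x) (u m))
      = complex_of_real ((sn \<xi>)\<^sup>2) * hip K (\<rho> (g l) (u l)) (\<rho> (g m) (u m)) - hip K (\<rho> (g l) (u l)) (\<rho> (\<lambda>x. k x * g m x) (u m))"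
      using ip_rep_diff[OF Cc_scale[OF g] kC u rep_closed[OF g u]] ip_rep_scale[OF g u rep_closed[OF g u]] by simp
    finally show ?thesis .
  qed
  have "0 \<le> Re (\<Sum>l\<in>J. \<Sum>m\<in>J. cnj 1 * 1 * hip K (\<rho> (\<lambda>x. b x * g l x) (u l)) (\<rho> (\<lambda>x. b x * g m x) (u m)))"
    by (rule K.lincomb_positive[OF J]) (intro rep_closed bC u)
  also have "(\<Sum>l\<in>J. \<Sum>m\<in>J. cnj 1 * 1 * hip K (\<rho> (\<lambda>x. b x * g l x) (u l)) (\<rho> (\<lambda>x. b x * g m x) (u m)))
    = complex_of_real ((sn \<xi>)\<^sup>2) * (\<Sum>l\<in>J. \<Sum>m\<in>J. hip K (\<rho> (g l) (u l)) (\<rho> (g m) (u m))) - (\<Sum>l\<in>J. \<Sum>m\<in>J. hip K (\<rho> (g l) (u l)) (\<rho> (\<lambda>x. k x * g m x) (u m)))"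
    unfolding eq by (simp add: sum_subtractf sum_distrib_left)
  finally show ?thesis unfolding k_def by (simp del: of_real_power)
qed

context
  fixes \<xi> \<eta> :: "'g \<Rightarrow> 'h" and f :: "nat \<Rightarrow> nat \<Rightarrow> 'g \<Rightarrow> complex" and n :: nat and M :: real
  assumes \<xi>: "\<xi> \<in> bs" and \<eta>: "\<eta> \<in> bs" and f: "\<And>i j. f i j \<in> Cc" and M: "0 \<le> M"
    and bound: "\<And>(K' :: 'g cyclic_point hilbert) \<sigma> y. \<lbrakk>Cc_representation G lam K' \<sigma>; \<And>j. j < n \<Longrightarrow> y j \<in> hcar K'\<rbrakk> \<Longrightarrow>
      L2_set (\<lambda>i. hnorm K' (hsum K' (\<lambda>j. \<sigma> (f i j) (y j)) n)) {..<n} \<le> M * L2_set (\<lambda>j. hnorm K' (y j)) {..<n}"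
begin

text \<open>One GNS space has to contain all entries of both columns, tensored with
  \<open>\<xi>\<close> and \<open>\<eta>\<close> respectively. There the form is an inner product of
  the column \<open>ov True\<close> with the matrix \<open>T.\<sigma> (f i j)\<close> applied to
  \<open>ov False\<close>. Cauchy-Schwarz finishes, with \<open>bound\<close> for the matrix; it
  applies because the completion has points of type \<open>cyclic_point\<close>.\<close>

lemma multiplier_form_bound_range:
  assumes gv: "\<And>j l. gv j l \<in> Cc" and gw: "\<And>j l. gw j l \<in> Cc" and vv: "\<And>l. vv l \<in> hcar K" and ww: "\<And>l. ww l \<in> hcar K"
    and v: "v = (\<lambda>j. hsum K (\<lambda>l. \<rho> (gv j l) (vv l)) n)" and w: "w = (\<lambda>j. hsum K (\<lambda>l. \<rho> (gw j l) (ww l)) n)"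
  shows "cmod (\<Sum>i<n. \<Sum>j<n. hip K (w i) (\<rho> (\<lambda>x. coefficient G H L \<xi> \<eta> x * f i j x) (v j)))
     \<le> (sn \<xi> * sn \<eta> * M) * (L2_set (\<lambda>i. hnorm K (w i)) {..<n} * L2_set (\<lambda>i. hnorm K (v i)) {..<n})"
proof -
  \<comment> \<open>The Boolean selects the section, \<open>True\<close> for \<open>\<eta>\<close>
    and \<open>False\<close> for \<open>\<xi>\<close>; then come the position in the column and the
    summand of the vector at that position.\<close>
  define S where "S = (UNIV :: bool set) \<times> {..<n} \<times> {..<n}"
  have memS: "(c, i, l) \<in> S" if "i < n" "l < n" for c i l using that by (simp add: S_def)
  define \<zeta> where "\<zeta> s = (if fst s then \<eta> else \<xi>)" for s :: "bool \<times> nat \<times> nat"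
  define g where "g s = (if fst s then gw (fst (snd s)) (snd (snd s)) else gv (fst (snd s)) (snd (snd s)))" for s :: "bool \<times> nat \<times> nat"
  define u where "u s = (if fst s then ww (snd (snd s)) else vv (snd (snd s)))" for s :: "bool \<times> nat \<times> nat"
  interpret T: tensor_data G lam H \<Gamma> L K \<rho> S \<zeta> g u
    by unfold_locales (auto simp: S_def \<zeta>_def g_def u_def \<xi> \<eta> gv gw vv ww)
  interpret C: hilbert_space T.Q.completed by (rule T.Q.hilbert_space_K)
  \<comment> \<open>The tensor of the selected section with the whole vector at position
    \<open>i\<close>, summed over its presentation.\<close>
  define ov where "ov c i = hsum T.Q.completed (\<lambda>l. T.\<omega> (c, i, l)) n" for c i
  have oc: "ov c i \<in> hcar T.Q.completed" for c i unfolding ov_def by (intro C.hsum_closed T.\<omega>_closed)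
  have rc: "F \<in> Cc \<Longrightarrow> y \<in> hcar T.Q.completed \<Longrightarrow> T.\<sigma> F y \<in> hcar T.Q.completed" for F y
    by (rule C.opD(1)[OF T.\<sigma>_bounded])
  \<comment> \<open>The section depends on the Boolean alone; the zeros in
    \<open>\<zeta> (c, 0, 0)\<close> are placeholders.\<close>
  have norm_o: "(hnorm T.Q.completed (ov c i))\<^sup>2 \<le> (sn (\<zeta> (c, 0, 0)))\<^sup>2 * (hnorm K (hsum K (\<lambda>l. \<rho> (g (c, i, l)) (u (c, i, l))) n))\<^sup>2"
    if i: "i < n" for c i
  proof -
    have "(hnorm T.Q.completed (ov c i))\<^sup>2 = Re (hip T.Q.completed (ov c i) (ov c i))" by (rule C.norm_sq[OF oc])
    also have "hip T.Q.completed (ov c i) (ov c i) = (\<Sum>l<n. \<Sum>m<n. hip T.Q.completed (T.\<omega> (c, i, l)) (T.\<omega> (c, i, m)))"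
      unfolding ov_def by (rule C.ip_hsum_hsum) (rule T.\<omega>_closed)+
    also have "\<dots> = (\<Sum>l<n. \<Sum>m<n. hip K (\<rho> (g (c, i, l)) (u (c, i, l))) (\<rho> (\<lambda>x. hip (H (rng G x)) (\<zeta> (c, 0, 0) (rng G x)) (\<zeta> (c, 0, 0) (rng G x)) * g (c, i, m) x) (u (c, i, m))))"
      using i by (intro sum.cong refl) (simp add: T.tensor_ip_\<omega> memS T.D_def T.v_def T.\<kappa>_def \<zeta>_def)
    also have "Re \<dots> \<le> (sn (\<zeta> (c, 0, 0)))\<^sup>2 * Re (\<Sum>l<n. \<Sum>m<n. hip K (\<rho> (g (c, i, l)) (u (c, i, l))) (\<rho> (g (c, i, m)) (u (c, i, m))))"
      by (rule multiplier_norm_bound) (auto intro: T.\<zeta> T.g T.v')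
    also have "(\<Sum>l<n. \<Sum>m<n. hip K (\<rho> (g (c, i, l)) (u (c, i, l))) (\<rho> (g (c, i, m)) (u (c, i, m))))
      = hip K (hsum K (\<lambda>l. \<rho> (g (c, i, l)) (u (c, i, l))) n) (hsum K (\<lambda>l. \<rho> (g (c, i, l)) (u (c, i, l))) n)"
      by (rule K.ip_hsum_hsum[symmetric]) (intro rep_closed T.g T.v')+
    also have "Re \<dots> = (hnorm K (hsum K (\<lambda>l. \<rho> (g (c, i, l)) (u (c, i, l))) n))\<^sup>2"
      by (intro K.norm_sq[symmetric] K.hsum_closed rep_closed T.g T.v')
    finally show ?thesis .
  qed
  have L2o: "L2_set (\<lambda>i. hnorm T.Q.completed (ov c i)) {..<n} \<le> sn (\<zeta> (c, 0, 0)) * L2_set (\<lambda>i. hnorm K (hsum K (\<lambda>l. \<rho> (g (c, i, l)) (u (c, i, l))) n)) {..<n}" for c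
  proof (rule power2_le_imp_le)
    have "(\<Sum>i<n. (hnorm T.Q.completed (ov c i))\<^sup>2) \<le> (\<Sum>i<n. (sn (\<zeta> (c, 0, 0)))\<^sup>2 * (hnorm K (hsum K (\<lambda>l. \<rho> (g (c, i, l)) (u (c, i, l))) n))\<^sup>2)"
      using norm_o by (intro sum_mono) auto
    then show "(L2_set (\<lambda>i. hnorm T.Q.completed (ov c i)) {..<n})\<^sup>2 \<le> (sn (\<zeta> (c, 0, 0)) * L2_set (\<lambda>i. hnorm K (hsum K (\<lambda>l. \<rho> (g (c, i, l)) (u (c, i, l))) n)) {..<n})\<^sup>2"
      by (simp add: L2_set_sq power_mult_distrib sum_distrib_left)
    show "0 \<le> sn (\<zeta> (c, 0, 0)) * L2_set (\<lambda>i. hnorm K (hsum K (\<lambda>l. \<rho> (g (c, i, l)) (u (c, i, l))) n)) {..<n}"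
      using T.\<zeta> by (intro mult_nonneg_nonneg sn_nonneg L2_set_nonneg)
  qed
  have \<phi>C: "(\<lambda>x. coefficient G H L \<xi> \<eta> x * f i j x) \<in> Cc" for i j
    by (intro Cc_mult f continuous_coefficient \<xi> \<eta>)
  have "hip K (w i) (\<rho> (\<lambda>x. coefficient G H L \<xi> \<eta> x * f i j x) (v j)) = hip T.Q.completed (ov True i) (T.\<sigma> (f i j) (ov False j))"
    if i: "i < n" and j: "j < n" for i j
  proof -
    have "\<rho> (\<lambda>x. coefficient G H L \<xi> \<eta> x * f i j x) (v j) = hsum K (\<lambda>m. \<rho> (\<lambda>x. coefficient G H L \<xi> \<eta> x * f i j x) (\<rho> (gv j m) (vv m))) n"
      unfolding v by (rule K.op_hsum[OF rep_bounded[OF \<phi>C]]) (intro rep_closed gv vv)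
    then have "hip K (w i) (\<rho> (\<lambda>x. coefficient G H L \<xi> \<eta> x * f i j x) (v j))
      = (\<Sum>l<n. \<Sum>m<n. hip K (\<rho> (gw i l) (ww l)) (\<rho> (\<lambda>x. coefficient G H L \<xi> \<eta> x * f i j x) (\<rho> (gv j m) (vv m))))"
      unfolding w by (simp only:) (rule K.ip_hsum_hsum; intro rep_closed \<phi>C gv gw vv ww)
    also have "\<dots> = (\<Sum>l<n. \<Sum>m<n. hip T.Q.completed (T.\<omega> (True, i, l)) (T.\<sigma> (f i j) (T.\<omega> (False, j, m))))"
      using i j by (intro sum.cong refl) (simp add: T.tensor_ip_\<sigma>_\<omega> memS f T.v_def T.\<phi>_def \<zeta>_def g_def u_def)
    also have "\<dots> = hip T.Q.completed (ov True i) (hsum T.Q.completed (\<lambda>m. T.\<sigma> (f i j) (T.\<omega> (False, j, m))) n)"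
      unfolding ov_def by (rule C.ip_hsum_hsum[symmetric]) (intro rc f T.\<omega>_closed)+
    also have "hsum T.Q.completed (\<lambda>m. T.\<sigma> (f i j) (T.\<omega> (False, j, m))) n = T.\<sigma> (f i j) (ov False j)"
      unfolding ov_def by (rule C.op_hsum[OF T.\<sigma>_bounded[OF f], symmetric]) (rule T.\<omega>_closed)
    finally show ?thesis .
  qed
  then have "(\<Sum>i<n. \<Sum>j<n. hip K (w i) (\<rho> (\<lambda>x. coefficient G H L \<xi> \<eta> x * f i j x) (v j)))
    = (\<Sum>i<n. \<Sum>j<n. hip T.Q.completed (ov True i) (T.\<sigma> (f i j) (ov False j)))"
    by (intro sum.cong refl) auto
  also have "\<dots> = (\<Sum>i<n. hip T.Q.completed (ov True i) (hsum T.Q.completed (\<lambda>j. T.\<sigma> (f i j) (ov False j)) n))"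
    by (simp add: C.ip_hsum oc rc f)
  finally have eqn: "(\<Sum>i<n. \<Sum>j<n. hip K (w i) (\<rho> (\<lambda>x. coefficient G H L \<xi> \<eta> x * f i j x) (v j)))
    = (\<Sum>i<n. hip T.Q.completed (ov True i) (hsum T.Q.completed (\<lambda>j. T.\<sigma> (f i j) (ov False j)) n))" .
  have "cmod (\<Sum>i<n. \<Sum>j<n. hip K (w i) (\<rho> (\<lambda>x. coefficient G H L \<xi> \<eta> x * f i j x) (v j))) \<le> L2_set (\<lambda>i. hnorm T.Q.completed (ov True i)) {..<n} * L2_set (\<lambda>i. hnorm T.Q.completed (hsum T.Q.completed (\<lambda>j. T.\<sigma> (f i j) (ov False j)) n)) {..<n}"
    unfolding eqn by (rule C.ip_sum_bound) (intro oc C.hsum_closed rc f)+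
  also have "\<dots> \<le> (sn \<eta> * L2_set (\<lambda>i. hnorm K (w i)) {..<n}) * (M * (sn \<xi> * L2_set (\<lambda>i. hnorm K (v i)) {..<n}))"
  proof (rule mult_mono)
    show "L2_set (\<lambda>i. hnorm T.Q.completed (ov True i)) {..<n} \<le> sn \<eta> * L2_set (\<lambda>i. hnorm K (w i)) {..<n}"
      using L2o[of True] by (simp add: \<zeta>_def g_def u_def w)
    have "L2_set (\<lambda>i. hnorm T.Q.completed (hsum T.Q.completed (\<lambda>j. T.\<sigma> (f i j) (ov False j)) n)) {..<n} \<le> M * L2_set (\<lambda>i. hnorm T.Q.completed (ov False i)) {..<n}"
      by (rule bound[OF T.\<sigma>_representation oc])
    also have "\<dots> \<le> M * (sn \<xi> * L2_set (\<lambda>i. hnorm K (v i)) {..<n})"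
      using L2o[of False] M by (intro mult_left_mono) (simp_all add: \<zeta>_def g_def u_def v)
    finally show "L2_set (\<lambda>i. hnorm T.Q.completed (hsum T.Q.completed (\<lambda>j. T.\<sigma> (f i j) (ov False j)) n)) {..<n} \<le> M * (sn \<xi> * L2_set (\<lambda>i. hnorm K (v i)) {..<n})" .
  qed (use \<eta> in \<open>auto intro!: mult_nonneg_nonneg sn_nonneg L2_set_nonneg\<close>)
  finally show ?thesis by (simp add: ac_simps)
qed

text \<open>
  The previous bound only concerns vectors in the span of the range of \<open>\<rho>\<close>. For a matrix
  operator \<open>A\<close>, both \<open>A v\<close> and \<open>A\<^sup>* A v\<close> are of this form, so that
  \<open>\<parallel>A\<^sup>* A v\<parallel>\<^sup>2 = \<langle>A A\<^sup>* A v, A v\<rangle>\<close> and \<open>\<parallel>A v\<parallel>\<^sup>2 = \<langle>v, A\<^sup>* A v\<rangle>\<close> give the general case.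
\<close>

lemma multiplier_bound:
  assumes v: "\<And>j. v j \<in> hcar K"
  shows "L2_set (\<lambda>i. hnorm K (hsum K (\<lambda>j. \<rho> (\<lambda>x. coefficient G H L \<xi> \<eta> x * f i j x) (v j)) n)) {..<n}
     \<le> (sn \<xi> * sn \<eta> * M) * L2_set (\<lambda>j. hnorm K (v j)) {..<n}"
proof -
  define F where "F i j = (\<lambda>x. coefficient G H L \<xi> \<eta> x * f i j x)" for i j
  have FC: "F i j \<in> Cc" for i j unfolding F_def by (intro Cc_mult f continuous_coefficient \<xi> \<eta>)
  have stC: "st (F i j) \<in> Cc" for i j by (intro Cc_involution FC)
  define y where "y i = hsum K (\<lambda>j. \<rho> (F i j) (v j)) n" for i
  have yc: "y i \<in> hcar K" for i unfolding y_def by (intro K.hsum_closed rep_closed FC v)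
  define z where "z j = hsum K (\<lambda>i. \<rho> (st (F i j)) (y i)) n" for j
  have zc: "z j \<in> hcar K" for j unfolding z_def by (intro K.hsum_closed rep_closed stC yc)
  let ?B = "sn \<xi> * sn \<eta> * M"
  let ?v = "L2_set (\<lambda>i. hnorm K (v i)) {..<n}"
  let ?y = "L2_set (\<lambda>i. hnorm K (y i)) {..<n}"
  let ?z = "L2_set (\<lambda>i. hnorm K (z i)) {..<n}"
  have B: "0 \<le> ?B" using \<xi> \<eta> M by (intro mult_nonneg_nonneg sn_nonneg)
  have sq: "complex_of_real ((L2_set (\<lambda>i. hnorm K (x i)) {..<n})\<^sup>2) = (\<Sum>i<n. hip K (x i) (x i))" if "\<And>i. x i \<in> hcar K" for x
    using that by (simp add: L2_set_sq K.ip_self)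
  have adj: "hip K (\<rho> (st (F i j)) a) b = hip K a (\<rho> (F i j) b)" if "a \<in> hcar K" "b \<in> hcar K" for i j a b
    using rep_adj[OF stC that] by (simp add: st_st)
  have "?z\<^sup>2 \<le> ?B * (?y * ?z)"
  proof -
    have "(\<Sum>j<n. hip K (z j) (z j)) = (\<Sum>j<n. \<Sum>i<n. hip K (\<rho> (st (F i j)) (y i)) (z j))"
    proof (intro sum.cong refl)
      fix j
      show "hip K (z j) (z j) = (\<Sum>i<n. hip K (\<rho> (st (F i j)) (y i)) (z j))"
        unfolding z_def[of j] by (rule K.ip_hsum_left) (intro K.hsum_closed rep_closed stC yc)+
    qed
    also have "\<dots> = (\<Sum>j<n. \<Sum>i<n. hip K (y i) (\<rho> (F i j) (z j)))"
      by (simp add: adj yc zc)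
    also have "\<dots> = (\<Sum>i<n. \<Sum>j<n. hip K (y i) (\<rho> (F i j) (z j)))" by (rule sum.swap)
    finally have "complex_of_real (?z\<^sup>2) = (\<Sum>i<n. \<Sum>j<n. hip K (y i) (\<rho> (F i j) (z j)))" using sq[OF zc] by simp
    moreover have "cmod (\<Sum>i<n. \<Sum>j<n. hip K (y i) (\<rho> (F i j) (z j))) \<le> ?B * (?y * ?z)"
      unfolding F_def
    proof (rule multiplier_form_bound_range[where gv = "\<lambda>j i. st (F i j)" and gw = F and vv = y and ww = v])
      show "z = (\<lambda>j. hsum K (\<lambda>l. \<rho> (st (F l j)) (y l)) n)" by (simp add: z_def fun_eq_iff)
      show "y = (\<lambda>j. hsum K (\<lambda>l. \<rho> (F j l) (v l)) n)" by (simp add: y_def fun_eq_iff)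
    qed (simp_all add: stC FC yc v)
    ultimately show ?thesis by (metis abs_of_nonneg norm_of_real zero_le_power2)
  qed
  then have zy: "?z \<le> ?B * ?y"
    using B by (cases "?z = 0") (auto simp: power2_eq_square mult.assoc[symmetric] L2_set_nonneg less_le intro: mult_nonneg_nonneg)
  have "?y\<^sup>2 \<le> ?z * ?v"
  proof -
    have "(\<Sum>i<n. hip K (y i) (y i)) = (\<Sum>i<n. \<Sum>j<n. hip K (y i) (\<rho> (F i j) (v j)))"
    proof (intro sum.cong refl)
      fix i
      have "hip K (y i) (hsum K (\<lambda>j. \<rho> (F i j) (v j)) n) = (\<Sum>j<n. hip K (y i) (\<rho> (F i j) (v j)))"
        by (rule K.ip_hsum) (intro rep_closed FC v yc)+
      then show "hip K (y i) (y i) = (\<Sum>j<n. hip K (y i) (\<rho> (F i j) (v j)))" by (simp add: y_def[of i, symmetric])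
    qed
    also have "\<dots> = (\<Sum>j<n. \<Sum>i<n. hip K (\<rho> (st (F i j)) (y i)) (v j))"
      by (subst sum.swap) (simp add: adj yc v)
    also have "\<dots> = (\<Sum>j<n. hip K (z j) (v j))"
      unfolding z_def by (intro sum.cong refl K.ip_hsum_left[symmetric] rep_closed stC yc v)
    finally have "complex_of_real (?y\<^sup>2) = (\<Sum>j<n. hip K (z j) (v j))" using sq[OF yc] by simp
    moreover have "cmod (\<Sum>j<n. hip K (z j) (v j)) \<le> ?z * ?v" by (rule K.ip_sum_bound) (rule zc v)+
    ultimately show ?thesis by (metis abs_of_nonneg norm_of_real zero_le_power2)
  qed
  also have "\<dots> \<le> (?B * ?y) * ?v" using zy by (intro mult_right_mono L2_set_nonneg)
  finally have "?y * ?y \<le> (?B * ?v) * ?y" by (simp add: power2_eq_square ac_simps)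
  then have "?y \<le> ?B * ?v"
    using B by (cases "?y = 0") (auto simp: L2_set_nonneg less_le intro: mult_nonneg_nonneg)
  then show ?thesis by (simp add: y_def F_def)
qed

end

end

section \<open>Extension to the groupoid algebra\<close>

lemma hsum_cong: "(\<And>i. i < n \<Longrightarrow> x i = y i) \<Longrightarrow> hsum H x n = hsum H y n"
  by (induction n) auto

lemma infsum_finite_sum:
  fixes f :: "'i \<Rightarrow> 'a \<Rightarrow> real"
  assumes "finite J" "\<And>j. j \<in> J \<Longrightarrow> f j summable_on A"
  shows "(\<lambda>x. \<Sum>j\<in>J. f j x) summable_on A" and "(\<Sum>\<^sub>\<infinity>x\<in>A. \<Sum>j\<in>J. f j x) = (\<Sum>j\<in>J. \<Sum>\<^sub>\<infinity>x\<in>A. f j x)"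
proof -
  have "(\<lambda>x. \<Sum>j\<in>J. f j x) summable_on A \<and> (\<Sum>\<^sub>\<infinity>x\<in>A. \<Sum>j\<in>J. f j x) = (\<Sum>j\<in>J. \<Sum>\<^sub>\<infinity>x\<in>A. f j x)"
    using assms by (induction J) (auto simp: infsum_add intro: summable_on_add)
  then show "(\<lambda>x. \<Sum>j\<in>J. f j x) summable_on A" and "(\<Sum>\<^sub>\<infinity>x\<in>A. \<Sum>j\<in>J. f j x) = (\<Sum>j\<in>J. \<Sum>\<^sub>\<infinity>x\<in>A. f j x)" by auto
qed

context hilbert_family
begin

lemma hsum_component: "i \<in> I \<Longrightarrow> hsum S x n i = hsum (H i) (\<lambda>j. x j i) n"
  by (induction n) (simp_all add: sum_simps)

definition inject :: "'i \<Rightarrow> 'h \<Rightarrow> 'i \<Rightarrow> 'h" where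
  "inject i v = (\<lambda>j\<in>I. if j = i then v else hzero (H j))"

lemma inject:
  assumes i: "i \<in> I" and v: "v \<in> hcar (H i)"
  shows inject_mem: "inject i v \<in> hcar S" and inject_norm: "hnorm S (inject i v) = hnorm (H i) v"
    and inject_component: "inject i v i = v"
proof -
  have z: "(hnorm (H j) (inject i v j))\<^sup>2 = 0" if "j \<in> I - {i}" for j
    using that by (simp add: inject_def pre_hilbert.norm_zero fibre_pre)
  have "(\<lambda>j. (hnorm (H j) (inject i v j))\<^sup>2) summable_on I"
    using summable_on_cong_neutral[of "{i}" I "\<lambda>j. (hnorm (H j) (inject i v j))\<^sup>2" "\<lambda>j. (hnorm (H j) (inject i v j))\<^sup>2"] z i by auto
  moreover have "inject i v \<in> (\<Pi>\<^sub>E j\<in>I. hcar (H j))"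
    using v by (auto simp: inject_def intro!: pre_hilbert.zero_closed[OF fibre_pre])
  ultimately show m: "inject i v \<in> hcar S" by (simp add: sum_mem)
  show "inject i v i = v" using i by (simp add: inject_def)
  have "(hnorm S (inject i v))\<^sup>2 = (\<Sum>\<^sub>\<infinity>j\<in>{i}. (hnorm (H j) (inject i v j))\<^sup>2)"
    unfolding sum_norm_sq[OF m] by (rule infsum_cong_neutral) (use z i in auto)
  then have "(hnorm S (inject i v))\<^sup>2 = (hnorm (H i) v)\<^sup>2" using i by (simp add: inject_def)
  then show "hnorm S (inject i v) = hnorm (H i) v"
    by (rule power2_eq_imp_eq) (use m v i in \<open>auto intro: pre_hilbert.norm_nonneg[OF sum_pre_hilbert] pre_hilbert.norm_nonneg[OF fibre_pre]\<close>)
qed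

end

context hilbert_space
begin

lemma op_sub_self_norm: "a \<in> bounded_ops H \<Longrightarrow> op_norm H (op_sub H a a) = 0"
proof -
  assume a: "a \<in> bounded_ops H"
  have "op_norm H (op_sub H a a) \<le> 0"
    using a by (intro op_norm_le) (auto simp: op_sub_apply sub_self opD norm_zero)
  then show ?thesis using op_norm_nonneg[OF op_sub_closed[OF a a]] by simp
qed

lemma op_eq_if_norm_sub_zero:
  assumes "a \<in> bounded_ops H" "b \<in> bounded_ops H" "op_norm H (op_sub H a b) \<le> 0"
  shows "a = b"
proof (rule op_ext[OF assms(1,2)])
  fix x assume x: "x \<in> hcar H"
  have "hdist H (a x) (b x) \<le> op_norm H (op_sub H a b) * hnorm H x" by (rule op_norm_sub_bound[OF assms(1,2) x])
  also have "\<dots> \<le> 0" using assms(3) x by (simp add: mult_nonpos_nonneg)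
  finally have "hdist H (a x) (b x) = 0"
    using dist_nonneg[OF opD(1)[OF assms(1) x] opD(1)[OF assms(2) x]] by linarith
  then show "a x = b x" by (rule eq_if_dist_zero[OF opD(1)[OF assms(1) x] opD(1)[OF assms(2) x]])
qed

lemma hsum_one: "x 0 \<in> hcar H \<Longrightarrow> hsum H x 1 = x 0"
  using add_commute[of "hzero H" "x 0"] by (simp add: closed add_zero)

text \<open>Lets the operator norm estimate be read off from the matrix estimate for size 1.\<close>

lemma matrix_norm_one:
  assumes a: "a \<in> bounded_ops H"
  shows "matrix_norm H 1 (\<lambda>_ _. a) = op_norm H a"
proof (rule antisym)
  show "matrix_norm H 1 (\<lambda>_ _. a) \<le> op_norm H a"
  proof (rule matrix_norm_le)
    fix x :: "nat \<Rightarrow> 'h" assume "\<And>j. j < 1 \<Longrightarrow> x j \<in> hcar H"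
    then have x: "x 0 \<in> hcar H" by simp
    have "(hnorm H (a (x 0)))\<^sup>2 \<le> (op_norm H a * hnorm H (x 0))\<^sup>2"
      by (rule power_mono[OF op_norm_bound[OF a x] norm_nonneg[OF opD(1)[OF a x]]])
    then show "(\<Sum>i<(1::nat). (hnorm H (hsum H (\<lambda>j. a (x j)) 1))\<^sup>2) \<le> (op_norm H a)\<^sup>2 * (\<Sum>j<1. (hnorm H (x j))\<^sup>2)"
      using a x hsum_one[of "\<lambda>j. a (x j)"] by (simp add: opD power_mult_distrib del: hsum.simps)
  qed (use a op_norm_nonneg in auto)
  show "op_norm H a \<le> matrix_norm H 1 (\<lambda>_ _. a)"
  proof (rule op_norm_le)
    fix x assume x: "x \<in> hcar H"
    have "(\<Sum>i<(1::nat). (hnorm H (hsum H (\<lambda>j. a x) 1))\<^sup>2) \<le> (matrix_norm H 1 (\<lambda>_ _. a))\<^sup>2 * (\<Sum>j<(1::nat). (hnorm H x)\<^sup>2)"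
      by (rule matrix_norm_bound[of 1 "\<lambda>_ _. a" "\<lambda>_. x"]) (rule a, rule x)
    then have "(hnorm H (a x))\<^sup>2 \<le> (matrix_norm H 1 (\<lambda>_ _. a) * hnorm H x)\<^sup>2"
      using a x hsum_one[of "\<lambda>j. a x"] by (simp add: opD power_mult_distrib del: hsum.simps)
    then show "hnorm H (a x) \<le> matrix_norm H 1 (\<lambda>_ _. a) * hnorm H x"
      by (rule power2_le_imp_le) (use a x matrix_norm_nonneg[of 1 "\<lambda>_ _. a"] in simp)
  qed (use a matrix_norm_nonneg[of 1 "\<lambda>_ _. a"] in simp)
qed

end

section \<open>The universal representation\<close>

context haar_groupoid
begin

abbreviation "U \<equiv> universal_space G lam"
abbreviation "\<pi> \<equiv> universal_rep G lam"

lemma Reps_rep: "R \<in> Reps G lam \<Longrightarrow> cc_rep G lam (fst R) (snd R)"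
  by unfold_locales (auto simp: Reps_def)

lemma Reps_family: "hilbert_family (Reps G lam) fst"
  by (rule hilbert_family.intro) (auto simp: Reps_def Cc_representation_def)

lemma universal_hilbert_space: "hilbert_space U"
  unfolding universal_space_def by (rule hilbert_family.sum_hilbert_space[OF Reps_family])

lemma universal_component: "\<lbrakk>x \<in> hcar U; R \<in> Reps G lam\<rbrakk> \<Longrightarrow> x R \<in> hcar (fst R)"
  unfolding universal_space_def by (rule hilbert_family.component[OF Reps_family])

lemma universal_norm_sq: "x \<in> hcar U \<Longrightarrow> (hnorm U x)\<^sup>2 = (\<Sum>\<^sub>\<infinity>R\<in>Reps G lam. (hnorm (fst R) (x R))\<^sup>2)"
  unfolding universal_space_def by (rule hilbert_family.sum_norm_sq[OF Reps_family])

lemma universal_summable: "x \<in> hcar U \<Longrightarrow> (\<lambda>R. (hnorm (fst R) (x R))\<^sup>2) summable_on Reps G lam"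
  unfolding universal_space_def by (rule hilbert_family.norm_sq_summable[OF Reps_family])

lemma universal_simps:
  "hadd U x y = (\<lambda>R\<in>Reps G lam. hadd (fst R) (x R) (y R))"
  "hscale U c x = (\<lambda>R\<in>Reps G lam. hscale (fst R) c (x R))"
  unfolding universal_space_def by (rule hilbert_family.sum_simps[OF Reps_family])+

lemma universal_mem: "x \<in> hcar U \<longleftrightarrow> x \<in> (\<Pi>\<^sub>E R\<in>Reps G lam. hcar (fst R)) \<and> (\<lambda>R. (hnorm (fst R) (x R))\<^sup>2) summable_on Reps G lam"
  unfolding universal_space_def by (rule hilbert_family.sum_mem[OF Reps_family])

lemma \<pi>_component: "\<lbrakk>x \<in> hcar U; R \<in> Reps G lam\<rbrakk> \<Longrightarrow> \<pi> f x R = snd R f (x R)"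
  by (simp add: universal_rep_def)

text \<open>The bound by \<open>I f\<close> is the same in every summand, so it survives the Hilbert
  sum.\<close>

lemma \<pi>_mem_norm:
  assumes f: "f \<in> Cc" and x: "x \<in> hcar U"
  shows \<pi>_mem: "\<pi> f x \<in> hcar U" and \<pi>_norm: "hnorm U (\<pi> f x) \<le> I f * hnorm U x"
proof -
  interpret U: hilbert_space U by (rule universal_hilbert_space)
  have le: "(hnorm (fst R) (\<pi> f x R))\<^sup>2 \<le> (I f)\<^sup>2 * (hnorm (fst R) (x R))\<^sup>2" if R: "R \<in> Reps G lam" for R
  proof -
    interpret R: cc_rep G lam "fst R" "snd R" by (rule Reps_rep[OF R])
    have xR: "x R \<in> hcar (fst R)" by (rule universal_component[OF x R])
    have "(hnorm (fst R) (snd R f (x R)))\<^sup>2 \<le> (I f * hnorm (fst R) (x R))\<^sup>2"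
      using f xR by (intro power_mono R.rep_norm R.K.norm_nonneg R.rep_closed)
    then show ?thesis using x R by (simp add: \<pi>_component power_mult_distrib)
  qed
  have sm: "(\<lambda>R. (I f)\<^sup>2 * (hnorm (fst R) (x R))\<^sup>2) summable_on Reps G lam"
    by (intro summable_on_cmult_right universal_summable x)
  have sm': "(\<lambda>R. (hnorm (fst R) (\<pi> f x R))\<^sup>2) summable_on Reps G lam"
    by (rule summable_on_comparison_test[OF sm]) (use le in auto)
  have "\<pi> f x \<in> (\<Pi>\<^sub>E R\<in>Reps G lam. hcar (fst R))"
    using x f cc_rep.rep_closed[OF Reps_rep] universal_component by (auto simp: universal_rep_def)
  with sm' show m: "\<pi> f x \<in> hcar U" by (simp add: universal_mem)
  have "(hnorm U (\<pi> f x))\<^sup>2 \<le> (\<Sum>\<^sub>\<infinity>R\<in>Reps G lam. (I f)\<^sup>2 * (hnorm (fst R) (x R))\<^sup>2)"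
    unfolding universal_norm_sq[OF m] by (rule infsum_mono[OF sm' sm le])
  also have "\<dots> = (I f * hnorm U x)\<^sup>2"
    using x by (simp add: infsum_cmult_right' universal_norm_sq power_mult_distrib)
  finally show "hnorm U (\<pi> f x) \<le> I f * hnorm U x"
    by (rule power2_le_imp_le) (use f x in \<open>simp add: I_nonneg\<close>)
qed

lemma \<pi>_bounded: "f \<in> Cc \<Longrightarrow> \<pi> f \<in> bounded_ops U"
proof (rule hilbert_space.bounded_opsI[OF universal_hilbert_space])
  interpret U: hilbert_space U by (rule universal_hilbert_space)
  assume f: "f \<in> Cc"
  show "\<pi> f \<in> extensional (hcar U)" by (simp add: universal_rep_def)
  fix x assume x: "x \<in> hcar U"
  show "\<pi> f x \<in> hcar U" "hnorm U (\<pi> f x) \<le> I f * hnorm U x" using f x by (rule \<pi>_mem, rule \<pi>_norm)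
  have op: "snd R f \<in> bounded_ops (fst R)" "hilbert_space (fst R)" if "R \<in> Reps G lam" for R
    using f that by (auto simp: Reps_def Cc_representation_def)
  show "\<pi> f (hscale U c x) = hscale U c (\<pi> f x)" for c
    using x op hilbert_space.opD(3)[OF op(2,1)] universal_component[OF x] U.scale_closed[OF x]
    by (auto simp: universal_rep_def universal_simps fun_eq_iff)
  fix y assume y: "y \<in> hcar U"
  show "\<pi> f (hadd U x y) = hadd U (\<pi> f x) (\<pi> f y)"
    using x y op hilbert_space.opD(2)[OF op(2,1)] universal_component[OF x] universal_component[OF y] U.add_closed[OF x y]
    by (auto simp: universal_rep_def universal_simps fun_eq_iff)
qed

lemma \<pi>_add: "\<lbrakk>f \<in> Cc; g \<in> Cc\<rbrakk> \<Longrightarrow> \<pi> (\<lambda>x. f x + g x) = op_add U (\<pi> f) (\<pi> g)"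
  using cc_rep.rep_add[OF Reps_rep] universal_component
  by (auto simp: fun_eq_iff op_add_def universal_simps universal_rep_def restrict_def)

lemma \<pi>_scale: "f \<in> Cc \<Longrightarrow> \<pi> (\<lambda>x. c * f x) = op_scale U c (\<pi> f)"
  using cc_rep.rep_scale[OF Reps_rep] universal_component
  by (auto simp: fun_eq_iff op_scale_def universal_simps universal_rep_def restrict_def)

lemma \<pi>_sub: "\<lbrakk>f \<in> Cc; g \<in> Cc\<rbrakk> \<Longrightarrow> \<pi> (\<lambda>x. f x - g x) = op_sub U (\<pi> f) (\<pi> g)"
  using \<pi>_add[of f "\<lambda>x. -1 * g x"] \<pi>_scale[of g "-1"] Cc_scale[of g "-1"] by (simp add: op_sub_def)

text \<open>Every representation on a space of this type is a summand of the universal one: a column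
  is embedded by \<open>inject\<close>, and the component of the result has at most the norm of the
  whole. This is where the choice of the type of points pays off.\<close>

lemma representation_matrix_bound:
  fixes K :: "'g cyclic_point hilbert"
  assumes f: "\<And>i j. f i j \<in> Cc" and rep: "Cc_representation G lam K \<sigma>" and y: "\<And>j. j < n \<Longrightarrow> y j \<in> hcar K"
  shows "L2_set (\<lambda>i. hnorm K (hsum K (\<lambda>j. \<sigma> (f i j) (y j)) n)) {..<n}
    \<le> matrix_norm U n (\<lambda>i j. \<pi> (f i j)) * L2_set (\<lambda>j. hnorm K (y j)) {..<n}"
proof -
  interpret U: hilbert_space U by (rule universal_hilbert_space)
  interpret F: hilbert_family "Reps G lam" fst by (rule Reps_family)
  define R where "R = (K, \<sigma>)"
  have R: "R \<in> Reps G lam" "fst R = K" "snd R = \<sigma>" using rep by (auto simp: R_def Reps_def)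
  note inj = F.inject[OF R(1), unfolded R(2), folded universal_space_def]
  define x where "x j = F.inject R (y j)" for j
  have x: "x j \<in> hcar U" "hnorm U (x j) = hnorm K (y j)" "x j R = y j" if "j < n" for j
    using inj[OF y[OF that]] by (auto simp: x_def)
  let ?N = "matrix_norm U n (\<lambda>i j. \<pi> (f i j))"
  have hc: "hsum U (\<lambda>j. \<pi> (f i j) (x j)) n \<in> hcar U" for i
    by (intro U.hsum_closed \<pi>_mem f x)
  have "hnorm K (hsum K (\<lambda>j. \<sigma> (f i j) (y j)) n) \<le> hnorm U (hsum U (\<lambda>j. \<pi> (f i j) (x j)) n)" for i
  proof -
    have "hsum U (\<lambda>j. \<pi> (f i j) (x j)) n R = hsum K (\<lambda>j. \<pi> (f i j) (x j) R) n"
      unfolding universal_space_def using F.hsum_component[OF R(1)] R(2) by simp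
    also have "\<dots> = hsum K (\<lambda>j. \<sigma> (f i j) (y j)) n"
      by (rule hsum_cong) (simp add: \<pi>_component x R)
    finally show ?thesis
      using F.component_norm_le[folded universal_space_def, OF hc[of i] R(1)] R(2) by simp
  qed
  then have "(\<Sum>i<n. (hnorm K (hsum K (\<lambda>j. \<sigma> (f i j) (y j)) n))\<^sup>2) \<le> (\<Sum>i<n. (hnorm U (hsum U (\<lambda>j. \<pi> (f i j) (x j)) n))\<^sup>2)"
    using rep f y cc_rep.rep_closed[OF Reps_rep[OF R(1)]] R
    by (intro sum_mono power_mono pre_hilbert.norm_nonneg pre_hilbert.hsum_closed hilbert_space.pre_hilbert) (auto simp: Cc_representation_def)
  also have "\<dots> \<le> ?N\<^sup>2 * (\<Sum>j<n. (hnorm U (x j))\<^sup>2)"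
    by (rule U.matrix_norm_bound) (intro \<pi>_bounded f x)+
  also have "\<dots> = ?N\<^sup>2 * (\<Sum>j<n. (hnorm K (y j))\<^sup>2)" using x by simp
  finally have "(L2_set (\<lambda>i. hnorm K (hsum K (\<lambda>j. \<sigma> (f i j) (y j)) n)) {..<n})\<^sup>2 \<le> (?N * L2_set (\<lambda>j. hnorm K (y j)) {..<n})\<^sup>2"
    by (simp add: L2_set_sq power_mult_distrib)
  then show ?thesis
    by (rule power2_le_imp_le) (intro mult_nonneg_nonneg L2_set_nonneg U.matrix_norm_nonneg \<pi>_bounded f)
qed

end

section \<open>The multiplier on the closure of the convolution algebra\<close>

context bundle_groupoid
begin

text \<open>The estimate holds in every summand with the same constant, the universal matrix norm
  serving as \<open>M\<close>; squared norms are then added over all summands.\<close>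

lemma multiplier_matrix_norm:
  assumes \<xi>: "\<xi> \<in> bs" and \<eta>: "\<eta> \<in> bs" and f: "\<And>i j. f i j \<in> Cc"
  shows "matrix_norm U n (\<lambda>i j. \<pi> (\<lambda>x. coefficient G H L \<xi> \<eta> x * f i j x)) \<le> sn \<xi> * sn \<eta> * matrix_norm U n (\<lambda>i j. \<pi> (f i j))"
proof -
  interpret U: hilbert_space U by (rule universal_hilbert_space)
  interpret F: hilbert_family "Reps G lam" fst by (rule Reps_family)
  let ?N = "matrix_norm U n (\<lambda>i j. \<pi> (f i j))"
  let ?B = "sn \<xi> * sn \<eta> * ?N"
  have N: "0 \<le> ?N" by (intro U.matrix_norm_nonneg \<pi>_bounded f)
  have B: "0 \<le> ?B" using \<xi> \<eta> N by (intro mult_nonneg_nonneg sn_nonneg)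
  define F where "F i j = (\<lambda>x. coefficient G H L \<xi> \<eta> x * f i j x)" for i j
  have FC: "F i j \<in> Cc" for i j unfolding F_def by (intro Cc_mult f continuous_coefficient \<xi> \<eta>)
  have "matrix_norm U n (\<lambda>i j. \<pi> (F i j)) \<le> ?B"
  proof (rule U.matrix_norm_le[OF \<pi>_bounded[OF FC] _ B])
    fix x :: "nat \<Rightarrow> 'g rep \<Rightarrow> 'g cyclic_point"
    assume x: "\<And>j. j < n \<Longrightarrow> x j \<in> hcar U"
    have hc: "hsum U (\<lambda>j. \<pi> (F i j) (x j)) n \<in> hcar U" for i
      by (intro U.hsum_closed \<pi>_mem FC x)
    have comp: "hsum U (\<lambda>j. \<pi> (F i j) (x j)) n R = hsum (fst R) (\<lambda>j. snd R (F i j) (x j R)) n" if R: "R \<in> Reps G lam" for i R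
    proof -
      have "hsum U (\<lambda>j. \<pi> (F i j) (x j)) n R = hsum (fst R) (\<lambda>j. \<pi> (F i j) (x j) R) n"
        unfolding universal_space_def by (rule F.hsum_component[OF R])
      also have "\<dots> = hsum (fst R) (\<lambda>j. snd R (F i j) (x j R)) n" by (rule hsum_cong) (simp add: \<pi>_component x R)
      finally show ?thesis .
    qed
    have le: "(\<Sum>i<n. (hnorm (fst R) (hsum U (\<lambda>j. \<pi> (F i j) (x j)) n R))\<^sup>2) \<le> ?B\<^sup>2 * (\<Sum>j<n. (hnorm (fst R) (x j R))\<^sup>2)" if R: "R \<in> Reps G lam" for R
    proof -
      interpret cc_rep G lam "fst R" "snd R" by (rule Reps_rep[OF R])
      interpret bundle_rep G lam H \<Gamma> L "fst R" "snd R" ..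
      \<comment> \<open>\<open>multiplier_bound\<close> asks for vectors at all indices, so the
        column is continued by zero.\<close>
      define v where "v j = (if j < n then x j R else hzero (fst R))" for j
      have v: "v j \<in> hcar (fst R)" for j using universal_component[OF x R] by (simp add: v_def K.zero_closed)
      have "L2_set (\<lambda>i. hnorm (fst R) (hsum (fst R) (\<lambda>j. snd R (F i j) (v j)) n)) {..<n} \<le> ?B * L2_set (\<lambda>j. hnorm (fst R) (v j)) {..<n}"
        unfolding F_def
      proof (rule multiplier_bound[OF \<xi> \<eta> f N])
        fix K' :: "'g cyclic_point hilbert" and \<sigma> y
        assume "Cc_representation G lam K' \<sigma>" "\<And>j. j < n \<Longrightarrow> y j \<in> hcar K'"
        then show "L2_set (\<lambda>i. hnorm K' (hsum K' (\<lambda>j. \<sigma> (f i j) (y j)) n)) {..<n} \<le> ?N * L2_set (\<lambda>j. hnorm K' (y j)) {..<n}"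
          by (rule representation_matrix_bound[of f, OF f])
      qed (rule v)
      then have "(L2_set (\<lambda>i. hnorm (fst R) (hsum (fst R) (\<lambda>j. snd R (F i j) (v j)) n)) {..<n})\<^sup>2 \<le> (?B * L2_set (\<lambda>j. hnorm (fst R) (v j)) {..<n})\<^sup>2"
        by (rule power_mono) (rule L2_set_nonneg)
      moreover have "hsum (fst R) (\<lambda>j. snd R (F i j) (v j)) n = hsum U (\<lambda>j. \<pi> (F i j) (x j)) n R" for i
        unfolding comp[OF R] by (rule hsum_cong) (simp add: v_def)
      ultimately show ?thesis by (simp add: L2_set_sq power_mult_distrib v_def)
    qed
    have sx: "(\<lambda>R. (hnorm (fst R) (x j R))\<^sup>2) summable_on Reps G lam" if "j \<in> {..<n}" for j
      using that by (intro universal_summable x) simp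
    have sh: "(\<lambda>R. (hnorm (fst R) (hsum U (\<lambda>j. \<pi> (F i j) (x j)) n R))\<^sup>2) summable_on Reps G lam" for i
      by (intro universal_summable hc)
    have "(\<Sum>i<n. (hnorm U (hsum U (\<lambda>j. \<pi> (F i j) (x j)) n))\<^sup>2)
      = (\<Sum>\<^sub>\<infinity>R\<in>Reps G lam. \<Sum>i<n. (hnorm (fst R) (hsum U (\<lambda>j. \<pi> (F i j) (x j)) n R))\<^sup>2)"
      unfolding universal_norm_sq[OF hc] by (rule infsum_finite_sum(2)[symmetric]) (use sh in auto)
    also have "\<dots> \<le> (\<Sum>\<^sub>\<infinity>R\<in>Reps G lam. ?B\<^sup>2 * (\<Sum>j<n. (hnorm (fst R) (x j R))\<^sup>2))"
      by (rule infsum_mono[OF _ _ le]) (intro infsum_finite_sum(1) summable_on_cmult_right finite_lessThan sh sx)+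
    also have "\<dots> = ?B\<^sup>2 * (\<Sum>\<^sub>\<infinity>R\<in>Reps G lam. \<Sum>j<n. (hnorm (fst R) (x j R))\<^sup>2)" by (rule infsum_cmult_right')
    also have "(\<Sum>\<^sub>\<infinity>R\<in>Reps G lam. \<Sum>j<n. (hnorm (fst R) (x j R))\<^sup>2) = (\<Sum>j<n. \<Sum>\<^sub>\<infinity>R\<in>Reps G lam. (hnorm (fst R) (x j R))\<^sup>2)"
      by (rule infsum_finite_sum(2)) (use sx in auto)
    also have "\<dots> = (\<Sum>j<n. (hnorm U (x j))\<^sup>2)" using x by (simp add: universal_norm_sq)
    finally show "(\<Sum>i<n. (hnorm U (hsum U (\<lambda>j. \<pi> (F i j) (x j)) n))\<^sup>2) \<le> ?B\<^sup>2 * (\<Sum>j<n. (hnorm U (x j))\<^sup>2)" .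
  qed
  then show ?thesis by (simp add: F_def)
qed

context
  fixes \<xi> \<eta> :: "'g \<Rightarrow> 'h"
  assumes \<xi>: "\<xi> \<in> bs" and \<eta>: "\<eta> \<in> bs"
begin

definition mult_by :: "('g \<Rightarrow> complex) \<Rightarrow> 'g \<Rightarrow> complex" where
  "mult_by f = (\<lambda>x. coefficient G H L \<xi> \<eta> x * f x)"

interpretation U: hilbert_space U by (rule universal_hilbert_space)

abbreviation dst :: "(('g rep \<Rightarrow> 'g cyclic_point) \<Rightarrow> 'g rep \<Rightarrow> 'g cyclic_point) \<Rightarrow> (('g rep \<Rightarrow> 'g cyclic_point) \<Rightarrow> 'g rep \<Rightarrow> 'g cyclic_point) \<Rightarrow> real" where
  "dst a b \<equiv> op_norm U (op_sub U a b)"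

lemma mult_by_Cc: "f \<in> Cc \<Longrightarrow> mult_by f \<in> Cc"
  unfolding mult_by_def by (intro Cc_mult continuous_coefficient \<xi> \<eta>)

lemma mult_by_norm:
  assumes f: "f \<in> Cc"
  shows "op_norm U (\<pi> (mult_by f)) \<le> sn \<xi> * sn \<eta> * op_norm U (\<pi> f)"
  using multiplier_matrix_norm[OF \<xi> \<eta>, of "\<lambda>_ _. f" 1, folded mult_by_def] f
  unfolding U.matrix_norm_one[OF \<pi>_bounded[OF f]] U.matrix_norm_one[OF \<pi>_bounded[OF mult_by_Cc[OF f]]] by simp

lemma mult_by_dst:
  assumes "f \<in> Cc" "g \<in> Cc"
  shows "dst (\<pi> (mult_by f)) (\<pi> (mult_by g)) \<le> sn \<xi> * sn \<eta> * dst (\<pi> f) (\<pi> g)"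
proof -
  have "mult_by (\<lambda>x. f x - g x) = (\<lambda>x. mult_by f x - mult_by g x)" by (simp add: mult_by_def fun_eq_iff right_diff_distrib)
  then show ?thesis using mult_by_norm[OF Cc_diff[OF assms]] assms by (simp add: \<pi>_sub mult_by_Cc)
qed

text \<open>The closure of the graph of the multiplication map: one sequence in \<open>Cc\<close>
  witnesses that \<open>a\<close> is a limit and that its multiples converge to
  \<open>b\<close>.\<close>

definition approx :: "(('g rep \<Rightarrow> 'g cyclic_point) \<Rightarrow> 'g rep \<Rightarrow> 'g cyclic_point) \<Rightarrow> (('g rep \<Rightarrow> 'g cyclic_point) \<Rightarrow> 'g rep \<Rightarrow> 'g cyclic_point)
    \<Rightarrow> (nat \<Rightarrow> 'g \<Rightarrow> complex) \<Rightarrow> bool" where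
  "approx a b s \<longleftrightarrow> a \<in> bounded_ops U \<and> b \<in> bounded_ops U \<and> (\<forall>k. s k \<in> Cc)
     \<and> (\<lambda>k. dst a (\<pi> (s k))) \<longlonglongrightarrow> 0 \<and> (\<lambda>k. dst b (\<pi> (mult_by (s k)))) \<longlonglongrightarrow> 0"

lemma Cstar_bounded: "a \<in> Cstar G lam \<Longrightarrow> a \<in> bounded_ops U"
  by (simp add: Cstar_def op_closure_def)

lemma CstarI:
  assumes "a \<in> bounded_ops U" "\<And>k. s k \<in> Cc" "(\<lambda>k. dst a (\<pi> (s k))) \<longlonglongrightarrow> 0"
  shows "a \<in> Cstar G lam"
  unfolding Cstar_def op_closure_def
proof (intro CollectI conjI allI impI assms(1))
  fix e :: real assume "0 < e"
  then obtain k where "norm (dst a (\<pi> (s k)) - 0) < e" using LIMSEQ_D[OF assms(3)] by blast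
  then show "\<exists>b\<in>\<pi> ` Cc. op_norm U (op_add U a (op_scale U (- 1) b)) < e"
    using assms(2)[of k] by (intro bexI[of _ "\<pi> (s k)"]) (auto simp: op_sub_def)
qed

lemma approx_Cstar: "approx a b s \<Longrightarrow> b \<in> Cstar G lam"
  by (rule CstarI[of _ "\<lambda>k. mult_by (s k)"]) (auto simp: approx_def mult_by_Cc)

text \<open>The multiplication map is Lipschitz on the image of \<open>Cc\<close>, so it sends a
  sequence converging to \<open>a\<close> to a Cauchy sequence, which converges among the bounded
  operators.\<close>

lemma approx_exists:
  assumes a: "a \<in> Cstar G lam"
  shows "\<exists>b s. approx a b s"
proof -
  have ab: "a \<in> bounded_ops U" by (rule Cstar_bounded[OF a])
  have "\<exists>f\<in>Cc. dst a (\<pi> f) < 1 / real (Suc k)" for k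
    using a unfolding Cstar_def op_closure_def op_sub_def by simp
  then obtain s where s: "\<And>k. s k \<in> Cc" and sd: "\<And>k. dst a (\<pi> (s k)) < 1 / real (Suc k)" by metis
  have l0: "(\<lambda>k. 1 / real (Suc k)) \<longlonglongrightarrow> 0"
    using LIMSEQ_inverse_real_of_nat by (simp add: inverse_eq_divide)
  have lim: "(\<lambda>k. dst a (\<pi> (s k))) \<longlonglongrightarrow> 0"
  proof (rule Lim_null_comparison[OF always_eventually[OF allI] l0])
    show "norm (dst a (\<pi> (s k))) \<le> 1 / real (Suc k)" for k
      using sd[of k] U.op_norm_nonneg[OF U.op_sub_closed[OF ab \<pi>_bounded[OF s[of k]]]] by simp
  qed
  have C: "0 \<le> sn \<xi> * sn \<eta>" using \<xi> \<eta> by (intro mult_nonneg_nonneg sn_nonneg)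
  have "\<exists>b\<in>bounded_ops U. (\<lambda>k. dst (\<pi> (mult_by (s k))) b) \<longlonglongrightarrow> 0"
  proof (rule U.bounded_ops_complete)
    show "\<pi> (mult_by (s k)) \<in> bounded_ops U" for k by (intro \<pi>_bounded mult_by_Cc s)
    fix e :: real assume e: "0 < e"
    \<comment> \<open>Terms within \<open>d\<close> of \<open>a\<close> are within
      \<open>2 * d\<close> of each other; the added 1 covers a vanishing constant and makes the last
      inequality strict.\<close>
    define d where "d = e / (2 * (sn \<xi> * sn \<eta> + 1))"
    have d: "0 < d" using e C by (simp add: d_def)
    obtain N where N: "\<forall>k\<ge>N. norm (dst a (\<pi> (s k)) - 0) < d" using LIMSEQ_D[OF lim d] by blast
    have "dst (\<pi> (mult_by (s m))) (\<pi> (mult_by (s k))) < e" if "m \<ge> N" "k \<ge> N" for m k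
    proof -
      have "dst (\<pi> (s m)) (\<pi> (s k)) \<le> dst (\<pi> (s m)) a + dst a (\<pi> (s k))"
        by (intro U.op_norm_sub_triangle \<pi>_bounded s ab)
      also have "\<dots> = dst a (\<pi> (s m)) + dst a (\<pi> (s k))"
        using U.op_norm_sub_commute[OF ab \<pi>_bounded[OF s[of m]]] by simp
      also have "\<dots> \<le> d + d" using N that by (intro add_mono) (auto simp: less_imp_le abs_less_iff)
      finally have le: "dst (\<pi> (s m)) (\<pi> (s k)) \<le> 2 * d" by simp
      have "dst (\<pi> (mult_by (s m))) (\<pi> (mult_by (s k))) \<le> sn \<xi> * sn \<eta> * dst (\<pi> (s m)) (\<pi> (s k))"
        by (intro mult_by_dst s)
      also have "\<dots> \<le> sn \<xi> * sn \<eta> * (2 * d)" using le C by (rule mult_left_mono)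
      also have "\<dots> < (sn \<xi> * sn \<eta> + 1) * (2 * d)" using d by (simp add: distrib_right)
      also have "\<dots> = e"
      proof -
        have *: "c * (2 * (e / (2 * c))) = e" if "c \<noteq> 0" for c using that by simp
        show ?thesis unfolding d_def by (rule *) (use C in linarith)
      qed
      finally show ?thesis .
    qed
    then show "\<exists>N. \<forall>m\<ge>N. \<forall>k\<ge>N. dst (\<pi> (mult_by (s m))) (\<pi> (mult_by (s k))) < e" by blast
  qed
  then obtain b where b: "b \<in> bounded_ops U" "(\<lambda>k. dst (\<pi> (mult_by (s k))) b) \<longlonglongrightarrow> 0" by blast
  have "(\<lambda>k. dst b (\<pi> (mult_by (s k)))) \<longlonglongrightarrow> 0"
    using b U.op_norm_sub_commute[OF b(1) \<pi>_bounded[OF mult_by_Cc[OF s]]] by simp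
  then show ?thesis using ab b s lim unfolding approx_def by blast
qed

text \<open>The Lipschitz bound compares the two witnesses. Well-definedness on the image of
  \<open>Cc\<close> is included: functions with the same image under \<open>\<pi>\<close> have
  multiples with the same image.\<close>

lemma approx_unique:
  assumes "approx a b s" "approx a b' s'"
  shows "b = b'"
proof -
  note p = assms[unfolded approx_def]
  have "dst b b' \<le> dst b (\<pi> (mult_by (s k))) + sn \<xi> * sn \<eta> * (dst a (\<pi> (s k)) + dst a (\<pi> (s' k))) + dst b' (\<pi> (mult_by (s' k)))" for k
  proof -
    have C: "0 \<le> sn \<xi> * sn \<eta>" using \<xi> \<eta> by (intro mult_nonneg_nonneg sn_nonneg)
    have sC: "s k \<in> Cc" "s' k \<in> Cc" using p by auto
    have bd: "\<pi> (s k) \<in> bounded_ops U" "\<pi> (s' k) \<in> bounded_ops U" "\<pi> (mult_by (s k)) \<in> bounded_ops U" "\<pi> (mult_by (s' k)) \<in> bounded_ops U"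
      "a \<in> bounded_ops U" "b \<in> bounded_ops U" "b' \<in> bounded_ops U"
      using p by (auto intro: \<pi>_bounded mult_by_Cc)
    have "dst (\<pi> (s k)) (\<pi> (s' k)) \<le> dst a (\<pi> (s k)) + dst a (\<pi> (s' k))"
      using U.op_norm_sub_triangle[OF bd(1) bd(5) bd(2)] U.op_norm_sub_commute[OF bd(5) bd(1)] by simp
    then have "dst (\<pi> (mult_by (s k))) (\<pi> (mult_by (s' k))) \<le> sn \<xi> * sn \<eta> * (dst a (\<pi> (s k)) + dst a (\<pi> (s' k)))"
      by (intro order_trans[OF mult_by_dst[OF sC]] mult_left_mono C)
    then show ?thesis
      using U.op_norm_sub_triangle[OF bd(6) bd(3) bd(7)] U.op_norm_sub_triangle[OF bd(3) bd(4) bd(7)] U.op_norm_sub_commute[OF bd(7) bd(4)] by simp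
  qed
  moreover have "(\<lambda>k. dst b (\<pi> (mult_by (s k))) + sn \<xi> * sn \<eta> * (dst a (\<pi> (s k)) + dst a (\<pi> (s' k))) + dst b' (\<pi> (mult_by (s' k)))) \<longlonglongrightarrow> 0 + sn \<xi> * sn \<eta> * (0 + 0) + 0"
    using p by (intro tendsto_intros) auto
  ultimately have "dst b b' \<le> 0 + sn \<xi> * sn \<eta> * (0 + 0) + 0" by (intro LIMSEQ_le_const) blast+
  then show ?thesis using p by (intro U.op_eq_if_norm_sub_zero) auto
qed

lemma approx_\<pi>: "f \<in> Cc \<Longrightarrow> approx (\<pi> f) (\<pi> (mult_by f)) (\<lambda>_. f)"
  by (simp add: approx_def \<pi>_bounded mult_by_Cc U.op_sub_self_norm)

lemma approx_add:
  assumes "approx a b s" "approx a' b' s'"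
  shows "approx (op_add U a a') (op_add U b b') (\<lambda>k x. s k x + s' k x)"
proof -
  note p = assms[unfolded approx_def]
  have key: "(\<lambda>k. dst (op_add U c c') (\<pi> (\<lambda>x. t k x + t' k x))) \<longlonglongrightarrow> 0"
    if c: "c \<in> bounded_ops U" "c' \<in> bounded_ops U" and t: "\<And>k. t k \<in> Cc" "\<And>k. t' k \<in> Cc"
      and l: "(\<lambda>k. dst c (\<pi> (t k))) \<longlonglongrightarrow> 0" "(\<lambda>k. dst c' (\<pi> (t' k))) \<longlonglongrightarrow> 0" for c c' t t'
  proof (rule Lim_null_comparison[OF always_eventually[OF allI]])
    fix k
    have bd: "\<pi> (t k) \<in> bounded_ops U" "\<pi> (t' k) \<in> bounded_ops U" using t by (auto intro: \<pi>_bounded)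
    have "op_sub U (op_add U c c') (op_add U (\<pi> (t k)) (\<pi> (t' k))) = op_add U (op_sub U c (\<pi> (t k))) (op_sub U c' (\<pi> (t' k)))"
    proof (rule U.op_ext)
      fix x assume x: "x \<in> hcar U"
      show "op_sub U (op_add U c c') (op_add U (\<pi> (t k)) (\<pi> (t' k))) x = op_add U (op_sub U c (\<pi> (t k))) (op_sub U c' (\<pi> (t' k))) x"
        by (rule U.ip_ext) (use x c bd in \<open>auto simp: U.op_sub_apply U.op_add_apply U.opD U.closed U.ip_simps\<close>)
    qed (intro U.op_sub_closed U.op_add_closed c bd)+
    then show "norm (dst (op_add U c c') (\<pi> (\<lambda>x. t k x + t' k x))) \<le> dst c (\<pi> (t k)) + dst c' (\<pi> (t' k))"
      using c bd t by (simp add: \<pi>_add U.op_norm_triangle U.op_sub_closed U.op_norm_nonneg U.op_add_closed)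
  next
    show "(\<lambda>k. dst c (\<pi> (t k)) + dst c' (\<pi> (t' k))) \<longlonglongrightarrow> 0" using tendsto_add[OF l] by simp
  qed
  have "mult_by (\<lambda>x. s k x + s' k x) = (\<lambda>x. mult_by (s k) x + mult_by (s' k) x)" for k
    by (simp add: mult_by_def fun_eq_iff distrib_left)
  then show ?thesis unfolding approx_def
    using p key[of a a' s s'] key[of b b' "\<lambda>k. mult_by (s k)" "\<lambda>k. mult_by (s' k)"]
    by (auto simp: U.op_add_closed Cc_add mult_by_Cc)
qed

lemma approx_scale:
  assumes "approx a b s"
  shows "approx (op_scale U d a) (op_scale U d b) (\<lambda>k x. d * s k x)"
proof -
  note p = assms[unfolded approx_def]
  have key: "(\<lambda>k. dst (op_scale U d c) (\<pi> (\<lambda>x. d * t k x))) \<longlonglongrightarrow> 0"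
    if c: "c \<in> bounded_ops U" and t: "\<And>k. t k \<in> Cc" and l: "(\<lambda>k. dst c (\<pi> (t k))) \<longlonglongrightarrow> 0" for c t
  proof (rule Lim_null_comparison[OF always_eventually[OF allI]])
    fix k
    have bd: "\<pi> (t k) \<in> bounded_ops U" using t by (auto intro: \<pi>_bounded)
    have "op_sub U (op_scale U d c) (op_scale U d (\<pi> (t k))) = op_scale U d (op_sub U c (\<pi> (t k)))"
    proof (rule U.op_ext)
      fix x assume x: "x \<in> hcar U"
      show "op_sub U (op_scale U d c) (op_scale U d (\<pi> (t k))) x = op_scale U d (op_sub U c (\<pi> (t k))) x"
        by (rule U.ip_ext) (use x c bd in \<open>auto simp: U.op_sub_apply U.op_scale_apply U.opD U.closed U.ip_simps right_diff_distrib\<close>)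
    qed (intro U.op_sub_closed U.op_scale_closed c bd)+
    then show "norm (dst (op_scale U d c) (\<pi> (\<lambda>x. d * t k x))) \<le> cmod d * dst c (\<pi> (t k))"
      using c bd t by (simp add: \<pi>_scale U.op_norm_scale U.op_sub_closed U.op_norm_nonneg U.op_scale_closed)
  next
    show "(\<lambda>k. cmod d * dst c (\<pi> (t k))) \<longlonglongrightarrow> 0" using tendsto_mult_left[OF l, of "cmod d"] by simp
  qed
  have "mult_by (\<lambda>x. d * s k x) = (\<lambda>x. d * mult_by (s k) x)" for k
    by (simp add: mult_by_def fun_eq_iff)
  then show ?thesis unfolding approx_def
    using p key[of a s] key[of b "\<lambda>k. mult_by (s k)"] by (auto simp: U.op_scale_closed Cc_scale mult_by_Cc)
qed

text \<open>The matrix estimate for functions passes to the limit in all entries, with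
  \<open>matrix_norm_perturb\<close> used once on each side.\<close>

lemma approx_matrix_norm:
  assumes ab: "\<And>i j. \<lbrakk>i < n; j < n\<rbrakk> \<Longrightarrow> approx (a i j) (b i j) (s i j)"
  shows "matrix_norm U n b \<le> sn \<xi> * sn \<eta> * matrix_norm U n a"
proof -
  \<comment> \<open>Zero outside the square of size \<open>n\<close>, since
    \<open>multiplier_matrix_norm\<close> needs every entry in \<open>Cc\<close>.\<close>
  define t where "t k i j = (if i < n \<and> j < n then s i j k else (\<lambda>x. 0))" for k i j
  have tC: "t k i j \<in> Cc" for k i j using ab by (auto simp: t_def approx_def Cc_zero)
  have C: "0 \<le> sn \<xi> * sn \<eta>" using \<xi> \<eta> by (intro mult_nonneg_nonneg sn_nonneg)
  have bd: "\<pi> (t k i j) \<in> bounded_ops U" "\<pi> (mult_by (t k i j)) \<in> bounded_ops U" for k i j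
    by (auto intro: \<pi>_bounded mult_by_Cc tC)
  have ba: "a i j \<in> bounded_ops U" "b i j \<in> bounded_ops U" if "i < n" "j < n" for i j using ab[OF that] by (auto simp: approx_def)
  have le: "matrix_norm U n b \<le> sn \<xi> * sn \<eta> * (matrix_norm U n a + (\<Sum>i<n. \<Sum>j<n. dst (a i j) (\<pi> (t k i j)))) + (\<Sum>i<n. \<Sum>j<n. dst (b i j) (\<pi> (mult_by (t k i j))))" for k
  proof -
    have "matrix_norm U n b \<le> matrix_norm U n (\<lambda>i j. \<pi> (mult_by (t k i j))) + (\<Sum>i<n. \<Sum>j<n. dst (b i j) (\<pi> (mult_by (t k i j))))"
      by (rule U.matrix_norm_perturb) (intro bd ba; assumption)+
    moreover have "matrix_norm U n (\<lambda>i j. \<pi> (mult_by (t k i j))) \<le> sn \<xi> * sn \<eta> * matrix_norm U n (\<lambda>i j. \<pi> (t k i j))"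
      unfolding mult_by_def by (rule multiplier_matrix_norm[OF \<xi> \<eta> tC])
    moreover have "matrix_norm U n (\<lambda>i j. \<pi> (t k i j)) \<le> matrix_norm U n a + (\<Sum>i<n. \<Sum>j<n. dst (\<pi> (t k i j)) (a i j))"
      by (rule U.matrix_norm_perturb) (intro bd ba; assumption)+
    moreover have "(\<Sum>i<n. \<Sum>j<n. dst (\<pi> (t k i j)) (a i j)) = (\<Sum>i<n. \<Sum>j<n. dst (a i j) (\<pi> (t k i j)))"
      by (intro sum.cong refl U.op_norm_sub_commute bd ba) auto
    ultimately have 1: "matrix_norm U n b \<le> sn \<xi> * sn \<eta> * matrix_norm U n (\<lambda>i j. \<pi> (t k i j)) + (\<Sum>i<n. \<Sum>j<n. dst (b i j) (\<pi> (mult_by (t k i j))))"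
      and 2: "matrix_norm U n (\<lambda>i j. \<pi> (t k i j)) \<le> matrix_norm U n a + (\<Sum>i<n. \<Sum>j<n. dst (a i j) (\<pi> (t k i j)))"
      by linarith+
    show ?thesis using 1 mult_left_mono[OF 2 C] by linarith
  qed
  have lim: "(\<lambda>k. dst (a i j) (\<pi> (t k i j))) \<longlonglongrightarrow> 0" "(\<lambda>k. dst (b i j) (\<pi> (mult_by (t k i j)))) \<longlonglongrightarrow> 0" if "i \<in> {..<n}" "j \<in> {..<n}" for i j
    using ab[of i j] that by (auto simp: approx_def t_def)
  have "(\<lambda>k. sn \<xi> * sn \<eta> * (matrix_norm U n a + (\<Sum>i<n. \<Sum>j<n. dst (a i j) (\<pi> (t k i j)))) + (\<Sum>i<n. \<Sum>j<n. dst (b i j) (\<pi> (mult_by (t k i j)))))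
    \<longlonglongrightarrow> sn \<xi> * sn \<eta> * (matrix_norm U n a + (\<Sum>i<n. \<Sum>j<n. 0)) + (\<Sum>i<n. \<Sum>j<n. 0)"
    by (intro tendsto_intros lim)
  then have "matrix_norm U n b \<le> sn \<xi> * sn \<eta> * (matrix_norm U n a + (\<Sum>i<n. \<Sum>j<n. 0)) + (\<Sum>i<n. \<Sum>j<n. 0)"
    by (rule LIMSEQ_le_const) (intro exI allI impI le)
  then show ?thesis by simp
qed

lemma multiplier_extension:
  "\<exists>T. T \<in> Cstar G lam \<rightarrow> Cstar G lam
    \<and> (\<forall>f\<in>Cc. T (\<pi> f) = \<pi> (\<lambda>x. coefficient G H L \<xi> \<eta> x * f x))
    \<and> completely_bounded U (Cstar G lam) T
    \<and> cb_norm U (Cstar G lam) T \<le> ennreal (sn \<xi> * sn \<eta>)"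
proof -
  \<comment> \<open>By \<open>approx_unique\<close> the choice is the only one possible, so
    linearity of \<open>T\<close> can be read off from \<open>approx_add\<close> and
    \<open>approx_scale\<close>.\<close>
  define T where "T a = (SOME b. \<exists>s. approx a b s)" for a
  have T: "\<exists>s. approx a (T a) s" if "a \<in> Cstar G lam" for a
    unfolding T_def using approx_exists[OF that] by (rule someI_ex)
  have T_eq: "T a = b" if "approx a b s" for a b s
  proof -
    have "\<exists>b s. approx a b s" using that by blast
    then have "\<exists>s. approx a (T a) s" unfolding T_def by (rule someI_ex)
    then obtain s' where "approx a (T a) s'" by blast
    then show ?thesis using that by (rule approx_unique)
  qed
  have maps: "T \<in> Cstar G lam \<rightarrow> Cstar G lam" using T approx_Cstar by blast
  have \<pi>: "\<forall>f\<in>Cc. T (\<pi> f) = \<pi> (\<lambda>x. coefficient G H L \<xi> \<eta> x * f x)"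
    using T_eq[OF approx_\<pi>] by (simp add: mult_by_def)
  have lin: "op_linear_on U (Cstar G lam) T"
    unfolding op_linear_on_def
  proof (intro conjI ballI allI)
    fix a b assume a: "a \<in> Cstar G lam" and b: "b \<in> Cstar G lam"
    obtain s s' where "approx a (T a) s" "approx b (T b) s'" using T a b by blast
    then show "T (op_add U a b) = op_add U (T a) (T b)" by (intro T_eq[OF approx_add])
  next
    fix c a assume a: "a \<in> Cstar G lam"
    obtain s where "approx a (T a) s" using T a by blast
    then show "T (op_scale U c a) = op_scale U c (T a)" by (intro T_eq[OF approx_scale])
  qed
  have C: "0 \<le> sn \<xi> * sn \<eta>" using \<xi> \<eta> by (intro mult_nonneg_nonneg sn_nonneg)
  have cb: "cb_norm U (Cstar G lam) T \<le> ennreal (sn \<xi> * sn \<eta>)"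
    unfolding cb_norm_def
  proof (intro SUP_least)
    fix n a assume "a \<in> {a. (\<forall>i<n. \<forall>j<n. a i j \<in> Cstar G lam) \<and> matrix_norm U n a \<le> 1}"
    then have a: "\<And>i j. i < n \<Longrightarrow> j < n \<Longrightarrow> a i j \<in> Cstar G lam" and a1: "matrix_norm U n a \<le> 1" by auto
    have "\<exists>s. i < n \<longrightarrow> j < n \<longrightarrow> approx (a i j) (T (a i j)) s" for i j using T a by blast
    then obtain s where s: "\<And>i j. i < n \<Longrightarrow> j < n \<Longrightarrow> approx (a i j) (T (a i j)) (s i j)" by metis
    have "matrix_norm U n (\<lambda>i j. T (a i j)) \<le> sn \<xi> * sn \<eta> * matrix_norm U n a"
      by (rule approx_matrix_norm[OF s])
    also have "\<dots> \<le> sn \<xi> * sn \<eta>" using mult_left_mono[OF a1 C] by simp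
    finally show "ennreal (matrix_norm U n (\<lambda>i j. T (a i j))) \<le> ennreal (sn \<xi> * sn \<eta>)" by (rule ennreal_leI)
  qed
  then have "cb_norm U (Cstar G lam) T < \<infinity>" by (rule le_less_trans) simp
  then have "completely_bounded U (Cstar G lam) T" using lin by (simp add: completely_bounded_def)
  with maps \<pi> cb show ?thesis by blast
qed

end

end

theorem theorem3:
  fixes G :: "'g::{t2_space, second_countable_topology} groupoid"
    and lam :: "'g \<Rightarrow> 'g measure"
    and H :: "'g \<Rightarrow> 'h hilbert" and \<Gamma> :: "('g \<Rightarrow> 'h) set" and L :: "'g \<Rightarrow> 'h \<Rightarrow> 'h"
    and \<xi> \<eta> :: "'g \<Rightarrow> 'h" and \<phi> :: "'g \<Rightarrow> complex"
  assumes "locally_compact_groupoid G"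
    and "left_haar_system G lam"
    and "hilbert_bundle G H \<Gamma> L"
    and "\<xi> \<in> bounded_sections (units G) H \<Gamma>"
    and "\<eta> \<in> bounded_sections (units G) H \<Gamma>"
    and "\<phi> = coefficient G H L \<xi> \<eta>"
  shows "\<exists>T. T \<in> Cstar G lam \<rightarrow> Cstar G lam
    \<and> (\<forall>f\<in>Cc. T (universal_rep G lam f) = universal_rep G lam (\<lambda>x. \<phi> x * f x))
    \<and> completely_bounded (universal_space G lam) (Cstar G lam) T
    \<and> cb_norm (universal_space G lam) (Cstar G lam) T
        \<le> ennreal (section_norm (units G) H \<xi> * section_norm (units G) H \<eta>)"
proof -
  interpret bundle_groupoid G lam H \<Gamma> L
    using assms(1-3) by (simp add: bundle_groupoid_def haar_groupoid_def)
  show ?thesis unfolding assms(6) using assms(4,5) by (rule multiplier_extension)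
qed

end
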